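(* Let $\mathsf X=\{X_n\}$ be a uniformly elliptic Markov chain, and let $\mathsf f$ be a reducible a.s. uniformly bounded additive functional on $\mathsf X$ with essential range $\delta(\mathsf f)\mathbb Z$, where $\delta(\mathsf f)\ne0$ (so $\delta(\mathsf f)>0$). Then there are random variables $b_N=b_N(X_1,X_{N+1})$ ($N\ge 1$) and $\mathfrak F=\mathfrak F(X_1,X_2,\dots)$ with the following properties: (1) For every sequence $z_N\in\delta(\mathsf f)\mathbb Z$ such that $\frac{z_N-\mathbb E(S_N)}{\sqrt{V_N}}\to z\in\mathbb R$, every continuous compactly supported $\phi:\mathbb R\to\mathbb R$, and every $x\in\mathfrak S_1$, $$\lim_{N\to\infty}\sqrt{V_N}\,\mathbb E_x[\phi(S_N-z_N-b_N)]=\frac{\delta(\mathsf f)e^{-z^2/2}}{\sqrt{2\pi}}\sum_{m\in\mathbb Z}\mathbb E_x[\phi(m\delta(\mathsf f)+\mathfrak F)].$$ (2) For $z_N,z,\phi$ as in (1), for every sequence of measurable sets $\mathfrak A_{N+1}\subset\mathfrak S_{N+1}$ such that $\mathbb P[X_{N+1}\in\mathfrak A_{N+1}]$ is bounded below by a positive constant, and for every $x\in\mathfrak S_1$, $$\lim_{N\to\infty}\sqrt{V_N}\,\mathbb E_x\bigl[\phi(S_N-z_N-b_N)\,\big|\,X_{N+1}\in\mathfrak A_{N+1}\bigr]=\frac{\delta(\mathsf f)e^{-z^2/2}}{\sqrt{2\pi}}\sum_{m\in\mathbb Z}\mathbb E_x[\phi(m\delta(\mathsf f)+\mathfrak F)].$$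 (3) $\|b_N\|_\infty\le9\delta(\mathsf f)$ and $\mathfrak F\in[0,\delta(\mathsf f))$.
   Context: A Markov chain $\mathsf X=\{X_n\}_{n\ge1}$ (possibly inhomogeneous) has complete separable metric state spaces $\mathfrak S_n\ni X_n$ with Borel $\sigma$-algebras, an initial distribution on $\mathfrak S_1$, and transition kernels $\pi_{n,n+1}(x,dy)$, so that $\mathbb P(X_{n+1}\in E\mid X_n,\dots,X_1)=\pi_{n,n+1}(X_n,E)$. $\mathbb P_x,\mathbb E_x$ denote probability and expectation when the initial distribution is replaced by the point mass at $x\in\mathfrak S_1$. The chain is uniformly elliptic if there are $0<\epsilon_0<1$, Borel probability measures $\mu_n$ on $\mathfrak S_n$ and measurable $p_n:\mathfrak S_n\times\mathfrak S_{n+1}\to[0,\infty)$ such that for all $n\ge1$: (a) $\pi_{n,n+1}(x,dy)=p_n(x,y)\mu_{n+1}(dy)$; (b) $0\le p_n\le1/\epsilon_0$; (c) $\int_{\mathfrak S_{n+1}}p_n(x,y)p_{n+1}(y,z)\mu_{n+1}(dy)>\epsilon_0$ for all $x\in\mathfrak S_n$, $z\in\mathfrak S_{n+2}$. An additive functional is a sequence $\mathsf f=\{f_n\}$ of measurable $f_n:\mathfrak S_n\times\mathfrak S_{n+1}\to\mathbb R$; $S_N=\sum_{n=1}^Nf_n(X_n,X_{n+1})$; $V_N=\mathrm{Var}(S_N)$. $\mathsf f$ is a.s. uniformly bounded if $\sup_n\mathrm{ess\,sup}|f_n(X_n,X_{n+1})|<\infty$. $\mathsf f$ is center-tight if there are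 constants $m_N$ such that for every $\epsilon>0$ there is $M$ with $\mathbb P[|S_N-m_N|>M]<\epsilon$ for all $N$. $G_{alg}(\mathsf X,\mathsf f)$ (algebraic range) is the intersection of all closed subgroups $G\le\mathbb R$ for which there are $c_n\in\mathbb R$ with $\mathbb P[f_n(X_n,X_{n+1})-c_n\in G]=1$ for all $n\ge1$. The essential range is $G_{ess}(\mathsf X,\mathsf f)=\bigcap\{G_{alg}(\mathsf X,\mathsf g):\mathsf g$ an additive functional on $\mathsf X$ with $\mathsf f-\mathsf g$ center-tight$\}$. $\mathsf f$ is reducible if there is an additive functional $\mathsf g$ on $\mathsf X$ with $\mathsf f-\mathsf g$ center-tight and $G_{alg}(\mathsf X,\mathsf g)\subsetneq G_{alg}(\mathsf X,\mathsf f)$. *)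

theory Defs
  imports "HOL-Probability.Probability"
begin

section \<open>Inhomogeneous Markov chains on complete separable metric spaces\<close>

text \<open>
  Indices start at 1, and index 0 of every sequence below is unused.  The state spaces are carriers
  inside one type, each with its own metric; since this type is arbitrary, so is the sequence of
  spaces.
\<close>

definition borel_of :: "'a metric \<Rightarrow> 'a measure" where
  "borel_of m = sigma (mspace m) {U. openin (mtopology_of m) U}"

definition markov_chain ::
    "(nat \<Rightarrow> 'a metric) \<Rightarrow> 'a measure \<Rightarrow> (nat \<Rightarrow> 'a \<Rightarrow> 'a measure) \<Rightarrow> bool" where
  "markov_chain S \<nu> \<pi> \<longleftrightarrow>
     (\<forall>n\<ge>1. mcomplete_of (S n) \<and> separable_space (mtopology_of (S n))) \<and>
     \<nu> \<in> space (prob_algebra (borel_of (S 1))) \<and>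
     (\<forall>n\<ge>1. \<pi> n \<in> borel_of (S n) \<rightarrow>\<^sub>M prob_algebra (borel_of (S (Suc n))))"

definition path_space :: "(nat \<Rightarrow> 'a metric) \<Rightarrow> (nat \<Rightarrow> 'a) measure" where
  "path_space S = PiM {1..} (\<lambda>n. borel_of (S n))"

text \<open>
  The chain is realised on its path space, so that \<open>X\<^sub>n\<close> is the coordinate \<open>\<lambda>\<omega>. \<omega> n\<close>.  The measure
  comes from the Ionescu-Tulcea theorem of the library, whose coordinates start at 0; hence the shift.
\<close>

definition step_kernel ::
    "'a measure \<Rightarrow> (nat \<Rightarrow> 'a \<Rightarrow> 'a measure) \<Rightarrow> nat \<Rightarrow> (nat \<Rightarrow> 'a) \<Rightarrow> 'a measure" where
  "step_kernel \<nu> \<pi> i \<omega> = (case i of 0 \<Rightarrow> \<nu> | Suc j \<Rightarrow> \<pi> (Suc j) (\<omega> j))"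

definition path_law ::
    "(nat \<Rightarrow> 'a metric) \<Rightarrow> 'a measure \<Rightarrow> (nat \<Rightarrow> 'a \<Rightarrow> 'a measure) \<Rightarrow> (nat \<Rightarrow> 'a) measure" where
  "path_law S \<nu> \<pi> =
     distr (projective_family.lim UNIV
              (Ionescu_Tulcea.CI (step_kernel \<nu> \<pi>) (\<lambda>i. borel_of (S (Suc i))))
              (\<lambda>i. borel_of (S (Suc i))))
           (path_space S) (\<lambda>\<omega>. \<lambda>n\<in>{1..}. \<omega> (n - 1))"

definition path_law_from ::
    "(nat \<Rightarrow> 'a metric) \<Rightarrow> (nat \<Rightarrow> 'a \<Rightarrow> 'a measure) \<Rightarrow> 'a \<Rightarrow> (nat \<Rightarrow> 'a) measure" where
  "path_law_from S \<pi> x = path_law S (return (borel_of (S 1)) x) \<pi>"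

text \<open>
  The path law is a probability measure with initial distribution \<open>\<nu>\<close> and
  \<open>P(X\<^sub>n\<^sub>+\<^sub>1 \<in> E | X\<^sub>1, \<dots>, X\<^sub>n) = \<pi> n X\<^sub>n E\<close>; the last property is written below in integrated form.
\<close>

lemma space_borel_of: "space (borel_of m) = mspace m"
  by (simp add: borel_of_def space_measure_of_conv)

lemma nn_integral_distr':
  assumes "T \<in> M \<rightarrow>\<^sub>M M'" "g \<in> borel_measurable M'"
  shows "integral\<^sup>N (distr M M' T) g = (\<integral>\<^sup>+x. g (T x) \<partial>M)"
  using assms by (intro nn_integral_distr) auto

lemma Ionescu_Tulcea_step_kernel:
  assumes "markov_chain S \<nu> \<pi>"
  shows "Ionescu_Tulcea (step_kernel \<nu> \<pi>) (\<lambda>i. borel_of (S (Suc i)))"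
proof -
  let ?M = "\<lambda>i. borel_of (S (Suc i))"
  have K: "step_kernel \<nu> \<pi> i \<in> PiM {0..<i} ?M \<rightarrow>\<^sub>M prob_algebra (?M i)" for i
  proof (cases i)
    case 0
    then show ?thesis using assms by (auto simp: markov_chain_def step_kernel_def[abs_def])
  next
    case (Suc j)
    have "(\<lambda>\<omega>. \<omega> j) \<in> PiM {0..<i} ?M \<rightarrow>\<^sub>M ?M j"
      using Suc by (intro measurable_component_singleton) auto
    moreover have "\<pi> (Suc j) \<in> ?M j \<rightarrow>\<^sub>M prob_algebra (?M i)"
      using assms Suc by (auto simp: markov_chain_def)
    ultimately show ?thesis
      using Suc by (auto simp: step_kernel_def[abs_def])
  qed
  have "step_kernel \<nu> \<pi> i \<in> PiM {0..<i} ?M \<rightarrow>\<^sub>M subprob_algebra (?M i)" for i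
    by (rule measurable_prob_algebraD[OF K])
  moreover have "prob_space (step_kernel \<nu> \<pi> i \<omega>)" if "\<omega> \<in> space (PiM {0..<i} ?M)" for i \<omega>
    using measurable_space[OF K that] by (simp add: space_prob_algebra)
  ultimately show ?thesis
    by (rule Ionescu_Tulcea.intro)
qed

context Ionescu_Tulcea
begin

lemma nn_integral_lim:
  assumes g: "g \<in> borel_measurable (PiM {0..<n} M)"
  shows "(\<integral>\<^sup>+\<omega>. g (restrict \<omega> {0..<n}) \<partial>PF.lim) = (\<integral>\<^sup>+\<omega>. g \<omega> \<partial>C 0 n (\<lambda>_. undefined))"
proof -
  have r: "(\<lambda>\<omega>. restrict \<omega> {0..<n}) \<in> PF.lim \<rightarrow>\<^sub>M PiM {0..<n} M"
    by (auto intro!: measurable_restrict simp: measurable_cong_sets[OF PF.sets_lim refl])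
  have upn: "up_to {0..<n} = n"
    unfolding up_to_def by (rule Least_equality) (auto simp: not_less [symmetric])
  have CI: "CI {0..<n} = C 0 n (\<lambda>_. undefined)"
    using distr_C[of n n "\<lambda>_. undefined" 0] by (simp add: CI_def upn)
  have "(\<integral>\<^sup>+\<omega>. g (restrict \<omega> {0..<n}) \<partial>PF.lim)
      = (\<integral>\<^sup>+\<omega>. g \<omega> \<partial>distr PF.lim (PiM {0..<n} M) (\<lambda>\<omega>. restrict \<omega> {0..<n}))"
    by (rule nn_integral_distr'[OF r g, symmetric])
  then show ?thesis by (simp add: distr_lim CI)
qed

lemma nn_integral_lim_step:
  assumes g: "g \<in> borel_measurable (PiM {0..<Suc n} M)"
  shows "(\<integral>\<^sup>+\<omega>. g (restrict \<omega> {0..<Suc n}) \<partial>PF.lim) =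
    (\<integral>\<^sup>+\<omega>. (\<integral>\<^sup>+x. g ((restrict \<omega> {0..<n})(n := x)) \<partial>P n (restrict \<omega> {0..<n})) \<partial>PF.lim)"
proof -
  let ?C = "C 0 n (\<lambda>_. undefined)"
  have sp: "space ?C = space (PiM {0..<n} M)" by (simp add: space_C)
  have eP0: "eP n \<in> PiM {0..<n} M \<rightarrow>\<^sub>M subprob_algebra (PiM {0..<Suc n} M)" by simp
  have eP: "eP n \<in> ?C \<rightarrow>\<^sub>M subprob_algebra (PiM {0..<Suc n} M)"
    using eP0 by (subst measurable_cong_sets[OF sets_C refl]) auto
  have "(\<integral>\<^sup>+\<omega>. g (restrict \<omega> {0..<Suc n}) \<partial>PF.lim) = (\<integral>\<^sup>+\<omega>. g \<omega> \<partial>(?C \<bind> eP n))"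
    using nn_integral_lim[OF g] by simp
  also have "\<dots> = (\<integral>\<^sup>+\<omega>. (\<integral>\<^sup>+y. g y \<partial>eP n \<omega>) \<partial>?C)"
    by (rule nn_integral_bind[OF g eP])
  also have "\<dots> = (\<integral>\<^sup>+\<omega>. (\<integral>\<^sup>+y. g y \<partial>eP n (restrict \<omega> {0..<n})) \<partial>PF.lim)"
    by (rule nn_integral_lim[symmetric])
       (rule measurable_compose[OF eP0 nn_integral_measurable_subprob_algebra[OF g]])
  also have "\<dots> = (\<integral>\<^sup>+\<omega>. (\<integral>\<^sup>+x. g ((restrict \<omega> {0..<n})(n := x)) \<partial>P n (restrict \<omega> {0..<n})) \<partial>PF.lim)"
    by (intro nn_integral_cong nn_integral_eP g) (auto simp: space_PiM PiE_iff)
  finally show ?thesis .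
qed

lemma prob_space_lim: "prob_space PF.lim"
proof -
  have "prob_space (distr PF.lim (PiM {} M) (\<lambda>x. restrict x {}))"
    by (subst distr_lim) (auto intro: PF.prob_space_P)
  then show ?thesis
    by (rule prob_space_distrD[rotated])
       (auto intro!: measurable_restrict)
qed

end

lemma path_shift_measurable:
  "(\<lambda>\<omega>. \<lambda>n\<in>{1..}. \<omega> (n - 1)) \<in> PiM UNIV (\<lambda>i. borel_of (S (Suc i))) \<rightarrow>\<^sub>M path_space S"
  unfolding path_space_def
proof (rule measurable_restrict)
  fix n :: nat assume "n \<in> {1..}"
  then show "(\<lambda>\<omega>. \<omega> (n - 1)) \<in> PiM UNIV (\<lambda>i. borel_of (S (Suc i))) \<rightarrow>\<^sub>M borel_of (S n)"
    using measurable_component_singleton[of "n - 1" UNIV "\<lambda>i. borel_of (S (Suc i))"] by simp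
qed

lemma sets_path_law [simp]: "sets (path_law S \<nu> \<pi>) = sets (path_space S)"
  by (simp add: path_law_def)

lemma space_path_law [simp]: "space (path_law S \<nu> \<pi>) = space (path_space S)"
  by (simp add: path_law_def)

lemma
  assumes "markov_chain S \<nu> \<pi>"
  shows prob_space_path_law: "prob_space (path_law S \<nu> \<pi>)"
    and path_law_initial: "distr (path_law S \<nu> \<pi>) (borel_of (S 1)) (\<lambda>\<omega>. \<omega> 1) = \<nu>"
    and path_law_Markov:
      "\<lbrakk>n \<ge> 1; A \<in> sets (PiM {1..n} (\<lambda>k. borel_of (S k))); E \<in> sets (borel_of (S (Suc n)))\<rbrakk> \<Longrightarrow>
         emeasure (path_law S \<nu> \<pi>)
           {\<omega> \<in> space (path_space S). restrict \<omega> {1..n} \<in> A \<and> \<omega> (Suc n) \<in> E} =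
         (\<integral>\<^sup>+\<omega>. indicator A (restrict \<omega> {1..n}) * emeasure (\<pi> n (\<omega> n)) E \<partial>path_law S \<nu> \<pi>)"
proof -
  let ?M = "\<lambda>i. borel_of (S (Suc i))" and ?T = "\<lambda>\<omega>::nat \<Rightarrow> 'a. \<lambda>n\<in>{1..}. \<omega> (n - 1 :: nat)"
  interpret IT: Ionescu_Tulcea "step_kernel \<nu> \<pi>" ?M
    by (rule Ionescu_Tulcea_step_kernel[OF assms])
  have PL: "path_law S \<nu> \<pi> = distr IT.PF.lim (path_space S) ?T"
    by (simp add: path_law_def)
  have T: "?T \<in> IT.PF.lim \<rightarrow>\<^sub>M path_space S"
    using path_shift_measurable[of S] by (simp add: measurable_cong_sets[OF IT.PF.sets_lim refl])
  show "prob_space (path_law S \<nu> \<pi>)"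
    unfolding PL by (rule prob_space.prob_space_distr[OF IT.prob_space_lim T])
  have X: "(\<lambda>\<omega>. \<omega> k) \<in> path_space S \<rightarrow>\<^sub>M borel_of (S k)" if "k \<ge> 1" for k
    unfolding path_space_def using that by (intro measurable_component_singleton) auto
  have \<nu>: "sets \<nu> = sets (borel_of (S 1))"
    using assms by (simp add: markov_chain_def space_prob_algebra)
  show "distr (path_law S \<nu> \<pi>) (borel_of (S 1)) (\<lambda>\<omega>. \<omega> 1) = \<nu>"
  proof (rule measure_eqI)
    fix E assume "E \<in> sets (distr (path_law S \<nu> \<pi>) (borel_of (S 1)) (\<lambda>\<omega>. \<omega> 1))"
    then have E: "E \<in> sets (borel_of (S 1))" by simp
    have m: "(\<lambda>\<omega>. indicator E (\<omega> 0) :: ennreal) \<in> borel_measurable (PiM {0..<Suc 0} ?M)"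
      by (rule measurable_compose[OF measurable_component_singleton])
         (use E in auto)
    have "emeasure (distr (path_law S \<nu> \<pi>) (borel_of (S 1)) (\<lambda>\<omega>. \<omega> 1)) E
        = (\<integral>\<^sup>+x. indicator E x \<partial>distr (path_law S \<nu> \<pi>) (borel_of (S 1)) (\<lambda>\<omega>. \<omega> 1))"
      using E by (simp del: One_nat_def)
    also have "\<dots> = (\<integral>\<^sup>+\<omega>. indicator E (\<omega> 1) \<partial>path_law S \<nu> \<pi>)"
      using E X[of 1] by (subst nn_integral_distr) (simp_all add: measurable_cong_sets[OF sets_path_law refl])
    also have "\<dots> = (\<integral>\<^sup>+\<omega>. indicator E (?T \<omega> 1) \<partial>IT.PF.lim)"
      unfolding PL
      by (rule nn_integral_distr'[OF T]) (use E X[of 1] in \<open>intro measurable_compose[OF X], auto\<close>)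
    also have "\<dots> = (\<integral>\<^sup>+\<omega>. indicator E (restrict \<omega> {0..<Suc 0} 0) \<partial>IT.PF.lim)"
      by simp
    also have "\<dots> = (\<integral>\<^sup>+\<omega>. (\<integral>\<^sup>+x. indicator E x \<partial>\<nu>) \<partial>IT.PF.lim)"
      using IT.nn_integral_lim_step[OF m] by (simp add: step_kernel_def)
    also have "\<dots> = emeasure \<nu> E"
      using E \<nu> prob_space.emeasure_space_1[OF IT.prob_space_lim] by simp
    finally show "emeasure (distr (path_law S \<nu> \<pi>) (borel_of (S 1)) (\<lambda>\<omega>. \<omega> 1)) E = emeasure \<nu> E" .
  qed (simp add: \<nu>)
  assume n: "n \<ge> 1" and A: "A \<in> sets (PiM {1..n} (\<lambda>k. borel_of (S k)))"
    and E: "E \<in> sets (borel_of (S (Suc n)))"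
  obtain j where j: "n = Suc j" using n by (cases n) auto
  have R: "(\<lambda>\<omega>. restrict \<omega> {1..n}) \<in> path_space S \<rightarrow>\<^sub>M PiM {1..n} (\<lambda>k. borel_of (S k))"
    unfolding path_space_def by (rule measurable_restrict_subset) auto
  let ?g = "\<lambda>\<omega>. indicator A (\<lambda>k\<in>{1..n}. \<omega> (k - 1)) * indicator E (\<omega> n) :: ennreal"
  have T': "(\<lambda>\<omega>. \<lambda>k\<in>{1..n}. \<omega> (k - 1)) \<in> PiM {0..<Suc n} ?M \<rightarrow>\<^sub>M PiM {1..n} (\<lambda>k. borel_of (S k))"
  proof (rule measurable_restrict)
    fix k assume "k \<in> {1..n}"
    then show "(\<lambda>\<omega>. \<omega> (k - 1)) \<in> PiM {0..<Suc n} ?M \<rightarrow>\<^sub>M borel_of (S k)"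
      using measurable_component_singleton[of "k - 1" "{0..<Suc n}" ?M] by auto
  qed
  have g: "?g \<in> borel_measurable (PiM {0..<Suc n} ?M)"
  proof (rule borel_measurable_times_ennreal)
    show "(\<lambda>\<omega>. indicator A (\<lambda>k\<in>{1..n}. \<omega> (k - 1)) :: ennreal) \<in> borel_measurable (PiM {0..<Suc n} ?M)"
      using A by (intro measurable_compose[OF T']) auto
    show "(\<lambda>\<omega>. indicator E (\<omega> n) :: ennreal) \<in> borel_measurable (PiM {0..<Suc n} ?M)"
      using E by (intro measurable_compose[OF measurable_component_singleton]) auto
  qed
  have kern: "\<pi> n \<in> borel_of (S n) \<rightarrow>\<^sub>M prob_algebra (borel_of (S (Suc n)))"
    using assms n by (auto simp: markov_chain_def)
  have mI: "(\<lambda>\<omega>. indicator A (restrict \<omega> {1..n}) :: ennreal) \<in> borel_measurable (path_space S)"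
    using A by (intro measurable_compose[OF R]) auto
  have mE: "(\<lambda>\<omega>. indicator E (\<omega> (Suc n)) :: ennreal) \<in> borel_measurable (path_space S)"
    using E by (intro measurable_compose[OF X]) auto
  have mK: "(\<lambda>\<omega>. emeasure (\<pi> n (\<omega> n)) E) \<in> borel_measurable (path_space S)"
    by (rule measurable_compose[OF X[OF n]])
       (rule measurable_emeasure_kernel[OF measurable_prob_algebraD[OF kern] E])
  have set: "{\<omega> \<in> space (path_space S). restrict \<omega> {1..n} \<in> A \<and> \<omega> (Suc n) \<in> E} \<in> sets (path_space S)"
    (is "?B \<in> _")
  proof -
    have "?B = ((\<lambda>\<omega>. restrict \<omega> {1..n}) -` A \<inter> space (path_space S)) \<inter>
               ((\<lambda>\<omega>. \<omega> (Suc n)) -` E \<inter> space (path_space S))" by auto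
    then show ?thesis
      using measurable_sets[OF R A] measurable_sets[OF X[of "Suc n"] E] by auto
  qed
  have "emeasure (path_law S \<nu> \<pi>) ?B = (\<integral>\<^sup>+\<omega>. indicator ?B \<omega> \<partial>path_law S \<nu> \<pi>)"
    using set by simp
  also have "\<dots> = (\<integral>\<^sup>+\<omega>. indicator A (restrict \<omega> {1..n}) * indicator E (\<omega> (Suc n)) \<partial>path_law S \<nu> \<pi>)"
    by (intro nn_integral_cong) (auto split: split_indicator)
  also have "\<dots> = (\<integral>\<^sup>+\<omega>. indicator A (restrict (?T \<omega>) {1..n}) * indicator E (?T \<omega> (Suc n)) \<partial>IT.PF.lim)"
    unfolding PL by (rule nn_integral_distr'[OF T]) (use mI mE in \<open>auto intro!: borel_measurable_times_ennreal\<close>)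
  also have "\<dots> = (\<integral>\<^sup>+\<omega>. ?g (restrict \<omega> {0..<Suc n}) \<partial>IT.PF.lim)"
  proof (intro nn_integral_cong)
    fix \<omega> :: "nat \<Rightarrow> 'a"
    have "restrict (?T \<omega>) {1..n} = (\<lambda>k\<in>{1..n}. restrict \<omega> {0..<Suc n} (k - 1))"
      by (auto simp: fun_eq_iff)
    then show "indicator A (restrict (?T \<omega>) {1..n}) * indicator E (?T \<omega> (Suc n)) = ?g (restrict \<omega> {0..<Suc n})"
      by simp
  qed
  also have "\<dots> = (\<integral>\<^sup>+\<omega>. (\<integral>\<^sup>+x. ?g ((restrict \<omega> {0..<n})(n := x)) \<partial>step_kernel \<nu> \<pi> n (restrict \<omega> {0..<n})) \<partial>IT.PF.lim)"
    by (rule IT.nn_integral_lim_step[OF g])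
  also have "\<dots> = (\<integral>\<^sup>+\<omega>. indicator A (restrict (?T \<omega>) {1..n}) * emeasure (\<pi> n (?T \<omega> n)) E \<partial>IT.PF.lim)"
  proof (intro nn_integral_cong)
    fix \<omega> assume \<omega>: "\<omega> \<in> space IT.PF.lim"
    have eq: "(\<lambda>k\<in>{1..n}. ((restrict \<omega> {0..<n})(n := x)) (k - 1)) = restrict (?T \<omega>) {1..n}" for x
      by (auto simp: fun_eq_iff)
    have k: "step_kernel \<nu> \<pi> n (restrict \<omega> {0..<n}) = \<pi> n (?T \<omega> n)"
      by (simp add: j step_kernel_def)
    have "?T \<omega> n \<in> space (borel_of (S n))"
      using \<omega> j by (auto simp: space_PiM PiE_iff)
    from measurable_space[OF kern this] have s: "sets (\<pi> n (?T \<omega> n)) = sets (borel_of (S (Suc n)))"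
      by (simp add: space_prob_algebra)
    show "(\<integral>\<^sup>+x. ?g ((restrict \<omega> {0..<n})(n := x)) \<partial>step_kernel \<nu> \<pi> n (restrict \<omega> {0..<n}))
        = indicator A (restrict (?T \<omega>) {1..n}) * emeasure (\<pi> n (?T \<omega> n)) E"
      unfolding eq k using E s by (simp add: nn_integral_cmult_indicator)
  qed
  also have "\<dots> = (\<integral>\<^sup>+\<omega>. indicator A (restrict \<omega> {1..n}) * emeasure (\<pi> n (\<omega> n)) E \<partial>path_law S \<nu> \<pi>)"
    unfolding PL by (rule nn_integral_distr'[OF T, symmetric]) (use mI mK in \<open>auto intro!: borel_measurable_times_ennreal\<close>)
  finally show "emeasure (path_law S \<nu> \<pi>) ?B =
      (\<integral>\<^sup>+\<omega>. indicator A (restrict \<omega> {1..n}) * emeasure (\<pi> n (\<omega> n)) E \<partial>path_law S \<nu> \<pi>)" .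
qed

lemma markov_chain_return:
  assumes "markov_chain S \<nu> \<pi>" "x \<in> mspace (S 1)"
  shows "markov_chain S (return (borel_of (S 1)) x) \<pi>"
  using assms by (auto simp: markov_chain_def space_prob_algebra prob_space_return space_borel_of)

definition uniformly_elliptic ::
    "(nat \<Rightarrow> 'a metric) \<Rightarrow> (nat \<Rightarrow> 'a \<Rightarrow> 'a measure) \<Rightarrow> bool" where
  "uniformly_elliptic S \<pi> \<longleftrightarrow>
     (\<exists>(\<epsilon>\<^sub>0::real) (\<mu> :: nat \<Rightarrow> 'a measure) (p :: nat \<Rightarrow> 'a \<Rightarrow> 'a \<Rightarrow> real).
        0 < \<epsilon>\<^sub>0 \<and> \<epsilon>\<^sub>0 < 1 \<and>
        (\<forall>n\<ge>1. \<mu> n \<in> space (prob_algebra (borel_of (S n)))) \<and>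
        (\<forall>n\<ge>1. (\<lambda>(x, y). p n x y) \<in> borel_measurable (borel_of (S n) \<Otimes>\<^sub>M borel_of (S (Suc n)))) \<and>
        (\<forall>n\<ge>1. \<forall>x\<in>mspace (S n). \<pi> n x = density (\<mu> (Suc n)) (\<lambda>y. ennreal (p n x y))) \<and>
        (\<forall>n\<ge>1. \<forall>x\<in>mspace (S n). \<forall>y\<in>mspace (S (Suc n)). 0 \<le> p n x y \<and> p n x y \<le> 1 / \<epsilon>\<^sub>0) \<and>
        (\<forall>n\<ge>1. \<forall>x\<in>mspace (S n). \<forall>z\<in>mspace (S (Suc (Suc n))).
           (\<integral>y. p n x y * p (Suc n) y z \<partial>\<mu> (Suc n)) > \<epsilon>\<^sub>0))"


section \<open>Additive functionals\<close>

text \<open>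
  The state spaces are separable, so the product of two Borel \<open>\<sigma>\<close>-algebras is the Borel
  \<open>\<sigma>\<close>-algebra of the product space.
\<close>

definition additive_functional ::
    "(nat \<Rightarrow> 'a metric) \<Rightarrow> (nat \<Rightarrow> 'a \<Rightarrow> 'a \<Rightarrow> real) \<Rightarrow> bool" where
  "additive_functional S f \<longleftrightarrow>
     (\<forall>n\<ge>1. (\<lambda>(x, y). f n x y) \<in> borel_measurable (borel_of (S n) \<Otimes>\<^sub>M borel_of (S (Suc n))))"

definition partial_sum :: "(nat \<Rightarrow> 'a \<Rightarrow> 'a \<Rightarrow> real) \<Rightarrow> nat \<Rightarrow> (nat \<Rightarrow> 'a) \<Rightarrow> real" where
  "partial_sum f N \<omega> = (\<Sum>n=1..N. f n (\<omega> n) (\<omega> (Suc n)))"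

text \<open>In the following, \<open>P\<close> is the law of the chain on its path space.\<close>

definition as_unif_bounded ::
    "(nat \<Rightarrow> 'a) measure \<Rightarrow> (nat \<Rightarrow> 'a \<Rightarrow> 'a \<Rightarrow> real) \<Rightarrow> bool" where
  "as_unif_bounded P f \<longleftrightarrow>
     (SUP n\<in>{1..}. esssup P (\<lambda>\<omega>. ereal \<bar>f n (\<omega> n) (\<omega> (Suc n))\<bar>)) < \<infinity>"

definition center_tight ::
    "(nat \<Rightarrow> 'a) measure \<Rightarrow> (nat \<Rightarrow> 'a \<Rightarrow> 'a \<Rightarrow> real) \<Rightarrow> bool" where
  "center_tight P f \<longleftrightarrow>
     (\<exists>m :: nat \<Rightarrow> real. \<forall>\<epsilon>>0. \<exists>M. \<forall>N\<ge>1.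
        measure P {\<omega> \<in> space P. \<bar>partial_sum f N \<omega> - m N\<bar> > M} < \<epsilon>)"

definition closed_subgroup :: "real set \<Rightarrow> bool" where
  "closed_subgroup G \<longleftrightarrow> closed G \<and> 0 \<in> G \<and> (\<forall>x\<in>G. \<forall>y\<in>G. x - y \<in> G)"

definition algebraic_range ::
    "(nat \<Rightarrow> 'a) measure \<Rightarrow> (nat \<Rightarrow> 'a \<Rightarrow> 'a \<Rightarrow> real) \<Rightarrow> real set" where
  "algebraic_range P f =
     \<Inter>{G. closed_subgroup G \<and>
          (\<exists>c :: nat \<Rightarrow> real. \<forall>n\<ge>1. AE \<omega> in P. f n (\<omega> n) (\<omega> (Suc n)) - c n \<in> G)}"

definition essential_range ::
    "(nat \<Rightarrow> 'a metric) \<Rightarrow> (nat \<Rightarrow> 'a) measure \<Rightarrow> (nat \<Rightarrow> 'a \<Rightarrow> 'a \<Rightarrow> real) \<Rightarrow> real set" where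
  "essential_range S P f =
     \<Inter>{algebraic_range P g | g.
          additive_functional S g \<and> center_tight P (\<lambda>n x y. f n x y - g n x y)}"

definition reducible ::
    "(nat \<Rightarrow> 'a metric) \<Rightarrow> (nat \<Rightarrow> 'a) measure \<Rightarrow> (nat \<Rightarrow> 'a \<Rightarrow> 'a \<Rightarrow> real) \<Rightarrow> bool" where
  "reducible S P f \<longleftrightarrow>
     (\<exists>g. additive_functional S g \<and> center_tight P (\<lambda>n x y. f n x y - g n x y) \<and>
          algebraic_range P g \<subset> algebraic_range P f)"

text \<open>The expectation of \<open>Y\<close> given an event \<open>E\<close> of positive probability (0 for a null event).\<close>

definition expectation_given ::
    "'b measure \<Rightarrow> ('b \<Rightarrow> real) \<Rightarrow> 'b set \<Rightarrow> real" where
  "expectation_given P Y E = (\<integral>\<omega>. indicator E \<omega> * Y \<omega> \<partial>P) / measure P E"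

text \<open>The group \<open>d\<int>\<close>.\<close>

definition multiples :: "real \<Rightarrow> real set" where
  "multiples d = range (\<lambda>m::int. d * of_int m)"

definition compactly_supported :: "(real \<Rightarrow> real) \<Rightarrow> bool" where
  "compactly_supported \<phi> \<longleftrightarrow> compact (closure {t. \<phi> t \<noteq> 0})"

end

theory Submission
 imports Defs
begin

text \<open>
Let D_N(xi) be the sum over n \<le> N of the average squared spread of the phases of exp(i xi S) over
the bridges of length three starting at time n. Uniform ellipticity gives
|E exp(i xi S_N)| \<le> C exp(-c D_N(xi)), and if D_N(xi) stays bounded then f is, modulo 2 pi / xi and
up to constants, a gradient plus a square-summable term. Hence D_N(xi) is bounded exactly for xi in
(2 pi / \<delta>)\<int>, and at these frequencies the gradient and the convergent centred series produce
b_N and F. By Fourier inversion the limit only sees neighbourhoods of these frequencies: if xi* minimizes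
D_N on an interval, then D_N(xi) \<ge> D_N(xi - xi*) / 4, and D_N is at least c xi^2 V_N near 0, so the
mass elsewhere is o(1 / sqrt V_N), while near each frequency the central limit theorem applies.
Poisson summation for the Fejer kernel and Levy's continuity theorem extend the limit to all test functions.
\<close>

text \<open>Centring and variance refer to \<open>P\<close>, the expectations to the chain started
  at \<open>x\<close>, and these laws may be mutually singular at times 1 and 2. All estimates are
  therefore proved for two arbitrary laws \<open>P\<close>, \<open>Q\<close> with the same kernels.
  Two steps after any start the law is comparable to \<open>mu\<close>, so from time 3 on moments
  under \<open>Q\<close> are controlled by moments under \<open>P\<close>. The first two summands
  are kept as one function \<open>R\<close> that only enters through unimodular factors. Bridges
  have length three because z, y, x, x' splits both as two steps plus one and as one step plus two,
  and two-step densities exceed \<open>eps\<close>. Multiplying one splitting by the conjugate of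
  the other compares the phase of the last step with that of the first; with z, y running along a
  fixed path this exhibits the last step as a constant plus a gradient. F has to be the same
  function for all starting points: the subsequence along which the centred series converges is
  chosen from moments under \<open>P\<close> alone. Conditioning at time N + 1 is carried through
  the Fourier estimates as a weight \<open>u N\<close> and decoupled by mixing over the last few
  steps.\<close>

declare One_nat_def [simp del]

notation (input) LIMSEQ (infix "---->" 60)

abbreviation st :: "(nat => 'a => 'a => 'b) => nat => (nat => 'a) => 'b" where
 "st u n w \<equiv> u n (w n) (w (Suc n))"

abbreviation fq :: "real => int => real" where "fq d k \<equiv> 2 * pi / d * of_int k"

section \<open>Markov property and mixing\<close>

text \<open>The bounds on \<open>p\<close> hold for all arguments and index 0 is a dummy time, so
  that estimates carry no side conditions. The densities of a given chain are brought into this form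
  by clipping them and by choosing a constant density at time 0.\<close>

locale elliptic_chain =
 fixes B :: "nat => 'a measure" and mu :: "nat => 'a measure"
  and p :: "nat => 'a => 'a => real" and eps :: real
 assumes eps_pos: "0 < eps" and eps_less: "eps < 1"
  and prob_mu: "!!n. prob_space (mu n)"
  and sets_mu [simp, measurable_cong]: "!!n. sets (mu n) = sets (B n)"
  and p_measurable: "!!n. (%(x, y). p n x y) : borel_measurable (B n \<Otimes>\<^sub>M B (Suc n))"
  and p_nonneg [simp]: "!!n x y. 0 <= p n x y"
  and p_le: "!!n x y. p n x y <= 1 / eps"
  and p_int: "!!n x. x : space (B n) ==> (LINT y|(mu (Suc n)). p n x y) = 1"
  and two_step: "!!n x z. n >= 1 ==> x : space (B n) ==> z : space (B (Suc (Suc n))) ==>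
      (LINT y|(mu (Suc n)). p n x y * p (Suc n) y z) > eps"
begin

lemma space_mu [simp]: "space (mu n) = space (B n)" using sets_eq_imp_space_eq[OF sets_mu] .

lemma p_meas [measurable (raw)]:
 assumes [measurable]: "f : M \<rightarrow>\<^sub>M B n" "g : M \<rightarrow>\<^sub>M B (Suc n)"
 shows "(%x. p n (f x) (g x)) : borel_measurable M" using measurable_compose[OF measurable_Pair[OF assms] p_measurable] by simp

sublocale mu: prob_space "mu n" for n by (rule prob_mu)

text \<open>Values in a Banach space let the same operator serve real test functions and complex
  twisted ones.\<close>

definition trans :: "nat => ('a => 'b::{banach, second_countable_topology}) => 'a => 'b" where
 "trans n u x = (LINT y|(mu (Suc n)). p n x y *\<^sub>R u y)"

lemma trans_measurable [measurable (raw)]: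
 fixes u :: "'c => 'a => 'b::{banach, second_countable_topology}"
 assumes [measurable]: "f : M \<rightarrow>\<^sub>M B n" "(%(x, y). u x y) : borel_measurable (M \<Otimes>\<^sub>M B (Suc n))"
 shows "(%x. trans n (u x) (f x)) : borel_measurable M" unfolding trans_def by measurable

lemma integrable_mu:
 fixes u :: "'a => 'b::{banach, second_countable_topology}"
 assumes "u : borel_measurable (B n)" "!!y. y : space (B n) ==> norm (u y) <= C"
 shows "integrable (mu n) u" using assms by (intro mu.integrable_const_bound[where B=C]) (auto intro!: AE_I2)

lemma integrable_pu:
 fixes u :: "'a => 'b::{banach, second_countable_topology}"
 assumes [measurable]: "u : borel_measurable (B (Suc n))"
  and "!!y. y : space (B (Suc n)) ==> norm (u y) <= C" and x [measurable]: "x : space (B n)"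
 shows "integrable (mu (Suc n)) (%y. p n x y *\<^sub>R u y)"
proof (rule integrable_mu)
 fix y assume "y : space (B (Suc n))"
 then show "norm (p n x y *\<^sub>R u y) <= (1/eps) * C" using mult_mono[OF p_le[of n x y] assms(2)[of y]] eps_pos by simp
qed measurable

lemma integrable_p: "x : space (B n) ==> integrable (mu (Suc n)) (p n x)" using integrable_pu[of "%_. 1::real" n 1 x] by simp

lemma norm_trans_le:
 fixes u :: "'a => 'b::{banach, second_countable_topology}"
 assumes [measurable]: "u : borel_measurable (B (Suc n))"
  and C: "!!y. y : space (B (Suc n)) ==> norm (u y) <= C" and x [measurable]: "x : space (B n)"
 shows "norm (trans n u x) <= C"
proof -
 have "norm (trans n u x) <= (LINT y|(mu (Suc n)). p n x y * C)" unfolding trans_def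
 proof (rule order_trans[OF integral_norm_bound integral_mono])
  show "integrable (mu (Suc n)) (%y. norm (p n x y *\<^sub>R u y))" by (rule integrable_norm[OF integrable_pu[OF assms]])
  show "integrable (mu (Suc n)) (%y. p n x y * C)" using integrable_p[OF x] by simp
 qed (use C in \<open>auto intro!: mult_left_mono\<close>)
 also have "... = C" using p_int[OF x] by simp
 finally show ?thesis .
qed

definition paths :: "(nat => 'a) measure" where "paths = PiM {1..} B"

text \<open>The initial distribution is left free: the law of the chain and all laws started at a
  point are instances, and the main estimates compare two of them.\<close>

definition chain_law :: "(nat => 'a) measure => bool" where
 "chain_law Q \<longleftrightarrow> prob_space Q & sets Q = sets paths &
   (\<forall>n\<ge>1. \<forall>A\<in>sets (PiM {1..n} B). \<forall>E\<in>sets (B (Suc n)).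
    emeasure Q {w : space paths. restrict w {1..n} : A & w (Suc n) : E} =
    (\<integral>\<^sup>+w. indicator A (restrict w {1..n}) * (\<integral>\<^sup>+y. ennreal (p n (w n) y) * indicator E y \<partial>mu (Suc n)) \<partial>Q))"

lemma chain_lawD:
 assumes "chain_law Q"
 shows "prob_space Q" "sets Q = sets paths" "space Q = space paths" using assms sets_eq_imp_space_eq unfolding chain_law_def by auto

lemma coord [measurable (raw)]: "k >= 1 ==> (%w. w k) : paths \<rightarrow>\<^sub>M B k" unfolding paths_def by (rule measurable_component_singleton) auto

lemma coord_space: "k >= 1 ==> w : space paths ==> w k : space (B k)" using measurable_space[OF coord] by blast

lemma restr_measurable: "(%w. restrict w {1..n}) : paths \<rightarrow>\<^sub>M PiM {1..n} B" unfolding paths_def by (rule measurable_restrict_subset) auto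

text \<open>The second condition makes \<open>G\<close> literally a function of the restricted path,
  so the same \<open>G\<close> can be applied to full paths and to finite ones.\<close>

definition adapted :: "nat => ((nat => 'a) => 'b::topological_space) => bool" where
 "adapted n G \<longleftrightarrow> G : borel_measurable (PiM {1..n} B) & (\<forall>w. G (restrict w {1..n}) = G w)"

lemma adapted_measurable: "adapted n G ==> G : borel_measurable paths" unfolding adapted_def using measurable_compose[OF restr_measurable, of G n borel] by simp

lemma adapted_const [intro]: "adapted n (%_. c)" by (auto simp: adapted_def)

lemma adapted_compose:
 assumes "adapted n G" "h : borel_measurable borel" shows "adapted n (%w. h (G w))" using assms measurable_compose[of G _ borel h borel] by (auto simp: adapted_def)

lemma adapted_mult [intro]:
 fixes G H :: "_ => 'b::{real_normed_algebra, second_countable_topology}"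
 assumes "adapted n G" "adapted n H" shows "adapted n (%w. G w * H w)" using assms by (auto simp: adapted_def intro!: borel_measurable_times)

lemma adapted_add [intro]:
 fixes G H :: "_ => 'b::{real_normed_vector, second_countable_topology}"
 assumes "adapted n G" "adapted n H" shows "adapted n (%w. G w + H w)" using assms by (auto simp: adapted_def intro!: borel_measurable_add)

lemma adapted_diff [intro]:
 fixes G H :: "_ => 'b::{real_normed_vector, second_countable_topology}"
 assumes "adapted n G" "adapted n H" shows "adapted n (%w. G w - H w)" using assms by (auto simp: adapted_def intro!: borel_measurable_diff)

lemma adapted_sum [intro]:
 fixes G :: "'i => _ => 'b::{real_normed_vector, second_countable_topology}"
 assumes "!!i. i : I ==> adapted n (G i)" shows "adapted n (%w. \<Sum>i\<in>I. G i w)" using assms by (auto simp: adapted_def intro!: borel_measurable_sum sum.cong)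

lemma adapted_coord:
 assumes "u : borel_measurable (B k)" "1 <= k" "k <= n" shows "adapted n (%w. u (w k))" using assms measurable_compose[OF measurable_component_singleton[of k "{1..n}" B] assms(1)] by (auto simp: adapted_def)

lemma adapted_coord2:
 assumes u: "(%(x, y). u x y) : borel_measurable (B k \<Otimes>\<^sub>M B (Suc k))" and "1 <= k" "Suc k <= n"
 shows "adapted n (%w. u (w k) (w (Suc k)))"
proof -
 have [measurable]: "(%w. w k) : PiM {1..n} B \<rightarrow>\<^sub>M B k" "(%w. w (Suc k)) : PiM {1..n} B \<rightarrow>\<^sub>M B (Suc k)" using assms by (auto intro!: measurable_component_singleton)
 show ?thesis using assms measurable_compose[OF measurable_Pair u, of "%w. w k" "PiM {1..n} B" "%w. w (Suc k)"] by (auto simp: adapted_def)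
qed

lemma adapted_mono:
 assumes "adapted m G" "m <= n" shows "adapted n G"
proof -
 have r: "(%w. restrict w {1..m}) : PiM {1..n} B \<rightarrow>\<^sub>M PiM {1..m} B" by (rule measurable_restrict_subset) (use assms in auto)
 have "G : borel_measurable (PiM {1..n} B)"
 proof -
  have "(%w. G (restrict w {1..m})) : borel_measurable (PiM {1..n} B)" using assms by (intro measurable_compose[OF r]) (simp add: adapted_def)
  then show ?thesis using assms(1) by (simp add: adapted_def)
 qed
 moreover have "G (restrict w {1..n}) = G w" for w
 proof -
  have "restrict (restrict w {1..n}) {1..m} = restrict w {1..m}" using assms(2) by (auto simp: restrict_def fun_eq_iff)
  then have "G (restrict (restrict w {1..n}) {1..m}) = G (restrict w {1..m})" by simp
  then show ?thesis using assms(1) by (simp add: adapted_def del: restrict_restrict)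
 qed
 ultimately show ?thesis by (simp add: adapted_def)
qed

lemma law_integrable:
 fixes G :: "_ => 'b::{banach, second_countable_topology}"
 assumes "chain_law Q" "G : borel_measurable paths" "!!w. w : space paths ==> norm (G w) <= C"
 shows "integrable Q G"
proof -
 interpret prob_space Q using chain_lawD[OF assms(1)] by simp
 show ?thesis using assms(2,3) chain_lawD[OF assms(1)] by (intro integrable_const_bound[where B=C] AE_I2)
    (simp_all add: measurable_cong_sets[OF chain_lawD(2)[OF assms(1)] refl])
qed

text \<open>Two finite measures on a product space that agree on rectangles coincide; on rectangles
  the identity is the defining property of \<open>chain_law\<close>.\<close>

lemma markov_distr:
 assumes Q: "chain_law Q" and n: "n >= 1"
 shows "distr Q (PiM {1..n} B \<Otimes>\<^sub>M B (Suc n)) (%w. (restrict w {1..n}, w (Suc n))) =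
  density (distr Q (PiM {1..n} B) (%w. restrict w {1..n}) \<Otimes>\<^sub>M mu (Suc n))
   (%(wt, y). ennreal (p n (wt n) y))" (is "?L = ?R")
proof -
 interpret Q: prob_space Q using chain_lawD[OF Q] by simp
 note [measurable_cong] = chain_lawD(2)[OF Q]
 have [measurable]: "(%w. restrict w {1..n}) : Q \<rightarrow>\<^sub>M PiM {1..n} B" using restr_measurable by (simp add: measurable_cong_sets[OF chain_lawD(2)[OF Q] refl])
 have [measurable]: "(%wt. wt n) : PiM {1..n} B \<rightarrow>\<^sub>M B n" using n by (intro measurable_component_singleton) auto
 let ?D = "distr Q (PiM {1..n} B) (%w. restrict w {1..n})"
 interpret D: prob_space ?D by (rule Q.prob_space_distr) measurable
 let ?E = "{a \<times> b | a b. a : sets (PiM {1..n} B) & b : sets (B (Suc n))}"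
 let ?S = "space (PiM {1..n} B) \<times> space (B (Suc n))"
 have pr [measurable]: "(%w. (restrict w {1..n}, w (Suc n))) : Q \<rightarrow>\<^sub>M PiM {1..n} B \<Otimes>\<^sub>M B (Suc n)" by (rule measurable_Pair) measurable
 have eqE: "emeasure ?L X = emeasure ?R X" and finE: "emeasure ?L X ~= \<infinity>" if XE: "X : ?E" for X
 proof -
  obtain A E where X: "X = A \<times> E" and A [measurable]: "A : sets (PiM {1..n} B)" and E [measurable]: "E : sets (B (Suc n))" using XE by auto
  have "emeasure ?L X = emeasure Q ((%w. (restrict w {1..n}, w (Suc n))) -` X \<inter> space Q)" unfolding X by (rule emeasure_distr[OF pr]) simp
  also have "... = emeasure Q {w : space paths. restrict w {1..n} : A & w (Suc n) : E}" unfolding X by (rule arg_cong[where f="emeasure Q"]) (auto simp: chain_lawD[OF Q])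
  also have "... = (\<integral>\<^sup>+w. indicator A (restrict w {1..n}) * (\<integral>\<^sup>+y. ennreal (p n (restrict w {1..n} n) y) * indicator E y \<partial>mu (Suc n)) \<partial>Q)"
   using Q n A E unfolding chain_law_def by auto
  also have "... = (\<integral>\<^sup>+wt. indicator A wt * (\<integral>\<^sup>+y. ennreal (p n (wt n) y) * indicator E y \<partial>mu (Suc n)) \<partial>?D)" by (subst nn_integral_distr) measurable
  also have "... = (\<integral>\<^sup>+wt. (\<integral>\<^sup>+y. ennreal (p n (wt n) y) * indicator (A \<times> E) (wt, y) \<partial>mu (Suc n)) \<partial>?D)" by (intro nn_integral_cong) (auto simp: indicator_def)
  also have "... = (\<integral>\<^sup>+z. (%(wt, y). ennreal (p n (wt n) y)) z * indicator X z \<partial>(?D \<Otimes>\<^sub>M mu (Suc n)))" unfolding X by (subst mu.nn_integral_fst[symmetric]) (auto simp: case_prod_beta')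
  also have "... = emeasure ?R X" unfolding X by (rule emeasure_density[symmetric]) auto
  finally show "emeasure ?L X = emeasure ?R X" .
  have "prob_space ?L" by (rule Q.prob_space_distr[OF pr])
  then interpret L: prob_space ?L .
  show "emeasure ?L X ~= \<infinity>" by simp
 qed
 show ?thesis
 proof (rule measure_eqI_generator_eq[where E="?E" and \<Omega>="?S" and A="%_. ?S"])
  show "Int_stable ?E" by (rule Int_stable_pair_measure_generator)
  show "?E \<subseteq> Pow ?S" by (auto dest: sets.sets_into_space)
  show "sets ?L = sigma_sets ?S ?E" by (simp add: sets_pair_measure)
  show "sets ?R = sigma_sets ?S ?E" using sets_pair_measure_cong[of ?D "PiM {1..n} B" "mu (Suc n)" "B (Suc n)"] by (simp add: sets_pair_measure)
  show "range (%_. ?S) \<subseteq> ?E" by auto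
  show "(\<Union>i. ?S) = ?S" by simp
  show "emeasure ?L X = emeasure ?R X" if "X : ?E" for X using that by (rule eqE)
  have "?S : ?E" by auto
  then show "emeasure ?L ?S ~= \<infinity>" by (rule finE)
 qed
qed

lemma markov_gen:
 fixes g :: "(nat => 'a) => 'a => 'b::{banach, second_countable_topology}"
 assumes Q: "chain_law Q" and n: "n >= 1"
  and g [measurable]: "(%(wt, y). g wt y) : borel_measurable (PiM {1..n} B \<Otimes>\<^sub>M B (Suc n))"
  and C: "!!wt y. wt : space (PiM {1..n} B) ==> y : space (B (Suc n)) ==> norm (g wt y) <= C"
 shows "(LINT w|Q. g (restrict w {1..n}) (w (Suc n))) = (LINT w|Q. trans n (g (restrict w {1..n})) (w n))"
proof -
 interpret Q: prob_space Q using chain_lawD[OF Q] by simp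
 note [measurable_cong] = chain_lawD(2)[OF Q]
 have [measurable]: "(%w. restrict w {1..n}) : Q \<rightarrow>\<^sub>M PiM {1..n} B" using restr_measurable by (simp add: measurable_cong_sets[OF chain_lawD(2)[OF Q] refl])
 have [measurable]: "(%wt. wt n) : PiM {1..n} B \<rightarrow>\<^sub>M B n" using n by (intro measurable_component_singleton) auto
 let ?D = "distr Q (PiM {1..n} B) (%w. restrict w {1..n})"
 interpret D: prob_space ?D by (rule Q.prob_space_distr) measurable
 interpret DM: pair_prob_space ?D "mu (Suc n)" ..
 have wn: "wt n : space (B n)" if "wt : space (PiM {1..n} B)" for wt using measurable_space[OF \<open>(%wt. wt n) : PiM {1..n} B \<rightarrow>\<^sub>M B n\<close> that] .
 have int: "integrable (?D \<Otimes>\<^sub>M mu (Suc n)) (%(wt, y). p n (wt n) y *\<^sub>R g wt y)"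
 proof (rule DM.integrable_const_bound[where B="(1/eps) * C"])
  show "AE x in ?D \<Otimes>\<^sub>M mu (Suc n). norm (case x of (wt, y) => p n (wt n) y *\<^sub>R g wt y) <= 1/eps * C"
  proof (rule AE_I2)
   fix z assume "z : space (?D \<Otimes>\<^sub>M mu (Suc n))"
   then show "norm (case z of (wt, y) => p n (wt n) y *\<^sub>R g wt y) <= 1/eps * C" using mult_mono[OF p_le[of n "fst z n" "snd z"] C[of "fst z" "snd z"]] eps_pos by (auto simp: space_pair_measure split_beta)
  qed
 qed measurable
 have "(LINT w|Q. g (restrict w {1..n}) (w (Suc n))) =
   (LINT z|(distr Q (PiM {1..n} B \<Otimes>\<^sub>M B (Suc n)) (%w. (restrict w {1..n}, w (Suc n)))). (%(wt, y). g wt y) z)" by (subst integral_distr) (auto simp del: restrict_apply)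
 also have "... = (LINT z|(?D \<Otimes>\<^sub>M mu (Suc n)). (%(wt, y). p n (wt n) y *\<^sub>R g wt y) z)" unfolding markov_distr[OF Q n]
  using integral_density[of "%(wt, y). g wt y" "?D \<Otimes>\<^sub>M mu (Suc n)" "%(wt, y). p n (wt n) y"] by (simp add: case_prod_beta')
 also have "... = (LINT wt|?D. (LINT y|(mu (Suc n)). p n (wt n) y *\<^sub>R g wt y))" by (subst DM.integral_fst'[symmetric, OF int]) simp
 also have "... = (LINT w|Q. (LINT y|(mu (Suc n)). p n (restrict w {1..n} n) y *\<^sub>R g (restrict w {1..n}) y))" by (rule integral_distr) measurable
 also have "... = (LINT w|Q. trans n (g (restrict w {1..n})) (w n))" using n by (simp add: trans_def)
 finally show ?thesis .
qed

text \<open>The factor \<open>G\<close> carries everything known up to time n. All later inductions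
  over time integrate out one step in this form and then absorb its result into \<open>G\<close> or
  into the test function.\<close>

lemma markov:
 fixes G :: "_ => 'b::{real_normed_field, banach, second_countable_topology}"
 assumes Q: "chain_law Q" and n: "n >= 1" and G: "adapted n G"
  and GC: "!!w. w : space (PiM {1..n} B) ==> norm (G w) <= C"
  and u [measurable]: "(%(x, y). u x y) : borel_measurable (B n \<Otimes>\<^sub>M B (Suc n))"
  and uC: "!!x y. x : space (B n) ==> y : space (B (Suc n)) ==> norm (u x y) <= C'"
 shows "(LINT w|Q. G w * u (w n) (w (Suc n))) = (LINT w|Q. G w * trans n (u (w n)) (w n))"
proof -
 have [measurable]: "G : borel_measurable (PiM {1..n} B)" and Gr: "!!w. G (restrict w {1..n}) = G w" using G by (auto simp: adapted_def)
 have [measurable]: "(%wt. wt n) : PiM {1..n} B \<rightarrow>\<^sub>M B n" using n by (intro measurable_component_singleton) auto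
 have "(LINT w|Q. G w * u (w n) (w (Suc n))) =
   (LINT w|Q. (%wt y. G wt * u (wt n) y) (restrict w {1..n}) (w (Suc n)))" using n by (simp add: Gr)
 also have "... = (LINT w|Q. trans n ((%wt y. G wt * u (wt n) y) (restrict w {1..n})) (w n))"
 proof (rule markov_gen[OF Q n, where C="C * C'"])
  fix wt y assume "wt : space (PiM {1..n} B)" "y : space (B (Suc n))"
  moreover from this have "wt n : space (B n)" using measurable_space[OF \<open>(%wt. wt n) : PiM {1..n} B \<rightarrow>\<^sub>M B n\<close>] by blast
  ultimately show "norm (G wt * u (wt n) y) <= C * C'" using GC[of wt] uC[of "wt n" y] norm_ge_zero[of "G wt"] order_trans[OF norm_ge_zero GC[of wt]] by (auto simp: norm_mult intro!: mult_mono)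
 qed measurable
 also have "... = (LINT w|Q. G w * trans n (u (w n)) (w n))" using n by (simp add: trans_def Gr mult_scaleR_right[symmetric] del: mult_scaleR_right)
 finally show ?thesis .
qed

end

lemma (in prob_space) integral_between:
 fixes f :: "'a => real"
 assumes "integrable M f" "!!x. x : space M ==> a <= f x" "!!x. x : space M ==> f x <= b"
 shows "a <= (LINT x|M. f x)" "(LINT x|M. f x) <= b"
proof -
 have "(LINT x|M. a) <= (LINT x|M. f x)" "(LINT x|M. f x) <= (LINT x|M. b)" by (intro integral_mono assms; use assms in simp)+
 then show "a <= (LINT x|M. f x)" "(LINT x|M. f x) <= b" by (simp_all add: prob_space)
qed

section \<open>Two-step densities, contraction of oscillation and mixing\<close>

context elliptic_chain
begin

text \<open>Two-step transition density. A one-step density may vanish on large sets; a lower bound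
  is only available after two steps.\<close>

definition q :: "nat => 'a => 'a => real" where
 "q n x z = (LINT y|(mu (Suc n)). p n x y * p (Suc n) y z)"

lemma q_measurable [measurable (raw)]:
 assumes [measurable]: "f : M \<rightarrow>\<^sub>M B n" "g : M \<rightarrow>\<^sub>M B (Suc (Suc n))"
 shows "(%x. q n (f x) (g x)) : borel_measurable M" unfolding q_def by measurable

lemma q_gt: "n >= 1 ==> x : space (B n) ==> z : space (B (Suc (Suc n))) ==> eps < q n x z" unfolding q_def by (rule two_step)

lemma trans_le:
 assumes "u : borel_measurable (B (Suc n))" "!!y. y : space (B (Suc n)) ==> abs (u y) <= C"
  and "!!y. y : space (B (Suc n)) ==> u y <= (b::real)" "x : space (B n)"
 shows "trans n u x <= b"
proof -
 have "trans n u x <= (LINT y|(mu (Suc n)). p n x y * b)" unfolding trans_def real_scaleR_def using integrable_pu[of u n C x] integrable_p[of x n] assms by (intro integral_mono) (auto intro!: mult_left_mono)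
 then show ?thesis using p_int[OF assms(4)] by simp
qed

lemma trans_ge:
 assumes "u : borel_measurable (B (Suc n))" "!!y. y : space (B (Suc n)) ==> abs (u y) <= C"
  and "!!y. y : space (B (Suc n)) ==> (b::real) <= u y" "x : space (B n)"
 shows "b <= trans n u x"
proof -
 have "(LINT y|(mu (Suc n)). p n x y * b) <= trans n u x" unfolding trans_def real_scaleR_def using integrable_pu[of u n C x] integrable_p[of x n] assms by (intro integral_mono) (auto intro!: mult_left_mono)
 then show ?thesis using p_int[OF assms(4)] by simp
qed

lemma q_le:
 assumes "x : space (B n)" "z : space (B (Suc (Suc n)))"
 shows "0 <= q n x z" "q n x z <= 1 / eps"
proof -
 have [measurable]: "(%y. p (Suc n) y z) : borel_measurable (B (Suc n))" using assms by measurable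
 have q: "q n x z = trans n (%y. p (Suc n) y z) x" by (simp add: q_def trans_def)
 show "0 <= q n x z" unfolding q by (rule trans_ge[where C="1/eps"]) (use assms p_le in auto)
 show "q n x z <= 1/eps" unfolding q by (rule trans_le[where C="1/eps"]) (use assms p_le in auto)
qed

lemma trans_trans:
 fixes u :: "'a => 'b::{banach, second_countable_topology}"
 assumes u [measurable]: "u : borel_measurable (B (Suc (Suc n)))"
  and C: "!!y. y : space (B (Suc (Suc n))) ==> norm (u y) <= C" and x [measurable]: "x : space (B n)"
 shows "trans n (trans (Suc n) u) x = (LINT z|(mu (Suc (Suc n))). q n x z *\<^sub>R u z)"
proof -
 interpret pair_prob_space "mu (Suc n)" "mu (Suc (Suc n))" ..
 have "trans n (trans (Suc n) u) x =
   (LINT y|(mu (Suc n)). (LINT z|(mu (Suc (Suc n))). (p n x y * p (Suc n) y z) *\<^sub>R u z))" by (simp add: trans_def integral_scaleR_right[symmetric] del: integral_scaleR_right)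
 also have "... = (LINT z|(mu (Suc (Suc n))). (LINT y|(mu (Suc n)). (p n x y * p (Suc n) y z) *\<^sub>R u z))"
 proof (rule Fubini_integral[symmetric])
  show "integrable (mu (Suc n) \<Otimes>\<^sub>M mu (Suc (Suc n))) (%(y, z). (p n x y * p (Suc n) y z) *\<^sub>R u z)"
  proof (rule integrable_const_bound[where B="((1/eps) * (1/eps)) * C"])
   show "AE wt in mu (Suc n) \<Otimes>\<^sub>M mu (Suc (Suc n)). norm (case wt of (y, z) => (p n x y * p (Suc n) y z) *\<^sub>R u z) <= 1 / eps * (1 / eps) * C"
   proof (rule AE_I2)
    fix wt assume "wt : space (mu (Suc n) \<Otimes>\<^sub>M mu (Suc (Suc n)))"
    then show "norm (case wt of (y, z) => (p n x y * p (Suc n) y z) *\<^sub>R u z) <= 1 / eps * (1 / eps) * C" using mult_mono[OF mult_mono[OF p_le[of n x "fst wt"] p_le[of "Suc n" "fst wt" "snd wt"]] C[of "snd wt"]] eps_pos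
     by (auto simp: space_pair_measure split_beta)
   qed
  qed measurable
 qed
 also have "... = (LINT z|(mu (Suc (Suc n))). q n x z *\<^sub>R u z)"
 proof (rule Bochner_Integration.integral_cong[OF refl])
  fix z assume z [measurable]: "z : space (mu (Suc (Suc n)))"
  then have [measurable]: "(%y. p (Suc n) y z) : borel_measurable (B (Suc n))" by simp
  have "integrable (mu (Suc n)) (%y. p n x y *\<^sub>R p (Suc n) y z)" by (rule integrable_pu[where C="1/eps"]) (use x p_le in auto)
  then show "(LINT y|(mu (Suc n)). (p n x y * p (Suc n) y z) *\<^sub>R u z) = q n x z *\<^sub>R u z" by (simp add: q_def integral_scaleR_left)
 qed
 finally show ?thesis .
qed

lemma q_int:
 assumes x: "x : space (B n)"
 shows "(LINT z|(mu (Suc (Suc n))). q n x z) = 1" "integrable (mu (Suc (Suc n))) (q n x)"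
proof -
 have "trans n (trans (Suc n) (%_. 1::real)) x = (LINT z|(mu (Suc (Suc n))). q n x z *\<^sub>R 1)" using x by (intro trans_trans[where C=1]) auto
 moreover have "trans n (trans (Suc n) (%_. 1::real)) x = trans n (%_. 1) x" unfolding trans_def[of n] using x p_int by (intro Bochner_Integration.integral_cong) (auto simp: trans_def)
 ultimately show "(LINT z|(mu (Suc (Suc n))). q n x z) = 1" using p_int[OF x] by (simp add: trans_def)
 show "integrable (mu (Suc (Suc n))) (q n x)" using q_le x by (intro integrable_mu[where C="1/eps"]) (auto intro!: q_measurable)
qed

text \<open>A bound on differences instead of a supremum, which spares the existence of
  suprema.\<close>

definition osc_le :: "nat => ('a => real) => real => bool" where
 "osc_le n u c \<longleftrightarrow> (\<forall>x\<in>space (B n). \<forall>y\<in>space (B n). u x - u y <= c)"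

lemma osc_le_range:
 assumes "osc_le n u c" obtains a where "!!x. x : space (B n) ==> a <= u x & u x <= a + c"
proof -
 obtain x0 where x0: "x0 : space (B n)" using mu.not_empty[of n] by auto
 have bdd: "bdd_below (u ` space (B n))" by (rule bdd_belowI2[where m="u x0 - c"]) (use assms x0 in \<open>force simp: osc_le_def\<close>)
 have "Inf (u ` space (B n)) <= u x & u x <= Inf (u ` space (B n)) + c" if x: "x : space (B n)" for x
 proof -
  have "u x - c <= Inf (u ` space (B n))" by (rule cInf_greatest) (use assms x in \<open>force simp: osc_le_def\<close>)+
  then show ?thesis using cInf_lower[OF _ bdd, of "u x"] x by auto
 qed
 then show ?thesis using that by blast
qed

lemma osc_le_trans:
 assumes [measurable]: "u : borel_measurable (B (Suc n))" and o: "osc_le (Suc n) u c"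
 shows "osc_le n (trans n u) c"
proof -
 obtain a where a: "!!x. x : space (B (Suc n)) ==> a <= u x & u x <= a + c" using osc_le_range[OF o] by blast
 have b: "abs (u y) <= abs a + abs c" if "y : space (B (Suc n))" for y using a[OF that] by linarith
 show ?thesis using trans_le[OF assms(1) b, of "a + c"] trans_ge[OF assms(1) b, of a] a unfolding osc_le_def by (smt (verit, best))
qed

text \<open>Doeblin's argument: split the density \<open>q n x\<close> into the constant
  \<open>eps\<close> and the nonnegative rest \<open>q n x - eps\<close>. The constant part
  contributes the same number \<open>I\<close> for every \<open>x\<close>; the rest has mass
  \<open>1 - eps\<close>, and only this share of the oscillation survives.\<close>

lemma osc_le_two_step:
 assumes n: "n >= 1" and u [measurable]: "u : borel_measurable (B (Suc (Suc n)))"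
  and o: "osc_le (Suc (Suc n)) u c"
 shows "osc_le n (trans n (trans (Suc n) u)) ((1 - eps) * c)"
proof -
 let ?m = "mu (Suc (Suc n))"
 obtain a where a: "!!x. x : space (B (Suc (Suc n))) ==> a <= u x & u x <= a + c" using osc_le_range[OF o] by blast
 have b: "norm (u y) <= abs a + abs c" if "y : space (B (Suc (Suc n)))" for y using a[OF that] unfolding real_norm_def by linarith
 define I where "I = eps * (LINT z|?m. u z)"
 have iu: "integrable ?m u" by (rule integrable_mu[OF u b])
 have "I + (1 - eps) * a <= trans n (trans (Suc n) u) x &
    trans n (trans (Suc n) u) x <= I + (1 - eps) * (a + c)" if x: "x : space (B n)" for x
 proof -
  have iqu: "integrable ?m (%z. q n x z * u z)"
  proof (rule integrable_mu)
   fix y assume "y : space (B (Suc (Suc n)))"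
   then show "norm (q n x y * u y) <= (1/eps) * (abs a + abs c)" unfolding norm_mult using b q_le[OF x] eps_pos by (intro mult_mono) auto
  qed (use x in measurable)
  have wt: "integrable ?m (%z. (q n x z - eps) * u z)" "integrable ?m (%z. (q n x z - eps) * a)"
    "integrable ?m (%z. (q n x z - eps) * (a + c))" using iqu iu q_int[OF x] by (auto simp: left_diff_distrib)
  have t: "trans n (trans (Suc n) u) x = I + (LINT z|?m. (q n x z - eps) * u z)" using trans_trans[OF u b x] iqu iu by (simp add: I_def left_diff_distrib)
  have wi: "(LINT z|?m. (q n x z - eps) * r) = (1 - eps) * r" for r using q_int[OF x] mu.prob_space[of "Suc (Suc n)"] by simp
  have "(LINT z|?m. (q n x z - eps) * a) <= (LINT z|?m. (q n x z - eps) * u z)" using wt a q_gt[OF n x] by (intro integral_mono mult_left_mono) (auto intro: less_imp_le)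
  moreover have "(LINT z|?m. (q n x z - eps) * u z) <= (LINT z|?m. (q n x z - eps) * (a + c))" using wt a q_gt[OF n x] by (intro integral_mono mult_left_mono) (auto intro: less_imp_le)
  ultimately show ?thesis unfolding t wi by simp
 qed
 then show ?thesis unfolding osc_le_def by (smt (verit, best) distrib_left)
qed

text \<open>\<open>cexp m k v x\<close> is the expectation of \<open>v\<close> at time
  \<open>m + k\<close> given the state \<open>x\<close> at time \<open>m\<close>.\<close>

fun cexp :: "nat => nat => ('a => 'b) => 'a => 'b::{banach, second_countable_topology}" where
 "cexp m 0 v = v"
| "cexp m (Suc k) v = trans m (cexp (Suc m) k v)"

lemma cexp_measurable [measurable]:
 "v : borel_measurable (B (m + k)) ==> cexp m k v : borel_measurable (B m)"
proof (induction k arbitrary: m)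
 case (Suc k)
 then have [measurable]: "cexp (Suc m) k v : borel_measurable (B (Suc m))" by simp
 show ?case by simp
qed simp

lemma norm_cexp_le:
 assumes "v : borel_measurable (B (m + k))" "!!y. y : space (B (m + k)) ==> norm (v y) <= C"
 shows "x : space (B m) ==> norm (cexp m k v x) <= C" using assms
proof (induction k arbitrary: m x)
 case (Suc k)
 show ?case unfolding cexp.simps by (rule norm_trans_le) (use Suc.prems cexp_measurable[of v "Suc m" k] in \<open>auto intro!: Suc.IH\<close>)
qed simp

lemma cexp_add: "cexp m (k + l) v = cexp m k (cexp (m + k) l v)" by (induction k arbitrary: m) auto

lemma osc_le_cexp:
 assumes "v : borel_measurable (B (m + k))" "osc_le (m + k) v c" "m >= 1"
 shows "osc_le m (cexp m k v) ((1 - eps) ^ (k div 2) * c)" using assms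
proof (induction k arbitrary: m rule: induct_nat_012)
 case 1
 then show ?case using osc_le_trans[of v m c] by simp
next
 case (ge2 k)
 have "osc_le (Suc (Suc m)) (cexp (Suc (Suc m)) k v) ((1 - eps) ^ (k div 2) * c)" using ge2 by simp
 moreover have "cexp (Suc (Suc m)) k v : borel_measurable (B (Suc (Suc m)))" using ge2 by (intro cexp_measurable) simp
 ultimately show ?case using osc_le_two_step[of m "cexp (Suc (Suc m)) k v" "(1 - eps) ^ (k div 2) * c"] ge2 by (simp add: mult.assoc)
qed simp

lemma cexp_law:
 fixes G :: "_ => 'b::{real_normed_field, banach, second_countable_topology}"
 assumes Q: "chain_law Q" and "m >= 1" "adapted m G"
  and "!!w. norm (G w) <= C"
  and v: "v : borel_measurable (B (m + k))" and vC: "!!y. y : space (B (m + k)) ==> norm (v y) <= C'"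
 shows "(LINT w|Q. G w * v (w (m + k))) = (LINT w|Q. G w * cexp m k v (w m))" using assms
proof (induction k arbitrary: m)
 case (Suc k)
 have [measurable]: "cexp (Suc m) k v : borel_measurable (B (Suc m))" using Suc.prems by (intro cexp_measurable) simp
 have "(LINT w|Q. G w * v (w (m + Suc k))) = (LINT w|Q. G w * v (w (Suc m + k)))" by simp
 also have "... = (LINT w|Q. G w * cexp (Suc m) k v (w (Suc m)))" using Suc.prems by (intro Suc.IH) (auto intro: adapted_mono)
 also have "... = (LINT w|Q. G w * trans m (%y. cexp (Suc m) k v y) (w m))" by (rule markov[OF Q, where u="%_ y. cexp (Suc m) k v y" and C=C and C'=C'])
    (use Suc.prems norm_cexp_le[of v "Suc m" k C'] in auto)
 finally show ?case by simp
qed simp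

text \<open>Time 3 is the first one that lies two steps after a time at least 1, so the two-sided
  bound on \<open>q\<close> applies whatever the initial law is. This is why sums and estimates
  below begin at 3.\<close>

lemma law_le:
 assumes Q: "chain_law Q" and j: "j >= 3" and v: "v : borel_measurable (B j)"
  and vb: "!!y. y : space (B j) ==> 0 <= v y & v y <= (C::real)"
 shows "eps * (LINT y|(mu j). v y) <= (LINT w|Q. v (w j))" "(LINT w|Q. v (w j)) <= (1/eps) * (LINT y|(mu j). v y)"
proof -
 interpret Q: prob_space Q using chain_lawD[OF Q] by simp
 obtain m where m: "j = Suc (Suc m)" and m1: "m >= 1" using that[of "j - 2"] j by auto
 note v' = v[unfolded m]
 have vn: "norm (v y) <= C" if "y : space (B (Suc (Suc m)))" for y using vb[of y] that m by simp
 have [measurable]: "trans m (trans (Suc m) v) : borel_measurable (B m)" using cexp_measurable[of v m 2] v' by (simp add: numeral_2_eq_2)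
 have E: "(LINT w|Q. v (w j)) = (LINT w|Q. trans m (trans (Suc m) v) (w m))" using cexp_law[OF Q m1, of "%_. 1::real" 1 v 2 C] v' vn m by (auto simp: numeral_2_eq_2)
 have iv: "integrable (mu j) v" using integrable_mu[OF v'[folded m], of C] vn m by simp
 have b: "eps * (LINT y|(mu j). v y) <= trans m (trans (Suc m) v) x & trans m (trans (Suc m) v) x <= (1/eps) * (LINT y|(mu j). v y)"
  if x: "x : space (B m)" for x
 proof -
  have iq: "integrable (mu j) (%z. q m x z * v z)" unfolding m
  proof (rule integrable_mu)
   fix y assume y: "y : space (B (Suc (Suc m)))"
   show "norm (q m x y * v y) <= (1/eps) * C" unfolding norm_mult using vn[OF y] q_le[OF x y] eps_pos by (intro mult_mono) auto
  qed (use x v' in measurable)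
  have t: "trans m (trans (Suc m) v) x = (LINT z|(mu j). q m x z * v z)" using trans_trans[OF v' vn x] m by simp
  have "(LINT y|(mu j). eps * v y) <= (LINT z|(mu j). q m x z * v z)" using iv iq q_gt[OF m1 x] vb by (intro integral_mono mult_right_mono) (auto simp: m intro: less_imp_le)
  moreover have "(LINT z|(mu j). q m x z * v z) <= (LINT y|(mu j). (1/eps) * v y)" using iv iq q_le[OF x] vb by (intro integral_mono mult_right_mono) (auto simp: m)
  ultimately show ?thesis unfolding t by simp
 qed
 have i: "integrable Q (%w. trans m (trans (Suc m) v) (w m))" by (rule law_integrable[OF Q, where C="C"])
    (use norm_cexp_le[of v m 2 C] v' vn m1 coord_space in \<open>auto simp: numeral_2_eq_2\<close>)
 show "eps * (LINT y|(mu j). v y) <= (LINT w|Q. v (w j))" "(LINT w|Q. v (w j)) <= (1/eps) * (LINT y|(mu j). v y)" unfolding E using Q.integral_between[OF i, of "eps * (LINT y|(mu j). v y)" "(1/eps) * (LINT y|(mu j). v y)"]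
   b[OF coord_space[OF m1]] chain_lawD(3)[OF Q] by simp_all
qed


definition rate :: "nat => real" where "rate k = (1 - eps) ^ (k div 2)"

lemma rate_nonneg: "0 <= rate k" and rate_le1: "rate k <= 1" using eps_pos eps_less by (auto simp: rate_def power_le_one)

lemma trans_of_real:
 "trans n (%y. of_real (u y) :: complex) x = of_real (trans n u x)" by (simp add: trans_def scaleR_conv_of_real of_real_mult[symmetric] del: of_real_mult)

lemma cexp_of_real:
 "cexp m k (%y. of_real (v y) :: complex) = (%x. of_real (cexp m k v x))" by (induction k arbitrary: m) (auto simp: trans_of_real)

text \<open>The centring is the mean under \<open>P\<close> although the integral is taken under
  \<open>Q\<close>. The last two of the k + 2 steps replace the sup norm of \<open>v\<close> by its
  \<open>mu\<close>-average, through \<open>q <= 1/eps\<close>; the other k steps contract the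
  oscillation of the conditional expectation. Its mean under \<open>P\<close> is the centring, hence
  within one oscillation of every value.\<close>

lemma mix_coord:
 fixes G :: "_ => complex"
 assumes P: "chain_law P" and Q: "chain_law Q" and m: "m >= 1" and G: "adapted m G"
  and GC: "!!w. norm (G w) <= C"
  and v [measurable]: "v : borel_measurable (B (m + k + 2))"
  and vC: "!!y. y : space (B (m + k + 2)) ==> abs (v y) <= C'"
 shows "norm (LINT w|Q. G w * of_real (v (w (m + k + 2)) - (LINT w|P. v (w (m + k + 2))))) <=
  (LINT w|Q. norm (G w)) * ((2/eps) * rate k * (LINT y|(mu (m + k + 2)). abs (v y)))"
proof -
 interpret P: prob_space P using chain_lawD[OF P] by simp
 interpret Q: prob_space Q using chain_lawD[OF Q] by simp
 define I where "I = (LINT y|(mu (m + k + 2)). abs (v y))"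
 define wt where "wt = cexp (m + k) 2 v"
 have v' [measurable]: "v : borel_measurable (B (Suc (Suc (m + k))))" using v by simp
 have wt [measurable]: "wt : borel_measurable (B (m + k))" unfolding wt_def by (rule cexp_measurable) simp
 have iv: "integrable (mu (m + k + 2)) v" using integrable_mu[OF v, of C'] vC by simp
 have w_le: "abs (wt x) <= I / eps" if x: "x : space (B (m + k))" for x
 proof -
  have "wt x = (LINT z|(mu (Suc (Suc (m + k)))). q (m + k) x z *\<^sub>R v z)" using trans_trans[OF v' _ x, of C'] vC by (simp add: wt_def numeral_2_eq_2)
  also have "abs (...) <= (LINT z|(mu (Suc (Suc (m + k)))). (1/eps) * abs (v z))" unfolding real_norm_def[symmetric]
  proof (rule order_trans[OF integral_norm_bound integral_mono])
   show "integrable (mu (Suc (Suc (m + k)))) (%z. norm (q (m + k) x z *\<^sub>R v z))"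
   proof (rule integrable_norm, rule integrable_mu)
    fix y assume y: "y : space (B (Suc (Suc (m + k))))"
    show "norm (q (m + k) x y *\<^sub>R v y) <= (1/eps) * C'" unfolding norm_scaleR using vC[of y] q_le[OF x y] eps_pos y by (intro mult_mono) auto
   qed (use x in measurable)
   fix z assume "z : space (mu (Suc (Suc (m + k))))"
   then show "norm (q (m + k) x z *\<^sub>R v z) <= (1/eps) * norm (v z)" using q_le[OF x, of z] eps_pos unfolding norm_scaleR by (intro mult_mono) auto
  qed (use iv in auto)
  also have "... = I / eps" by (simp add: I_def)
  finally show ?thesis .
 qed
 define c where "c = cexp m k wt"
 have c [measurable]: "c : borel_measurable (B m)" unfolding c_def by (rule cexp_measurable[OF wt])
 have cb: "abs (c x) <= I / eps" if "x : space (B m)" for x using norm_cexp_le[OF wt, of "I / eps" x] w_le that by (simp add: c_def)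
 have osc: "osc_le m c (rate k * (2 * I / eps))" unfolding c_def rate_def
 proof (rule osc_le_cexp[OF wt _ m])
  show "osc_le (m + k) wt (2 * I / eps)" unfolding osc_le_def
  proof (intro ballI)
   fix x y assume "x : space (B (m + k))" "y : space (B (m + k))"
   then have "abs (wt x) <= I / eps" "abs (wt y) <= I / eps" using w_le by auto
   moreover have "2 * I / eps = I / eps + I / eps" by simp
   ultimately show "wt x - wt y <= 2 * I / eps" by linarith
  qed
 qed
 have ceq: "cexp m (k + 2) v = c" unfolding c_def wt_def by (rule cexp_add)
 define e where "e = (LINT w|P. v (w (m + k + 2)))"
 have e: "e = (LINT w|P. c (w m))" using cexp_law[OF P m adapted_const[of m "1::real"], of 1 v "k + 2" C', unfolded ceq] v vC by (simp add: e_def)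
 have ci: "integrable P (%w. c (w m))" "integrable Q (%w. c (w m))" by (rule law_integrable[OF P, where C="I/eps"] law_integrable[OF Q, where C="I/eps"],
    use m cb coord_space in auto)+
 have dev: "abs (c x - e) <= rate k * (2 * I / eps)" if x: "x : space (B m)" for x
 proof -
  have "c x - rate k * (2 * I / eps) <= c (w m) & c (w m) <= c x + rate k * (2 * I / eps)" if "w : space P" for w using osc x coord_space[OF m, of w] that chain_lawD[OF P] unfolding osc_le_def by force
  then show ?thesis unfolding e using P.integral_between[OF ci(1), of "c x - rate k * (2 * I / eps)" "c x + rate k * (2 * I / eps)"] by auto
 qed
 have Gm [measurable]: "G : borel_measurable paths" by (rule adapted_measurable[OF G])
 have mm: "m + k + 2 >= 1" by simp
 have vm [measurable]: "(%w. v (w (m + k + 2))) : borel_measurable paths" using measurable_compose[OF coord[OF mm] v] .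
 have cm [measurable]: "(%w. c (w m)) : borel_measurable paths" using measurable_compose[OF coord[OF m] c] .
 have i1: "integrable Q G" by (rule law_integrable[OF Q Gm GC])
 have i2: "integrable Q (%w. G w * of_real (v (w (m + k + 2))))"
 proof (rule law_integrable[OF Q, where C="C * C'"])
  fix w assume "w : space paths"
  then show "norm (G w * of_real (v (w (m + k + 2)))) <= C * C'" unfolding norm_mult using GC[of w] vC coord_space[OF mm] order_trans[OF norm_ge_zero GC[of w]] by (intro mult_mono) auto
 qed measurable
 have i3: "integrable Q (%w. G w * of_real (c (w m)))"
 proof (rule law_integrable[OF Q, where C="C * (I / eps)"])
  fix w assume "w : space paths"
  then show "norm (G w * of_real (c (w m))) <= C * (I / eps)" unfolding norm_mult using GC[of w] cb coord_space[OF m] order_trans[OF norm_ge_zero GC[of w]] by (intro mult_mono) auto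
 qed measurable
 have "(LINT w|Q. G w * of_real (v (w (m + k + 2)) - e)) = (LINT w|Q. G w * of_real (v (w (m + k + 2)))) - (LINT w|Q. G w) * of_real e" using i1 i2 by (simp add: right_diff_distrib)
 also have "(LINT w|Q. G w * of_real (v (w (m + k + 2)))) = (LINT w|Q. G w * of_real (c (w m)))" using cexp_law[OF Q m G GC, of "%y. of_real (v y)" "k + 2" C', unfolded cexp_of_real ceq] v vC by simp
 also have "(LINT w|Q. G w * of_real (c (w m))) - (LINT w|Q. G w) * of_real e = (LINT w|Q. G w * of_real (c (w m) - e))" using i1 i3 by (simp add: right_diff_distrib)
 also have "norm ... <= (LINT w|Q. norm (G w) * (rate k * (2 * I / eps)))"
 proof (rule order_trans[OF integral_norm_bound integral_mono])
  show "integrable Q (%w. norm (G w * of_real (c (w m) - e)))" using i1 i3 by (intro integrable_norm) (simp add: right_diff_distrib)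
  show "integrable Q (%w. norm (G w) * (rate k * (2 * I / eps)))" using i1 by simp
  fix w assume "w : space Q"
  then have "abs (c (w m) - e) <= rate k * (2 * I / eps)" using dev coord_space[OF m] chain_lawD[OF Q] by auto
  then show "norm (G w * of_real (c (w m) - e)) <= norm (G w) * (rate k * (2 * I / eps))" unfolding norm_mult norm_of_real by (intro mult_left_mono) auto
 qed
 also have "... = (LINT w|Q. norm (G w)) * ((2/eps) * rate k * I)" by (simp add: mult_ac)
 finally show ?thesis unfolding I_def e_def .
qed

text \<open>Integrating out the last coordinate reduces a function of a pair to
  \<open>mix_coord\<close>. The \<open>mu\<close>-average that appears there is turned back into an
  expectation under \<open>P\<close> by \<open>law_le\<close>, at the price of another factor
  \<open>1/eps\<close>.\<close>

lemma mix_pair: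
 fixes G :: "_ => complex"
 assumes P: "chain_law P" and Q: "chain_law Q" and m: "m >= 1" and G: "adapted m G"
  and GC: "!!w. norm (G w) <= C" and j: "j = m + k + 2"
  and u [measurable]: "(%(x, y). u x y) : borel_measurable (B j \<Otimes>\<^sub>M B (Suc j))"
  and uC: "!!x y. x : space (B j) ==> y : space (B (Suc j)) ==> abs (u x y) <= C'"
 shows "norm (LINT w|Q. G w * of_real (u (w j) (w (Suc j)) - (LINT w|P. u (w j) (w (Suc j))))) <=
  (LINT w|Q. norm (G w)) * ((2/eps^2) * rate k * (LINT w|P. abs (u (w j) (w (Suc j)))))"
proof -
 have j1: "j >= 1" "j >= 3" using j m by auto
 have ux: "u x : borel_measurable (B (Suc j))" if "x : space (B j)" for x using measurable_compose[OF measurable_Pair1'[OF that, of "B (Suc j)"] u] by simp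
 define v where "v x = trans j (u x) x" for x
 have v [measurable]: "v : borel_measurable (B j)" unfolding v_def by measurable
 have vC: "abs (v x) <= C'" if "x : space (B j)" for x using norm_trans_le[OF ux[OF that] _ that, of C'] uC[OF that] by (simp add: v_def)
 define va where "va x = trans j (%y. abs (u x y)) x" for x
 have va [measurable]: "va : borel_measurable (B j)" unfolding va_def by measurable
 have vaC: "0 <= va x & va x <= C'" if "x : space (B j)" for x
 proof
  have [measurable]: "u x : borel_measurable (B (Suc j))" by (rule ux[OF that])
  show "va x <= C'" unfolding va_def by (rule trans_le[where C=C']) (use that uC in auto)
  show "0 <= va x" unfolding va_def by (rule trans_ge[where C=C']) (use that uC in auto)
 qed
 have vva: "abs (v x) <= va x" if "x : space (B j)" for x unfolding v_def va_def trans_def real_norm_def[symmetric] using integral_norm_bound[of "mu (Suc j)" "%y. p j x y *\<^sub>R u x y"] by (simp add: abs_mult)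
 have e1: "(LINT w|P. u (w j) (w (Suc j))) = (LINT w|P. v (w j))" using markov[OF P j1(1) adapted_const[of j "1::real"], of 1 u C'] uC by (simp add: v_def)
 have e2: "(LINT w|P. abs (u (w j) (w (Suc j)))) = (LINT w|P. va (w j))" using markov[OF P j1(1) adapted_const[of j "1::real"], of 1 "%x y. abs (u x y)" C'] uC by (simp add: va_def)
 have "(LINT x|(mu j). abs (v x)) <= (LINT x|(mu j). va x)" using vva vC vaC by (intro integral_mono integrable_mu[where C=C']) auto
 also have "... <= (1/eps) * (LINT w|P. abs (u (w j) (w (Suc j))))" using law_le(1)[OF P j1(2) va vaC] eps_pos by (simp add: e2 field_simps)
 finally have I: "(LINT x|(mu j). abs (v x)) <= (1/eps) * (LINT w|P. abs (u (w j) (w (Suc j))))" .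
 define e where "e = (LINT w|P. v (w j))"
 have Gj: "adapted j G" using G j by (auto intro: adapted_mono)
 have "(LINT w|Q. G w * of_real (u (w j) (w (Suc j)) - e)) =
   (LINT w|Q. G w * trans j (%y. of_real (u (w j) y - e)) (w j))"
 proof (rule markov[OF Q j1(1) Gj, where C=C and C'="C' + abs e" and u="%x y. of_real (u x y - e)"])
  fix x y assume xy: "x : space (B j)" "y : space (B (Suc j))"
  then show "norm (complex_of_real (u x y - e)) <= C' + abs e" using uC[OF xy] by (simp only: norm_of_real)
 qed (use GC in auto)
 also have "... = (LINT w|Q. G w * of_real (v (w j) - e))"
 proof (rule Bochner_Integration.integral_cong[OF refl])
  fix w assume "w : space Q"
  then have x: "w j : space (B j)" using coord_space[OF j1(1)] chain_lawD[OF Q] by auto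
  have "integrable (mu (Suc j)) (%y. p j (w j) y * u (w j) y)" using integrable_pu[OF ux[OF x] _ x, of C'] uC[OF x] by simp
  then have "trans j (%y. u (w j) y - e) (w j) = v (w j) - e" using integrable_p[OF x] p_int[OF x] by (simp add: v_def trans_def right_diff_distrib)
  then show "G w * trans j (%y. of_real (u (w j) y - e)) (w j) = G w * of_real (v (w j) - e)" unfolding trans_of_real by simp
 qed
 also have "norm ... <= (LINT w|Q. norm (G w)) * ((2/eps) * rate k * (LINT y|(mu j). abs (v y)))" using mix_coord[OF P Q m G GC, of v k C'] v vC by (simp add: e_def j)
 also have "... <= (LINT w|Q. norm (G w)) * ((2/eps) * rate k * ((1/eps) * (LINT w|P. abs (u (w j) (w (Suc j))))))" using I eps_pos rate_nonneg[of k] by (intro mult_left_mono) auto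
 finally show ?thesis by (simp add: e1 e_def power2_eq_square)
qed

end

lemma abs_le_square_iff_D: "abs x <= (c::real) ==> x^2 <= c^2" using power_mono[of "abs x" c 2] by simp

lemma (in prob_space) square_integral_le:
 fixes f :: "'a => real"
 assumes "integrable M f" "integrable M (%x. (f x)^2)"
 shows "(LINT x|M. f x)^2 <= (LINT x|M. (f x)^2)"
proof -
 have "0 <= (LINT x|M. (f x - expectation f)^2)" by simp
 also have "... = (LINT x|M. (f x)^2) - (LINT x|M. f x)^2" using variance_eq[OF assms] by simp
 finally show ?thesis by simp
qed

section \<open>Variance of additive functionals\<close>

context elliptic_chain
begin

definition pmeas :: "nat => ('a => 'a => 'b::topological_space) => bool" where
 "pmeas n u \<longleftrightarrow> (%(x, y). u x y) : borel_measurable (B n \<Otimes>\<^sub>M B (Suc n))"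

lemma pmeasD [measurable_dest]: "pmeas n u ==> (%(x, y). u x y) : borel_measurable (B n \<Otimes>\<^sub>M B (Suc n))" by (simp add: pmeas_def)

lemma pmeas_comp:
 assumes "pmeas n u" "f : M \<rightarrow>\<^sub>M B n" "g : M \<rightarrow>\<^sub>M B (Suc n)"
 shows "(%x. u (f x) (g x)) : borel_measurable M" using measurable_compose[OF measurable_Pair[OF assms(2,3)] pmeasD[OF assms(1)]] by simp

lemma pmeas_right: "pmeas n u ==> x : space (B n) ==> u x : borel_measurable (B (Suc n))" using pmeas_comp[of n u "%_. x" "B (Suc n)" "%y. y"] by simp

lemma pmeas_path: "pmeas n u ==> n >= 1 ==> (%w. u (w n) (w (Suc n))) : borel_measurable paths" by (rule pmeas_comp) (auto intro: coord)

lemma pmeas_trans: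
 fixes u :: "'a => 'a => 'b::{banach, second_countable_topology}"
 shows "pmeas n u ==> (%x. trans n (u x) x) : borel_measurable (B n)" using trans_measurable[of "%x. x" "B n" n u] by (simp add: pmeas_def)

lemma law_pair_le:
 assumes P: "chain_law P" and Q: "chain_law Q" and j: "j >= 3" and u: "pmeas j u"
  and ub: "!!x y. 0 <= u x y" "!!x y. u x y <= (C::real)"
 shows "(LINT w|Q. u (w j) (w (Suc j))) <= (1/eps^2) * (LINT w|P. u (w j) (w (Suc j)))"
  and "(LINT x|(mu j). trans j (u x) x) <= (1/eps) * (LINT w|P. u (w j) (w (Suc j)))"
  and "(LINT w|P. u (w j) (w (Suc j))) <= (1/eps) * (LINT x|(mu j). trans j (u x) x)"
proof -
 have j1: "j >= 1" using j by simp
 define v where "v x = trans j (u x) x" for x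
 have v: "v : borel_measurable (B j)" unfolding v_def by (rule pmeas_trans[OF u])
 have vC: "0 <= v x & v x <= C" if x: "x : space (B j)" for x using trans_le[OF pmeas_right[OF u x] _ _ x, of C C] trans_ge[OF pmeas_right[OF u x] _ _ x, of C 0] ub by (simp add: v_def)
 have e: "(LINT w|R. u (w j) (w (Suc j))) = (LINT w|R. v (w j))" if "chain_law R" for R using markov[OF that j1 adapted_const[of j "1::real"], of 1 u C] ub pmeasD[OF u] by (simp add: v_def)
 note le = law_le[OF P j v vC] law_le[OF Q j v vC]
 show "(LINT x|(mu j). trans j (u x) x) <= (1/eps) * (LINT w|P. u (w j) (w (Suc j)))" using le(1) eps_pos unfolding e[OF P] v_def by (simp add: field_simps)
 show "(LINT w|P. u (w j) (w (Suc j))) <= (1/eps) * (LINT x|(mu j). trans j (u x) x)" using le(2) unfolding e[OF P] v_def .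
 have "(1/eps) * (LINT y|(mu j). v y) <= (1/eps) * ((1/eps) * (LINT w|P. v (w j)))" using le(1) eps_pos by (intro mult_left_mono) (auto simp: field_simps)
 then show "(LINT w|Q. u (w j) (w (Suc j))) <= (1/eps^2) * (LINT w|P. u (w j) (w (Suc j)))" using le(4) unfolding e[OF P] e[OF Q] by (simp add: power2_eq_square)
qed

lemma rate_sum: "(\<Sum>k<K. rate k) <= 2 / eps"
proof -
 have "(\<Sum>k<2*K. rate k) = 2 * (\<Sum>k<K. (1 - eps) ^ k)" by (induction K) (auto simp: rate_def)
 also have "... <= 2 * (1 / eps)" using sum_gp_strict[of "1 - eps" K] eps_pos eps_less zero_le_power[of "1 - eps" K] by (auto simp: divide_right_mono)
 finally have "(\<Sum>k<2*K. rate k) <= 2 / eps" by simp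
 moreover have "(\<Sum>k<K. rate k) <= (\<Sum>k<2*K. rate k)" by (rule sum_mono2) (auto simp: rate_nonneg)
 ultimately show ?thesis by simp
qed

text \<open>Lags below 3 leave no room for mixing and count 1 each.\<close>

lemma rate_sum_lag: "(\<Sum>k<K. rate (k - 3)) <= 3 + 2 / eps"
proof -
 have "(\<Sum>k<K. rate (k - 3)) <= (\<Sum>k<Suc (Suc (Suc K)). rate (k - 3))" by (rule sum_mono2) (auto simp: rate_nonneg)
 also have "... = 3 + (\<Sum>k<K. rate k)"
 proof -
  have "rate (0 - 3) = 1" "rate (Suc 0 - 3) = 1" "rate (Suc (Suc 0) - 3) = 1" "!!k. rate (Suc (Suc (Suc k)) - 3) = rate k" by (simp_all add: rate_def)
  then show ?thesis unfolding sum.lessThan_Suc_shift by simp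
 qed
 finally show ?thesis using rate_sum[of K] by simp
qed

definition Ex :: "(nat => 'a) measure => nat => ('a => 'a => real) => real" where
 "Ex P n u = (LINT w|P. u (w n) (w (Suc n)))"

text \<open>The bound uses second moments and not sup norms, because the functions to which it is
  applied later are bounded but small only in mean square. From lag 3 on mixing applies to the pair
  at time j, with the pair at time i known at time i + 1; for shorter lags 2|xy| \<le> x^2 + y^2
  suffices.\<close>

lemma cov_bound:
 assumes P: "chain_law P" and Q: "chain_law Q" and i: "3 <= i" and ij: "i <= j"
  and hi: "pmeas i (h i)" and hj: "pmeas j (h j)"
  and hb: "!!n x y. abs (h n x y) <= C n"
 shows "abs ((LINT w|Q. (st h i w - Ex P i (h i)) * (st h j w - Ex P j (h j))))
  <= (1/eps^4) * rate (j - i - 3) * (Ex P i (%x y. (h i x y)^2) + Ex P j (%x y. (h j x y)^2))"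
proof -
 interpret P: prob_space P using chain_lawD[OF P] by simp
 interpret Q: prob_space Q using chain_lawD[OF Q] by simp
 define g where "g n x y = h n x y - Ex P n (h n)" for n x y
 have e4: "1/eps^2 <= 1/eps^4" "1 <= 1/eps^2" "0 < 1/eps^2" using eps_pos eps_less by (auto simp: field_simps power_le_one power_decreasing)
 have meas: "pmeas n (g n)" if "pmeas n (h n)" for n using that unfolding pmeas_def g_def by measurable
 define D where "D n = C n + abs (Ex P n (h n))" for n
 have gb: "abs (g n x y) <= D n" for n x y using hb[of n x y] unfolding g_def D_def by linarith
 have D0: "0 <= D n" for n by (rule order_trans[OF abs_ge_zero gb])
 have g2: "(g n x y)^2 <= (D n)^2" for n x y using gb[of n x y] by (rule abs_le_square_iff_D)
 have C0: "0 <= C n" for n by (rule order_trans[OF abs_ge_zero hb])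
 have h2: "(h n x y)^2 <= (C n)^2" for n x y using hb[of n x y] by (rule abs_le_square_iff_D)
 have ph: "(%w. st h n w) : borel_measurable paths" if "pmeas n (h n)" "n >= 3" for n using that by (auto intro: pmeas_path)
 have pg: "(%w. st g n w) : borel_measurable paths" if "pmeas n (h n)" "n >= 3" for n using that by (auto intro!: pmeas_path meas)
 have int_h: "integrable R (%w. st h n w)" "integrable R (%w. (st h n w)^2)"
  if "chain_law R" "pmeas n (h n)" "n >= 3" for R n
 proof -
  note [measurable] = ph[OF that(2,3)]
  show "integrable R (%w. st h n w)" by (rule law_integrable[OF that(1), where C="C n"]) (use hb in simp_all)
  show "integrable R (%w. (st h n w)^2)" by (rule law_integrable[OF that(1), where C="(C n)^2"]) (use h2 in simp_all)
 qed
 have int_g: "integrable R (%w. st g n w)" "integrable R (%w. (st g n w)^2)"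
  if "chain_law R" "pmeas n (h n)" "n >= 3" for R n
 proof -
  note [measurable] = pg[OF that(2,3)]
  show "integrable R (%w. st g n w)" by (rule law_integrable[OF that(1), where C="D n"]) (use gb in simp_all)
  show "integrable R (%w. (st g n w)^2)" by (rule law_integrable[OF that(1), where C="(D n)^2"]) (use g2 in simp_all)
 qed
 define s where "s n = Ex P n (%x y. (h n x y)^2)" for n
 have s0: "0 <= s n" for n unfolding s_def Ex_def by simp
 have gP: "Ex P n (%x y. (g n x y)^2) <= s n" if "pmeas n (h n)" "n >= 3" for n using P.variance_eq[OF int_h[OF P that]] unfolding Ex_def g_def s_def by simp
 have gQ: "(LINT w|Q. (st g n w)^2) <= (1/eps^2) * s n" if "pmeas n (h n)" "n >= 3" for n
 proof -
  have "pmeas n (%x y. (g n x y)^2)" using meas[OF that(1)] unfolding pmeas_def by measurable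
  from law_pair_le(1)[OF P Q that(2) this, of "(D n)^2"]
  have "(LINT w|Q. (st g n w)^2) <= (1/eps^2) * Ex P n (%x y. (g n x y)^2)" using g2 by (simp add: Ex_def)
  also have "... <= (1/eps^2) * s n" using gP[OF that] e4 by (intro mult_left_mono) auto
  finally show ?thesis .
 qed
 have j: "3 <= j" using i ij by simp
 let ?gi = "%w. st g i w" and ?gj = "%w. st g j w"
 have "abs ((LINT w|Q. ?gi w * ?gj w)) <= (1/eps^4) * rate (j - i - 3) * (s i + s j)"
 proof (cases "j - i >= 3")
  case False
  then have r: "rate (j - i - 3) = 1" by (simp add: rate_def)
  have "abs ((LINT w|Q. ?gi w * ?gj w)) <= (LINT w|Q. abs (?gi w * ?gj w))" by (rule integral_abs_bound)
  also have "... <= (LINT w|Q. ((?gi w)^2 + (?gj w)^2) / 2)"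
  proof (rule integral_mono)
   show "integrable Q (%w. abs (?gi w * ?gj w))" using pg[OF hi i] pg[OF hj j] gb D0 by (auto intro!: law_integrable[OF Q, where C="D i * D j"] mult_mono simp: abs_mult)
   show "integrable Q (%w. ((?gi w)^2 + (?gj w)^2) / 2)" using int_g[OF Q hi i] int_g[OF Q hj j] by simp
   show "abs (?gi w * ?gj w) <= ((?gi w)^2 + (?gj w)^2) / 2" for w using sum_squares_bound[of "abs (?gi w)" "abs (?gj w)"] by (simp add: abs_mult)
  qed
  also have "... = ((LINT w|Q. (?gi w)^2) + (LINT w|Q. (?gj w)^2)) / 2" using int_g[OF Q hi i] int_g[OF Q hj j] by simp
  also have "... <= ((1/eps^2) * s i + (1/eps^2) * s j) / 2" by (intro divide_right_mono add_mono gQ hi hj i j) simp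
  also have "... <= (1/eps^2) * (s i + s j)" using e4(3) s0 by (simp add: field_simps)
  also have "... <= (1/eps^4) * (s i + s j)" using e4(1) s0 by (intro mult_right_mono) auto
  finally show ?thesis using r by simp
 next
  case True
  \<comment> \<open>The pair at i is known at time i + 1; \<open>mix_pair\<close> consumes two
    further steps before contraction starts, which leaves j - i - 3.\<close>
  define k where "k = j - i - 3"
  have jk: "j = Suc i + k + 2" using True k_def by simp
  let ?G = "%w. complex_of_real (?gi w)"
  have ad: "adapted (Suc i) ?G" using adapted_coord2[OF pmeasD[OF meas[OF hi]], of "Suc i"] i by (intro adapted_compose[where h=complex_of_real]) auto
  have "norm (LINT w|Q. ?G w * of_real (st h j w - (LINT w|P. st h j w))) <=
   (LINT w|Q. norm (?G w)) * ((2/eps^2) * rate k * (LINT w|P. abs (h j (w j) (w (Suc j)))))" by (rule mix_pair[OF P Q _ ad _ jk pmeasD[OF hj], where C="D i" and C'="C j"]) (use gb hb in auto)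
  also have "(LINT w|Q. ?G w * of_real (st h j w - (LINT w|P. st h j w))) = of_real (LINT w|Q. ?gi w * ?gj w)" by (simp add: g_def[of j] Ex_def integral_complex_of_real[symmetric] del: integral_complex_of_real)
  finally have *: "abs ((LINT w|Q. ?gi w * ?gj w)) <= (2/eps^2) * rate k * ((LINT w|Q. abs (?gi w)) * (LINT w|P. abs (h j (w j) (w (Suc j)))))" by (simp add: mult_ac)
  define a b where "a = (LINT w|Q. abs (?gi w))" and "b = (LINT w|P. abs (h j (w j) (w (Suc j))))"
  have a: "a^2 <= (1/eps^2) * s i" unfolding a_def using Q.square_integral_le[of "%w. abs (?gi w)"] int_g[OF Q hi i] gQ[OF hi i] by simp
  have b: "b^2 <= s j" unfolding b_def using P.square_integral_le[of "%w. abs (h j (w j) (w (Suc j)))"] int_h[OF P hj j] by (simp add: s_def Ex_def)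
  have "a * b <= (a^2 + b^2) / 2" using sum_squares_bound[of a b] by simp
  also have "... <= ((1/eps^2) * s i + (1/eps^2) * s j) / 2" using a order_trans[OF b, of "(1/eps^2) * s j"] mult_right_mono[OF e4(2) s0[of j]] by (intro divide_right_mono add_mono) auto
  finally have ab: "a * b <= ((1/eps^2) * s i + (1/eps^2) * s j) / 2" .
  have "(2/eps^2) * rate k * (a * b) <= (2/eps^2) * rate k * (((1/eps^2) * s i + (1/eps^2) * s j) / 2)" using ab rate_nonneg[of k] by (intro mult_left_mono) auto
  also have "... = (1/eps^4) * rate k * (s i + s j)" using eps_pos by (simp add: field_simps power2_eq_square power4_eq_xxxx)
  finally show ?thesis using * unfolding a_def b_def k_def by linarith
 qed
 then show ?thesis unfolding g_def s_def by simp
qed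

text \<open>Both second moments in \<open>cov_bound\<close> are summed over the lags on either side,
  and each side costs at most \<open>3 + 2 / eps\<close>; this makes the factor 4.\<close>

definition cvar :: real where "cvar = 4 * (3 + 2 / eps) / eps ^ 4"

lemma cvar_nonneg: "0 <= cvar" using eps_pos by (simp add: cvar_def)

text \<open>Uniform in the initial law: the right side and the centring belong to \<open>P\<close>,
  the integral to \<open>Q\<close>. Later this makes one and the same series converge under all laws
  at once.\<close>

lemma var_bound:
 assumes P: "chain_law P" and Q: "chain_law Q" and M: "3 <= M"
  and h: "!!n. M <= n ==> n <= N ==> pmeas n (h n)"
  and hb: "!!n x y. abs (h n x y) <= C n"
 shows "(LINT w|Q. (\<Sum>n=M..N. st h n w - Ex P n (h n))^2) <= cvar * (\<Sum>n=M..N. Ex P n (%x y. (h n x y)^2))"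
proof -
 interpret Q: prob_space Q using chain_lawD[OF Q] by simp
 define g where "g n w = st h n w - Ex P n (h n)" for n w
 define s where "s n = Ex P n (%x y. (h n x y)^2)" for n
 have s0: "0 <= s n" for n unfolding s_def Ex_def by simp
 \<comment> \<open>With truncated subtraction one of the two terms is zero, so this is the distance
   of the indices.\<close>
 define d where "d i j = (j - i) + (i - j)" for i j :: nat
 have cov: "abs ((LINT w|Q. g i w * g j w)) <= (1/eps^4) * (rate (d i j - 3) * s i + rate (d i j - 3) * s j)"
  if "i : {M..N}" "j : {M..N}" for i j
 proof -
  have *: "abs ((LINT w|Q. g i w * g j w)) <= (1/eps^4) * rate (d i j - 3) * (s i + s j)"
   if "i <= j" "i : {M..N}" "j : {M..N}" for i j using cov_bound[OF P Q _ that(1) h[of i] h[of j] hb] that M by (simp add: g_def s_def d_def)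
  show ?thesis
  proof (cases "i <= j")
   case True
   then show ?thesis using *[OF True that] by (simp only: distrib_left mult.assoc)
  next
   case False
   have "d i j = d j i" "(%w. g i w * g j w) = (%w. g j w * g i w)" by (auto simp: d_def mult.commute)
   then show ?thesis using *[of j i] False that by (simp only: distrib_left mult.assoc add.commute)
  qed
 qed
 have gb: "abs (g n w) <= C n + abs (Ex P n (h n))" for n w using hb[of n "w n" "w (Suc n)"] unfolding g_def by linarith
 have gm: "g n : borel_measurable paths" if "n : {M..N}" for n using pmeas_path[OF h[of n]] that M by (auto simp: g_def[abs_def])
 have int: "integrable Q (%w. g i w * g j w)" if "i : {M..N}" "j : {M..N}" for i j
 proof (rule law_integrable[OF Q])
  show "(%w. g i w * g j w) : borel_measurable paths" using gm that by measurable
  show "norm (g i w * g j w) <= (C i + abs (Ex P i (h i))) * (C j + abs (Ex P j (h j)))" for w unfolding real_norm_def abs_mult by (rule mult_mono[OF gb gb]) (use order_trans[OF abs_ge_zero gb] in auto)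
 qed
 have rs: "(\<Sum>j\<in>{M..N}. rate (d i j - 3)) <= 2 * (3 + 2 / eps)" if "i : {M..N}" for i
 proof -
  have "(\<Sum>j\<in>{M..N}. rate (d i j - 3)) <= (\<Sum>j\<in>{M..i} \<union> {i..N}. rate (d i j - 3))" by (rule sum_mono2) (auto simp: rate_nonneg)
  also have "... <= (\<Sum>j\<in>{M..i}. rate (d i j - 3)) + (\<Sum>j\<in>{i..N}. rate (d i j - 3))" using sum.union_inter[of "{M..i}" "{i..N}" "%j. rate (d i j - 3)"] sum_nonneg[of "{M..i} \<inter> {i..N}" "%j. rate (d i j - 3)"]
   by (simp add: rate_nonneg)
  also have "(\<Sum>j\<in>{M..i}. rate (d i j - 3)) = (\<Sum>k<Suc i - M. rate (k - 3))" by (rule sum.reindex_bij_witness[of _ "%k. i - k" "%j. i - j"]) (auto simp: d_def)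
  also have "(\<Sum>j\<in>{i..N}. rate (d i j - 3)) = (\<Sum>k<Suc N - i. rate (k - 3))" by (rule sum.reindex_bij_witness[of _ "%k. i + k" "%j. j - i"]) (auto simp: d_def)
  finally show ?thesis unfolding mult_2 by (rule order_trans) (intro add_mono rate_sum_lag)
 qed
 have dsym: "d i j = d j i" for i j by (simp add: d_def)
 have "(LINT w|Q. (\<Sum>n=M..N. g n w)^2) = (\<Sum>i=M..N. (LINT w|Q. (\<Sum>j=M..N. g i w * g j w)))" unfolding power2_eq_square sum_product by (intro Bochner_Integration.integral_sum Bochner_Integration.integrable_sum int)
 also have "... = (\<Sum>i=M..N. \<Sum>j=M..N. (LINT w|Q. g i w * g j w))" by (intro sum.cong refl Bochner_Integration.integral_sum int)
 also have "... <= (\<Sum>i=M..N. \<Sum>j=M..N. (1/eps^4) * (rate (d i j - 3) * s i + rate (d i j - 3) * s j))" using cov by (intro sum_mono) (force intro: order_trans[OF abs_ge_self])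
 also have "... = (1/eps^4) * ((\<Sum>i=M..N. \<Sum>j=M..N. rate (d i j - 3) * s i) + (\<Sum>i=M..N. \<Sum>j=M..N. rate (d i j - 3) * s j))" by (simp add: sum_distrib_left sum.distrib distrib_left)
 also have "(\<Sum>i=M..N. \<Sum>j=M..N. rate (d i j - 3) * s j) = (\<Sum>i=M..N. \<Sum>j=M..N. rate (d i j - 3) * s i)" by (subst sum.swap) (simp add: dsym)
 also have "(\<Sum>i=M..N. \<Sum>j=M..N. rate (d i j - 3) * s i) = (\<Sum>i=M..N. (\<Sum>j=M..N. rate (d i j - 3)) * s i)" by (simp add: sum_distrib_right)
 also have "(1/eps^4) * ((\<Sum>i=M..N. (\<Sum>j=M..N. rate (d i j - 3)) * s i) + (\<Sum>i=M..N. (\<Sum>j=M..N. rate (d i j - 3)) * s i))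
   <= (1/eps^4) * ((\<Sum>i=M..N. (2 * (3 + 2 / eps)) * s i) + (\<Sum>i=M..N. (2 * (3 + 2 / eps)) * s i))" using rs s0 eps_pos by (intro mult_left_mono add_mono sum_mono mult_right_mono) auto
 also have "... = cvar * (\<Sum>n=M..N. s n)"
 proof -
  have "(1/x) * (2 * c * S + 2 * c * S) = 4 * c / x * S" for x c S :: real by simp
  then show ?thesis unfolding cvar_def sum_distrib_left[symmetric] .
 qed
 finally show ?thesis unfolding g_def s_def .
qed

end

section \<open>Phase gaps and decay of characteristic functions\<close>

text \<open>With 1 - cos x = 2 sin^2 (x/2) this is (u + v)^2 \<le> 2 u^2 + 2 v^2. It is the source
  of the almost-subadditivity of the gaps in the frequency, on which the comparison of frequencies
  rests.\<close>

lemma one_minus_cos_add: "1 - cos (a + b) <= 2 * (1 - cos a) + 2 * (1 - cos (b::real))"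
proof -
 have h: "1 - cos x = 2 * (sin (x/2))^2" for x :: real using cos_double_sin[of "x/2"] by simp
 have "(sin (a/2 + b/2))^2 <= 2 * (sin (a/2) * cos (b/2))^2 + 2 * (cos (a/2) * sin (b/2))^2" unfolding sin_add using sum_squares_bound[of "sin (a/2) * cos (b/2)" "cos (a/2) * sin (b/2)"] by (simp add: power2_sum)
 also have "... <= 2 * ((sin (a/2))^2 * 1) + 2 * (1 * (sin (b/2))^2)" unfolding power_mult_distrib by (intro add_mono mult_left_mono mult_right_mono) (auto simp: cos_squared_eq)
 finally show ?thesis unfolding h by (simp add: add_divide_distrib)
qed

text \<open>The difference of squares, rather than of absolute values, is a double integral of 1 -
  cos; it is therefore nonnegative, even in \<open>xi\<close> and almost subadditive in
  \<open>xi\<close>.\<close>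

definition phase_gap :: "'b measure => ('b => real) => ('b => real) => real => real" where
 "phase_gap M wt phi xi = (LINT a|M. wt a)^2 - (cmod (LINT a|M. wt a *\<^sub>R cis (xi * phi a)))^2"

lemma cis_measurable [measurable]: "cis : borel_measurable borel" by (intro borel_measurable_continuous_onI continuous_intros)

context
 fixes M :: "'b measure" and wt phi :: "'b => real"
 assumes wt: "integrable M wt" "!!a. 0 <= wt a" and phi [measurable]: "phi : borel_measurable M"
begin

text \<open>Expanding cos (u - v) separates the variables, and the double integral becomes W^2 - C^2
  - S^2 with the total mass and the cosine and sine integrals.\<close>

lemma phase_gap_eq: "phase_gap M wt phi xi = (LINT a|M. (LINT b|M. wt a * wt b * (1 - cos (xi * (phi a - phi b)))))"
proof -
 define W C S where "W = (LINT a|M. wt a)" and "C = (LINT a|M. wt a * cos (xi * phi a))" and "S = (LINT a|M. wt a * sin (xi * phi a))"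
 have [measurable]: "wt : borel_measurable M" using wt(1) by simp
 have iC: "integrable M (%a. wt a * cos (xi * phi a))" and iS: "integrable M (%a. wt a * sin (xi * phi a))" by (rule Bochner_Integration.integrable_bound[OF wt(1)]; auto simp: abs_mult wt(2) mult_left_le)+
 have iZ: "integrable M (%a. wt a *\<^sub>R cis (xi * phi a))" by (rule Bochner_Integration.integrable_bound[OF wt(1)]) (auto simp: abs_mult wt(2))
 have "Re (LINT a|M. wt a *\<^sub>R cis (xi * phi a)) = C" "Im (LINT a|M. wt a *\<^sub>R cis (xi * phi a)) = S" using integral_Re[OF iZ] integral_Im[OF iZ] by (simp_all add: C_def S_def)
 then have g: "phase_gap M wt phi xi = W^2 - (C^2 + S^2)" by (simp add: phase_gap_def W_def cmod_power2)
 have "(LINT b|M. wt a * wt b * (1 - cos (xi * (phi a - phi b)))) = wt a * W - (wt a * cos (xi * phi a)) * C - (wt a * sin (xi * phi a)) * S" for a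
 proof -
  have "(LINT b|M. wt a * wt b * (1 - cos (xi * (phi a - phi b)))) =
   (LINT b|M. wt a * wt b - (wt a * cos (xi * phi a)) * (wt b * cos (xi * phi b)) - (wt a * sin (xi * phi a)) * (wt b * sin (xi * phi b)))" by (simp add: right_diff_distrib cos_diff algebra_simps)
  then show ?thesis using wt(1) iC iS by (simp add: W_def C_def S_def)
 qed
 then have "(LINT a|M. (LINT b|M. wt a * wt b * (1 - cos (xi * (phi a - phi b))))) = W * W - C * C - S * S" using wt(1) iC iS by (simp add: W_def C_def S_def)
 then show ?thesis unfolding g by (simp add: power2_eq_square)
qed

lemma phase_gap_nonneg: "0 <= phase_gap M wt phi xi" unfolding phase_gap_eq by (intro Bochner_Integration.integral_nonneg mult_nonneg_nonneg wt) auto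

lemma phase_gap_le: "phase_gap M wt phi xi <= (LINT a|M. wt a)^2" by (simp add: phase_gap_def)

lemma phase_gap_uminus: "phase_gap M wt phi (- xi) = phase_gap M wt phi xi"
proof -
 have "cos (- xi * (phi a - phi b)) = cos (xi * (phi a - phi b))" for a b using cos_minus[of "xi * (phi a - phi b)"] by simp
 then show ?thesis unfolding phase_gap_eq by simp
qed

lemma phase_gap_add: "phase_gap M wt phi (xi + et) <= 2 * phase_gap M wt phi xi + 2 * phase_gap M wt phi et"
proof -
 have [measurable]: "wt : borel_measurable M" using wt(1) by simp
 let ?g = "%xi a b. wt a * wt b * (1 - cos (xi * (phi a - phi b)))"
 have i: "integrable M (?g xi a)" for xi a
 proof (rule Bochner_Integration.integrable_bound[where f="%b. wt a * wt b * 2"])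
  show "AE b in M. norm (?g xi a b) <= norm (wt a * wt b * 2)" unfolding norm_mult by (intro AE_I2 mult_left_mono mult_nonneg_nonneg)
     (use cos_ge_minus_one in \<open>auto simp: abs_le_iff intro: order_trans[of _ 1]\<close>)
 qed (use wt(1) in auto)
 define h where "h xi a = (LINT b|M. ?g xi a b)" for xi a
 have hi: "integrable M (h xi)" for xi
 proof -
  have "(%b. wt b * cos (xi * phi b)) : borel_measurable M" by measurable
  have iC: "integrable M (%a. wt a * cos (xi * phi a))" and iS: "integrable M (%a. wt a * sin (xi * phi a))" by (rule Bochner_Integration.integrable_bound[OF wt(1)]; auto simp: abs_mult wt(2) mult_left_le)+
  have "h xi a = wt a * (LINT a|M. wt a) - (wt a * cos (xi * phi a)) * (LINT a|M. wt a * cos (xi * phi a)) - (wt a * sin (xi * phi a)) * (LINT a|M. wt a * sin (xi * phi a))" for a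
  proof -
   have "h xi a = (LINT b|M. wt a * wt b - (wt a * cos (xi * phi a)) * (wt b * cos (xi * phi b)) - (wt a * sin (xi * phi a)) * (wt b * sin (xi * phi b)))" unfolding h_def by (simp add: right_diff_distrib cos_diff algebra_simps)
   then show ?thesis using wt(1) iC iS by simp
  qed
  then have "h xi = (%a. wt a * (LINT a|M. wt a) - (wt a * cos (xi * phi a)) * (LINT a|M. wt a * cos (xi * phi a)) - (wt a * sin (xi * phi a)) * (LINT a|M. wt a * sin (xi * phi a)))" by blast
  then show ?thesis using wt(1) iC iS by simp
 qed
 have "phase_gap M wt phi (xi + et) = (LINT a|M. h (xi + et) a)" by (simp add: phase_gap_eq h_def)
 also have "... <= (LINT a|M. 2 * h xi a + 2 * h et a)"
 proof (rule integral_mono)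
  fix a
  have "h (xi + et) a <= (LINT b|M. 2 * ?g xi a b + 2 * ?g et a b)" unfolding h_def
  proof (rule integral_mono)
   fix b
   have "?g (xi + et) a b <= wt a * wt b * (2 * (1 - cos (xi * (phi a - phi b))) + 2 * (1 - cos (et * (phi a - phi b))))" using one_minus_cos_add[of "xi * (phi a - phi b)" "et * (phi a - phi b)"] wt(2)
    by (intro mult_left_mono) (auto simp: distrib_right)
   then show "?g (xi + et) a b <= 2 * ?g xi a b + 2 * ?g et a b" by (simp add: algebra_simps)
  qed (use i in auto)
  then show "h (xi + et) a <= 2 * h xi a + 2 * h et a" using i by (simp add: h_def)
 qed (use hi in auto)
 also have "... = 2 * (LINT a|M. h xi a) + 2 * (LINT a|M. h et a)" using hi by simp
 also have "... = 2 * phase_gap M wt phi xi + 2 * phase_gap M wt phi et" by (simp add: phase_gap_eq h_def)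
 finally show ?thesis .
qed

end

context elliptic_chain
begin

definition addf :: "(nat => 'a => 'a => real) => bool" where
 "addf f \<longleftrightarrow> (\<forall>n\<ge>1. pmeas n (f n))"

lemma addfD: "addf f ==> n >= 1 ==> pmeas n (f n)" by (simp add: addf_def)

definition Wt :: "nat => 'a => 'a => 'a \<times> 'a => real" where
 "Wt n z x' = (%(y, x). p n z y * p (Suc n) y x * p (Suc (Suc n)) x x')"

definition Ph :: "(nat => 'a => 'a => real) => nat => 'a => 'a => 'a \<times> 'a => real" where
 "Ph f n z x' = (%(y, x). f n z y + f (Suc n) y x + f (Suc (Suc n)) x x')"

definition M2 :: "nat => ('a \<times> 'a) measure" where "M2 n = mu (Suc n) \<Otimes>\<^sub>M mu (Suc (Suc n))"

definition gap :: "(nat => 'a => 'a => real) => real => nat => 'a => 'a => real" where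
 "gap f xi n z x' = phase_gap (M2 n) (Wt n z x') (Ph f n z x') xi"

text \<open>The end points are averaged over \<open>mu\<close>, not over a law of the chain, so the
  quantity is independent of the initial distribution.\<close>

definition dd :: "(nat => 'a => 'a => real) => real => nat => real" where
 "dd f xi n = (LINT z|(mu n). (LINT x'|(mu (Suc (Suc (Suc n)))). gap f xi n z x'))"

lemma M2_prob: "prob_space (M2 n)" unfolding M2_def by (rule prob_space_pair) (rule prob_mu)+

lemma sets_M2 [measurable_cong]: "sets (M2 n) = sets (B (Suc n) \<Otimes>\<^sub>M B (Suc (Suc n)))" unfolding M2_def by (rule sets_pair_measure_cong) auto

lemma Wt_meas [measurable (raw)]:
 assumes [measurable]: "a : M \<rightarrow>\<^sub>M B n" "b : M \<rightarrow>\<^sub>M B (Suc (Suc (Suc n)))" "c : M \<rightarrow>\<^sub>M M2 n"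
 shows "(%x. Wt n (a x) (b x) (c x)) : borel_measurable M"
proof -
 have [measurable]: "(%x. fst (c x)) : M \<rightarrow>\<^sub>M B (Suc n)" "(%x. snd (c x)) : M \<rightarrow>\<^sub>M B (Suc (Suc n))"
  using measurable_compose[OF assms(3)[unfolded measurable_cong_sets[OF refl sets_M2]]] by (auto intro: measurable_fst measurable_snd)
 show ?thesis unfolding Wt_def split_beta by measurable
qed

lemma Ph_meas:
 assumes f: "addf f" "n >= 1" and [measurable]: "a : M \<rightarrow>\<^sub>M B n" "b : M \<rightarrow>\<^sub>M B (Suc (Suc (Suc n)))" "c : M \<rightarrow>\<^sub>M M2 n"
 shows "(%x. Ph f n (a x) (b x) (c x)) : borel_measurable M"
proof -
 have [measurable]: "(%x. fst (c x)) : M \<rightarrow>\<^sub>M B (Suc n)" "(%x. snd (c x)) : M \<rightarrow>\<^sub>M B (Suc (Suc n))"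
  using measurable_compose[OF assms(5)[unfolded measurable_cong_sets[OF refl sets_M2]]] by (auto intro: measurable_fst measurable_snd)
 have "(%x. f n (a x) (fst (c x))) : borel_measurable M" "(%x. f (Suc n) (fst (c x)) (snd (c x))) : borel_measurable M"
  "(%x. f (Suc (Suc n)) (snd (c x)) (b x)) : borel_measurable M" using f(2) by (auto intro!: pmeas_comp[OF addfD[OF f(1)]])
 then show ?thesis unfolding Ph_def split_beta by measurable
qed

lemma Wt_nonneg: "0 <= Wt n z x' a" by (simp add: Wt_def split_beta)

lemma Wt_le: "Wt n z x' a <= 1 / eps ^ 3"
proof -
 have "Wt n z x' a <= (1/eps) * (1/eps) * (1/eps)" unfolding Wt_def split_beta using eps_pos by (intro mult_mono p_le) auto
 then show ?thesis by (simp add: power3_eq_cube)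
qed

lemma Wt_integrable:
 assumes [measurable]: "z : space (B n)" "x' : space (B (Suc (Suc (Suc n))))"
 shows "integrable (M2 n) (Wt n z x')"
proof -
 interpret prob_space "M2 n" by (rule M2_prob)
 show ?thesis using Wt_le Wt_nonneg by (intro integrable_const_bound[where B="1/eps^3"] AE_I2) (auto intro!: Wt_meas)
qed

lemma gap_measurable:
 assumes f: "addf f" "n >= 1" and [measurable]: "a : M \<rightarrow>\<^sub>M B n" "b : M \<rightarrow>\<^sub>M B (Suc (Suc (Suc n)))"
 shows "(%x. gap f xi n (a x) (b x)) : borel_measurable M"
proof -
 interpret prob_space "M2 n" by (rule M2_prob)
 note [measurable (raw)] = Ph_meas[OF f]
 show ?thesis unfolding gap_def phase_gap_def by measurable
qed

context
 fixes f n z x' assumes f: "addf f" and n: "n >= 1" and z: "z : space (B n)" and x': "x' : space (B (Suc (Suc (Suc n))))"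
begin

lemma Ph_meas0: "Ph f n z x' : borel_measurable (M2 n)" using Ph_meas[OF f n, of "%_. z" "M2 n" "%_. x'" "%x. x"] z x' by simp

lemma gap_nonneg: "0 <= gap f xi n z x'" unfolding gap_def by (rule phase_gap_nonneg[OF Wt_integrable[OF z x'] Wt_nonneg Ph_meas0])

lemma gap_uminus: "gap f (- xi) n z x' = gap f xi n z x'" unfolding gap_def by (rule phase_gap_uminus[OF Wt_integrable[OF z x'] Wt_nonneg Ph_meas0])

lemma gap_add: "gap f (xi + et) n z x' <= 2 * gap f xi n z x' + 2 * gap f et n z x'" unfolding gap_def by (rule phase_gap_add[OF Wt_integrable[OF z x'] Wt_nonneg Ph_meas0])

lemma gap_le: "gap f xi n z x' <= (1 / eps^3)^2"
proof -
 interpret prob_space "M2 n" by (rule M2_prob)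
 have "gap f xi n z x' <= (LINT a|(M2 n). Wt n z x' a)^2" unfolding gap_def by (rule phase_gap_le[OF Wt_integrable[OF z x'] Wt_nonneg Ph_meas0])
 also have "... <= (1/eps^3)^2" using integral_between[OF Wt_integrable[OF z x'], of 0 "1/eps^3"] Wt_le Wt_nonneg by (intro power_mono) auto
 finally show ?thesis .
qed

end

lemma gap_inner:
 assumes f: "addf f" and n: "n >= 1"
 shows "z : space (B n) ==> integrable (mu (Suc (Suc (Suc n)))) (gap f xi n z)"
  and "integrable (mu n) (%z. (LINT x'|(mu (Suc (Suc (Suc n)))). gap f xi n z x'))"
  and "z : space (B n) ==> 0 <= (LINT x'|(mu (Suc (Suc (Suc n)))). gap f xi n z x')"
  and "z : space (B n) ==> (LINT x'|(mu (Suc (Suc (Suc n)))). gap f xi n z x') <= (1 / eps^3)^2"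
proof -
 note [measurable (raw)] = gap_measurable[OF f n]
 show i: "integrable (mu (Suc (Suc (Suc n)))) (gap f xi n z)" if [measurable]: "z : space (B n)" for z using gap_nonneg[OF f n that] gap_le[OF f n that]
  by (intro integrable_mu[where C="(1/eps^3)^2"]) (auto intro!: gap_measurable[OF f n])
 show nn: "0 <= (LINT x'|(mu (Suc (Suc (Suc n)))). gap f xi n z x')" if "z : space (B n)" for z using gap_nonneg[OF f n that] by (intro Bochner_Integration.integral_nonneg) auto
 show le: "(LINT x'|(mu (Suc (Suc (Suc n)))). gap f xi n z x') <= (1 / eps^3)^2" if "z : space (B n)" for z using gap_le[OF f n that] by (intro mu.integral_le_const[OF i[OF that]] AE_I2) auto
 show "integrable (mu n) (%z. (LINT x'|(mu (Suc (Suc (Suc n)))). gap f xi n z x'))"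
 proof (rule integrable_mu[where C="(1/eps^3)^2"])
  fix z assume z: "z : space (B n)"
  show "norm (LINT x'|(mu (Suc (Suc (Suc n)))). gap f xi n z x') <= (1/eps^3)^2" using nn[OF z] le[OF z] by simp
 qed measurable
qed

lemma dd_nonneg: "addf f ==> n >= 1 ==> 0 <= dd f xi n" unfolding dd_def by (rule Bochner_Integration.integral_nonneg) (simp add: gap_inner(3))

lemma dd_uminus: "addf f ==> n >= 1 ==> dd f (- xi) n = dd f xi n" unfolding dd_def by (intro Bochner_Integration.integral_cong refl gap_uminus) auto

lemma dd_add:
 assumes f: "addf f" and n: "n >= 1"
 shows "dd f (xi + et) n <= 2 * dd f xi n + 2 * dd f et n"
proof -
 note gi = gap_inner[OF f n]
 have "dd f (xi + et) n <= (LINT z|(mu n). 2 * (LINT x'|(mu (Suc (Suc (Suc n)))). gap f xi n z x') + 2 * (LINT x'|(mu (Suc (Suc (Suc n)))). gap f et n z x'))" unfolding dd_def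
 proof (rule integral_mono)
  fix z assume "z : space (mu n)"
  then have z: "z : space (B n)" by simp
  have "(LINT x'|(mu (Suc (Suc (Suc n)))). gap f (xi + et) n z x') <= (LINT x'|(mu (Suc (Suc (Suc n)))). 2 * gap f xi n z x' + 2 * gap f et n z x')" using gi(1)[OF z] gap_add[OF f n z] by (intro integral_mono) auto
  then show "(LINT x'|(mu (Suc (Suc (Suc n)))). gap f (xi + et) n z x') <= 2 * (LINT x'|(mu (Suc (Suc (Suc n)))). gap f xi n z x') + 2 * (LINT x'|(mu (Suc (Suc (Suc n)))). gap f et n z x')" using gi(1)[OF z] by simp
 qed (use gi in auto)
 then show ?thesis using gi by (simp add: dd_def)
qed

text \<open>Continuity in the frequency is what allows minimizers on compact intervals of
  frequencies and limits of such minimizers.\<close>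

lemma continuous_dd:
 assumes f: "addf f" and n: "n >= 1"
 shows "continuous_on UNIV (%xi. dd f xi n)" unfolding continuous_on_sequentially
proof (intro ballI allI impI)
 fix s :: "nat => real" and xi assume "(\<forall>k. s k : UNIV) & s ----> xi"
 then have s: "s ----> xi" by simp
 interpret M2: prob_space "M2 n" by (rule M2_prob)
 note [measurable (raw)] = gap_measurable[OF f n]
 have g: "(%k. gap f (s k) n z x') ----> gap f xi n z x'" if z: "z : space (B n)" and x': "x' : space (B (Suc (Suc (Suc n))))" for z x'
 proof -
  note [measurable] = Ph_meas0[OF f n z x'] borel_measurable_integrable[OF Wt_integrable[OF z x']]
  have "(%k. (LINT a|(M2 n). Wt n z x' a *\<^sub>R cis (s k * Ph f n z x' a))) ----> (LINT a|(M2 n). Wt n z x' a *\<^sub>R cis (xi * Ph f n z x' a))"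
  proof (rule integral_dominated_convergence[where w="%_. 1/eps^3"])
   show "AE a in M2 n. (%k. Wt n z x' a *\<^sub>R cis (s k * Ph f n z x' a)) ----> Wt n z x' a *\<^sub>R cis (xi * Ph f n z x' a)" using s by (intro AE_I2 tendsto_intros)
  qed (use Wt_le Wt_nonneg in \<open>auto\<close>)
  then show ?thesis unfolding gap_def phase_gap_def by (intro tendsto_intros)
 qed
 have "(%k. dd f (s k) n) ----> dd f xi n" unfolding dd_def
 proof (rule integral_dominated_convergence[where w="%_. (1/eps^3)^2"])
  show "AE z in mu n. (%k. (LINT x'|(mu (Suc (Suc (Suc n)))). gap f (s k) n z x')) ----> (LINT x'|(mu (Suc (Suc (Suc n)))). gap f xi n z x')"
  proof (rule AE_I2)
   fix z assume "z : space (mu n)"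
   then have z [measurable]: "z : space (B n)" by simp
   show "(%k. (LINT x'|(mu (Suc (Suc (Suc n)))). gap f (s k) n z x')) ----> (LINT x'|(mu (Suc (Suc (Suc n)))). gap f xi n z x')" by (rule integral_dominated_convergence[where w="%_. (1/eps^3)^2"])
      (use g[OF z] gap_nonneg[OF f n z] gap_le[OF f n z] z in auto)
  qed
  show "AE z in mu n. norm (LINT x'|(mu (Suc (Suc (Suc n)))). gap f (s k) n z x') <= (1/eps^3)^2" for k
  proof (rule AE_I2)
   fix z assume "z : space (mu n)"
   then have z: "z : space (B n)" by simp
   show "norm (LINT x'|(mu (Suc (Suc (Suc n)))). gap f (s k) n z x') <= (1/eps^3)^2" using gap_inner(3,4)[OF f n z] by simp
  qed
 qed (use gap_inner(2)[OF f n] in auto)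
 then show "((%xi. dd f xi n) \<circ> s) ----> dd f xi n" by (simp add: o_def)
qed

end

section \<open>Twisted transition operators and exponential decay\<close>

context elliptic_chain
begin

lemma pair_integrable:
 fixes g :: "'a => 'a => 'b::{banach, second_countable_topology}"
 assumes "(%(x, y). g x y) : borel_measurable (B a \<Otimes>\<^sub>M B b)"
  and "!!x y. x : space (B a) ==> y : space (B b) ==> norm (g x y) <= C"
 shows "integrable (mu a \<Otimes>\<^sub>M mu b) (%(x, y). g x y)"
proof -
 interpret pair_prob_space "mu a" "mu b" ..
 show ?thesis
 proof (rule integrable_const_bound[where B=C])
  show "AE wt in mu a \<Otimes>\<^sub>M mu b. norm (case wt of (x, y) => g x y) <= C" using assms(2) by (intro AE_I2) (auto simp: space_pair_measure)
 qed (use assms(1) measurable_cong_sets[OF sets_pair_measure_cong[OF sets_mu sets_mu] refl] in blast)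
qed

lemma swap_integral:
 fixes g :: "'a => 'a => 'b::{banach, second_countable_topology}"
 assumes "(%(x, y). g x y) : borel_measurable (B a \<Otimes>\<^sub>M B b)"
  and "!!x y. x : space (B a) ==> y : space (B b) ==> norm (g x y) <= C"
 shows "(LINT x|(mu a). (LINT y|(mu b). g x y)) = (LINT y|(mu b). (LINT x|(mu a). g x y))"
proof -
 interpret pair_prob_space "mu a" "mu b" ..
 show ?thesis using Fubini_integral[OF pair_integrable[OF assms]] by simp
qed

lemma norm_mu_integral_le:
 fixes u :: "'a => 'b::{banach, second_countable_topology}"
 assumes "!!y. y : space (B n) ==> norm (u y) <= C" "0 <= C"
 shows "norm (LINT y|(mu n). u y) <= C"
proof (cases "integrable (mu n) u")
 case True
 then have "norm (LINT y|(mu n). u y) <= (LINT y|(mu n). norm (u y))" by simp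
 also have "... <= C" using True assms by (intro mu.integral_le_const AE_I2) auto
 finally show ?thesis .
qed (simp add: not_integrable_integral_eq assms)

text \<open>The transition operator perturbed by exp (i xi f n); its iterates compute characteristic
  functions of the sums (Nagaev's method).\<close>

definition twist :: "(nat => 'a => 'a => real) => real => nat => ('a => complex) => 'a => complex" where
 "twist f xi n u x = trans n (%y. cis (xi * f n x y) * u y) x"

fun Tit :: "(nat => 'a => 'a => real) => real => nat => nat => ('a => complex) => 'a => complex" where
 "Tit f xi m 0 u = u"
| "Tit f xi m (Suc k) u = twist f xi m (Tit f xi (Suc m) k u)"

lemma pmeas_cis:
 assumes "pmeas n u" shows "pmeas n (%x y. cis (xi * u x y))" unfolding pmeas_def
proof -
 have [measurable]: "(%z. u (fst z) (snd z)) : borel_measurable (B n \<Otimes>\<^sub>M B (Suc n))" using assms by (simp add: pmeas_def split_beta')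
 show "(%(x, y). cis (xi * u x y)) : borel_measurable (B n \<Otimes>\<^sub>M B (Suc n))" unfolding split_beta' by measurable
qed

lemma twist_measurable:
 assumes f: "addf f" "n >= 1" and [measurable]: "u : borel_measurable (B (Suc n))"
 shows "twist f xi n u : borel_measurable (B n)"
proof -
 note [measurable (raw)] = pmeas_comp[OF pmeas_cis[OF addfD[OF f]]]
 show ?thesis unfolding twist_def by measurable
qed

lemma norm_twist_le:
 assumes f: "addf f" "n >= 1" and u [measurable]: "u : borel_measurable (B (Suc n))"
  and C: "!!y. y : space (B (Suc n)) ==> cmod (u y) <= C" and x: "x : space (B n)"
 shows "cmod (twist f xi n u x) <= C"
proof -
 have [measurable]: "(%y. cis (xi * f n x y)) : borel_measurable (B (Suc n))" using pmeas_right[OF pmeas_cis[OF addfD[OF f]] x] .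
 show ?thesis unfolding twist_def by (rule norm_trans_le[OF _ _ x]) (use C in \<open>auto simp: norm_mult\<close>)
qed

lemma Tit_measurable:
 "addf f ==> m >= 1 ==> u : borel_measurable (B (m + k)) ==> Tit f xi m k u : borel_measurable (B m)" by (induction k arbitrary: m) (auto intro!: twist_measurable)

lemma norm_Tit_le:
 assumes "addf f" "m >= 1" "u : borel_measurable (B (m + k))" "!!y. y : space (B (m + k)) ==> cmod (u y) <= C"
 shows "x : space (B m) ==> cmod (Tit f xi m k u x) <= C" using assms
proof (induction k arbitrary: m x)
 case (Suc k)
 show ?case unfolding Tit.simps by (rule norm_twist_le) (use Suc.prems Tit_measurable[of f "Suc m" u k] in \<open>auto intro!: Suc.IH\<close>)
qed simp

lemma Tit_add: "Tit f xi m (k + l) u = Tit f xi m k (Tit f xi (m + k) l u)" by (induction k arbitrary: m) auto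

text \<open>Induction from the left end: the oscillating factor of the first step joins
  \<open>G\<close>, which is then adapted one step later.\<close>

lemma Tit_law:
 assumes Q: "chain_law Q" and f: "addf f" and "m >= 1" "adapted m G" "!!w. cmod (G w) <= C"
  and "u : borel_measurable (B (m + k))" "!!y. y : space (B (m + k)) ==> cmod (u y) <= C'"
 shows "(LINT w|Q. G w * cis (xi * (\<Sum>n\<in>{m..<m+k}. st f n w)) * u (w (m + k))) = (LINT w|Q. G w * Tit f xi m k u (w m))" using assms(3-)
proof (induction k arbitrary: m G)
 case (Suc k)
 let ?G = "%w. G w * cis (xi * f m (w m) (w (Suc m)))"
 have pm: "pmeas m (%x y. cis (xi * f m x y))" using pmeas_cis[OF addfD[OF f]] Suc.prems by blast
 have aG: "adapted (Suc m) ?G" using Suc.prems adapted_coord2[OF pmeasD[OF pm], of "Suc m"] by (intro adapted_mult) (auto intro: adapted_mono)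
 have eq: "{m..<m + Suc k} = insert m {Suc m..<Suc m + k}" by auto
 have "(LINT w|Q. G w * cis (xi * (\<Sum>n\<in>{m..<m+Suc k}. st f n w)) * u (w (m + Suc k))) =
   (LINT w|Q. ?G w * cis (xi * (\<Sum>n\<in>{Suc m..<Suc m+k}. st f n w)) * u (w (Suc m + k)))" unfolding eq by (simp add: distrib_left cis_mult[symmetric] mult_ac)
 also have "... = (LINT w|Q. ?G w * Tit f xi (Suc m) k u (w (Suc m)))" using Suc.prems aG by (intro Suc.IH) (auto simp: norm_mult)
 also have "... = (LINT w|Q. G w * (cis (xi * f m (w m) (w (Suc m))) * Tit f xi (Suc m) k u (w (Suc m))))" by (simp add: mult.assoc)
 also have "... = (LINT w|Q. G w * trans m (%y. cis (xi * f m (w m) y) * Tit f xi (Suc m) k u y) (w m))"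
 proof (rule markov[OF Q Suc.prems(1,2), where C=C and C'=C'])
  have [measurable]: "Tit f xi (Suc m) k u : borel_measurable (B (Suc m))" using Suc.prems f by (intro Tit_measurable) auto
  have [measurable]: "(%z. cis (xi * f m (fst z) (snd z))) : borel_measurable (B m \<Otimes>\<^sub>M B (Suc m))" using pm by (simp add: pmeas_def split_beta')
  show "(%(x, y). cis (xi * f m x y) * Tit f xi (Suc m) k u y) : borel_measurable (B m \<Otimes>\<^sub>M B (Suc m))" unfolding split_beta' by measurable
 qed (use Suc.prems f norm_Tit_le[of f "Suc m" u k C'] in \<open>auto simp: norm_mult\<close>)
 finally show ?case by (simp add: twist_def)
qed simp

definition K3 :: "(nat => 'a => 'a => real) => real => nat => 'a => 'a => complex" where
 "K3 f xi n z x' = (LINT a|(M2 n). Wt n z x' a *\<^sub>R cis (xi * Ph f n z x' a))"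

definition W3 :: "nat => 'a => 'a => real" where
 "W3 n z x' = (LINT a|(M2 n). Wt n z x' a)"

lemma gap_alt: "gap f xi n z x' = (W3 n z x')^2 - (cmod (K3 f xi n z x'))^2" by (simp add: gap_def phase_gap_def W3_def K3_def)

lemma K3_measurable:
 assumes f: "addf f" "n >= 1" and [measurable]: "a : M \<rightarrow>\<^sub>M B n" "b : M \<rightarrow>\<^sub>M B (Suc (Suc (Suc n)))"
 shows "(%x. K3 f xi n (a x) (b x)) : borel_measurable M"
proof -
 interpret prob_space "M2 n" by (rule M2_prob)
 note [measurable (raw)] = Ph_meas[OF f]
 show ?thesis unfolding K3_def by measurable
qed

lemma M2_integral:
 fixes g :: "'a => 'a => 'b::{banach, second_countable_topology}"
 assumes "(%(x, y). g x y) : borel_measurable (B (Suc n) \<Otimes>\<^sub>M B (Suc (Suc n)))"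
  and "!!x y. x : space (B (Suc n)) ==> y : space (B (Suc (Suc n))) ==> norm (g x y) <= C"
 shows "(LINT a|(M2 n). g (fst a) (snd a)) = (LINT y|(mu (Suc n)). (LINT x|(mu (Suc (Suc n))). g y x))"
proof -
 interpret pair_prob_space "mu (Suc n)" "mu (Suc (Suc n))" ..
 show ?thesis unfolding M2_def using integral_fst'[OF pair_integrable[OF assms]] by (simp add: split_beta')
qed

lemma Tit3:
 assumes f: "addf f" and n: "n >= 1" and u [measurable]: "u : borel_measurable (B (Suc (Suc (Suc n))))"
  and C: "!!y. y : space (B (Suc (Suc (Suc n)))) ==> cmod (u y) <= C" and z: "z : space (B n)"
 shows "Tit f xi n 3 u z = (LINT x'|(mu (Suc (Suc (Suc n)))). K3 f xi n z x' * u x')"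
proof -
 let ?n1 = "Suc n" and ?n2 = "Suc (Suc n)" and ?n3 = "Suc (Suc (Suc n))"
 have n': "?n1 >= 1" "?n2 >= 1" using n by auto
 note pm = pmeas_comp[OF pmeas_cis[OF addfD[OF f n]]] pmeas_comp[OF pmeas_cis[OF addfD[OF f n'(1)]]] pmeas_comp[OF pmeas_cis[OF addfD[OF f n'(2)]]]
 note [measurable (raw)] = pm
 note [measurable] = z
 obtain y0 where "y0 : space (B ?n3)" using mu.not_empty[of ?n3] by auto
 then have C0: "0 <= C" using C[of y0] norm_ge_zero order_trans by blast
 define E where "E y x x' = (Wt n z x' (y, x) *\<^sub>R cis (xi * Ph f n z x' (y, x))) * u x'" for y x x'
 have Eb: "cmod (E y x x') <= (1/eps^3) * C" if "x' : space (B ?n3)" for y x x' unfolding E_def norm_mult norm_scaleR using Wt_le[of n z x' "(y, x)"] Wt_nonneg[of n z x' "(y, x)"] C[OF that] C0 eps_pos by (intro mult_mono) auto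
 have Eeq: "E y x x' = (p n z y *\<^sub>R cis (xi * f n z y)) * ((p ?n1 y x *\<^sub>R cis (xi * f ?n1 y x)) * ((p ?n2 x x' *\<^sub>R cis (xi * f ?n2 x x')) * u x'))" for y x x'
  unfolding E_def Wt_def Ph_def by (simp add: scaleR_conv_of_real distrib_left cis_mult[symmetric] mult_ac)
 have "Tit f xi n 3 u z = (LINT y|(mu ?n1). (LINT x|(mu ?n2). (LINT x'|(mu ?n3). E y x x')))" unfolding Eeq numeral_3_eq_3 Tit.simps twist_def trans_def
  by (simp add: scaleR_conv_of_real mult_ac integral_mult_right_zero[symmetric] del: integral_mult_right_zero)
 also have "... = (LINT a|(M2 n). (LINT x'|(mu ?n3). E (fst a) (snd a) x'))"
 proof (rule M2_integral[symmetric, where C="(1/eps^3) * C"])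
  show "(%(y, x). (LINT x'|(mu ?n3). E y x x')) : borel_measurable (B ?n1 \<Otimes>\<^sub>M B ?n2)" unfolding Eeq by measurable
  show "norm (LINT x'|(mu ?n3). E y x x') <= (1/eps^3) * C" for y x by (rule norm_mu_integral_le) (use Eb C0 eps_pos in auto)
 qed
 also have "... = (LINT x'|(mu ?n3). (LINT a|(M2 n). E (fst a) (snd a) x'))"
 proof -
  interpret M2: prob_space "M2 n" by (rule M2_prob)
  interpret pair_prob_space "M2 n" "mu ?n3" ..
  have "integrable (M2 n \<Otimes>\<^sub>M mu ?n3) (%(a, x'). E (fst a) (snd a) x')"
  proof (rule integrable_const_bound[where B="(1/eps^3) * C"])
   show "AE wt in M2 n \<Otimes>\<^sub>M mu ?n3. norm (case wt of (a, x') => E (fst a) (snd a) x') <= (1/eps^3) * C" using Eb by (intro AE_I2) (auto simp: space_pair_measure)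
   have "(%(a, x'). E (fst a) (snd a) x') : borel_measurable ((B ?n1 \<Otimes>\<^sub>M B ?n2) \<Otimes>\<^sub>M B ?n3)" unfolding Eeq by measurable
   then show "(%(a, x'). E (fst a) (snd a) x') : borel_measurable (M2 n \<Otimes>\<^sub>M mu ?n3)" using measurable_cong_sets[OF sets_pair_measure_cong[OF sets_M2 sets_mu] refl] by blast
  qed
  then show ?thesis using Fubini_integral[of "%a x'. E (fst a) (snd a) x'"] by simp
 qed
 also have "... = (LINT x'|(mu ?n3). K3 f xi n z x' * u x')" unfolding E_def K3_def by (simp only: prod.collapse integral_mult_left_zero)
 finally show ?thesis .
qed

lemma W3_props:
 assumes n: "n >= 1" and z [measurable]: "z : space (B n)"
 shows "x' : space (B (Suc (Suc (Suc n)))) ==> 0 <= W3 n z x'"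
  and "x' : space (B (Suc (Suc (Suc n)))) ==> W3 n z x' <= 1 / eps"
  and "integrable (mu (Suc (Suc (Suc n)))) (W3 n z)"
  and "(LINT x'|(mu (Suc (Suc (Suc n)))). W3 n z x') = 1"
proof -
 let ?n1 = "Suc n" and ?n2 = "Suc (Suc n)" and ?n3 = "Suc (Suc (Suc n))"
 show nn: "0 <= W3 n z x'" for x' unfolding W3_def by (rule Bochner_Integration.integral_nonneg) (rule Wt_nonneg)
 show le: "W3 n z x' <= 1 / eps" if x' [measurable]: "x' : space (B ?n3)" for x'
 proof -
  have "W3 n z x' = (LINT a|(M2 n). (%y x. p n z y * p ?n1 y x * p ?n2 x x') (fst a) (snd a))" by (simp add: W3_def Wt_def split_beta')
  also have "... = (LINT y|(mu ?n1). (LINT x|(mu ?n2). p n z y * p ?n1 y x * p ?n2 x x'))"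
  proof (rule M2_integral[where C="1/eps^3"])
   show "norm (p n z y * p ?n1 y x * p ?n2 x x') <= 1/eps^3" for x y using Wt_le[of n z x' "(y, x)"] Wt_nonneg[of n z x' "(y, x)"] by (simp add: Wt_def)
  qed measurable
  also have "... = trans n (%y. q ?n1 y x') z" by (simp add: trans_def q_def mult.assoc)
  also have "... <= 1 / eps" by (rule trans_le[where C="1/eps"]) (use q_le x' z in \<open>auto intro!: q_measurable\<close>)
  finally show ?thesis .
 qed
 \<comment> \<open>For the zero functional the twisted operators are the plain transition operators,
   so measurability and total mass of \<open>W3\<close> can be read off from the statements about
   \<open>K3\<close>.\<close>
 define f0 :: "nat => 'a => 'a => real" where "f0 = (%_ _ _. 0)"
 have f0: "addf f0" by (auto simp: addf_def pmeas_def f0_def)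
 have K: "K3 f0 0 n z x' = of_real (W3 n z x')" for x' by (simp add: K3_def W3_def scaleR_conv_of_real)
 have "(%x'. Re (K3 f0 0 n z x')) : borel_measurable (B ?n3)" using K3_measurable[OF f0 n, of "%_. z" "B ?n3" "%x. x"] by measurable
 then have Wm: "W3 n z : borel_measurable (B ?n3)" by (simp add: K)
 show int: "integrable (mu ?n3) (W3 n z)" by (rule integrable_mu[OF Wm, where C="1/eps"]) (use nn le in auto)
 have t1: "trans k (%_. 1) x = (1::complex)" if "x : space (B k)" for k x using p_int[OF that] by (simp add: trans_def scaleR_conv_of_real)
 have tc: "trans k u x = trans k v x" if "!!y. y : space (B (Suc k)) ==> u y = (v y :: complex)" for k x u v unfolding trans_def using that by (intro Bochner_Integration.integral_cong) auto
 have "Tit f0 0 n 3 (%_. 1) z = trans n (trans ?n1 (trans ?n2 (%_. 1))) z" by (simp add: numeral_3_eq_3 twist_def f0_def)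
 also have "... = trans n (trans ?n1 (%_. 1)) z" by (intro tc t1)
 also have "... = trans n (%_. 1) z" by (intro tc t1)
 also have "... = 1" by (rule t1[OF z])
 finally have "(LINT x'|(mu ?n3). K3 f0 0 n z x' * 1) = 1" using Tit3[OF f0 n _ _ z, of "%_. 1" 1 0] by simp
 then have "complex_of_real (LINT x'|(mu ?n3). W3 n z x') = 1" by (simp add: K)
 then show "(LINT x'|(mu ?n3). W3 n z x') = 1" by (simp only: of_real_eq_1_iff)
qed

text \<open>Factor the gap as (W - |K|) (W + |K|) and bound the second factor by
  \<open>2 / eps\<close>.\<close>

lemma K3_le:
 assumes f: "addf f" and n: "n >= 1" and z: "z : space (B n)" and x': "x' : space (B (Suc (Suc (Suc n))))"
 shows "cmod (K3 f xi n z x') <= W3 n z x' - (eps / 2) * gap f xi n z x'"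
proof -
 let ?K = "cmod (K3 f xi n z x')" and ?W = "W3 n z x'"
 have "?K^2 <= ?W^2" using gap_nonneg[OF f n z x', of xi] unfolding gap_alt by simp
 then have KW: "?K <= ?W" using W3_props(1)[OF n z x'] by (rule power2_le_imp_le)
 have "gap f xi n z x' = (?W - ?K) * (?W + ?K)" unfolding gap_alt by (simp add: power2_eq_square algebra_simps)
 also have "... <= (?W - ?K) * (2 / eps)" using KW W3_props(2)[OF n z x'] by (intro mult_left_mono) (auto simp: field_simps)
 finally have "(eps/2) * gap f xi n z x' <= (eps/2) * ((?W - ?K) * (2/eps))" using eps_pos by (intro mult_left_mono) auto
 also have "... = ?W - ?K" using eps_pos by simp
 finally show ?thesis by simp
qed

text \<open>The first two steps only spread the starting point: since \<open>q > eps\<close>, a loss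
  that depends on the state at time n + 2 is felt at least with weight \<open>eps\<close> times its
  \<open>mu\<close>-average. The other three steps produce the loss \<open>(eps/2) * gap\<close>,
  whose average over both end points is \<open>dd\<close>.\<close>

lemma Tit5_le:
 assumes f: "addf f" and n: "n >= 1" and u [measurable]: "u : borel_measurable (B (n + 5))"
  and U: "!!y. y : space (B (n + 5)) ==> cmod (u y) <= U" and wt: "wt : space (B n)"
 shows "cmod (Tit f xi n 5 u wt) <= (1 - (eps^2) / 2 * dd f xi (n + 2)) * U"
proof -
 let ?m = "Suc (Suc n)"
 let ?m3 = "Suc (Suc (Suc ?m))"
 have m: "?m >= 1" by simp
 have e5: "n + 5 = ?m3" by (simp add: numeral_eq_Suc)
 have m3: "?m + 3 = ?m3" by (simp add: numeral_eq_Suc)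
 note u' = u[unfolded e5] and U' = U[unfolded e5]
 obtain y0 where "y0 : space (B ?m3)" using mu.not_empty[of ?m3] by auto
 then have U0: "0 <= U" using U'[of y0] norm_ge_zero order_trans by blast
 define et where "et z = (LINT x'|(mu ?m3). gap f xi ?m z x')" for z
 define v where "v = Tit f xi ?m 3 u"
 have v [measurable]: "v : borel_measurable (B ?m)" unfolding v_def by (rule Tit_measurable[OF f m]) (simp only: m3 u')
 have vU: "cmod (v z) <= U" if "z : space (B ?m)" for z unfolding v_def by (rule norm_Tit_le[OF f m _ _ that]) (simp_all only: m3 u' U')
 have vb: "cmod (v z) <= U * (1 - (eps/2) * et z)" if z: "z : space (B ?m)" for z
 proof -
  have iW: "integrable (mu ?m3) (%x'. (W3 ?m z x' - (eps / 2) * gap f xi ?m z x') * U)" using W3_props(3)[OF m z] gap_inner(1)[OF f m z] by simp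
  have "v z = (LINT x'|(mu ?m3). K3 f xi ?m z x' * u x')" unfolding v_def by (rule Tit3[OF f m u' _ z]) (rule U')
  then have "cmod (v z) <= (LINT x'|(mu ?m3). cmod (K3 f xi ?m z x' * u x'))" by (simp only: integral_norm_bound)
  also have "... <= (LINT x'|(mu ?m3). (W3 ?m z x' - (eps / 2) * gap f xi ?m z x') * U)"
  proof (rule integral_mono')
   fix x' assume "x' : space (mu ?m3)"
   then have x': "x' : space (B ?m3)" by simp
   show "cmod (K3 f xi ?m z x' * u x') <= (W3 ?m z x' - (eps / 2) * gap f xi ?m z x') * U"
    unfolding norm_mult using K3_le[OF f m z x', of xi] U'[OF x'] order_trans[OF norm_ge_zero K3_le[OF f m z x', of xi]] by (intro mult_mono) auto
   then show "0 <= (W3 ?m z x' - (eps / 2) * gap f xi ?m z x') * U" using norm_ge_zero order_trans by blast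
  qed (rule iW)
  also have "... = U * (1 - (eps/2) * et z)" using W3_props(3,4)[OF m z] gap_inner(1)[OF f m z] by (simp add: et_def)
  finally show ?thesis .
 qed
 have eti: "integrable (mu ?m) et" unfolding et_def by (rule gap_inner(2)[OF f m])
 have et0: "0 <= et z" "et z <= (1/eps^3)^2" if "z : space (B ?m)" for z unfolding et_def using gap_inner(3,4)[OF f m that] by auto
 have "Tit f xi n 5 u wt = twist f xi n (twist f xi (Suc n) v) wt" by (simp add: v_def numeral_eq_Suc)
 moreover have "cmod (twist f xi n (twist f xi (Suc n) v) wt) <= trans n (trans (Suc n) (%z. cmod (v z))) wt"
 proof -
  have tw: "cmod (twist f xi k g x) <= trans k h x"
   if "k >= 1" "g : borel_measurable (B (Suc k))" "!!y. y : space (B (Suc k)) ==> cmod (g y) <= h y" "h : borel_measurable (B (Suc k))"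
    "!!y. y : space (B (Suc k)) ==> h y <= U" "x : space (B k)" for k g h x
  proof -
   have h0: "0 <= h y" if "y : space (B (Suc k))" for y using that \<open>!!y. y : space (B (Suc k)) ==> cmod (g y) <= h y\<close>[OF that] norm_ge_zero order_trans by blast
   have "cmod (twist f xi k g x) <= (LINT y|(mu (Suc k)). cmod (p k x y *\<^sub>R (cis (xi * f k x y) * g y)))" unfolding twist_def trans_def by (rule integral_norm_bound)
   also have "... <= (LINT y|(mu (Suc k)). p k x y *\<^sub>R h y)" using that h0 integrable_pu[OF that(4) _ that(6), of U] by (intro integral_mono') (auto simp: norm_mult intro!: mult_left_mono)
   finally show ?thesis by (simp add: trans_def)
  qed
  have [measurable]: "twist f xi (Suc n) v : borel_measurable (B (Suc n))" by (rule twist_measurable[OF f]) (auto simp: v)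
  have m1: "(%z. cmod (v z)) : borel_measurable (B (Suc (Suc n)))" by measurable
  have m2: "trans (Suc n) (%z. cmod (v z)) : borel_measurable (B (Suc n))" using cexp_measurable[of "%z. cmod (v z)" "Suc n" 1] m1 by simp
  have b2: "trans (Suc n) (%z. cmod (v z)) y <= U" if "y : space (B (Suc n))" for y by (rule trans_le[OF m1, where C=U]) (use vU that in auto)
  show ?thesis by (rule tw[OF n]) (use m1 m2 b2 wt vU n in \<open>auto intro!: tw\<close>)
 qed
 moreover have "trans n (trans (Suc n) (%z. cmod (v z))) wt <= (1 - (eps^2) / 2 * dd f xi (n + 2)) * U"
 proof -
  have qm: "q n wt : borel_measurable (B ?m)" using wt by (auto intro!: q_measurable)
  have "trans n (trans (Suc n) (%z. cmod (v z))) wt = (LINT z|(mu ?m). q n wt z *\<^sub>R cmod (v z))" by (rule trans_trans[where C=U]) (use vU wt in auto)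
  also have "... <= (LINT z|(mu ?m). U * q n wt z - (U * (eps^2/2)) * et z)"
  proof (rule integral_mono')
   show "integrable (mu ?m) (%z. U * q n wt z - U * (eps^2/2) * et z)" using q_int(2)[OF wt] eti by simp
   fix z assume "z : space (mu ?m)"
   then have z: "z : space (B ?m)" by simp
   have "q n wt z * cmod (v z) <= q n wt z * (U * (1 - (eps/2) * et z))" using q_le(1)[OF wt z] vb[OF z] by (intro mult_left_mono) auto
   also have "... = U * q n wt z - U * (eps/2) * (q n wt z * et z)" by (simp add: algebra_simps)
   also have "... <= U * q n wt z - U * (eps/2) * (eps * et z)" using q_gt[OF n wt z] et0[OF z] U0 eps_pos by (intro diff_left_mono mult_left_mono mult_right_mono) auto
   finally show *: "q n wt z *\<^sub>R cmod (v z) <= U * q n wt z - U * (eps^2/2) * et z" by (simp add: power2_eq_square mult_ac)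
   have "0 <= q n wt z *\<^sub>R cmod (v z)" using q_le(1)[OF wt z] by simp
   then show "0 <= U * q n wt z - U * (eps^2/2) * et z" using * by linarith
  qed
  also have "... = (1 - (eps^2) / 2 * dd f xi (n + 2)) * U" using q_int[OF wt] eti by (simp add: dd_def et_def[symmetric] algebra_simps)
  finally show ?thesis .
 qed
 ultimately show ?thesis by simp
qed

text \<open>Five steps reveal only one gap, so iterating in blocks of five would lose four gaps out
  of five. The product of five consecutive sup norms moves forward one step at a time and collects
  every gap; the sup norms do not decrease in \<open>i\<close>, and the final fifth root turns
  \<open>eps^2 / 2\<close> into \<open>eps^2 / 10\<close>.\<close>

lemma Tit_decay:
 assumes f: "addf f" and m: "m >= 1" and u: "u : borel_measurable (B (m + k))"
  and U: "!!y. y : space (B (m + k)) ==> cmod (u y) <= 1" and x: "x : space (B m)"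
 shows "cmod (Tit f xi m k u x) <= exp (- (eps^2 / 10) * (\<Sum>i<k-4. dd f xi (m + i + 2)))"
proof (cases "k >= 4")
 case False
 then show ?thesis using norm_Tit_le[OF f m u U x] by simp
next
 case True
 define v where "v i = Tit f xi (m + i) (k - i) u" for i
 define b where "b i = (SUP x\<in>space (B (m + i)). cmod (v i x))" for i
 have um: "u : borel_measurable (B (m + i + (k - i)))" "!!y. y : space (B (m + i + (k - i))) ==> cmod (u y) <= 1" if "i <= k" for i using u U that by auto
 have v1: "cmod (v i x) <= 1" if "i <= k" "x : space (B (m + i))" for i x unfolding v_def by (rule norm_Tit_le[OF f]) (use m um[OF that(1)] that in auto)
 have vm: "v i : borel_measurable (B (m + i))" if "i <= k" for i unfolding v_def by (rule Tit_measurable[OF f]) (use m um[OF that] in auto)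
 have bdd: "bdd_above ((%x. cmod (v i x)) ` space (B (m + i)))" if "i <= k" for i using v1[OF that] by (intro bdd_aboveI2[where M=1])
 have ne: "space (B (m + i)) ~= {}" for i using mu.not_empty[of "m + i"] by simp
 have vb: "cmod (v i x) <= b i" if "i <= k" "x : space (B (m + i))" for i x unfolding b_def by (rule cSUP_upper[OF that(2) bdd[OF that(1)]])
 have b0: "0 <= b i" if "i <= k" for i
 proof -
  obtain x where "x : space (B (m + i))" using ne[of i] by blast
  then show ?thesis using vb[OF that] norm_ge_zero order_trans by blast
 qed
 have b1: "b i <= 1" if "i <= k" for i unfolding b_def using v1[OF that] by (intro cSUP_least ne)
 have step: "b i <= exp (- (eps^2 / 2) * dd f xi (m + i + 2)) * b (i + 5)" if i: "i + 5 <= k" for i unfolding b_def[of i]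
 proof (rule cSUP_least[OF ne])
  fix x assume x: "x : space (B (m + i))"
  have k: "k - i = 5 + (k - (i + 5))" using i by simp
  have "v i x = Tit f xi (m + i) 5 (v (i + 5)) x" unfolding v_def k Tit_add by (simp add: add.assoc)
  also have "cmod ... <= (1 - (eps^2) / 2 * dd f xi (m + i + 2)) * b (i + 5)" by (rule Tit5_le[OF f]) (use m x i vm[of "i + 5"] vb[of "i + 5"] in \<open>auto simp: add.assoc\<close>)
  also have "... <= exp (- (eps^2 / 2) * dd f xi (m + i + 2)) * b (i + 5)" using exp_ge_add_one_self[of "- (eps^2 / 2) * dd f xi (m + i + 2)"] b0[OF i] by (intro mult_right_mono) auto
  finally show "cmod (v i x) <= exp (- (eps^2 / 2) * dd f xi (m + i + 2)) * b (i + 5)" .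
 qed
 have mono: "b i <= b (Suc i)" if "i < k" for i unfolding b_def[of i]
 proof (rule cSUP_least[OF ne])
  fix x assume x: "x : space (B (m + i))"
  have k: "k - i = Suc (k - Suc i)" using that by simp
  have "v i x = twist f xi (m + i) (v (Suc i)) x" unfolding v_def k by simp
  then show "cmod (v i x) <= b (Suc i)" using norm_twist_le[OF f, of "m + i" "v (Suc i)" "b (Suc i)" x] m x vm[of "Suc i"] vb[of "Suc i"] that by simp
 qed
 \<comment> \<open>From \<open>Pr i\<close> to \<open>Pr (Suc i)\<close> the factor
   \<open>b i\<close> is exchanged for \<open>b (i + 5)\<close>, which is exactly what
   \<open>step\<close> estimates.\<close>
 define Pr where "Pr i = b i * b (i + 1) * b (i + 2) * b (i + 3) * b (i + 4)" for i
 have Pstep: "Pr i <= exp (- (eps^2 / 2) * dd f xi (m + i + 2)) * Pr (Suc i)" if i: "i + 5 <= k" for i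
 proof -
  let ?R = "b (i + 1) * b (i + 2) * b (i + 3) * b (i + 4)"
  have R: "0 <= ?R" using b0 i by simp
  have "Pr i = b i * ?R" by (simp add: Pr_def mult.assoc)
  also have "... <= (exp (- (eps^2 / 2) * dd f xi (m + i + 2)) * b (i + 5)) * ?R" by (rule mult_right_mono[OF step[OF i] R])
  also have "... = exp (- (eps^2 / 2) * dd f xi (m + i + 2)) * Pr (Suc i)"
  proof -
   have "Suc i = i + 1" "Suc i + 1 = i + 2" "Suc i + 2 = i + 3" "Suc i + 3 = i + 4" "Suc i + 4 = i + 5" by auto
   then have b: "b (Suc i) = b (i + 1)" "b (Suc i + 1) = b (i + 2)" "b (Suc i + 2) = b (i + 3)"
    "b (Suc i + 3) = b (i + 4)" "b (Suc i + 4) = b (i + 5)" by metis+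
   have "Pr (Suc i) = ?R * b (i + 5)" unfolding Pr_def b ..
   then show ?thesis by (simp only: mult_ac)
  qed
  finally show ?thesis .
 qed
 have P0: "Pr 0 <= exp (- (eps^2 / 2) * (\<Sum>i<j. dd f xi (m + i + 2))) * Pr j" if "j + 4 <= k" for j using that
 proof (induction j)
  case (Suc j)
  have "Pr 0 <= exp (- (eps^2 / 2) * (\<Sum>i<j. dd f xi (m + i + 2))) * Pr j" using Suc by simp
  also have "... <= exp (- (eps^2 / 2) * (\<Sum>i<j. dd f xi (m + i + 2))) * (exp (- (eps^2 / 2) * dd f xi (m + j + 2)) * Pr (Suc j))" using Pstep[of j] Suc.prems by (intro mult_left_mono) auto
  also have "... = exp (- (eps^2 / 2) * (\<Sum>i<Suc j. dd f xi (m + i + 2))) * Pr (Suc j)" by (simp add: mult.assoc[symmetric] exp_add[symmetric] algebra_simps)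
  finally show ?case .
 qed simp
 have "b 0 ^ 5 <= Pr 0"
 proof -
  have "b 0 <= b (0 + 1)" "b 0 <= b (0 + 2)" "b 0 <= b (0 + 3)" "b 0 <= b (0 + 4)" using mono[of 0] mono[of 1] mono[of 2] mono[of 3] True by (auto simp: numeral_eq_Suc One_nat_def)
  then have "b 0 * b 0 * b 0 * b 0 * b 0 <= Pr 0" unfolding Pr_def using b0 True by (intro mult_mono mult_nonneg_nonneg) auto
  moreover have "b 0 ^ 5 = b 0 * b 0 * b 0 * b 0 * b 0" by (simp add: numeral_eq_Suc)
  ultimately show ?thesis by simp
 qed
 also have "... <= exp (- (eps^2 / 2) * (\<Sum>i<k-4. dd f xi (m + i + 2))) * Pr (k - 4)" using P0[of "k - 4"] True by simp
 also have "Pr (k - 4) <= 1 * 1 * 1 * 1 * 1" unfolding Pr_def using b0 b1 True by (intro mult_mono mult_nonneg_nonneg) auto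
 finally have "b 0 ^ 5 <= exp (- (eps^2 / 2) * (\<Sum>i<k-4. dd f xi (m + i + 2)))" by simp
 also have "... = exp (- (eps^2 / 10) * (\<Sum>i<k-4. dd f xi (m + i + 2))) ^ 5" by (simp add: exp_of_nat_mult[symmetric] field_simps)
 finally have "b 0 <= exp (- (eps^2 / 10) * (\<Sum>i<k-4. dd f xi (m + i + 2)))" by (rule power_le_imp_le_base[of _ 4, simplified]) simp
 moreover have "cmod (Tit f xi m k u x) <= b 0" using vb[of 0 x] x by (simp add: v_def)
 ultimately show ?thesis by linarith
qed

end

text \<open>The value 1 at zero keeps it unimodular everywhere.\<close>

definition phase :: "complex => complex" where
 "phase z = (if z = 0 then 1 else z / of_real (cmod z))"

lemma phase_measurable [measurable]: "phase : borel_measurable borel" unfolding phase_def by measurable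

lemma norm_phase [simp]: "cmod (phase z) = 1" by (simp add: phase_def norm_divide)

lemma phase_mult: "z = of_real (cmod z) * phase z" by (simp add: phase_def)

lemma Re_mult_real: "Re (of_real r * z) = r * Re z" by simp

text \<open>Let r be the real part of the unimodular product. The right side is at least q q' (1 -
  r) if r \<ge> 0, because |k| |k'| \<le> q q', and at least q q' \<ge> q q' (1 - r) / 2 if r < 0.
  Thus a loss of modulus in \<open>k\<close> or \<open>k'\<close> can only help.\<close>

lemma phase_inequality:
 assumes q: "e <= q" "e <= q'" "0 <= (e::real)" and k: "cmod k <= q" "cmod k' <= q'" and b: "cmod b = 1"
 shows "e^2 / 2 * (1 - Re (phase k * b * cnj (phase k'))) <= q * q' - Re (k * b * cnj k')"
proof -
 define r where "r = Re (phase k * b * cnj (phase k'))"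
 have "abs r <= cmod (phase k * b * cnj (phase k'))" unfolding r_def by (rule abs_Re_le_cmod)
 then have r: "abs r <= 1" using b by (simp add: norm_mult)
 have "k * b * cnj k' = of_real (cmod k * cmod k') * (phase k * b * cnj (phase k'))"
 proof -
  have "k * b * cnj k' = (of_real (cmod k) * phase k) * b * cnj (of_real (cmod k') * phase k')" by (simp only: phase_mult[symmetric])
  then show ?thesis by (simp add: mult_ac)
 qed
 then have eq: "Re (k * b * cnj k') = cmod k * cmod k' * r" by (simp only: r_def Re_mult_real)
 have qq: "cmod k * cmod k' <= q * q'" "e * e <= q * q'" using q k norm_ge_zero order_trans by (auto intro!: mult_mono)
 have "q * q' / 2 * (1 - r) <= q * q' - cmod k * cmod k' * r"
 proof (cases "0 <= r")
  case True
  have "cmod k * cmod k' * r <= q * q' * r" by (rule mult_right_mono[OF qq(1) True])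
  moreover have "0 <= q * q' * (1 - r)" using qq(2) r q by (intro mult_nonneg_nonneg) auto
  ultimately show ?thesis by (simp add: field_simps)
 next
  case False
  have "cmod k * cmod k' * r <= 0" using False by (intro mult_nonneg_nonpos) auto
  moreover have "q * q' / 2 * (1 - r) <= q * q' / 2 * 2" using q r by (intro mult_left_mono) auto
  ultimately show ?thesis by simp
 qed
 moreover have "e^2 / 2 * (1 - r) <= q * q' / 2 * (1 - r)" using qq(2) r by (intro mult_right_mono) (auto simp: power2_eq_square)
 ultimately show ?thesis unfolding eq r_def[symmetric] by linarith
qed

section \<open>Reduction at frequencies with bounded phase gaps\<close>

context elliptic_chain
begin

text \<open>Kernel of two twisted steps. Its phase will serve as the exponential of the potential
  whose gradient is split off.\<close>

definition kap :: "(nat => 'a => 'a => real) => real => nat => 'a => 'a => complex" where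
 "kap f xi n x z = (LINT y|(mu (Suc n)). (p n x y *\<^sub>R cis (xi * f n x y)) * (p (Suc n) y z *\<^sub>R cis (xi * f (Suc n) y z)))"

lemma kap_measurable:
 assumes f: "addf f" "n >= 1" and [measurable]: "a : M \<rightarrow>\<^sub>M B n" "b : M \<rightarrow>\<^sub>M B (Suc (Suc n))"
 shows "(%x. kap f xi n (a x) (b x)) : borel_measurable M"
proof -
 have n': "Suc n >= 1" by simp
 note [measurable (raw)] = pmeas_comp[OF pmeas_cis[OF addfD[OF f]]] pmeas_comp[OF pmeas_cis[OF addfD[OF f(1) n']]]
 show ?thesis unfolding kap_def by measurable
qed

lemma kap_le:
 assumes f: "addf f" "n >= 1" and x: "x : space (B n)" and z: "z : space (B (Suc (Suc n)))"
 shows "cmod (kap f xi n x z) <= q n x z" unfolding kap_def q_def by (rule order_trans[OF integral_norm_bound]) (simp add: norm_mult mult.commute)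

lemma cos_abs_ge: "abs x <= K ==> K <= pi ==> cos K <= cos x" using cos_monotone_0_pi_le[of "abs x" K] by simp

text \<open>All phases over two steps lie within angle 2K of 0. Since 2K is at most pi/2 these
  numbers fill a convex cone, which averaging does not leave.\<close>

lemma phase_kap_ge:
 assumes f: "addf f" and K: "!!n x y. abs (xi * f n x y) <= K" "4 * K <= pi"
  and n: "n >= 1" and x [measurable]: "x : space (B n)" and z [measurable]: "z : space (B (Suc (Suc n)))"
 shows "cos (2 * K) <= Re (phase (kap f xi n x z))"
proof (cases "kap f xi n x z = 0")
 case False
 have n': "Suc n >= 1" by simp
 note [measurable (raw)] = pmeas_comp[OF pmeas_cis[OF addfD[OF f n]]] pmeas_comp[OF pmeas_cis[OF addfD[OF f n']]]
 have K0: "0 <= K" using K(1)[of 0 x x] by (rule order_trans[OF abs_ge_zero])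
 have c0: "0 <= cos (2 * K)" using K0 K(2) by (intro cos_ge_zero) auto
 let ?g = "%y. (p n x y *\<^sub>R cis (xi * f n x y)) * (p (Suc n) y z *\<^sub>R cis (xi * f (Suc n) y z))"
 have int: "integrable (mu (Suc n)) ?g"
 proof (rule integrable_mu[where C="(1/eps) * (1/eps)"])
  have [measurable]: "(%y. cis (xi * f n x y)) : borel_measurable (B (Suc n))"
   "(%y. cis (xi * f (Suc n) y z)) : borel_measurable (B (Suc n))" using x z by (auto intro!: pmeas_comp[OF pmeas_cis[OF addfD[OF f n]]] pmeas_comp[OF pmeas_cis[OF addfD[OF f n']]])
  show "?g : borel_measurable (B (Suc n))" by measurable
  show "cmod (?g y) <= (1/eps) * (1/eps)" for y using mult_mono[OF p_le[of n x y] p_le[of "Suc n" y z]] eps_pos by (simp add: norm_mult mult.commute)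
 qed
 have "cos (2 * K) * cmod (kap f xi n x z) <= cos (2 * K) * q n x z" using kap_le[OF f n x z] c0 by (rule mult_left_mono)
 also have "... = (LINT y|(mu (Suc n)). cos (2 * K) * (p n x y * p (Suc n) y z))" by (simp add: q_def)
 also have "... <= (LINT y|(mu (Suc n)). Re (?g y))"
 proof (rule integral_mono)
  show "integrable (mu (Suc n)) (%y. cos (2 * K) * (p n x y * p (Suc n) y z))"
  proof (rule integrable_mu[where C="1 * ((1/eps) * (1/eps))"])
   show "norm (cos (2 * K) * (p n x y * p (Suc n) y z)) <= 1 * ((1/eps) * (1/eps))" for y unfolding real_norm_def abs_mult using p_le eps_pos by (intro mult_mono) auto
  qed measurable
  show "integrable (mu (Suc n)) (%y. Re (?g y))" by (rule integrable_Re[OF int])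
  fix y
  have "?g y = of_real (p n x y * p (Suc n) y z) * cis (xi * f n x y + xi * f (Suc n) y z)" by (simp add: scaleR_conv_of_real cis_mult[symmetric] mult_ac)
  then have "Re (?g y) = (p n x y * p (Suc n) y z) * cos (xi * f n x y + xi * f (Suc n) y z)" by (simp only: Re_mult_real cis.sel)
  moreover have "cos (2 * K) <= cos (xi * f n x y + xi * f (Suc n) y z)" using K(1)[of n x y] K(1)[of "Suc n" y z] K0 K(2) by (intro cos_abs_ge) linarith+
  ultimately show "cos (2 * K) * (p n x y * p (Suc n) y z) <= Re (?g y)" by (simp only: mult.commute[of "cos (2*K)"]) (intro mult_left_mono mult_nonneg_nonneg p_nonneg)
 qed
 also have "... = Re (kap f xi n x z)" unfolding kap_def by (rule integral_Re[OF int])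
 finally show ?thesis using False by (simp add: phase_def Re_divide_of_real field_simps)
qed (simp add: phase_def)

text \<open>Fubini in both orders: integrating the first interior point leaves two steps followed by
  one, integrating the second leaves one step followed by two.\<close>

lemma K3_forms:
 assumes f: "addf f" and n: "n >= 1" and z [measurable]: "z : space (B n)" and x' [measurable]: "x' : space (B (Suc (Suc (Suc n))))"
 shows "K3 f xi n z x' = (LINT x|(mu (Suc (Suc n))). kap f xi n z x * (p (Suc (Suc n)) x x' *\<^sub>R cis (xi * f (Suc (Suc n)) x x')))"
  and "K3 f xi n z x' = (LINT y|(mu (Suc n)). (p n z y *\<^sub>R cis (xi * f n z y)) * kap f xi (Suc n) y x')"
proof -
 let ?n1 = "Suc n" and ?n2 = "Suc (Suc n)" and ?n3 = "Suc (Suc (Suc n))"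
 have n': "?n1 >= 1" "?n2 >= 1" using n by auto
 note pm = pmeas_comp[OF pmeas_cis[OF addfD[OF f n]]] pmeas_comp[OF pmeas_cis[OF addfD[OF f n'(1)]]] pmeas_comp[OF pmeas_cis[OF addfD[OF f n'(2)]]]
 note [measurable (raw)] = pm
 define E where "E y x = (p n z y *\<^sub>R cis (xi * f n z y)) * (p ?n1 y x *\<^sub>R cis (xi * f ?n1 y x)) * (p ?n2 x x' *\<^sub>R cis (xi * f ?n2 x x'))" for y x
 have Em: "(%(y, x). E y x) : borel_measurable (B ?n1 \<Otimes>\<^sub>M B ?n2)" unfolding E_def by measurable
 have Eeq: "E y x = Wt n z x' (y, x) *\<^sub>R cis (xi * Ph f n z x' (y, x))" for y x unfolding E_def Wt_def Ph_def by (simp add: scaleR_conv_of_real distrib_left cis_mult[symmetric] mult_ac)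
 have Eb: "cmod (E y x) <= 1/eps^3" for y x unfolding Eeq using Wt_le[of n z x' "(y, x)"] Wt_nonneg[of n z x' "(y, x)"] by simp
 have "K3 f xi n z x' = (LINT a|(M2 n). E (fst a) (snd a))" by (simp add: K3_def Eeq)
 then have K: "K3 f xi n z x' = (LINT y|(mu ?n1). (LINT x|(mu ?n2). E y x))" using M2_integral[OF Em Eb] by simp
 then show "K3 f xi n z x' = (LINT y|(mu ?n1). (p n z y *\<^sub>R cis (xi * f n z y)) * kap f xi ?n1 y x')" unfolding E_def kap_def by (simp only: mult.assoc integral_mult_right_zero)
 have "K3 f xi n z x' = (LINT x|(mu ?n2). (LINT y|(mu ?n1). E y x))" using K swap_integral[OF Em Eb] by simp
 then show "K3 f xi n z x' = (LINT x|(mu ?n2). kap f xi n z x * (p ?n2 x x' *\<^sub>R cis (xi * f ?n2 x x')))" unfolding E_def kap_def by (simp only: integral_mult_left_zero)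
qed

text \<open>Defect of a loop: the phase of two steps from z to x and the step from x to x', against
  the step from z to y and the phase of two steps from y to x'.\<close>

definition RR :: "(nat => 'a => 'a => real) => real => nat => 'a => 'a => 'a => 'a => real" where
 "RR f xi n z y x x' = 1 - Re (phase (kap f xi n z x) * (cis (xi * f (Suc (Suc n)) x x') * cnj (cis (xi * f n z y))) * cnj (phase (kap f xi (Suc n) y x')))"

lemma RR_bounds: "0 <= RR f xi n z y x x'" "RR f xi n z y x x' <= 2"
proof -
 have "abs (Re (phase (kap f xi n z x) * (cis (xi * f (Suc (Suc n)) x x') * cnj (cis (xi * f n z y))) * cnj (phase (kap f xi (Suc n) y x')))) <= 1" by (rule order_trans[OF abs_Re_le_cmod]) (simp add: norm_mult)
 then show "0 <= RR f xi n z y x x'" "RR f xi n z y x x' <= 2" unfolding RR_def by linarith+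
qed

lemma RR_measurable:
 assumes f: "addf f" "n >= 1" and [measurable]: "a : M \<rightarrow>\<^sub>M B n" "b : M \<rightarrow>\<^sub>M B (Suc n)" "c : M \<rightarrow>\<^sub>M B (Suc (Suc n))" "d : M \<rightarrow>\<^sub>M B (Suc (Suc (Suc n)))"
 shows "(%x. RR f xi n (a x) (b x) (c x) (d x)) : borel_measurable M"
proof -
 have n': "Suc n >= 1" "Suc (Suc n) >= 1" by simp_all
 note [measurable (raw)] = pmeas_comp[OF pmeas_cis[OF addfD[OF f]]] pmeas_comp[OF pmeas_cis[OF addfD[OF f(1) n'(2)]]]
  kap_measurable[OF f] kap_measurable[OF f(1) n'(1)]
 have [measurable]: "cnj : borel_measurable borel" by (intro borel_measurable_continuous_onI continuous_intros)
 show ?thesis unfolding RR_def by measurable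
qed

definition HH :: "(nat => 'a => 'a => real) => real => nat => 'a => 'a => real" where
 "HH f xi n z y = (LINT x|(mu (Suc (Suc n))). trans (Suc (Suc n)) (RR f xi n z y x) x)"

text \<open>Write |K3|^2 as one splitting times the conjugate of the other, and W3^2 as the product
  of the two corresponding mass integrals. Their difference is then an integral over x and y to
  which \<open>phase_inequality\<close> applies pointwise, the moduli being dominated by
  \<open>q\<close>, which exceeds \<open>eps\<close>.\<close>

lemma gap_ge:
 assumes f: "addf f" and n: "n >= 1" and z [measurable]: "z : space (B n)" and x' [measurable]: "x' : space (B (Suc (Suc (Suc n))))"
 shows "eps^2 / 2 * (LINT x|(mu (Suc (Suc n))). (LINT y|(mu (Suc n)). p n z y * p (Suc (Suc n)) x x' * RR f xi n z y x x')) <= gap f xi n z x'"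
proof -
 let ?n1 = "Suc n" and ?n2 = "Suc (Suc n)" and ?n3 = "Suc (Suc (Suc n))"
 have n': "?n1 >= 1" "?n2 >= 1" using n by auto
 note pm = pmeas_comp[OF pmeas_cis[OF addfD[OF f n]]] pmeas_comp[OF pmeas_cis[OF addfD[OF f n'(1)]]] pmeas_comp[OF pmeas_cis[OF addfD[OF f n'(2)]]]
 note [measurable (raw)] = pm kap_measurable[OF f n] kap_measurable[OF f n'(1)] RR_measurable[OF f n]
 define k1 where "k1 x = kap f xi n z x * (p ?n2 x x' *\<^sub>R cis (xi * f ?n2 x x'))" for x
 define k2 where "k2 y = (p n z y *\<^sub>R cis (xi * f n z y)) * kap f xi ?n1 y x'" for y
 define w1 where "w1 x = q n z x * p ?n2 x x'" for x
 define w2 where "w2 y = p n z y * q ?n1 y x'" for y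
 have [measurable]: "k1 : borel_measurable (B ?n2)" "k2 : borel_measurable (B ?n1)" "w1 : borel_measurable (B ?n2)" "w2 : borel_measurable (B ?n1)" unfolding k1_def k2_def w1_def w2_def by measurable
 define f0 :: "nat => 'a => 'a => real" where "f0 = (%_ _ _. 0)"
 have f0: "addf f0" by (auto simp: addf_def pmeas_def f0_def)
 have kap0: "kap f0 0 m a b = of_real (q m a b)" for m a b by (simp add: kap_def q_def scaleR_conv_of_real of_real_mult[symmetric] del: of_real_mult)
 have W0: "K3 f0 0 n z x' = of_real (W3 n z x')" by (simp add: K3_def W3_def scaleR_conv_of_real)
 have W: "W3 n z x' = (LINT x|(mu ?n2). w1 x)" "W3 n z x' = (LINT y|(mu ?n1). w2 y)" using K3_forms[OF f0 n z x', of 0] unfolding W0 kap0 w1_def w2_def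
  by (simp_all add: scaleR_conv_of_real of_real_mult[symmetric] del: of_real_mult)
 have K: "K3 f xi n z x' = (LINT x|(mu ?n2). k1 x)" "K3 f xi n z x' = (LINT y|(mu ?n1). k2 y)" unfolding k1_def k2_def by (rule K3_forms[OF f n z x'])+
 have wb: "abs (w1 x) <= (1/eps) * (1/eps)" if "x : space (B ?n2)" for x unfolding w1_def abs_mult using q_le[OF z that] p_le eps_pos by (intro mult_mono) auto
 have wb2: "abs (w2 y) <= (1/eps) * (1/eps)" if "y : space (B ?n1)" for y unfolding w2_def abs_mult using q_le[OF that x'] p_le eps_pos by (intro mult_mono) auto
 have kb: "cmod (k1 x) <= w1 x" if "x : space (B ?n2)" for x unfolding k1_def w1_def norm_mult using kap_le[OF f n z that] by (auto intro!: mult_right_mono)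
 have kb2: "cmod (k2 y) <= w2 y" if "y : space (B ?n1)" for y unfolding k2_def w2_def norm_mult using kap_le[OF f n'(1) that x'] by (auto intro!: mult_left_mono)
 have iw1: "integrable (mu ?n2) w1" by (rule integrable_mu[where C="(1/eps) * (1/eps)"]) (use wb in auto)
 have iw2: "integrable (mu ?n1) w2" by (rule integrable_mu[where C="(1/eps) * (1/eps)"]) (use wb2 in auto)
 have ik1: "integrable (mu ?n2) k1" by (rule integrable_mu[where C="(1/eps) * (1/eps)"]) (use wb kb in \<open>force intro: order_trans\<close>)+
 have ik2: "integrable (mu ?n1) k2" by (rule integrable_mu[where C="(1/eps) * (1/eps)"]) (use wb2 kb2 in \<open>force intro: order_trans\<close>)+
 have ik12: "integrable (mu ?n1) (%y. k1 x * cnj (k2 y))" "integrable (mu ?n2) (%x. k1 x * c)" for x c using ik1 ik2 by auto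
 have inner: "(LINT y|(mu ?n1). Re (k1 x * cnj (k2 y))) = Re (k1 x * cnj (LINT y|(mu ?n1). k2 y))" for x by (subst integral_Re[OF ik12(1)]) (simp only: integral_mult_right_zero Bochner_Integration.integral_cnj)
 have "(cmod (K3 f xi n z x'))^2 = Re (K3 f xi n z x' * cnj (K3 f xi n z x'))" by (simp add: complex_mult_cnj cmod_power2)
 also have "K3 f xi n z x' * cnj (K3 f xi n z x') = (LINT x|(mu ?n2). k1 x) * cnj (LINT y|(mu ?n1). k2 y)" using K by simp
 also have "... = (LINT x|(mu ?n2). k1 x * cnj (LINT y|(mu ?n1). k2 y))" by (simp only: integral_mult_left_zero)
 also have "Re ... = (LINT x|(mu ?n2). Re (k1 x * cnj (LINT y|(mu ?n1). k2 y)))" by (rule integral_Re[symmetric, OF ik12(2)])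
 also have "... = (LINT x|(mu ?n2). (LINT y|(mu ?n1). Re (k1 x * cnj (k2 y))))" by (intro Bochner_Integration.integral_cong refl) (simp only: inner)
 finally have Ksq: "(cmod (K3 f xi n z x'))^2 = (LINT x|(mu ?n2). (LINT y|(mu ?n1). Re (k1 x * cnj (k2 y))))" .
 have Wsq: "(W3 n z x')^2 = (LINT x|(mu ?n2). (LINT y|(mu ?n1). w1 x * w2 y))" unfolding power2_eq_square by (subst (1) W(1), subst W(2)) simp
 have iRe: "integrable (mu ?n1) (%y. Re (k1 x * cnj (k2 y)))" for x by (rule integrable_Re[OF ik12(1)])
 have iReo: "integrable (mu ?n2) (%x. (LINT y|(mu ?n1). Re (k1 x * cnj (k2 y))))"
 proof -
  have "(%x. (LINT y|(mu ?n1). Re (k1 x * cnj (k2 y)))) = (%x. Re (k1 x * cnj (LINT y|(mu ?n1). k2 y)))" by (simp only: inner)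
  then show ?thesis by (simp only: integrable_Re[OF ik12(2)])
 qed
 have g: "gap f xi n z x' = (LINT x|(mu ?n2). (LINT y|(mu ?n1). w1 x * w2 y - Re (k1 x * cnj (k2 y))))" unfolding gap_alt Ksq Wsq using iw1 iw2 iRe iReo by simp
 let ?T = "%x y. p n z y * p ?n2 x x' * RR f xi n z y x x'"
 have Tb: "abs (?T x y) <= (1/eps) * (1/eps) * 2" for x y unfolding abs_mult using p_le RR_bounds eps_pos by (intro mult_mono mult_nonneg_nonneg) auto
 have iT: "integrable (mu ?n1) (%y. ?T x y)" if [measurable]: "x : space (B ?n2)" for x by (rule integrable_mu[where C="(1/eps) * (1/eps) * 2"]) (use Tb in \<open>auto intro!: RR_measurable[OF f n]\<close>)
 have iTo: "integrable (mu ?n2) (%x. (LINT y|(mu ?n1). ?T x y))"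
 proof (rule integrable_mu[where C="(1/eps) * (1/eps) * 2"])
  show "norm (LINT y|(mu ?n1). ?T x y) <= (1/eps) * (1/eps) * 2" for x by (rule norm_mu_integral_le) (use Tb eps_pos in auto)
 qed measurable
 have "eps^2 / 2 * (LINT x|(mu ?n2). (LINT y|(mu ?n1). ?T x y)) = (LINT x|(mu ?n2). eps^2 / 2 * (LINT y|(mu ?n1). ?T x y))" by simp
 also have "... <= (LINT x|(mu ?n2). (LINT y|(mu ?n1). w1 x * w2 y - Re (k1 x * cnj (k2 y))))"
 proof (rule integral_mono)
  fix x assume "x : space (mu ?n2)"
  then have x: "x : space (B ?n2)" by simp
  have "eps^2 / 2 * (LINT y|(mu ?n1). ?T x y) = (LINT y|(mu ?n1). eps^2 / 2 * ?T x y)" by simp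
  also have "... <= (LINT y|(mu ?n1). w1 x * w2 y - Re (k1 x * cnj (k2 y)))"
  proof (rule integral_mono)
   fix y assume "y : space (mu ?n1)"
   then have y: "y : space (B ?n1)" by simp
   let ?b = "cis (xi * f ?n2 x x') * cnj (cis (xi * f n z y))"
   have "eps^2 / 2 * RR f xi n z y x x' <= q n z x * q ?n1 y x' - Re (kap f xi n z x * ?b * cnj (kap f xi ?n1 y x'))" unfolding RR_def
    by (rule phase_inequality) (use q_gt[OF n z x] q_gt[OF n'(1) y x'] eps_pos kap_le[OF f n z x] kap_le[OF f n'(1) y x'] in \<open>auto simp: norm_mult\<close>)
   then have "(p n z y * p ?n2 x x') * (eps^2 / 2 * RR f xi n z y x x') <=
     (p n z y * p ?n2 x x') * (q n z x * q ?n1 y x' - Re (kap f xi n z x * ?b * cnj (kap f xi ?n1 y x')))" by (rule mult_left_mono) simp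
   also have "... = w1 x * w2 y - Re (of_real (p n z y * p ?n2 x x') * (kap f xi n z x * ?b * cnj (kap f xi ?n1 y x')))" unfolding Re_mult_real w1_def w2_def by (simp only: right_diff_distrib mult_ac)
   also have "of_real (p n z y * p ?n2 x x') * (kap f xi n z x * ?b * cnj (kap f xi ?n1 y x')) = k1 x * cnj (k2 y)" unfolding k1_def k2_def by (simp add: scaleR_conv_of_real mult_ac)
   finally show "eps^2 / 2 * ?T x y <= w1 x * w2 y - Re (k1 x * cnj (k2 y))" by (simp add: mult_ac)
  qed (use iT[OF x] iw2 iRe in auto)
  finally show "eps^2 / 2 * (LINT y|(mu ?n1). ?T x y) <= (LINT y|(mu ?n1). w1 x * w2 y - Re (k1 x * cnj (k2 y)))" .
 next
  show "integrable (mu ?n2) (%x. (LINT y|(mu ?n1). w1 x * w2 y - Re (k1 x * cnj (k2 y))))" using iw1 iw2 iRe iReo by simp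
 qed (use iTo in auto)
 finally show ?thesis unfolding g .
qed

lemma HH_measurable:
 assumes f: "addf f" "n >= 1" shows "pmeas n (HH f xi n)"
proof -
 note [measurable (raw)] = RR_measurable[OF f]
 show ?thesis unfolding pmeas_def HH_def split_beta' trans_def by measurable
qed

lemma HH_bounds:
 assumes f: "addf f" "n >= 1" shows "0 <= HH f xi n z y" "HH f xi n z y <= (1/eps) * 2"
proof -
 have t: "0 <= trans m (RR f xi n z y x) x" for m x unfolding trans_def by (rule Bochner_Integration.integral_nonneg) (simp add: RR_bounds)
 show "0 <= HH f xi n z y" unfolding HH_def by (rule Bochner_Integration.integral_nonneg) (rule t)
 have "norm (trans m (RR f xi n z y x) x) <= (1/eps) * 2" for m x unfolding trans_def
  by (rule norm_mu_integral_le) (use p_le RR_bounds eps_pos in \<open>auto simp: abs_mult intro!: mult_mono simp del: times_divide_eq_left\<close>)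
 then have "norm (HH f xi n z y) <= (1/eps) * 2" unfolding HH_def by (intro norm_mu_integral_le) (use eps_pos in auto)
 then show "HH f xi n z y <= (1/eps) * 2" by simp
qed

text \<open>After exchanging integrals the bound becomes one on \<open>HH\<close>, a function of the
  pair (z, y) at times n and n + 1, whose mean along the chain can be compared with this
  one.\<close>

lemma dd_ge:
 assumes f: "addf f" and n: "n >= 1"
 shows "eps^2 / 2 * (LINT z|(mu n). trans n (HH f xi n z) z) <= dd f xi n"
proof -
 let ?n1 = "Suc n" and ?n2 = "Suc (Suc n)" and ?n3 = "Suc (Suc (Suc n))"
 note [measurable (raw)] = RR_measurable[OF f n] pmeas_comp[OF HH_measurable[OF f n]]
 let ?T = "%z y x x'. p n z y * p ?n2 x x' * RR f xi n z y x x'"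
 have Tb: "norm (?T z y x x') <= (1/eps) * (1/eps) * 2" for z y x x' unfolding real_norm_def abs_mult using p_le RR_bounds eps_pos by (intro mult_mono mult_nonneg_nonneg) auto
 have C0: "0 <= (1/eps) * (1/eps) * 2" using eps_pos by simp
 have nb: "norm (LINT a|(mu k). g a) <= (1/eps) * (1/eps) * 2" if "!!a. norm (g a) <= (1/eps) * (1/eps) * 2" for g :: "'a => real" and k using that by (intro norm_mu_integral_le C0) auto
 have sw: "(LINT x'|(mu ?n3). (LINT x|(mu ?n2). (LINT y|(mu ?n1). ?T z y x x'))) = trans n (HH f xi n z) z" if [measurable]: "z : space (B n)" for z
 proof -
  have "(LINT x'|(mu ?n3). (LINT x|(mu ?n2). (LINT y|(mu ?n1). ?T z y x x'))) = (LINT x|(mu ?n2). (LINT x'|(mu ?n3). (LINT y|(mu ?n1). ?T z y x x')))"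
   by (rule swap_integral[where C="(1/eps) * (1/eps) * 2"]) (measurable, intro nb Tb)
  also have "... = (LINT x|(mu ?n2). (LINT y|(mu ?n1). (LINT x'|(mu ?n3). ?T z y x x')))"
  proof (rule Bochner_Integration.integral_cong[OF refl])
   fix x assume "x : space (mu ?n2)"
   then have [measurable]: "x : space (B ?n2)" by simp
   show "(LINT x'|(mu ?n3). (LINT y|(mu ?n1). ?T z y x x')) = (LINT y|(mu ?n1). (LINT x'|(mu ?n3). ?T z y x x'))" by (rule swap_integral[where C="(1/eps) * (1/eps) * 2"]) (measurable, intro Tb)
  qed
  also have "... = (LINT y|(mu ?n1). (LINT x|(mu ?n2). (LINT x'|(mu ?n3). ?T z y x x')))" by (rule swap_integral[where C="(1/eps) * (1/eps) * 2"]) (measurable, intro nb Tb)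
  also have "... = trans n (HH f xi n z) z" unfolding HH_def trans_def by (simp add: mult.assoc)
  finally show ?thesis .
 qed
 have igo: "integrable (mu ?n3) (%x'. (LINT x|(mu ?n2). (LINT y|(mu ?n1). ?T z y x x')))" if [measurable]: "z : space (B n)" for z by (rule integrable_mu[where C="(1/eps) * (1/eps) * 2"]) (measurable, intro nb Tb)
 have "eps^2 / 2 * (LINT z|(mu n). trans n (HH f xi n z) z) = (LINT z|(mu n). eps^2 / 2 * trans n (HH f xi n z) z)" by simp
 also have "... <= dd f xi n" unfolding dd_def
 proof (rule integral_mono)
  have "norm (trans n (HH f xi n z) z) <= (1/eps) * 2" if [measurable]: "z : space (B n)" for z by (rule norm_trans_le) (use HH_bounds[OF f n] that in auto)
  then show "integrable (mu n) (%z. eps^2 / 2 * trans n (HH f xi n z) z)" using integrable_mu[of "%z. trans n (HH f xi n z) z" n "(1/eps) * 2"] by auto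
  fix z assume "z : space (mu n)"
  then have z: "z : space (B n)" by simp
  have "eps^2 / 2 * trans n (HH f xi n z) z = (LINT x'|(mu ?n3). eps^2 / 2 * (LINT x|(mu ?n2). (LINT y|(mu ?n1). ?T z y x x')))" unfolding sw[OF z, symmetric] by simp
  also have "... <= (LINT x'|(mu ?n3). gap f xi n z x')" by (rule integral_mono) (use igo[OF z] gap_inner(1)[OF f n z] gap_ge[OF f n z] in auto)
  finally show "eps^2 / 2 * trans n (HH f xi n z) z <= (LINT x'|(mu ?n3). gap f xi n z x')" .
 qed (use gap_inner(2)[OF f n] in auto)
 finally show ?thesis .
qed


text \<open>The expected series is at most \<open>c\<close>, so it cannot exceed
  \<open>c + 1\<close> on every path.\<close>

lemma exists_path_summable:
 assumes P: "chain_law P" and u: "!!n. n >= 1 ==> pmeas n (u n)" and u0: "u 0 = (%_ _. 0)"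
  and nn: "!!n x y. 0 <= u n x y" and ub: "!!n x y. u n x y <= C n"
  and s: "summable (%n. Ex P n (u n))" and c: "(\<Sum>n. Ex P n (u n)) <= c"
 obtains w where "w : space paths" "summable (%n. st u n w)" "(\<Sum>n. st u n w) <= c + 1"
proof -
 interpret P: prob_space P using chain_lawD[OF P] by simp
 note [measurable_cong] = chain_lawD(2)[OF P]
 have m: "(%w. st u n w) : borel_measurable paths" for n using u0 pmeas_path[OF u] by (cases "n = 0") auto
 have m' [measurable]: "(%w. st u n w) : borel_measurable P" for n using m by simp
 have i: "integrable P (%w. st u n w)" for n by (rule law_integrable[OF P m, where C="C n"]) (use nn ub in \<open>auto simp: abs_of_nonneg\<close>)
 have E0: "0 <= Ex P n (u n)" for n unfolding Ex_def using nn by simp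
 define F where "F w = (\<Sum>n. ennreal (st u n w))" for w
 have "(\<integral>\<^sup>+w. F w \<partial>P) = (\<Sum>n. \<integral>\<^sup>+w. ennreal (st u n w) \<partial>P)" unfolding F_def by (rule nn_integral_suminf) measurable
 also have "... = (\<Sum>n. ennreal (Ex P n (u n)))" unfolding Ex_def using i nn by (intro suminf_cong nn_integral_eq_integral) auto
 also have "... = ennreal (\<Sum>n. Ex P n (u n))" by (rule suminf_ennreal2[OF E0 s])
 finally have int: "(\<integral>\<^sup>+w. F w \<partial>P) <= ennreal c" using c by (simp add: ennreal_leI)
 have c0: "0 <= c" using suminf_nonneg[OF s E0] c by simp
 have "\<exists>w\<in>space P. F w <= ennreal (c + 1)"
 proof (rule ccontr)
  assume "~ ?thesis"
  then have "(\<integral>\<^sup>+w. ennreal (c + 1) \<partial>P) <= (\<integral>\<^sup>+w. F w \<partial>P)" by (intro nn_integral_mono) (auto simp: not_le)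
  then have "ennreal (c + 1) <= ennreal c" using int P.emeasure_space_1 by simp
  then show False using c0 by simp
 qed
 then obtain w where wt: "w : space P" "F w <= ennreal (c + 1)" by blast
 have fin: "F w ~= top" using wt(2) ennreal_neq_top[of "c + 1"] neq_top_trans by blast
 have su: "summable (%n. st u n w)" using fin nn unfolding F_def by (intro summable_suminf_not_top) auto
 have "ennreal (\<Sum>n. st u n w) <= ennreal (c + 1)" using wt(2) suminf_ennreal2[OF nn su] unfolding F_def by simp
 then have "(\<Sum>n. st u n w) <= c + 1" using c0 by (subst (asm) ennreal_le_iff) auto
 with su wt(1) show ?thesis using that chain_lawD(3)[OF P] by auto
qed

text \<open>With unimodular \<open>al\<close> and \<open>c\<close> it vanishes exactly when exp (i
  xi f) equals c times the quotient of the next \<open>al\<close> by the present one, that is, when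
  f is a constant plus a gradient modulo 2 pi / xi.\<close>

definition cgap :: "(nat => 'a => 'a => real) => real => (nat => 'a => complex) => (nat => complex) => nat => 'a => 'a => real" where
 "cgap f xi al c n x y = 1 - Re (al n x * cis (xi * f n x y) * cnj (c n * al (Suc n) y))"

text \<open>The functions al n are the phases of the two-step kernels issued from one fixed path with summable gaps.\<close>

lemma ladder:
 assumes P: "chain_law P" and f: "addf f" and s: "summable (%n. if n : I then dd f xi n else 0)" and I: "I \<subseteq> {3..}"
  and d: "(\<Sum>n. if n : I then dd f xi n else 0) <= d"
 obtains al c where "!!n. n >= 3 ==> al n : borel_measurable (B n)" "!!n x. cmod (al n x) = 1" "!!n. cmod (c n) = 1"
  "summable (%n. if n : I then Ex P (Suc (Suc n)) (cgap f xi al c (Suc (Suc n))) else 0)"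
  "(\<Sum>n. if n : I then Ex P (Suc (Suc n)) (cgap f xi al c (Suc (Suc n))) else 0) <= 2 / eps^4 * d + 1 / eps"
  "!!K n x. (!!n x y. abs (xi * f n x y) <= K) ==> 4 * K <= pi ==> n >= 3 ==> x : space (B n) ==> cos (2 * K) <= Re (al n x)"
  "!!K n. (!!n x y. abs (xi * f n x y) <= K) ==> 4 * K <= pi ==> cos K <= Re (c n)"
proof -
 define u where "u n = (%x y. if n : I then HH f xi n x y else 0)" for n
 have I1: "n >= 1" "n >= 3" if "n : I" for n using that I by auto
 have pu: "pmeas n (u n)" if "n >= 1" for n using HH_measurable[OF f that] by (cases "n : I") (auto simp: u_def pmeas_def)
 have ubd: "0 <= u n x y" "u n x y <= (1/eps) * 2" for n x y using HH_bounds[OF f] I1 eps_pos by (auto simp: u_def)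
 have Eu: "Ex P n (u n) <= (2/eps^3) * (if n : I then dd f xi n else 0)" "0 <= Ex P n (u n)" for n
 proof -
  show "0 <= Ex P n (u n)" unfolding Ex_def using ubd by simp
  show "Ex P n (u n) <= (2/eps^3) * (if n : I then dd f xi n else 0)"
  proof (cases "n : I")
   case True
   have "Ex P n (u n) <= (1/eps) * (LINT z|(mu n). trans n (HH f xi n z) z)" using law_pair_le(3)[OF P P I1(2)[OF True] HH_measurable[OF f I1(1)[OF True], of xi], of "(1/eps) * 2"] HH_bounds[OF f I1(1)[OF True]] True
    by (simp add: Ex_def u_def)
   also have "... <= (1/eps) * ((2/eps^2) * dd f xi n)" using dd_ge[OF f I1(1)[OF True], of xi] eps_pos by (intro mult_left_mono) (auto simp: field_simps)
   finally show ?thesis using True by (simp add: power2_eq_square power3_eq_cube)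
  qed (simp add: u_def Ex_def)
 qed
 have s': "summable (%n. Ex P n (u n))" by (rule summable_comparison_test'[OF summable_mult[OF s, of "2/eps^3"], of 0]) (use Eu in \<open>auto\<close>)
 have "(\<Sum>n. Ex P n (u n)) <= (\<Sum>n. (2/eps^3) * (if n : I then dd f xi n else 0))" by (rule suminf_le[OF Eu(1) s' summable_mult[OF s]])
 also have "... = (2/eps^3) * (\<Sum>n. if n : I then dd f xi n else 0)" by (rule suminf_mult[OF s])
 also have "... <= (2/eps^3) * d" using d eps_pos by (intro mult_left_mono) auto
 finally have c': "(\<Sum>n. Ex P n (u n)) <= (2/eps^3) * d" .
 have "u 0 = (%_ _. 0)" using I1(1)[of 0] by (cases "0 : I") (simp_all add: u_def)
 from exists_path_summable[OF P pu this ubd s' c'] obtain w where wt: "w : space paths"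
  "summable (%n. st u n w)" "(\<Sum>n. st u n w) <= (2/eps^3) * d + 1" by blast
 \<comment> \<open>The gap at n involves \<open>al\<close> at n + 2, issued from \<open>w n\<close>,
   and at n + 3, issued from \<open>w (Suc n)\<close>. The latter is the same function that the gap
   at n + 1 uses as its first one; this consistency is the reason for following a single
   path.\<close>
 define al where "al n x = phase (kap f xi (n - 2) (w (n - 2)) x)" for n x
 define c where "c n = cis (xi * f (n - 2) (w (n - 2)) (w (n - 1)))" for n
 have am: "al n : borel_measurable (B n)" if n: "n >= 3" for n
 proof -
  define k where "k = n - 2"
  have k: "n = Suc (Suc k)" "k >= 1" using n by (auto simp: k_def)
  have "(%x. kap f xi k (w k) x) : borel_measurable (B n)" using kap_measurable[OF f k(2), of "%_. w k" "B n" "%x. x"] coord_space[OF k(2) wt(1)] k(1) by simp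
  then show ?thesis unfolding al_def using k(1) by simp
 qed
 have cg: "cgap f xi al c (Suc (Suc n)) x y = RR f xi n (w n) (w (Suc n)) x y" if "n >= 1" for n x y unfolding cgap_def RR_def al_def c_def by (simp add: mult_ac)
 have Ec: "Ex P (Suc (Suc n)) (cgap f xi al c (Suc (Suc n))) <= (1/eps) * st u n w" "0 <= Ex P (Suc (Suc n)) (cgap f xi al c (Suc (Suc n)))" if n: "n : I" for n
 proof -
  have pm: "pmeas (Suc (Suc n)) (RR f xi n (w n) (w (Suc n)))" unfolding pmeas_def split_beta' using coord_space[OF _ wt(1)] I1[OF n] by (intro RR_measurable[OF f]) auto
  have "Ex P (Suc (Suc n)) (RR f xi n (w n) (w (Suc n))) <= (1/eps) * HH f xi n (w n) (w (Suc n))" unfolding Ex_def HH_def using law_pair_le(3)[OF P P _ pm, of 2] I1[OF n] by (simp add: RR_bounds)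
  then show "Ex P (Suc (Suc n)) (cgap f xi al c (Suc (Suc n))) <= (1/eps) * st u n w" using n cg[OF I1(1)[OF n]] by (simp add: u_def Ex_def)
  show "0 <= Ex P (Suc (Suc n)) (cgap f xi al c (Suc (Suc n)))" unfolding Ex_def cg[OF I1(1)[OF n]] by (simp add: RR_bounds)
 qed
 let ?e = "%n. if n : I then Ex P (Suc (Suc n)) (cgap f xi al c (Suc (Suc n))) else 0"
 have le: "?e n <= (1/eps) * st u n w" for n using Ec(1)[of n] ubd(1)[of n] eps_pos by (cases "n : I") auto
 have se: "summable ?e" by (rule summable_comparison_test'[OF summable_mult[OF wt(2), of "1/eps"], of 0]) (use le Ec(2) in auto)
 have "(\<Sum>n. ?e n) <= (\<Sum>n. (1/eps) * st u n w)" by (rule suminf_le[OF le se summable_mult[OF wt(2)]])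
 also have "... = (1/eps) * (\<Sum>n. st u n w)" by (rule suminf_mult[OF wt(2)])
 also have "... <= (1/eps) * ((2/eps^3) * d + 1)" using wt(3) eps_pos by (intro mult_left_mono) auto
 \<comment> \<open>The summand \<open>1 / eps\<close> is the margin 1 from the choice of the path,
   passed through the last comparison with \<open>mu\<close>.\<close>
 also have "... = 2 / eps^4 * d + 1 / eps" using eps_pos by (simp add: field_simps power4_eq_xxxx power3_eq_cube)
 finally have "(\<Sum>n. ?e n) <= 2 / eps^4 * d + 1 / eps" .
 moreover have "cos (2 * K) <= Re (al n x)"
  if K: "!!n x y. abs (xi * f n x y) <= K" "4 * K <= pi" and n: "n >= 3" and x: "x : space (B n)" for K n x
 proof -
  have "n - 2 >= 1" "Suc (Suc (n - 2)) = n" using n by auto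
  then show ?thesis using phase_kap_ge[OF f K, of "n - 2" "w (n - 2)" x] coord_space[OF _ wt(1), of "n - 2"] x by (simp add: al_def)
 qed
 moreover have "cos K <= Re (c n)" if K: "!!n x y. abs (xi * f n x y) <= K" "4 * K <= pi" for K n unfolding c_def using cos_abs_ge[OF K(1)] K(2) order_trans[OF abs_ge_zero K(1)] by simp
 ultimately show ?thesis using se am by (intro that[of al c]) (auto simp: al_def c_def)
qed

end

text \<open>From 1 - cos x \<ge> x^2/2 - x^4/24 and x^4 \<le> 10 x^2 there remains x^2/12. The range
  contains |x| \<le> 3, the largest argument that occurs.\<close>

lemma cos_bound: assumes "x^2 <= 10" shows "x^2 / 12 <= 1 - cos (x::real)"
proof -
 obtain t where t: "cos x = (\<Sum>m<4. cos_coeff m * x ^ m) + cos (t + 1/2 * real 4 * pi) / fact 4 * x ^ 4" using Maclaurin_cos_expansion[of x 4] by auto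
 have "(\<Sum>m<4. cos_coeff m * x ^ m) = 1 - (x^2)/2"
 proof -
  have "{..<4::nat} = {0, 1, 2, 3}" by auto
  then show ?thesis by (simp add: cos_coeff_def)
 qed
 moreover have "cos (t + 1/2 * real 4 * pi) / fact 4 * x ^ 4 <= 1 / 24 * x^4" by (intro mult_right_mono) (auto simp: fact_numeral)
 moreover have "x^4 <= 10 * x^2" using mult_right_mono[OF assms, of "x^2"] by (simp add: power2_eq_square power4_eq_xxxx mult_ac)
 ultimately show ?thesis using t by simp
qed

lemma cis_dist: "cmod (cis t - 1) <= abs t" using iexp_approx1[of t 0] by (simp add: cis_conv_exp)

text \<open>The principal argument on the unit circle; clipping the real part makes it measurable on
  the whole plane.\<close>

definition carg :: "complex => real" where
 "carg wt = (if 0 <= Im wt then 1 else - 1) * arccos (max (- 1) (min 1 (Re wt)))"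

lemma carg_measurable [measurable]: "carg : borel_measurable borel"
proof -
 have "continuous_on UNIV (%x. arccos (max (- 1) (min 1 x)))" by (intro continuous_on_compose2[OF continuous_on_arccos'] continuous_intros) auto
 from borel_measurable_continuous_onI[OF this]
 have [measurable]: "(%x. arccos (max (- 1) (min 1 x))) : borel_measurable borel" .
 show ?thesis unfolding carg_def by measurable
qed

text \<open>An angle t \<le> pi may be too large for \<open>cos_bound\<close>, but t/2 is not:
  (t/2)^2 / 12 \<le> 1 - cos (t/2) \<le> 1 - cos t. Hence the factor 48.\<close>

lemma carg:
 assumes wt: "cmod wt = 1"
 shows cis_carg: "cis (carg wt) = wt" and carg_le: "abs (carg wt) <= pi" and carg_sq: "(carg wt)^2 <= 48 * (1 - Re wt)"
  and carg_small: "0 <= K ==> K <= pi ==> cos K <= Re wt ==> abs (carg wt) <= K"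
proof -
 have r: "abs (Re wt) <= 1" using abs_Re_le_cmod[of wt] wt by simp
 then have m: "max (- 1) (min 1 (Re wt)) = Re wt" by auto
 have c: "abs (carg wt) = arccos (Re wt)" using arccos_lbound[of "Re wt"] r unfolding carg_def m by (auto simp: abs_mult)
 have "(Im wt)^2 = 1 - (Re wt)^2" using wt cmod_power2[of wt] by simp
 then have "sqrt (1 - (Re wt)^2) = abs (Im wt)" by (metis real_sqrt_abs)
 then have "sin (arccos (Re wt)) = abs (Im wt)" using r by (simp add: sin_arccos_abs)
 then show "cis (carg wt) = wt" unfolding carg_def m using r by (auto simp: complex_eq_iff)
 show le: "abs (carg wt) <= pi" unfolding c using arccos_ubound r by auto
 show "abs (carg wt) <= K" if "0 <= K" "K <= pi" "cos K <= Re wt" unfolding c using arccos_le_arccos[of "cos K" "Re wt"] that r arccos_cos[of K] by auto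
 let ?t = "arccos (Re wt)"
 have t: "0 <= ?t" "?t <= pi" using arccos_bounded[of "Re wt"] r by auto
 have "(?t/2)^2 <= 2^2" using t pi_less_4 by (intro power_mono) auto
 then have "(?t/2)^2 / 12 <= 1 - cos (?t/2)" by (intro cos_bound) simp
 also have "... <= 1 - cos ?t" using cos_monotone_0_pi_le[of "?t/2" ?t] t by simp
 finally have "?t^2 <= 48 * (1 - Re wt)" using r by (simp add: power_divide)
 then show "(carg wt)^2 <= 48 * (1 - Re wt)" unfolding c[symmetric] by simp
qed

section \<open>Bounded gaps: gradient, square-summable remainder, lattice values\<close>

context elliptic_chain
begin

text \<open>The decay estimate for the sum over times 3 to N spends two steps before each bridge and
  three on it, so it sees the gaps at times 5 to N - 2.\<close>

definition DD :: "(nat => 'a => 'a => real) => real => nat => real" where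
 "DD f xi N = (\<Sum>n\<in>{5..<N-1}. dd f xi n)"

abbreviation Sm :: "(nat => 'a => 'a => real) => nat => nat => (nat => 'a) => real" where
 "Sm f m N w \<equiv> (\<Sum>n\<in>{m..N}. st f n w)"

lemma DD_nonneg: "addf f ==> 0 <= DD f xi N" unfolding DD_def by (intro sum_nonneg dd_nonneg) auto

lemma DD_mono: "addf f ==> N <= N' ==> DD f xi N <= DD f xi N'" unfolding DD_def by (intro sum_mono2 dd_nonneg) auto

lemma DD_add: "addf f ==> DD f (xi + et) N <= 2 * DD f xi N + 2 * DD f et N" unfolding DD_def sum_distrib_left sum.distrib[symmetric] by (intro sum_mono dd_add) auto

lemma DD_uminus: "addf f ==> DD f (- xi) N = DD f xi N" unfolding DD_def by (intro sum.cong refl dd_uminus) auto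

lemma continuous_DD: "addf f ==> continuous_on UNIV (%xi. DD f xi N)" unfolding DD_def by (intro continuous_on_sum continuous_dd) auto

lemma Sm_measurable: "addf f ==> m >= 1 ==> Sm f m N : borel_measurable paths" by (intro borel_measurable_sum pmeas_path addfD) auto

lemma adapted_Sm: "addf f ==> m >= 1 ==> N < k ==> adapted k (Sm f m N)" by (intro adapted_sum adapted_coord2 pmeasD addfD) auto

definition cdec :: real where "cdec = eps^2 / 10"

lemma cdec_pos: "0 < cdec" using eps_pos by (simp add: cdec_def)

lemma char_bound:
 assumes Q: "chain_law Q" and f: "addf f" and N: "3 <= N" and G: "adapted 3 G" "!!w. cmod (G w) <= 1"
  and u [measurable]: "u : borel_measurable (B (Suc N))" and u1: "!!y. y : space (B (Suc N)) ==> cmod (u y) <= 1"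
 shows "cmod (LINT w|Q. G w * cis (xi * Sm f 3 N w) * u (w (Suc N))) <= exp (- cdec * DD f xi N)"
proof -
 interpret Q: prob_space Q using chain_lawD[OF Q] by simp
 define k where "k = N - 2"
 have k: "3 + k = Suc N" using N by (simp add: k_def)
 have u': "u : borel_measurable (B (3 + k))" "!!y. y : space (B (3 + k)) ==> cmod (u y) <= 1" using u u1 unfolding k by auto
 have eq: "{3..<3+k} = {3..N}" unfolding k by auto
 have "(\<Sum>i<k-4. dd f xi (3 + i + 2)) = DD f xi N" unfolding DD_def by (rule sum.reindex_bij_witness[of _ "%n. n - 5" "%i. i + 5"]) (auto simp: k_def add.commute)
 then have dec: "cmod (Tit f xi 3 k u x) <= exp (- cdec * DD f xi N)" if "x : space (B 3)" for x using Tit_decay[OF f _ u' that, of xi] by (simp add: cdec_def)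
 have "(LINT w|Q. G w * cis (xi * Sm f 3 N w) * u (w (Suc N))) = (LINT w|Q. G w * Tit f xi 3 k u (w 3))" using Tit_law[OF Q f _ G u', of xi, unfolded eq, unfolded k] by simp
 also have "cmod ... <= (LINT w|Q. exp (- cdec * DD f xi N))"
 proof (rule order_trans[OF integral_norm_bound integral_mono'])
  fix w assume "w : space Q"
  then have "w 3 : space (B 3)" using coord_space[of 3] chain_lawD(3)[OF Q] by auto
  then show "cmod (G w * Tit f xi 3 k u (w 3)) <= exp (- cdec * DD f xi N)" unfolding norm_mult using mult_mono[OF G(2) dec] by simp
 qed auto
 finally show ?thesis by (simp add: Q.prob_space)
qed

text \<open>If the sum is within M of a constant with probability 3/4, its characteristic function
  at |s| \<le> 1/(4M) differs from a unimodular number by at most 1/4 + 2/4. Being at least 1/4 it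
  limits the decay exponent to ln 4. Infinitely many N are enough because \<open>DD\<close>
  increases with N.\<close>

lemma tight_DD:
 assumes P: "chain_law P" and f: "addf f" and M: "M > 0" and s: "abs s <= 1 / (4 * M)"
  and inf: "!!N0. \<exists>N\<ge>N0. \<exists>m. measure P {w : space P. abs (Sm f 3 N w - m) > M} <= 1 / 4"
 shows "DD f s N <= ln 4 / cdec"
proof -
 interpret P: prob_space P using chain_lawD[OF P] by simp
 note [measurable_cong] = chain_lawD(2)[OF P]
 obtain N' m where N': "N' >= max 3 N" and m: "measure P {w : space P. abs (Sm f 3 N' w - m) > M} <= 1 / 4" using inf[of "max 3 N"] by blast
 have [measurable]: "Sm f 3 N' : borel_measurable P" using Sm_measurable[OF f, of 3 N'] by simp
 let ?A = "{w : space P. abs (Sm f 3 N' w - m) > M}"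
 have [measurable]: "?A : sets P" by measurable
 have iA: "integrable P (indicator ?A :: _ => real)" by (intro P.integrable_const_bound[where B=1]) (auto simp: indicator_def)
 have int: "integrable P (%w. cis (s * (Sm f 3 N' w - m)))" by (intro P.integrable_const_bound[where B=1]) auto
 have "cmod ((LINT w|P. cis (s * (Sm f 3 N' w - m))) - 1) = cmod (LINT w|P. cis (s * (Sm f 3 N' w - m)) - 1)" using int by (simp add: P.prob_space)
 also have "... <= (LINT w|P. 1/4 + 2 * indicator ?A w)"
 proof (rule order_trans[OF integral_norm_bound integral_mono'])
  show "integrable P (%w. 1/4 + 2 * indicator ?A w :: real)" using iA by simp
  fix w assume wt: "w : space P"
  show "cmod (cis (s * (Sm f 3 N' w - m)) - 1) <= 1/4 + 2 * indicator ?A w"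
  proof (cases "w : ?A")
   case True
   then show ?thesis using norm_triangle_ineq4[of "cis (s * (Sm f 3 N' w - m))" 1] by simp
  next
   case False
   then have "abs (s * (Sm f 3 N' w - m)) <= 1 / (4 * M) * M" unfolding abs_mult using wt s by (intro mult_mono) auto
   then have "abs (s * (Sm f 3 N' w - m)) <= 1/4" using M by simp
   with cis_dist have "cmod (cis (s * (Sm f 3 N' w - m)) - 1) <= 1/4" by (rule order_trans)
   then show ?thesis using False by simp
  qed
 qed auto
 also have "... = 1/4 + 2 * measure P ?A" using iA by (simp add: P.prob_space)
 also have "... <= 3/4" using m by simp
 finally have "1/4 <= cmod (LINT w|P. cis (s * (Sm f 3 N' w - m)))" using norm_triangle_ineq2[of 1 "1 - (LINT w|P. cis (s * (Sm f 3 N' w - m)))"] by (simp add: norm_minus_commute)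
 also have "(LINT w|P. cis (s * (Sm f 3 N' w - m))) = (LINT w|P. cis (- s * m) * cis (s * Sm f 3 N' w) * 1)" by (simp add: right_diff_distrib cis_mult)
 also have "cmod ... <= exp (- cdec * DD f s N')" by (rule char_bound[OF P f, where u="%_. 1"]) (use N' in auto)
 finally have "ln (1/4) <= ln (exp (- cdec * DD f s N'))" by (subst ln_le_cancel_iff) auto
 then have "DD f s N' <= ln 4 / cdec" using cdec_pos by (simp add: ln_div field_simps)
 moreover have "DD f s N <= DD f s N'" using N' by (intro DD_mono f) auto
 ultimately show ?thesis by linarith
qed

lemma summable_dd:
 assumes f: "addf f" and b: "!!N. DD f xi N <= d"
 shows "summable (%n. if n : {5..} then dd f xi n else 0)" "(\<Sum>n. if n : {5..} then dd f xi n else 0) <= d"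
proof -
 have p: "(\<Sum>n<N. if n : {5..} then dd f xi n else 0) = DD f xi (Suc N)" for N unfolding DD_def by (intro sum.mono_neutral_cong_right) auto
 have nn: "0 <= (if n : {5..} then dd f xi n else 0)" for n using dd_nonneg[OF f, of n] by auto
 show s: "summable (%n. if n : {5..} then dd f xi n else 0)" by (rule summableI_nonneg_bounded[OF nn, where x=d]) (simp only: p b)
 show "(\<Sum>n. if n : {5..} then dd f xi n else 0) <= d" by (rule suminf_le_const[OF s]) (simp only: p b)
qed

lemma cgap_pmeas:
 assumes f: "addf f" "n >= 3" and a: "!!n. n >= 3 ==> al n : borel_measurable (B n)"
 shows "pmeas n (%x y. al n x * cis (xi * f n x y) * cnj (c n * al (Suc n) y))"
proof -
 have [measurable]: "al n : borel_measurable (B n)" "al (Suc n) : borel_measurable (B (Suc n))" using a f by auto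
 have [measurable]: "cnj : borel_measurable borel" by (intro borel_measurable_continuous_onI continuous_intros)
 have [measurable]: "(%z. cis (xi * f n (fst z) (snd z))) : borel_measurable (B n \<Otimes>\<^sub>M B (Suc n))" using f by (intro pmeas_comp[OF pmeas_cis[OF addfD]]) auto
 show ?thesis unfolding pmeas_def split_beta' by measurable
qed

text \<open>Taking arguments of the unimodular numbers in \<open>cgap\<close> gives
  \<open>h\<close>, and \<open>carg_sq\<close> bounds its second moments by the summable
  expectations of \<open>cgap\<close>. The last property says that f minus \<open>h\<close>, a
  gradient and constants is a multiple of 2 pi / xi for all arguments, not merely almost
  surely.\<close>

lemma reduction:
 assumes P: "chain_law P" and f: "addf f" and b: "!!N. DD f xi N <= d" and xi: "xi ~= 0"
 obtains a h C where "!!n. n >= 3 ==> a n : borel_measurable (B n)" "!!n x. abs (a n x) <= pi / abs xi"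
  "!!n. n >= 3 ==> pmeas n (h n)" "!!n x y. abs (h n x y) <= pi / abs xi"
  "summable (%n. if n : {7..} then Ex P n (%x y. (h n x y)^2) else 0)"
  "!!n x y. n >= 3 ==> cis (xi * (f n x y - h n x y - a (Suc n) y + a n x - C n)) = 1"
proof -
 obtain al c where L: "!!n. n >= 3 ==> al n : borel_measurable (B n)" "!!n x. cmod (al n x) = 1" "!!n. cmod (c n) = 1"
  "summable (%n. if n : {5..} then Ex P (Suc (Suc n)) (cgap f xi al c (Suc (Suc n))) else 0)"
 proof (rule ladder[OF P f summable_dd(1)[OF f b] _ summable_dd(2)[OF f b]])
  fix al c assume "!!n. n >= 3 ==> al n : borel_measurable (B n)" "!!n x. cmod (al n x) = 1" "!!n. cmod (c n) = 1"
   "summable (%n. if n : {5..} then Ex P (Suc (Suc n)) (cgap f xi al c (Suc (Suc n))) else 0)"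
  then show thesis by (rule that)
 qed auto
 define wt where "wt n x y = al n x * cis (xi * f n x y) * cnj (c n * al (Suc n) y)" for n x y
 have w1: "cmod (wt n x y) = 1" for n x y unfolding wt_def using L by (simp add: norm_mult)
 have wm: "pmeas n (wt n)" if "n >= 3" for n unfolding wt_def by (rule cgap_pmeas[OF f that L(1)])
 define h where "h n x y = carg (wt n x y) / xi" for n x y
 define a where "a n x = carg (al n x) / xi" for n x
 define C where "C n = carg (c n) / xi" for n
 have hm: "pmeas n (h n)" if "n >= 3" for n using wm[OF that] unfolding pmeas_def h_def split_beta' by measurable
 have am: "a n : borel_measurable (B n)" if "n >= 3" for n
 proof -
  have [measurable]: "al n : borel_measurable (B n)" using L(1) that by auto
  show ?thesis unfolding a_def by measurable
 qed
 have hb: "abs (h n x y) <= pi / abs xi" for n x y unfolding h_def abs_divide using carg_le[OF w1] by (intro divide_right_mono) auto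
 have ab: "abs (a n x) <= pi / abs xi" for n x unfolding a_def abs_divide using carg_le[OF L(2)] by (intro divide_right_mono) auto
 have cis1: "cis (xi * (f n x y - h n x y - a (Suc n) y + a n x - C n)) = 1" for n x y
 proof -
  have "xi * (f n x y - h n x y - a (Suc n) y + a n x - C n) = xi * f n x y - carg (wt n x y) - carg (al (Suc n) y) + carg (al n x) - carg (c n)" using xi by (simp add: h_def a_def C_def algebra_simps)
  then have "cis (xi * (f n x y - h n x y - a (Suc n) y + a n x - C n)) =
    cis (xi * f n x y) / wt n x y / al (Suc n) y * al n x / c n" using cis_carg[OF w1[of n x y]] cis_carg[OF L(2)] cis_carg[OF L(3)] by (simp only: cis_mult[symmetric] cis_divide[symmetric])
  also have "... = (al n x * cis (xi * f n x y) * inverse (c n * al (Suc n) y)) / wt n x y" by (simp add: field_simps)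
  also have "inverse (c n * al (Suc n) y) = cnj (c n * al (Suc n) y)"
   using L(2)[of "Suc n" y] L(3)[of n] by (intro inverse_unique) (simp add: complex_mult_cnj cmod_power2[symmetric] norm_mult mult_ac complex_norm_square[symmetric])
  also have "(al n x * cis (xi * f n x y) * cnj (c n * al (Suc n) y)) / wt n x y = 1" using w1[of n x y] unfolding wt_def by (metis divide_self norm_zero zero_neq_one)
  finally show ?thesis .
 qed
 have Eh: "Ex P n (%x y. (h n x y)^2) <= 48 / xi^2 * Ex P n (cgap f xi al c n)" if n: "n >= 3" for n
 proof -
  have cg: "cgap f xi al c n x y = 1 - Re (wt n x y)" for x y by (simp add: cgap_def wt_def)
  have h2: "(h n x y)^2 <= 48 / xi^2 * cgap f xi al c n x y" for x y unfolding cg h_def power_divide using carg_sq[OF w1[of n x y]] xi by (simp add: field_simps)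
  have wp: "(%w. wt n (w n) (w (Suc n))) : borel_measurable paths" using n by (intro pmeas_path wm) auto
  have "integrable P (%w. wt n (w n) (w (Suc n)))" using w1 by (intro law_integrable[OF P wp, where C=1]) auto
  then have "integrable P (%w. cgap f xi al c n (w n) (w (Suc n)))" unfolding cg using integrable_Re law_integrable[OF P, of "%_. 1::real" 1] by (intro Bochner_Integration.integrable_diff) auto
  then have "Ex P n (%x y. (h n x y)^2) <= (LINT w|P. 48 / xi^2 * cgap f xi al c n (w n) (w (Suc n)))" unfolding Ex_def by (intro integral_mono' h2 order_trans[OF zero_le_power2 h2] integrable_mult_right)
  then show ?thesis by (simp add: Ex_def)
 qed
 \<comment> \<open>\<open>ladder\<close> controls time n + 2 by the gap at n; the gaps start at 5,
   so the second moments of \<open>h\<close> are controlled from 7 on.\<close>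
 have "summable (%n. 48 / xi^2 * (if n : {5..} then Ex P (Suc (Suc n)) (cgap f xi al c (Suc (Suc n))) else 0))" by (rule summable_mult[OF L(4)])
 then have "summable (%n. if n + 2 : {7..} then Ex P (n + 2) (%x y. (h (n + 2) x y)^2) else 0)" by (rule summable_comparison_test'[of _ 0]) (use Eh in \<open>auto simp: Ex_def\<close>)
 then have "summable (%n. if n : {7..} then Ex P n (%x y. (h n x y)^2) else 0)" by (subst (asm) summable_iff_shift)
 then show ?thesis using am ab hm hb cis1 by (intro that[of a h C])
qed

end

section \<open>Quadratic lower bound for the gaps near frequency zero\<close>

lemma sum_sq_le: "(x + y)^2 <= 2 * x^2 + 2 * (y::real)^2" using sum_squares_bound[of x y] by (simp add: power2_sum)

lemma (in prob_space) variance_le: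
 fixes X :: "'a => real"
 assumes "integrable M X" "integrable M (%x. (X x)^2)"
 shows "variance X <= (LINT x|M. (X x - k)^2)"
proof -
 have "(LINT x|M. (X x - k)^2) = (LINT x|M. (X x)^2 - 2 * k * X x + k^2)" by (simp add: power2_diff algebra_simps)
 also have "... = (LINT x|M. (X x)^2) - 2 * k * expectation X + k^2" using assms by (simp add: prob_space)
 also have "... = variance X + (expectation X - k)^2" unfolding variance_eq[OF assms] by (simp add: power2_eq_square algebra_simps)
 finally show ?thesis by simp
qed

context elliptic_chain
begin

definition Vr :: "(nat => 'a) measure => (nat => 'a => 'a => real) => nat => nat => real" where
 "Vr P f m N = (LINT w|P. (Sm f m N w - (LINT w|P. Sm f m N w))^2)"

text \<open>For |s| \<le> 1/(2K) all phases stay close to 0, so taking arguments loses no multiple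
  of 2 pi / s and f itself is \<open>h\<close> plus a gradient plus constants. The potential is
  bounded by 2K independently of s, and the second moments of \<open>h\<close> are controlled by
  \<open>DD\<close> for each fixed N.\<close>

lemma small_decomp:
 assumes P: "chain_law P" and f: "addf f" and K: "!!n x y. abs (f n x y) <= K" "K > 0" and s: "s ~= 0" "abs s <= 1 / (2 * K)"
 obtains a h C D where "!!n. n >= 3 ==> a n : borel_measurable (B n)" "!!n x. n >= 3 ==> x : space (B n) ==> abs (a n x) <= 2 * K"
  "!!n. n >= 3 ==> pmeas n (h n)" "!!n x y. abs (h n x y) <= D"
  "!!n x y. f n x y = h n x y + a (Suc n) y - a n x + C n"
  "(\<Sum>n=7..N. Ex P n (%x y. (h n x y)^2)) <= 12 / s^2 * (2 / eps^4 * DD f s N + 1 / eps)"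
proof -
 let ?I = "{5..<N-1}"
 have sK: "abs (s * f n x y) <= abs s * K" for n x y unfolding abs_mult using K by (intro mult_left_mono) auto
 have sK2: "abs s * K <= 1/2" using mult_right_mono[OF s(2), of K] K(2) by simp
 have pi4: "4 * (abs s * K) <= pi" using sK2 pi_ge_two by linarith
 have sKp: "0 <= abs s * K" "2 * (abs s * K) <= pi" "abs s * K <= pi" using sK2 pi_ge_two K(2) by (simp, linarith, linarith)
 have su: "(\<Sum>n. if n : ?I then g n else 0) = (\<Sum>n\<in>?I. g n)" "summable (%n. if n : ?I then g n else 0)" for g :: "nat => real" using sums_If_finite_set[of ?I g] sums_unique sums_summable by fastforce+
 obtain al c where L: "!!n. n >= 3 ==> al n : borel_measurable (B n)" "!!n x. cmod (al n x) = 1" "!!n. cmod (c n) = 1"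
  "(\<Sum>n\<in>?I. Ex P (Suc (Suc n)) (cgap f s al c (Suc (Suc n)))) <= 2 / eps^4 * DD f s N + 1 / eps"
  "!!n x. n >= 3 ==> x : space (B n) ==> cos (2 * (abs s * K)) <= Re (al n x)" "!!n. cos (abs s * K) <= Re (c n)"
 proof (rule ladder[where xi=s and I="?I" and d="DD f s N", OF P f su(2)])
  show "(\<Sum>n. if n : ?I then dd f s n else 0) <= DD f s N" unfolding su DD_def ..
  fix al c assume a: "!!n. n >= 3 ==> al n : borel_measurable (B n)" "!!n x. cmod (al n x) = 1" "!!n. cmod (c n) = 1"
   "(\<Sum>n. if n : ?I then Ex P (Suc (Suc n)) (cgap f s al c (Suc (Suc n))) else 0) <= 2 / eps^4 * DD f s N + 1 / eps"
   "!!K n x. (!!n x y. abs (s * f n x y) <= K) ==> 4 * K <= pi ==> n >= 3 ==> x : space (B n) ==> cos (2 * K) <= Re (al n x)"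
   "!!K n. (!!n x y. abs (s * f n x y) <= K) ==> 4 * K <= pi ==> cos K <= Re (c n)"
  show thesis by (rule that[OF a(1-3) _ a(5)[OF sK pi4] a(6)[OF sK pi4]]) (use a(4) su(1) in auto)
 qed auto
 define a where "a n x = carg (al n x) / s" for n x
 define C where "C n = carg (c n) / s" for n
 define h where "h n x y = f n x y + a n x - a (Suc n) y - C n" for n x y
 have am: "a n : borel_measurable (B n)" if "n >= 3" for n
 proof -
  have [measurable]: "al n : borel_measurable (B n)" using L(1) that by auto
  show ?thesis unfolding a_def by measurable
 qed
 have hm: "pmeas n (h n)" if n: "n >= 3" for n
 proof -
  have [measurable]: "a n : borel_measurable (B n)" "a (Suc n) : borel_measurable (B (Suc n))" using am n by auto
  have [measurable]: "(%z. f n (fst z) (snd z)) : borel_measurable (B n \<Otimes>\<^sub>M B (Suc n))" using n by (intro pmeas_comp[OF addfD[OF f]]) auto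
  show ?thesis unfolding h_def pmeas_def split_beta' by measurable
 qed
 have ab: "abs (a n x) <= pi / abs s" "abs (C n) <= pi / abs s" for n x unfolding a_def C_def abs_divide using carg_le L(2,3) by (auto intro!: divide_right_mono)
 have hb: "abs (h n x y) <= K + 3 * (pi / abs s)" for n x y using K(1)[of n x y] ab(1)[of n x] ab(1)[of "Suc n" y] ab(2)[of n] unfolding h_def by linarith
 have A: "abs (carg (al n x)) <= 2 * (abs s * K)" if "n >= 3" "x : space (B n)" for n x by (rule carg_small[OF L(2) _ _ L(5)[OF that]]) (use sKp in auto)
 have Cc: "abs (carg (c n)) <= abs s * K" for n by (rule carg_small[OF L(3) _ _ L(6)]) (use sKp in auto)
 have aK: "abs (a n x) <= 2 * K" if "n >= 3" "x : space (B n)" for n x using A[OF that] s unfolding a_def by (simp add: field_simps)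
 have h2: "(h n x y)^2 <= 12 / s^2 * cgap f s al c n x y" if n: "n >= 3" and x: "x : space (B n)" and y: "y : space (B (Suc n))" for n x y
 proof -
  have sh: "s * h n x y = carg (al n x) + s * f n x y - carg (c n) - carg (al (Suc n) y)" using s by (simp add: h_def a_def C_def algebra_simps)
  have ce: "cis (s * h n x y) = al n x * cis (s * f n x y) * cnj (c n * al (Suc n) y)"
  proof -
   have "cis (s * h n x y) = cis (carg (al n x)) * cis (s * f n x y) * (cnj (cis (carg (c n))) * cnj (cis (carg (al (Suc n) y))))" unfolding sh by (simp add: cis_cnj cis_mult algebra_simps)
   then show ?thesis using cis_carg[OF L(2)] cis_carg[OF L(3)] by simp
  qed
  \<comment> \<open>The two potentials have arguments at most 2|s|K \<le> 1, while s f and the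
    argument of \<open>c n\<close> are at most 1/2.\<close>
  have "abs (s * h n x y) <= 3" unfolding sh using A[OF n x] A[OF _ y] n Cc[of n] sK[of n x y] sK2 by linarith
  then have "(s * h n x y)^2 <= 3^2" by (rule abs_le_square_iff_D)
  then have "(s * h n x y)^2 / 12 <= 1 - cos (s * h n x y)" by (intro cos_bound) simp
  also have "1 - cos (s * h n x y) = cgap f s al c n x y" unfolding cgap_def ce[symmetric] by simp
  finally show ?thesis using s by (simp add: power_mult_distrib field_simps)
 qed
 have Eh: "Ex P n (%x y. (h n x y)^2) <= 12 / s^2 * Ex P n (cgap f s al c n)" if n: "n >= 3" for n
 proof -
  let ?wt = "%x y. al n x * cis (s * f n x y) * cnj (c n * al (Suc n) y)"
  have cg: "cgap f s al c n x y = 1 - Re (?wt x y)" for x y by (simp add: cgap_def)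
  have wp: "(%w. ?wt (w n) (w (Suc n))) : borel_measurable paths" using n by (intro pmeas_path cgap_pmeas f L(1)) auto
  have iw: "integrable P (%w. ?wt (w n) (w (Suc n)))" using L(2,3) by (intro law_integrable[OF P wp, where C=1]) (auto simp: norm_mult)
  have ci: "integrable P (%w. cgap f s al c n (w n) (w (Suc n)))" unfolding cg by (rule Bochner_Integration.integrable_diff[OF law_integrable[OF P, where C=1] integrable_Re[OF iw]]) auto
  have "Ex P n (%x y. (h n x y)^2) <= (LINT w|P. 12 / s^2 * cgap f s al c n (w n) (w (Suc n)))" unfolding Ex_def
  proof (rule integral_mono')
   fix w assume "w : space P"
   then have "w n : space (B n)" "w (Suc n) : space (B (Suc n))" using n coord_space chain_lawD(3)[OF P] by auto
   from h2[OF n this] show "(st h n w)^2 <= 12 / s^2 * cgap f s al c n (w n) (w (Suc n))" .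
   then show "0 <= 12 / s^2 * cgap f s al c n (w n) (w (Suc n))" by (rule order_trans[OF zero_le_power2])
  qed (intro integrable_mult_right ci)
  then show ?thesis by (simp add: Ex_def)
 qed
 have "(\<Sum>n=7..N. Ex P n (%x y. (h n x y)^2)) = (\<Sum>n\<in>?I. Ex P (Suc (Suc n)) (%x y. (h (Suc (Suc n)) x y)^2))"
 proof (rule sum.reindex_bij_witness[of _ "%n. n + 2" "%n. n - 2"])
  fix n assume "n : {7..N}"
  then have "Suc (Suc (n - 2)) = n" by auto
  then show "Ex P (Suc (Suc (n - 2))) (%x y. (h (Suc (Suc (n - 2))) x y)^2) = Ex P n (%x y. (h n x y)^2)" by simp
 qed auto
 also have "... <= (\<Sum>n\<in>?I. 12 / s^2 * Ex P (Suc (Suc n)) (cgap f s al c (Suc (Suc n))))" by (intro sum_mono Eh) auto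
 also have "... <= 12 / s^2 * (2 / eps^4 * DD f s N + 1 / eps)" unfolding sum_distrib_left[symmetric] using L(4) by (intro mult_left_mono) auto
 finally show ?thesis using am aK hm hb by (intro that[of a h "K + 3 * (pi / abs s)" C]) (auto simp: h_def)
qed

lemma Sm_bounded: "(!!n x y. abs (f n x y) <= K) ==> abs (Sm f m N w) <= real (Suc N - m) * K" by (rule order_trans[OF sum_abs], rule order_trans[OF sum_bounded_above[where K=K]]) auto

lemma Sm_integrable:
 assumes P: "chain_law P" and f: "addf f" and K: "!!n x y. abs (f n x y) <= K" and m: "m >= 1"
 shows "integrable P (Sm f m N)" "integrable P (%w. (Sm f m N w)^2)"
proof -
 have [measurable]: "Sm f m N : borel_measurable paths" by (rule Sm_measurable[OF f m])
 show "integrable P (Sm f m N)" by (rule law_integrable[OF P, where C="real (Suc N - m) * K"]) (use Sm_bounded[OF K] in auto)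
 show "integrable P (%w. (Sm f m N w)^2)" by (rule law_integrable[OF P, where C="(real (Suc N - m) * K)^2"]) (use abs_le_square_iff_D[OF Sm_bounded[OF K]] in auto)
qed

text \<open>The gradient telescopes to a bounded term, so the variance is at most a multiple of the
  second moments of \<open>h\<close> plus a constant of order K^2. Multiplied by s^2 the first part
  is at most a multiple of \<open>DD\<close> plus a constant, and the second is bounded because |s|
  K is.\<close>

lemma DD_lower:
 assumes P: "chain_law P" and f: "addf f" and K: "!!n x y. abs (f n x y) <= K" "K > 0"
 obtains c C where "c > 0" "!!N s. abs s <= 1 / (2 * K) ==> c * s^2 * Vr P f 7 N - C <= DD f s N"
proof -
 interpret P: prob_space P using chain_lawD[OF P] by simp
 define L where "L = 48 * cvar / eps^4 + 1"
 have L: "L > 0" using cvar_nonneg eps_pos unfolding L_def by (intro add_nonneg_pos divide_nonneg_nonneg) auto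
 define C where "C = 24 * cvar / eps + 8"
 have C0: "C >= 0" using cvar_nonneg eps_pos by (simp add: C_def)
 have "1 / L * s^2 * Vr P f 7 N - C / L <= DD f s N" if s: "abs s <= 1 / (2 * K)" for N s
 proof (cases "s = 0 \<or> N < 7")
  case True
  then have "1 / L * s^2 * Vr P f 7 N - C / L <= 0" using C0 L by (auto simp: Vr_def)
  also have "... <= DD f s N" by (rule DD_nonneg[OF f])
  finally show ?thesis .
 next
  case False
  then have s0: "s ~= 0" and N: "7 <= N" by auto
  obtain a h k D where H: "!!n. n >= 3 ==> a n : borel_measurable (B n)" "!!n x. n >= 3 ==> x : space (B n) ==> abs (a n x) <= 2 * K"
   "!!n. n >= 3 ==> pmeas n (h n)" "!!n x y. abs (h n x y) <= D"
   "!!n x y. f n x y = h n x y + a (Suc n) y - a n x + k n"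
   "(\<Sum>n=7..N. Ex P n (%x y. (h n x y)^2)) <= 12 / s^2 * (2 / eps^4 * DD f s N + 1 / eps)"
  proof (rule small_decomp[OF P f K s0 s, of N])
   fix a h k D assume "!!n. n >= 3 ==> a n : borel_measurable (B n)" "!!n x. n >= 3 ==> x : space (B n) ==> abs (a n x) <= 2 * K"
   "!!n. n >= 3 ==> pmeas n (h n)" "!!n x y. abs (h n x y) <= D"
   "!!n x y. f n x y = h n x y + a (Suc n) y - a n x + k n"
   "(\<Sum>n=7..N. Ex P n (%x y. (h n x y)^2)) <= 12 / s^2 * (2 / eps^4 * DD f s N + 1 / eps)"
   then show thesis by (rule that)
  qed
  define A where "A w = (\<Sum>n=7..N. st h n w - Ex P n (h n))" for w
  define b where "b w = a (Suc N) (w (Suc N)) - a 7 (w 7)" for w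
  define kp where "kp = (\<Sum>n=7..N. Ex P n (h n) + k n)"
  have tel: "(\<Sum>n=7..N. a (Suc n) (w (Suc n)) - a n (w n)) = b w" for w unfolding b_def using N by (intro sum_Suc_diff) simp
  have S: "Sm f 7 N w - kp = A w + b w" for w unfolding A_def kp_def tel[symmetric] sum.distrib[symmetric] sum_subtractf[symmetric] by (intro sum.cong refl) (simp add: H(5))
  have Am: "A : borel_measurable paths" unfolding A_def by (intro borel_measurable_sum borel_measurable_diff borel_measurable_const pmeas_path[OF H(3)]) auto
  have bm: "b : borel_measurable paths" unfolding b_def using N by (intro borel_measurable_diff measurable_compose[OF coord H(1)]) auto
  have Ab: "abs (A w) <= (\<Sum>n=7..N. D + abs (Ex P n (h n)))" for w unfolding A_def by (intro order_trans[OF sum_abs] sum_mono order_trans[OF abs_triangle_ineq4] add_mono H(4) order_refl)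
  have iA: "integrable P (%w. (A w)^2)" using Am by (intro law_integrable[OF P, where C="(\<Sum>n=7..N. D + abs (Ex P n (h n)))^2"]) (use abs_le_square_iff_D[OF Ab] in auto)
  have bb: "abs (b w) <= 4 * K" if "w : space paths" for w using H(2)[of "Suc N" "w (Suc N)"] H(2)[of 7 "w 7"] coord_space[OF _ that] N unfolding b_def by fastforce
  have ib: "integrable P (%w. (b w)^2)" using bm by (intro law_integrable[OF P, where C="(4 * K)^2"]) (use abs_le_square_iff_D[OF bb] in auto)
  have "Vr P f 7 N <= (LINT w|P. (Sm f 7 N w - kp)^2)" unfolding Vr_def by (rule P.variance_le) (use Sm_integrable[OF P f K(1), of 7 N] in auto)
  also have "... <= (LINT w|P. 2 * (A w)^2 + 2 * (b w)^2)" unfolding S using iA ib by (intro integral_mono' sum_sq_le) auto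
  also have "... = 2 * (LINT w|P. (A w)^2) + 2 * (LINT w|P. (b w)^2)" using iA ib by simp
  also have "(LINT w|P. (A w)^2) <= cvar * (\<Sum>n=7..N. Ex P n (%x y. (h n x y)^2))" unfolding A_def by (rule var_bound[OF P P _ H(3) H(4)]) auto
  also have "... <= cvar * (12 / s^2 * (2 / eps^4 * DD f s N + 1 / eps))" by (rule mult_left_mono[OF H(6) cvar_nonneg])
  also have "(LINT w|P. (b w)^2) <= (4 * K)^2" using ib abs_le_square_iff_D[OF bb] chain_lawD(3)[OF P] by (intro P.integral_le_const AE_I2) auto
  finally have V: "Vr P f 7 N <= 2 * (cvar * (12 / s^2 * (2 / eps^4 * DD f s N + 1 / eps))) + 2 * (4 * K)^2" by simp
  have "abs (s * (4 * K)) <= 2" using mult_right_mono[OF s, of "4 * K"] K(2) by (simp add: abs_mult)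
  then have sK: "(s * (4 * K))^2 <= 2^2" by (rule abs_le_square_iff_D)
  have "s^2 * Vr P f 7 N <= s^2 * (2 * (cvar * (12 / s^2 * (2 / eps^4 * DD f s N + 1 / eps))) + 2 * (4 * K)^2)" by (rule mult_left_mono[OF V]) simp
  also have "... = 48 * cvar / eps^4 * DD f s N + 24 * cvar / eps + 2 * (s * (4 * K))^2" using s0 by (simp add: power_mult_distrib distrib_left)
  also have "... <= L * DD f s N + C" using sK DD_nonneg[OF f, of s N] by (simp add: L_def C_def distrib_right)
  finally show ?thesis using L by (simp add: field_simps)
 qed
 then show ?thesis using L by (intro that[of "1 / L" "C / L"]) auto
qed

text \<open>Chebyshev's inequality converts a variance bounded along infinitely many N into the
  tightness that \<open>tight_DD\<close> asks for. The finitely many summands before time 7 are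
  bounded by 4K.\<close>

lemma variance_tight:
 assumes P: "chain_law P" and f: "addf f" and K: "!!n x y. abs (f n x y) <= K" "K > 0"
  and inf: "!!N0. \<exists>N\<ge>N0. Vr P f 7 N <= b"
 obtains t where "t > 0" "!!s N. abs s <= t ==> DD f s N <= ln 4 / cdec"
proof -
 interpret P: prob_space P using chain_lawD[OF P] by simp
 note [measurable_cong] = chain_lawD(2)[OF P]
 have b0: "0 <= b"
 proof -
  obtain N where "Vr P f 7 N <= b" using inf[of 0] by blast
  moreover have "0 <= Vr P f 7 N" by (simp add: Vr_def)
  ultimately show ?thesis by linarith
 qed
 \<comment> \<open>Chosen for b / r^2 \<le> 1/4; the summand 1 keeps it positive when b = 0.\<close>
 define r where "r = 2 * sqrt b + 1"
 have r: "r > 0" "b / r^2 <= 1/4"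
 proof -
  show "r > 0" using b0 by (simp add: r_def add_nonneg_pos)
  have "r^2 = 4 * b + 4 * sqrt b + 1" unfolding r_def using b0 by (simp add: power2_sum power_mult_distrib)
  then have "4 * b <= r^2" using b0 by simp
  then show "b / r^2 <= 1/4" using \<open>r > 0\<close> by (simp add: field_simps)
 qed
 define M where "M = 4 * K + r"
 have M: "M > 0" using K r by (simp add: M_def)
 have "DD f s N <= ln 4 / cdec" if "abs s <= 1 / (4 * M)" for s N
 proof (rule tight_DD[OF P f M that])
  fix N0
  obtain N where N: "N >= max N0 7" "Vr P f 7 N <= b" using inf by blast
  let ?E = "(LINT w|P. Sm f 7 N w)"
  have [measurable]: "Sm f 7 N : borel_measurable paths" "Sm f 3 N : borel_measurable paths" by (auto intro!: Sm_measurable[OF f])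
  have "{w : space P. abs (Sm f 3 N w - ?E) > M} \<subseteq> {w : space P. r <= abs (Sm f 7 N w - ?E)}"
  proof safe
   fix w assume "abs (Sm f 3 N w - ?E) > M"
   moreover have "{3..N} = {3..6} \<union> {7..N}" using N by auto
   then have "Sm f 3 N w = Sm f 3 6 w + Sm f 7 N w" by (simp add: sum.union_disjoint)
   moreover have "abs (Sm f 3 6 w) <= 4 * K" using Sm_bounded[OF K(1), where m=3 and N=6] by simp
   ultimately show "r <= abs (Sm f 7 N w - ?E)" unfolding M_def by linarith
  qed
  then have "measure P {w : space P. abs (Sm f 3 N w - ?E) > M} <= measure P {w : space P. r <= abs (Sm f 7 N w - ?E)}" by (intro P.finite_measure_mono) measurable
  also have "... <= Vr P f 7 N / r^2" unfolding Vr_def using Sm_integrable(2)[OF P f K(1), of 7 N] r by (intro P.Chebyshev_inequality) auto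
  also have "... <= b / r^2" using N by (intro divide_right_mono) auto
  also have "... <= 1/4" by (rule r)
  finally show "\<exists>N\<ge>N0. \<exists>m. measure P {w : space P. abs (Sm f 3 N w - m) > M} <= 1/4" using N by auto
 qed
 then show thesis using M by (intro that[of "1 / (4 * M)"]) auto
qed

end

section \<open>Central limit theorem\<close>

lemma cis_taylor: "cmod (cis x - (1 + \<i> * of_real x - of_real (x^2 / 2))) <= abs x^3 / 6"
proof -
 have "(\<Sum>k\<le>2. (\<i> * complex_of_real x) ^ k / fact k) = 1 + \<i> * of_real x - of_real (x^2 / 2)" by (simp add: numeral_2_eq_2 power2_eq_square field_simps)
 then show ?thesis using iexp_approx1[of x 2] by (simp add: cis_conv_exp fact_numeral numeral_3_eq_3)
qed

lemma exp_minus_taylor: "0 <= x ==> abs (exp (- x) - (1 - x)) <= x^2 / 2" for x :: real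
proof -
 assume x: "0 <= x"
 have 1: "1 - x <= exp (- x)" using exp_ge_add_one_self[of "- x"] by simp
 have "exp (- x) <= 1 - x + x^2 / 2"
 proof -
  define g where "g t = 1 - t + t^2/2 - exp (- t)" for t :: real
  have "g 0 <= g x"
  proof (rule DERIV_nonneg_imp_nondecreasing[OF x])
   fix t :: real assume t: "0 <= t"
   have "DERIV g t :> - 1 + t + exp (- t)" unfolding g_def by (auto intro!: derivative_eq_intros)
   moreover have "0 <= - 1 + t + exp (- t)" using exp_ge_add_one_self[of "- t"] by simp
   ultimately show "\<exists>y. DERIV g t :> y & 0 <= y" by blast
  qed
  then show ?thesis by (simp add: g_def)
 qed
 with 1 show ?thesis by simp
qed

lemma cis_diff_le: "cmod (cis x - cis y) <= abs (x - y)"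
proof -
 have "cis x - cis y = cis y * (cis (x - y) - 1)" by (simp add: right_diff_distrib cis_mult)
 then show ?thesis using cis_dist[of "x - y"] by (simp add: norm_mult)
qed

section \<open>Martingale approximation of the sums\<close>

context elliptic_chain
begin

text \<open>Expectation of the next k summands given the present state; it is the correction that
  turns the sums into martingales.\<close>

fun av :: "(nat => 'a => 'a => real) => nat => nat => 'a => real" where
 "av f n 0 x = 0"
| "av f n (Suc k) x = trans n (%y. f n x y + av f (Suc n) k y) x"

lemma av_measurable: "addf f ==> n >= 1 ==> av f n k : borel_measurable (B n)"
proof (induction k arbitrary: n)
 case (Suc k)
 have [measurable]: "av f (Suc n) k : borel_measurable (B (Suc n))" using Suc by simp
 note [measurable (raw)] = pmeas_comp[OF addfD[OF Suc.prems]]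
 show ?case unfolding av.simps by measurable
next
 case 0
 have "av f n 0 = (%_. 0)" by (rule ext) simp
 then show ?case by simp
qed

context
 fixes f :: "nat => 'a => 'a => real" and K :: real
 assumes f: "addf f" and K: "!!n x y. abs (f n x y) <= K"
begin

lemma K_nonneg: "0 <= K" using order_trans[OF abs_ge_zero K] .

lemma av_bound: "n >= 1 ==> x : space (B n) ==> abs (av f n k x) <= real k * K"
proof (induction k arbitrary: n x)
 case (Suc k)
 have [measurable]: "av f (Suc n) k : borel_measurable (B (Suc n))" "f n x : borel_measurable (B (Suc n))" using av_measurable[OF f] pmeas_right[OF addfD[OF f]] Suc.prems by auto
 have "norm (trans n (%y. f n x y + av f (Suc n) k y) x) <= real (Suc k) * K"
 proof (rule norm_trans_le)
  fix y assume "y : space (B (Suc n))"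
  then have "abs (av f (Suc n) k y) <= real k * K" using Suc by simp
  then show "norm (f n x y + av f (Suc n) k y) <= real (Suc k) * K" using K[of n x y] by (simp add: distrib_right)
 qed (use Suc.prems in auto)
 then show ?case by simp
qed simp

lemma trans_add:
 fixes u v :: "'a => real"
 assumes "u : borel_measurable (B (Suc n))" "v : borel_measurable (B (Suc n))" "x : space (B n)"
  "!!y. y : space (B (Suc n)) ==> abs (u y) <= C" "!!y. y : space (B (Suc n)) ==> abs (v y) <= C'"
 shows "trans n (%y. u y + v y) x = trans n u x + trans n v x" using integrable_pu[OF assms(1) _ assms(3), of C] integrable_pu[OF assms(2) _ assms(3), of C'] assms(4,5) by (simp add: trans_def distrib_left)

text \<open>The bound does not grow with k: it is the fixed point of c = 4K + (1 - eps) c. Two new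
  summands have a mean in [-2K, 2K], so they contribute at most 4K to the oscillation, and the rest
  is contracted over two steps.\<close>

lemma av_osc: "n >= 1 ==> osc_le n (av f n k) (4 * K / eps)"
proof (induction k arbitrary: n rule: induct_nat_012)
 case 0
 then show ?case using K_nonneg eps_pos by (simp add: osc_le_def)
next
 case (1 n)
 have "osc_le n (av f n 1) (2 * K)" unfolding osc_le_def
 proof (intro ballI)
  fix x y assume "x : space (B n)" "y : space (B n)"
  then show "av f n 1 x - av f n 1 y <= 2 * K" using av_bound[OF 1, of x 1] av_bound[OF 1, of y 1] by simp
 qed
 moreover have "2 * K <= 4 * K / eps" using mult_left_mono[of eps 2 K] K_nonneg eps_pos eps_less by (simp add: field_simps)
 ultimately show ?case unfolding osc_le_def by (simp add: One_nat_def) fastforce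
next
 case (ge2 k n)
 define wt where "wt y = trans (Suc n) (f (Suc n) y) y" for y
 define g where "g = av f (Suc (Suc n)) k"
 have gm [measurable]: "g : borel_measurable (B (Suc (Suc n)))" unfolding g_def using av_measurable[OF f] by simp
 have gb: "abs (g z) <= real k * K" if "z : space (B (Suc (Suc n)))" for z unfolding g_def using av_bound that by simp
 have wm [measurable]: "wt : borel_measurable (B (Suc n))" unfolding wt_def by (rule pmeas_trans[OF addfD[OF f]]) simp
 have wb: "abs (wt y) <= K" if "y : space (B (Suc n))" for y using norm_trans_le[OF pmeas_right[OF addfD[OF f] that] _ that, of K] K by (simp add: wt_def)
 have tgm [measurable]: "trans (Suc n) g : borel_measurable (B (Suc n))" using cexp_measurable[of g "Suc n" 1] gm by simp
 have tgb: "abs (trans (Suc n) g y) <= real k * K" if "y : space (B (Suc n))" for y using norm_trans_le[OF gm _ that, of "real k * K"] gb by simp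
 have eq: "av f n (Suc (Suc k)) x = trans n (%y. f n x y + wt y) x + trans n (trans (Suc n) g) x" if x: "x : space (B n)" for x
 proof -
  have [measurable]: "f n x : borel_measurable (B (Suc n))" using pmeas_right[OF addfD[OF f ge2(3)] x] .
  have "av f n (Suc (Suc k)) x = trans n (%y. (f n x y + wt y) + trans (Suc n) g y) x" unfolding av.simps(2)[of f n] trans_def[of n]
  proof (rule Bochner_Integration.integral_cong[OF refl])
   fix y assume "y : space (mu (Suc n))"
   then have y: "y : space (B (Suc n))" by simp
   have "av f (Suc n) (Suc k) y = wt y + trans (Suc n) g y" using trans_add[OF pmeas_right[OF addfD[OF f] y] gm y K gb] by (simp add: wt_def g_def)
   then show "p n x y *\<^sub>R (f n x y + av f (Suc n) (Suc k) y) = p n x y *\<^sub>R (f n x y + wt y + trans (Suc n) g y)" by simp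
  qed
  also have "... = trans n (%y. f n x y + wt y) x + trans n (trans (Suc n) g) x"
  proof (intro trans_add[where C="K + K" and C'="real k * K"] x tgb)
   fix y assume "y : space (B (Suc n))"
   then show "abs (f n x y + wt y) <= K + K" using wb[of y] K[of n x y] by linarith
  qed auto
  finally show ?thesis .
 qed
 have o: "osc_le n (trans n (trans (Suc n) g)) ((1 - eps) * (4 * K / eps))" unfolding g_def by (rule osc_le_two_step[OF ge2(3) gm[unfolded g_def] ge2(1)]) simp
 have b: "abs (trans n (%y. f n x y + wt y) x) <= 2 * K" if x: "x : space (B n)" for x
 proof -
  have [measurable]: "f n x : borel_measurable (B (Suc n))" using pmeas_right[OF addfD[OF f ge2(3)] x] .
  have "norm (trans n (%y. f n x y + wt y) x) <= 2 * K"
  proof (rule norm_trans_le[OF _ _ x])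
   fix y assume "y : space (B (Suc n))"
   then show "norm (f n x y + wt y) <= 2 * K" using wb[of y] K[of n x y] by simp
  qed measurable
  then show ?thesis by simp
 qed
 have e: "2 * K + 2 * K + (1 - eps) * (4 * K / eps) = 4 * K / eps" using eps_pos by (simp add: field_simps)
 show ?case unfolding osc_le_def
 proof (intro ballI)
  fix x y assume xy: "x : space (B n)" "y : space (B n)"
  have "trans n (trans (Suc n) g) x - trans n (trans (Suc n) g) y <= (1 - eps) * (4 * K / eps)" using o xy unfolding osc_le_def by blast
  then show "av f n (Suc (Suc k)) x - av f n (Suc (Suc k)) y <= 4 * K / eps" unfolding eq[OF xy(1)] eq[OF xy(2)] using b[OF xy(1)] b[OF xy(2)] e by linarith
 qed
qed

text \<open>An increment deviates from its conditional mean by at most its oscillation: 2K from f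
  and 4K / eps from \<open>av\<close>.\<close>

definition K1 :: real where "K1 = 2 * K + 4 * K / eps"

lemma K1_nonneg: "0 <= K1" using K_nonneg eps_pos by (simp add: K1_def)

definition md0 :: "nat => nat => 'a => 'a => real" where
 "md0 N n x y = f n x y + av f (Suc n) (N - n) y - av f n (Suc (N - n)) x"

text \<open>The clip is inactive on the state spaces, by \<open>md_eq\<close>; it provides a bound
  for all arguments.\<close>

definition md :: "nat => nat => 'a => 'a => real" where
 "md N n x y = max (- K1) (min K1 (md0 N n x y))"

lemma md_le: "abs (md N n x y) <= K1" using K1_nonneg by (auto simp: md_def)

lemma md_pmeas: assumes n: "n >= 1" shows "pmeas n (md N n)"
proof -
 have [measurable]: "av f n (Suc (N - n)) : borel_measurable (B n)" "av f (Suc n) (N - n) : borel_measurable (B (Suc n))" using av_measurable[OF f] n by (simp_all del: av.simps)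
 note [measurable (raw)] = pmeas_comp[OF addfD[OF f n]]
 show ?thesis unfolding pmeas_def split_beta' md_def md0_def by measurable
qed

lemma md_eq:
 assumes n: "n >= 1" and x: "x : space (B n)" and y: "y : space (B (Suc n))"
 shows "md N n x y = md0 N n x y"
proof -
 let ?a = "av f (Suc n) (N - n)"
 have [measurable]: "?a : borel_measurable (B (Suc n))" "f n x : borel_measurable (B (Suc n))" using av_measurable[OF f] pmeas_right[OF addfD[OF f n] x] by auto
 have ab: "abs (?a z) <= real (N - n) * K" if "z : space (B (Suc n))" for z using av_bound that by simp
 have bd: "abs (f n x z + ?a z) <= K + real (N - n) * K" if "z : space (B (Suc n))" for z using K[of n x z] ab[OF that] by linarith
 have o: "?a z - ?a z' <= 4 * K / eps" if "z : space (B (Suc n))" "z' : space (B (Suc n))" for z z' using av_osc[of "Suc n" "N - n"] that unfolding osc_le_def by auto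
 have "av f n (Suc (N - n)) x <= f n x y + ?a y + K1" unfolding av.simps
 proof (rule trans_le[OF _ bd _ x])
  fix z assume z: "z : space (B (Suc n))"
  show "f n x z + ?a z <= f n x y + ?a y + K1" using o[OF z y] K[of n x z] K[of n x y] unfolding K1_def by linarith
 qed measurable
 moreover have "f n x y + ?a y - K1 <= av f n (Suc (N - n)) x" unfolding av.simps
 proof (rule trans_ge[OF _ bd _ x])
  fix z assume z: "z : space (B (Suc n))"
  show "f n x y + ?a y - K1 <= f n x z + ?a z" using o[OF y z] K[of n x z] K[of n x y] unfolding K1_def by linarith
 qed measurable
 ultimately show ?thesis unfolding md_def md0_def by (simp del: av.simps)
qed

lemma md_centered:
 assumes n: "n >= 1" and x: "x : space (B n)" shows "(LINT y|(mu (Suc n)). p n x y * md N n x y) = 0"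
proof -
 let ?a = "av f (Suc n) (N - n)"
 have am: "(%y. f n x y + ?a y) : borel_measurable (B (Suc n))" using av_measurable[OF f] pmeas_right[OF addfD[OF f n] x] by (intro borel_measurable_add) auto
 have "abs (f n x z + ?a z) <= K + real (N - n) * K" if "z : space (B (Suc n))" for z using K[of n x z] av_bound[of "Suc n" z "N - n"] that by simp
 from integrable_pu[OF am _ x, of "K + real (N - n) * K"] this
 have i: "integrable (mu (Suc n)) (%y. p n x y * (f n x y + ?a y))" by simp
 have "(LINT y|(mu (Suc n)). p n x y * md N n x y) = (LINT y|(mu (Suc n)). p n x y * (f n x y + ?a y) - p n x y * av f n (Suc (N - n)) x)" by (intro Bochner_Integration.integral_cong refl)
    (simp add: md_eq[OF n x] md0_def right_diff_distrib distrib_left algebra_simps del: av.simps)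
 also have "... = 0" using i integrable_p[OF x] p_int[OF x] by (simp add: trans_def)
 finally show ?thesis .
qed

definition ta :: "nat => nat => 'a => real" where
 "ta N n x = trans n (%y. (md N n x y)^2) x"

lemma md2: "pmeas n (md N n) ==> pmeas n (%x y. (md N n x y)^2)" "(md N n x y)^2 <= K1^2" using abs_le_square_iff_D[OF md_le] by (auto simp: pmeas_def split_beta')

lemma ta_measurable: "n >= 1 ==> ta N n : borel_measurable (B n)" unfolding ta_def by (rule pmeas_trans[OF md2(1)[OF md_pmeas]])

lemma ta_bound:
 assumes n: "n >= 1" and x: "x : space (B n)" shows "0 <= ta N n x" "ta N n x <= K1^2" unfolding ta_def using trans_ge[OF pmeas_right[OF md2(1)[OF md_pmeas[OF n]] x] _ _ x, where C="K1^2" and b=0]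
  trans_le[OF pmeas_right[OF md2(1)[OF md_pmeas[OF n]] x] _ _ x, where C="K1^2" and b="K1^2"] md2(2) by auto

text \<open>The linear term vanishes by centring. The cubic error is estimated by \<open>K1\<close>
  times the square, so it is proportional to the conditional variance; errors will add up to a
  multiple of the variance instead of N.\<close>

lemma chi_taylor:
 assumes n: "n >= 1" and x: "x : space (B n)"
 shows "cmod (trans n (%y. cis (t * md N n x y)) x - of_real (1 - (t^2) / 2 * ta N n x)) <= abs t^3 * K1 / 6 * ta N n x"
proof -
 have [measurable]: "md N n x : borel_measurable (B (Suc n))" by (rule pmeas_right[OF md_pmeas[OF n] x])
 have i1: "integrable (mu (Suc n)) (%y. p n x y *\<^sub>R md N n x y)" by (rule integrable_pu[OF _ _ x, where C=K1]) (use md_le in auto)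
 have i2: "integrable (mu (Suc n)) (%y. p n x y *\<^sub>R (md N n x y)^2)" by (rule integrable_pu[OF _ _ x, where C="K1^2"]) (use md2(2) in auto)
 have ic: "integrable (mu (Suc n)) (%y. p n x y *\<^sub>R cis (t * md N n x y))" by (rule integrable_pu[OF _ _ x, where C=1]) auto
 let ?g = "%y. p n x y *\<^sub>R (1 + \<i> * of_real (t * md N n x y) - of_real ((t * md N n x y)^2 / 2))"
 define F where "F y = p n x y - (t^2) / 2 * (p n x y *\<^sub>R (md N n x y)^2)" for y
 define H where "H y = t * (p n x y *\<^sub>R md N n x y)" for y
 have geq: "?g y = of_real (F y) + \<i> * of_real (H y)" for y by (simp add: F_def H_def scaleR_conv_of_real power_mult_distrib algebra_simps)
 have iF: "integrable (mu (Suc n)) F" and iH: "integrable (mu (Suc n)) H" unfolding F_def H_def using i1 i2 integrable_p[OF x] by (intro Bochner_Integration.integrable_diff integrable_mult_right, auto)+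
 have ig: "integrable (mu (Suc n)) ?g" unfolding geq using iF iH by simp
 have "(LINT y|(mu (Suc n)). ?g y) = of_real (LINT y|(mu (Suc n)). F y) + \<i> * of_real (LINT y|(mu (Suc n)). H y)" unfolding geq using iF iH by simp
 also have "(LINT y|(mu (Suc n)). H y) = 0" using md_centered[OF n x, of N] by (simp add: H_def)
 also have "(LINT y|(mu (Suc n)). F y) = 1 - (t^2) / 2 * ta N n x" unfolding F_def using i2 integrable_p[OF x] p_int[OF x] by (simp add: ta_def trans_def)
 finally have "(LINT y|(mu (Suc n)). ?g y) = of_real (1 - (t^2) / 2 * ta N n x)" by simp
 then have eq: "trans n (%y. cis (t * md N n x y)) x - of_real (1 - (t^2) / 2 * ta N n x) = (LINT y|(mu (Suc n)). p n x y *\<^sub>R cis (t * md N n x y) - ?g y)" using ic ig by (simp add: trans_def)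
 have "cmod (LINT y|(mu (Suc n)). p n x y *\<^sub>R cis (t * md N n x y) - ?g y) <= (LINT y|(mu (Suc n)). abs t^3 * K1 / 6 * (p n x y *\<^sub>R (md N n x y)^2))"
 proof (rule order_trans[OF integral_norm_bound integral_mono'])
  fix y
  have "cmod (p n x y *\<^sub>R cis (t * md N n x y) - ?g y) = p n x y * cmod (cis (t * md N n x y) - (1 + \<i> * of_real (t * md N n x y) - of_real ((t * md N n x y)^2 / 2)))"
   by (simp add: scaleR_diff_right[symmetric] del: scaleR_diff_right of_real_mult)
  also have "... <= p n x y * (abs (t * md N n x y)^3 / 6)" by (rule mult_left_mono[OF cis_taylor]) simp
  also have "abs (t * md N n x y)^3 = abs t^3 * (abs (md N n x y) * (md N n x y)^2)" unfolding abs_mult power_mult_distrib by (subst power2_abs[symmetric]) (simp add: power3_eq_cube power2_eq_square)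
  also have "p n x y * (abs t^3 * (abs (md N n x y) * (md N n x y)^2) / 6) <= p n x y * (abs t^3 * (K1 * (md N n x y)^2) / 6)" by (intro mult_left_mono divide_right_mono mult_right_mono md_le) auto
  finally show "cmod (p n x y *\<^sub>R cis (t * md N n x y) - ?g y) <= abs t^3 * K1 / 6 * (p n x y *\<^sub>R (md N n x y)^2)" by (simp add: mult_ac)
  show "0 <= abs t^3 * K1 / 6 * (p n x y *\<^sub>R (md N n x y)^2)" using K1_nonneg by simp
 qed (use i2 in simp)
 also have "... = abs t^3 * K1 / 6 * ta N n x" unfolding ta_def trans_def by (rule integral_mult_right_zero)
 finally show ?thesis unfolding eq .
qed

end

end

section \<open>Characteristic function of the martingale part\<close>

context elliptic_chain
begin

context
 fixes f :: "nat => 'a => 'a => real" and K :: real and P :: "(nat => 'a) measure"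
 assumes f: "addf f" and K: "!!n x y. abs (f n x y) <= K" and P: "chain_law P"
begin

text \<open>The mean conditional variances are taken under \<open>P\<close> even when sums are
  evaluated under another law: the normalisation is that of the original chain.\<close>

definition "tb N n = (LINT w|P. ta f K N n (w n))"
definition "TT N m k = (\<Sum>n\<in>{m..<k}. tb N n)"
definition "MM N m k w = (\<Sum>n\<in>{m..<k}. md f K N n (w n) (w (Suc n)))"

lemma ta_path: "n >= 1 ==> (%w. ta f K N n (w n)) : borel_measurable paths" using measurable_compose[OF coord ta_measurable[OF f K]] .

lemma ta_integrable: "chain_law Q ==> n >= 1 ==> integrable Q (%w. ta f K N n (w n))" by (rule law_integrable[where C="(K1 K)^2"]) (use ta_path ta_bound[OF f K] coord_space in \<open>auto simp: abs_of_nonneg\<close>)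

lemma tb_bounds: assumes n: "n >= 1" shows "0 <= tb N n" "tb N n <= (K1 K)^2"
proof -
 interpret P: prob_space P using chain_lawD[OF P] by simp
 show "0 <= tb N n" "tb N n <= (K1 K)^2" unfolding tb_def using P.integral_between[OF ta_integrable[OF P n], where a=0 and b="(K1 K)^2"] ta_bound[OF f K n] coord_space[OF n] chain_lawD(3)[OF P] by auto
qed

lemma ta_mu: assumes n: "n >= 3" shows "(LINT x|(mu n). ta f K N n x) <= (1/eps) * tb N n"
proof -
 have "eps * (LINT x|(mu n). ta f K N n x) <= tb N n" unfolding tb_def using n by (intro law_le(1)[OF P n ta_measurable[OF f K], where C="(K1 K)^2"]) (auto simp: ta_bound[OF f K])
 then show ?thesis using eps_pos by (simp add: field_simps)
qed

lemma ta_Q: assumes Q: "chain_law Q" and n: "n >= 3" shows "(LINT w|Q. ta f K N n (w n)) <= (1/eps^2) * tb N n"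
proof -
 have "(LINT w|Q. ta f K N n (w n)) <= (1/eps) * (LINT x|(mu n). ta f K N n x)" using n by (intro law_le(2)[OF Q n ta_measurable[OF f K], where C="(K1 K)^2"]) (auto simp: ta_bound[OF f K])
 also have "... <= (1/eps) * ((1/eps) * tb N n)" using ta_mu[OF n] eps_pos by (intro mult_left_mono) auto
 finally show ?thesis by (simp add: power2_eq_square)
qed

lemma adapted_MM: "m >= 1 ==> adapted k (MM N m k)" unfolding MM_def by (intro adapted_sum adapted_coord2 pmeasD md_pmeas[OF f K]) auto

lemma MM_bound: "abs (MM N m k w) <= real (k - m) * K1 K" unfolding MM_def by (rule order_trans[OF sum_abs], rule order_trans[OF sum_bounded_above[where K="K1 K"]]) (auto simp: md_le[OF f K])

lemma MM_Suc: "m <= k ==> MM N m (Suc k) w = MM N m k w + md f K N k (w k) (w (Suc k))" by (simp add: MM_def)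

lemma adapted_cis: "adapted k g ==> adapted k (%w. cis (t * g w))" by (rule adapted_compose[where h="%x. cis (t * x)"]) measurable

definition "c2 = 1 + 1 / eps^2"
text \<open>Error per unit of t^2 times variance: imperfect mixing over a lag L, deleting the last L
  increments, the cubic Taylor term, and 1 - x against exp (- x). As t tends to 0 only the mixing
  term remains.\<close>

definition "E1 t L = rate (L - 2) / eps^2 + abs t * (real L * K1 K * c2 / 2 + K1 K / (6 * eps^2)) + t^2 * (K1 K)^2 / 8"

lemma c2_pos: "0 < c2" using eps_pos unfolding c2_def by (intro add_pos_nonneg) auto

lemma ta_dev:
 assumes Q: "chain_law Q" and n: "n >= 3"
 shows "(LINT w|Q. abs (ta f K N n (w n) - tb N n)) <= c2 * tb N n"
proof -
 interpret Q: prob_space Q using chain_lawD[OF Q] by simp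
 have n1: "n >= 1" using n by simp
 have "(LINT w|Q. abs (ta f K N n (w n) - tb N n)) <= (LINT w|Q. ta f K N n (w n) + tb N n)"
 proof (rule integral_mono')
  fix w assume "w : space Q"
  then have "0 <= ta f K N n (w n)" using ta_bound[OF f K n1] coord_space[OF n1] chain_lawD(3)[OF Q] by auto
  then show "abs (ta f K N n (w n) - tb N n) <= ta f K N n (w n) + tb N n" "0 <= ta f K N n (w n) + tb N n" using tb_bounds[OF n1, of N] by auto
 qed (use ta_integrable[OF Q n1] in auto)
 also have "... = (LINT w|Q. ta f K N n (w n)) + tb N n" using ta_integrable[OF Q n1] by (simp add: Q.prob_space)
 also have "... <= c2 * tb N n" using ta_Q[OF Q n, of N] by (simp add: c2_def distrib_right)
 finally show ?thesis .
qed

text \<open>Conditioning on the past turns the new factor into 1 - t^2 \<open>ta\<close> / 2, and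
  the work lies in replacing \<open>ta\<close> by its mean. If L steps are available, the last L
  increments are deleted from the exponent at cost |t| L K1, after which \<open>ta\<close> mixes
  with what is left. Otherwise only the crude bound of \<open>ta_dev\<close> applies.\<close>

lemma char_step:
 fixes G :: "(nat => 'a) => complex"
 assumes Q: "chain_law Q" and m: "m >= 3" and n: "m <= n" and G: "adapted m G" "!!w. cmod (G w) <= 1" and L: "L >= 2"
 shows "cmod ((LINT w|Q. G w * cis (t * MM N m (Suc n) w)) - of_real (exp (- (t^2 / 2 * tb N n))) * (LINT w|Q. G w * cis (t * MM N m n w)))
   <= t^2 * tb N n * (E1 t L + (if n < m + L then c2 / 2 else 0))"
proof -
 interpret Q: prob_space Q using chain_lawD[OF Q] by simp
 have n1: "n >= 1" and n3: "n >= 3" using m n by auto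
 let ?ta = "%w. ta f K N n (w n)" and ?tb = "tb N n"
 define Gn where "Gn k w = G w * cis (t * MM N m k w)" for k w
 have Gna: "adapted k (Gn k)" if "m <= k" for k unfolding Gn_def using m that by (intro adapted_mult adapted_cis adapted_MM adapted_mono[OF G(1)]) auto
 have Gn1: "cmod (Gn k w) <= 1" for k w unfolding Gn_def using G(2) by (simp add: norm_mult)
 have Gnm: "Gn k : borel_measurable paths" if "m <= k" for k by (rule adapted_measurable[OF Gna[OF that]])
 define ch where "ch x = trans n (%y. cis (t * md f K N n x y)) x" for x
 have chm: "ch : borel_measurable (B n)" unfolding ch_def by (rule pmeas_trans[OF pmeas_cis[OF md_pmeas[OF f K n1]]])
 have ch1: "cmod (ch x) <= 1" if x: "x : space (B n)" for x unfolding ch_def by (rule norm_trans_le[OF pmeas_right[OF pmeas_cis[OF md_pmeas[OF f K n1]] x] _ x]) auto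
 have chp [measurable]: "(%w. ch (w n)) : borel_measurable paths" using measurable_compose[OF coord[OF n1] chm] .
 note [measurable] = ta_path[OF n1] Gnm[OF n]
 have sp: "w n : space (B n)" if "w : space Q" for w using coord_space[OF n1] that chain_lawD(3)[OF Q] by auto
 have sp': "w n : space (B n)" if "w : space paths" for w using coord_space[OF n1] that .
 have "(LINT w|Q. G w * cis (t * MM N m (Suc n) w)) = (LINT w|Q. Gn n w * cis (t * md f K N n (w n) (w (Suc n))))" unfolding Gn_def MM_Suc[OF n] by (simp add: distrib_left cis_mult[symmetric] mult_ac)
 also have "... = (LINT w|Q. Gn n w * ch (w n))" unfolding ch_def by (rule markov[OF Q n1 Gna[OF n] Gn1 pmeasD[OF pmeas_cis[OF md_pmeas[OF f K n1]]], where C'=1]) auto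
 finally have eq1: "(LINT w|Q. G w * cis (t * MM N m (Suc n) w)) = (LINT w|Q. Gn n w * ch (w n))" .
 \<comment> \<open>\<open>r1\<close> is the Taylor error of the conditional characteristic function,
   \<open>r2\<close> the fluctuation of the conditional variance, \<open>r3\<close> the error of 1 -
   x against exp (- x).\<close>
 define r1 where "r1 w = Gn n w * (ch (w n) - of_real (1 - (t^2) / 2 * ?ta w))" for w
 define r2 where "r2 w = Gn n w * of_real (?ta w - ?tb)" for w
 define r3 where "r3 = 1 - (t^2) / 2 * ?tb - exp (- (t^2 / 2 * ?tb))"
 have taK: "0 <= ?ta w" "?ta w <= (K1 K)^2" if "w : space paths" for w using ta_bound[OF f K n1 sp'[OF that]] by auto
 have [measurable]: "r1 : borel_measurable paths" "r2 : borel_measurable paths" unfolding r1_def r2_def by measurable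
 have r1b: "cmod (r1 w) <= abs t^3 * K1 K / 6 * ?ta w" if "w : space paths" for w unfolding r1_def norm_mult ch_def using mult_mono[OF Gn1[of n w] chi_taylor[OF f K n1 sp'[OF that], of t N]] by simp
 have r2b: "cmod (r2 w) <= abs (?ta w - ?tb)" for w unfolding r2_def norm_mult norm_of_real using mult_right_mono[OF Gn1[of n w]] by simp
 have tab: "abs (?ta w - ?tb) <= (K1 K)^2" if "w : space paths" for w using taK[OF that] tb_bounds[OF n1, of N] by auto
 have i1: "integrable Q r1"
 proof (rule law_integrable[OF Q, where C="abs t^3 * K1 K / 6 * (K1 K)^2"])
  fix w assume wt: "w : space paths"
  show "cmod (r1 w) <= abs t^3 * K1 K / 6 * (K1 K)^2" by (rule order_trans[OF r1b[OF wt] mult_left_mono[OF taK(2)[OF wt]]]) (use K1_nonneg[OF f K] in simp)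
 qed measurable
 have i2: "integrable Q r2"
 proof (rule law_integrable[OF Q, where C="(K1 K)^2"])
  show "cmod (r2 w) <= (K1 K)^2" if "w : space paths" for w using r2b[of w] tab[OF that] by linarith
 qed measurable
 have i3: "integrable Q (Gn n)" by (rule law_integrable[OF Q Gnm[OF n] Gn1])
 have dec: "Gn n w * ch (w n) = r1 w - of_real (t^2 / 2) * r2 w + of_real r3 * Gn n w + of_real (exp (- (t^2 / 2 * ?tb))) * Gn n w" for w unfolding r1_def r2_def r3_def by (simp add: algebra_simps)
 have "(LINT w|Q. Gn n w * ch (w n)) - exp (- (t^2 / 2 * ?tb)) * (LINT w|Q. Gn n w) = (LINT w|Q. r1 w) - of_real (t^2 / 2) * (LINT w|Q. r2 w) + of_real r3 * (LINT w|Q. Gn n w)" unfolding dec using i1 i2 i3 by simp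
 also have "cmod ... <= cmod (LINT w|Q. r1 w) + t^2 / 2 * cmod (LINT w|Q. r2 w) + abs r3 * cmod (LINT w|Q. Gn n w)"
  by (intro order_trans[OF norm_triangle_ineq] add_mono order_trans[OF norm_triangle_ineq4]) (auto simp: norm_mult norm_divide norm_power)
 finally have main: "cmod ((LINT w|Q. Gn n w * ch (w n)) - exp (- (t^2 / 2 * ?tb)) * (LINT w|Q. Gn n w)) <=
  cmod (LINT w|Q. r1 w) + t^2 / 2 * cmod (LINT w|Q. r2 w) + abs r3 * cmod (LINT w|Q. Gn n w)" .
 have b1: "cmod (LINT w|Q. r1 w) <= t^2 * ?tb * (abs t * (K1 K / (6 * eps^2)))"
 proof -
  have "cmod (LINT w|Q. r1 w) <= (LINT w|Q. abs t^3 * K1 K / 6 * ?ta w)"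
  proof (rule order_trans[OF integral_norm_bound integral_mono'])
   show "integrable Q (%w. abs t^3 * K1 K / 6 * ?ta w)" using ta_integrable[OF Q n1] by simp
   fix w assume "w : space Q"
   then have wt: "w : space paths" by (simp add: chain_lawD[OF Q])
   show "cmod (r1 w) <= abs t^3 * K1 K / 6 * ?ta w" by (rule r1b[OF wt])
   then show "0 <= abs t^3 * K1 K / 6 * ?ta w" by (rule order_trans[OF norm_ge_zero])
  qed
  also have "... = abs t^3 * K1 K / 6 * (LINT w|Q. ?ta w)" by (rule integral_mult_right_zero)
  also have "... <= abs t^3 * K1 K / 6 * ((1/eps^2) * ?tb)" using ta_Q[OF Q n3, of N] K1_nonneg[OF f K] by (intro mult_left_mono) auto
  also have "... = t^2 * ?tb * (abs t * (K1 K / (6 * eps^2)))" by (simp add: power3_eq_cube power2_eq_square abs_mult_self_eq mult_ac)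
  finally show ?thesis .
 qed
 have b3: "abs r3 * cmod (LINT w|Q. Gn n w) <= t^2 * ?tb * (t^2 * (K1 K)^2 / 8)"
 proof -
  have "cmod (LINT w|Q. Gn n w) <= (LINT w|Q. 1)" using Gn1 by (intro order_trans[OF integral_norm_bound integral_mono']) auto
  then have "cmod (LINT w|Q. Gn n w) <= 1" by (simp add: Q.prob_space)
  moreover have "abs r3 <= (t^2 / 2 * ?tb)^2 / 2" unfolding r3_def using exp_minus_taylor[of "t^2 / 2 * ?tb"] tb_bounds[OF n1, of N] by (simp add: abs_minus_commute)
  moreover have "(t^2 / 2 * ?tb)^2 / 2 = t^2 * ?tb * (t^2 * ?tb / 8)" by (simp add: power2_eq_square)
  moreover have "... <= t^2 * ?tb * (t^2 * (K1 K)^2 / 8)" using tb_bounds[OF n1, of N] by (intro mult_left_mono divide_right_mono) auto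
  ultimately show ?thesis using mult_mono[of "abs r3" "(t^2 / 2 * ?tb)^2 / 2" "cmod (LINT w|Q. Gn n w)" 1] by simp
 qed
 have itd: "integrable Q (%w. abs (?ta w - ?tb))" using ta_integrable[OF Q n1] by simp
 have b2: "cmod (LINT w|Q. r2 w) <= 2 * ?tb * (rate (L - 2) / eps^2 + abs t * (real L * K1 K * c2 / 2) + (if n < m + L then c2 / 2 else 0))"
 proof (cases "n < m + L")
  case True
  have "cmod (LINT w|Q. r2 w) <= (LINT w|Q. abs (?ta w - ?tb))" using itd r2b by (intro order_trans[OF integral_norm_bound integral_mono']) auto
  also have "... <= c2 * ?tb" by (rule ta_dev[OF Q n3])
  also have "... <= 2 * ?tb * (rate (L - 2) / eps^2 + abs t * (real L * K1 K * c2 / 2) + c2 / 2)"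
  proof -
   have "0 <= 2 * ?tb * (rate (L - 2) / eps^2 + abs t * (real L * K1 K * c2 / 2))" using tb_bounds[OF n1, of N] rate_nonneg K1_nonneg[OF f K] c2_pos by simp
   then show ?thesis by (simp add: distrib_left mult_ac)
  qed
  finally show ?thesis using True by simp
 next
  case False
  define k where "k = n - L"
  have k: "m <= k" "n = k + (L - 2) + 2" "n - k = L" "k <= n" "k >= 1" using False L m by (auto simp: k_def)
  define r2' where "r2' w = Gn k w * of_real (?ta w - ?tb)" for w
  note [measurable] = Gnm[OF k(1)]
  have i2': "integrable Q r2'" unfolding r2'_def by (rule law_integrable[OF Q, where C="1 * (K1 K)^2"])
    (measurable, unfold norm_mult norm_of_real, intro mult_mono Gn1 tab, auto)
  have dMM: "abs (MM N m n w - MM N m k w) <= real L * K1 K" for w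
  proof -
   have "MM N m n w - MM N m k w = MM N k n w" unfolding MM_def by (subst sum.atLeastLessThan_concat[OF k(1,4), symmetric]) simp
   then show ?thesis using MM_bound[of N k n w] k(3) by simp
  qed
  have "cmod (LINT w|Q. r2 w - r2' w) <= (LINT w|Q. abs t * (real L * K1 K) * abs (?ta w - ?tb))"
  proof (rule order_trans[OF integral_norm_bound integral_mono'])
   fix w
   have "cmod (Gn n w - Gn k w) <= 1 * abs (t * MM N m n w - t * MM N m k w)"
   proof -
    have "Gn n w - Gn k w = G w * (cis (t * MM N m n w) - cis (t * MM N m k w))" by (simp add: Gn_def right_diff_distrib)
    then show ?thesis using mult_mono[OF G(2)[of w] cis_diff_le[of "t * MM N m n w" "t * MM N m k w"]] by (simp add: norm_mult)
   qed
   also have "... <= abs t * (real L * K1 K)" unfolding right_diff_distrib[symmetric] abs_mult mult_1 by (intro mult_left_mono dMM) auto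
   finally show "cmod (r2 w - r2' w) <= abs t * (real L * K1 K) * abs (?ta w - ?tb)" unfolding r2_def r2'_def left_diff_distrib[symmetric] norm_mult norm_of_real by (intro mult_right_mono) auto
   then show "0 <= abs t * (real L * K1 K) * abs (?ta w - ?tb)" by (rule order_trans[OF norm_ge_zero])
  qed (use itd in auto)
  also have "... = abs t * (real L * K1 K) * (LINT w|Q. abs (?ta w - ?tb))" by (rule integral_mult_right_zero)
  also have "... <= abs t * (real L * K1 K) * (c2 * ?tb)" using ta_dev[OF Q n3] K1_nonneg[OF f K] by (intro mult_left_mono) auto
  finally have d1: "cmod ((LINT w|Q. r2 w) - (LINT w|Q. r2' w)) <= abs t * (real L * K1 K) * (c2 * ?tb)" using i2 i2' by simp
  have "cmod (LINT w|Q. r2' w) <= (LINT w|Q. cmod (Gn k w)) * ((2/eps) * rate (L - 2) * (LINT y|(mu n). abs (ta f K N n y)))"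
   using mix_coord[OF P Q k(5) Gna[OF k(1)] Gn1, of "ta f K N n" "L - 2" "(K1 K)^2"] ta_measurable[OF f K n1] ta_bound[OF f K n1] by (simp add: k(2)[symmetric] r2'_def tb_def del: add_2_eq_Suc')
  also have "... <= 1 * ((2/eps) * rate (L - 2) * ((1/eps) * ?tb))"
  proof (intro mult_mono)
   show "(LINT w|Q. cmod (Gn k w)) <= 1" using Gn1 law_integrable[OF Q Gnm[OF k(1)] Gn1] by (intro Q.integral_le_const AE_I2) auto
   have "(LINT y|(mu n). abs (ta f K N n y)) = (LINT y|(mu n). ta f K N n y)" using ta_bound[OF f K n1] by (intro Bochner_Integration.integral_cong) auto
   then show "(LINT y|(mu n). abs (ta f K N n y)) <= (1/eps) * ?tb" using ta_mu[OF n3] by simp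
  qed (use eps_pos rate_nonneg in auto)
  finally have d2: "cmod (LINT w|Q. r2' w) <= 2 * ?tb * (rate (L - 2) / eps^2)" by (simp add: power2_eq_square mult_ac)
  have "cmod (LINT w|Q. r2 w) <= cmod ((LINT w|Q. r2 w) - (LINT w|Q. r2' w)) + cmod (LINT w|Q. r2' w)" by (metis diff_add_cancel norm_triangle_ineq)
  also have "... <= abs t * (real L * K1 K) * (c2 * ?tb) + 2 * ?tb * (rate (L - 2) / eps^2)" by (rule add_mono[OF d1 d2])
  also have "... = 2 * ?tb * (rate (L - 2) / eps^2 + abs t * (real L * K1 K * c2 / 2))" by (simp add: distrib_left mult_ac)
  finally show ?thesis using False by simp
 qed
 have "t^2 / 2 * cmod (LINT w|Q. r2 w) <= t^2 / 2 * (2 * ?tb * (rate (L - 2) / eps^2 + abs t * (real L * K1 K * c2 / 2) + (if n < m + L then c2 / 2 else 0)))" by (rule mult_left_mono[OF b2]) simp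
 also have "... = t^2 * ?tb * (rate (L - 2) / eps^2 + abs t * (real L * K1 K * c2 / 2) + (if n < m + L then c2 / 2 else 0))" by simp
 finally have b2': "t^2 / 2 * cmod (LINT w|Q. r2 w) <= ..." .
 have "cmod ((LINT w|Q. Gn n w * ch (w n)) - exp (- (t^2 / 2 * ?tb)) * (LINT w|Q. Gn n w)) <=
   t^2 * ?tb * (abs t * (K1 K / (6 * eps^2))) + t^2 * ?tb * (rate (L - 2) / eps^2 + abs t * (real L * K1 K * c2 / 2) + (if n < m + L then c2 / 2 else 0)) + t^2 * ?tb * (t^2 * (K1 K)^2 / 8)"
  by (rule order_trans[OF main]) (intro add_mono b1 b2' b3)
 also have "... = t^2 * ?tb * (E1 t L + (if n < m + L then c2 / 2 else 0))" unfolding E1_def distrib_left[symmetric] by (simp add: distrib_left)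
 finally show ?thesis unfolding eq1 Gn_def .
qed


lemma TT_nonneg: "m >= 1 ==> 0 <= TT N m k" unfolding TT_def by (intro sum_nonneg tb_bounds) auto

text \<open>Telescoping over time: errors made earlier are multiplied by exp (- t^2
  \<open>tb\<close> / 2) \<le> 1 and never grow.\<close>

lemma char_sum:
 fixes G :: "(nat => 'a) => complex"
 assumes Q: "chain_law Q" and m: "m >= 3" and G: "adapted m G" "!!w. cmod (G w) <= 1" and L: "L >= 2" and k: "m <= k"
 shows "cmod ((LINT w|Q. G w * cis (t * MM N m k w)) - of_real (exp (- (t^2 / 2 * TT N m k))) * (LINT w|Q. G w))
   <= (\<Sum>n\<in>{m..<k}. t^2 * tb N n * (E1 t L + (if n < m + L then c2 / 2 else 0)))" using k
proof (induction k rule: dec_induct)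
 case base
 then show ?case by (simp add: MM_def TT_def)
next
 case (step k)
 let ?phi = "%k. (LINT w|Q. G w * cis (t * MM N m k w))" and ?e = "%x. complex_of_real (exp (- (t^2 / 2 * x)))"
 have T: "?e (TT N m (Suc k)) = ?e (tb N k) * ?e (TT N m k)" using step by (simp add: TT_def of_real_mult[symmetric] exp_add[symmetric] distrib_left del: of_real_mult of_real_exp)
 have eq: "?phi (Suc k) - ?e (TT N m (Suc k)) * (LINT w|Q. G w) = (?phi (Suc k) - ?e (tb N k) * ?phi k) + ?e (tb N k) * (?phi k - ?e (TT N m k) * (LINT w|Q. G w))" unfolding T by (simp add: algebra_simps)
 have "cmod (?phi (Suc k) - ?e (TT N m (Suc k)) * (LINT w|Q. G w)) <= cmod (?phi (Suc k) - ?e (tb N k) * ?phi k) + cmod (?phi k - ?e (TT N m k) * (LINT w|Q. G w))" unfolding eq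
 proof (rule order_trans[OF norm_triangle_ineq add_left_mono])
  have "cmod (?e (tb N k)) <= 1" using tb_bounds[of k N] step m unfolding norm_of_real by simp
  then show "cmod (?e (tb N k) * (?phi k - ?e (TT N m k) * (LINT w|Q. G w))) <= cmod (?phi k - ?e (TT N m k) * (LINT w|Q. G w))" unfolding norm_mult[of "?e (tb N k)"] by (intro mult_left_le_one_le) auto
 qed
 also have "... <= t^2 * tb N k * (E1 t L + (if k < m + L then c2 / 2 else 0)) + (\<Sum>n\<in>{m..<k}. t^2 * tb N n * (E1 t L + (if n < m + L then c2 / 2 else 0)))"
  using char_step[OF Q m step(1) G L] step.IH by (intro add_mono) auto
 finally show ?case using step by simp
qed

text \<open>At most L indices pay the crude error, which sums to a constant times t^2 and is
  independent of the length of the sum.\<close>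

lemma char_gauss:
 fixes G :: "(nat => 'a) => complex"
 assumes Q: "chain_law Q" and m: "m >= 3" and G: "adapted m G" "!!w. cmod (G w) <= 1" and L: "L >= 2" and k: "m <= k"
 shows "cmod ((LINT w|Q. G w * cis (t * MM N m k w)) - of_real (exp (- (t^2 / 2 * TT N m k))) * (LINT w|Q. G w))
   <= t^2 * TT N m k * E1 t L + t^2 * (real L * (K1 K)^2 * c2)"
proof -
 have "(\<Sum>n\<in>{m..<k}. t^2 * tb N n * (E1 t L + (if n < m + L then c2 / 2 else 0))) =
  (\<Sum>n\<in>{m..<k}. t^2 * tb N n * E1 t L) + (\<Sum>n\<in>{m..<k}. if n < m + L then t^2 * tb N n * (c2 / 2) else 0)" unfolding sum.distrib[symmetric] by (intro sum.cong refl) (simp add: distrib_left)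
 also have "(\<Sum>n\<in>{m..<k}. t^2 * tb N n * E1 t L) = t^2 * TT N m k * E1 t L" by (simp add: TT_def sum_distrib_left sum_distrib_right mult_ac)
 also have "(\<Sum>n\<in>{m..<k}. if n < m + L then t^2 * tb N n * (c2 / 2) else 0) <= (\<Sum>n\<in>{m..<m+L}. t^2 * (K1 K)^2 * c2)"
 proof -
  have "(\<Sum>n\<in>{m..<k}. if n < m + L then t^2 * tb N n * (c2 / 2) else 0) = (\<Sum>n\<in>{m..<k} \<inter> {m..<m+L}. t^2 * tb N n * (c2 / 2))" by (rule sum.mono_neutral_cong_right) auto
  also have "... <= (\<Sum>n\<in>{m..<m+L}. t^2 * tb N n * (c2 / 2))" using m c2_pos tb_bounds by (intro sum_mono2 mult_nonneg_nonneg) auto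
  also have "... <= (\<Sum>n\<in>{m..<m+L}. t^2 * (K1 K)^2 * c2)" using m c2_pos tb_bounds by (intro sum_mono mult_mono mult_left_mono) auto
  finally show ?thesis .
 qed
 also have "... = t^2 * (real L * (K1 K)^2 * c2)" by simp
 finally show ?thesis using char_sum[OF Q m G L k, of t N] by linarith
qed

text \<open>The corrections telescope. At the right end no summand remains, so \<open>av\<close>
  vanishes there and only the correction at time m is left.\<close>

lemma MM_Sm:
 assumes m: "m >= 1" and N: "m <= N" and wt: "w : space paths"
 shows "MM N m (Suc N) w = Sm f m N w - av f m (Suc N - m) (w m)"
proof -
 define g where "g n = av f n (Suc N - n) (w n)" for n
 have "MM N m (Suc N) w = (\<Sum>n\<in>{m..<Suc N}. st f n w + (g (Suc n) - g n))" unfolding MM_def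
 proof (intro sum.cong refl)
  fix n assume "n : {m..<Suc N}"
  then have n: "n >= 1" "Suc N - n = Suc (N - n)" using m by auto
  then show "md f K N n (w n) (w (Suc n)) = st f n w + (g (Suc n) - g n)" using md_eq[OF f K n(1), of "w n" "w (Suc n)" N] coord_space[OF _ wt] by (simp add: md0_def[OF f K] g_def del: av.simps)
 qed
 also have "... = (\<Sum>n\<in>{m..<Suc N}. st f n w) + (g (Suc N) - g m)" unfolding sum.distrib using N by (simp add: sum_Suc_diff' del: sum.op_ivl_Suc)
 also have "{m..<Suc N} = {m..N}" by auto
 finally show ?thesis by (simp add: g_def)
qed

text \<open>Orthogonality of martingale increments to the past; \<open>Z\<close> takes the
  correction known at time m.\<close>

lemma second_moment:
 assumes m: "m >= 1" and Z: "adapted m Z" "!!w. abs (Z w) <= c" and k: "m <= k"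
 shows "(LINT w|P. (Z w + MM N m k w)^2) = (LINT w|P. (Z w)^2) + TT N m k" using k
proof (induction k rule: dec_induct)
 case base
 then show ?case by (simp add: MM_def TT_def)
next
 case (step k)
 have k1: "k >= 1" using step m by simp
 let ?d = "%w. md f K N k (w k) (w (Suc k))"
 define Y where "Y w = Z w + MM N m k w" for w
 define c' where "c' = c + real (k - m) * K1 K"
 have Ya: "adapted k Y" unfolding Y_def using step m by (intro adapted_add adapted_MM adapted_mono[OF Z(1)]) auto
 have Yb: "abs (Y w) <= c'" for w using Z(2)[of w] MM_bound[of N m k w] unfolding Y_def c'_def by linarith
 note [measurable] = adapted_measurable[OF Ya] pmeas_path[OF md_pmeas[OF f K k1] k1]
 have dm: "pmeas k (md f K N k)" by (rule md_pmeas[OF f K k1])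
 have iY: "integrable P (%w. (Y w)^2)" by (rule law_integrable[OF P, where C="c'^2"]) (use abs_le_square_iff_D[OF Yb] in auto)
 have id: "integrable P (%w. (?d w)^2)" by (rule law_integrable[OF P, where C="(K1 K)^2"]) (use md2(2)[OF f K] in auto)
 have iYd: "integrable P (%w. Y w * ?d w)" by (rule law_integrable[OF P, where C="c' * K1 K"])
    (measurable, unfold real_norm_def abs_mult, intro mult_mono Yb md_le[OF f K], use order_trans[OF abs_ge_zero Yb] in auto)
 have "(LINT w|P. Y w * ?d w) = (LINT w|P. Y w * trans k (md f K N k (w k)) (w k))" by (rule markov[OF P k1 Ya _ pmeasD[OF dm], where C=c' and C'="K1 K"]) (use Yb md_le[OF f K] in auto)
 also have "... = (LINT w|P. 0)" by (intro Bochner_Integration.integral_cong refl)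
    (use md_centered[OF f K k1] coord_space[OF k1] chain_lawD(3)[OF P] in \<open>auto simp: trans_def\<close>)
 finally have z: "(LINT w|P. Y w * ?d w) = 0" by simp
 have d2: "(LINT w|P. (?d w)^2) = tb N k" using markov[OF P k1 adapted_const[of k "1::real"] _ pmeasD[OF md2(1)[OF f K dm]], where C=1 and C'="(K1 K)^2"] md2(2)[OF f K] by (simp add: tb_def ta_def[OF f K])
 have "(Z w + MM N m (Suc k) w)^2 = (Y w)^2 + 2 * (Y w * ?d w) + (?d w)^2" for w unfolding MM_Suc[OF step(1)] by (simp add: Y_def power2_eq_square algebra_simps)
 then have "(LINT w|P. (Z w + MM N m (Suc k) w)^2) = (LINT w|P. (Y w)^2) + tb N k" using iY id iYd z d2 by simp
 then show ?case using step by (simp add: Y_def TT_def)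
qed

lemma MM_mean:
 assumes m: "m >= 1" shows "(LINT w|P. MM N m k w) = 0"
proof -
 have "(LINT w|P. md f K N n (w n) (w (Suc n))) = 0" if n: "n >= 1" for n
 proof -
  have "(LINT w|P. md f K N n (w n) (w (Suc n))) = (LINT w|P. trans n (md f K N n (w n)) (w n))" using markov[OF P n adapted_const[of n "1::real"] _ pmeasD[OF md_pmeas[OF f K n]], where C=1 and C'="K1 K"] md_le[OF f K] by simp
  also have "... = (LINT w|P. 0)" by (intro Bochner_Integration.integral_cong refl)
     (use md_centered[OF f K n] coord_space[OF n] chain_lawD(3)[OF P] in \<open>auto simp: trans_def\<close>)
  finally show ?thesis by simp
 qed
 moreover have "integrable P (%w. md f K N n (w n) (w (Suc n)))" if n: "n >= 1" for n by (rule law_integrable[OF P pmeas_path[OF md_pmeas[OF f K n] n], where C="K1 K"]) (use md_le[OF f K] in auto)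
 ultimately show ?thesis unfolding MM_def using m by (subst Bochner_Integration.integral_sum) auto
qed

text \<open>The centred sum is the martingale plus a centred function of the state at time m,
  bounded by the oscillation from \<open>av_osc\<close>. Being known at time m, this function is
  orthogonal to all increments, which yields the two-sided comparison of variances.\<close>

lemma MM_decomp:
 assumes m: "m >= 1" and N: "m <= N"
 shows "w : space paths ==> abs (Sm f m N w - (LINT w|P. Sm f m N w) - MM N m (Suc N) w) <= 4 * K / eps"
  and "TT N m (Suc N) <= Vr P f m N" "Vr P f m N <= TT N m (Suc N) + (4 * K / eps)^2"
proof -
 interpret P: prob_space P using chain_lawD[OF P] by simp
 let ?k = "Suc N - m" and ?c = "4 * K / eps"
 have c0: "0 <= ?c" using K_nonneg[OF f K] eps_pos by simp
 define a where "a w = av f m ?k (w m)" for w :: "nat => 'a"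
 have am: "a : borel_measurable paths" unfolding a_def using measurable_compose[OF coord[OF m] av_measurable[OF f m]] .
 have ia: "integrable P a" unfolding a_def by (rule law_integrable[OF P am[unfolded a_def], where C="real ?k * K"]) (use av_bound[OF f K m] coord_space[OF m] in auto)
 have iM: "integrable P (MM N m (Suc N))" by (rule law_integrable[OF P adapted_measurable[OF adapted_MM[OF m]], where C="real ?k * K1 K"]) (use MM_bound[of N m "Suc N"] in auto)
 have S: "Sm f m N w = MM N m (Suc N) w + a w" if "w : space paths" for w using MM_Sm[OF m N that] by (simp add: a_def del: av.simps)
 have ES: "(LINT w|P. Sm f m N w) = P.expectation a"
 proof -
  have "(LINT w|P. Sm f m N w) = (LINT w|P. MM N m (Suc N) w + a w)" by (intro Bochner_Integration.integral_cong refl S) (simp add: chain_lawD[OF P])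
  then show ?thesis using iM ia MM_mean[OF m, of N "Suc N"] by simp
 qed
 have osc: "abs (a w - P.expectation a) <= ?c" if wt: "w : space paths" for w
 proof -
  have "a w - ?c <= a w' & a w' <= a w + ?c" if "w' : space P" for w' using av_osc[OF f K m, of ?k] coord_space[OF m wt] coord_space[OF m, of w'] that chain_lawD(3)[OF P]
   unfolding osc_le_def a_def by (auto simp: diff_le_eq add.commute simp del: av.simps)
  then show ?thesis using P.integral_between[OF ia, of "a w - ?c" "a w + ?c"] by auto
 qed
 have dev: "Sm f m N w - (LINT w|P. Sm f m N w) - MM N m (Suc N) w = a w - P.expectation a" if "w : space paths" for w using S[OF that] ES by simp
 then show "abs (Sm f m N w - (LINT w|P. Sm f m N w) - MM N m (Suc N) w) <= ?c" if "w : space paths" for w using osc[OF that] that by simp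
 \<comment> \<open>On path space the clip changes nothing; it supplies the bound for all arguments
   that \<open>second_moment\<close> requires.\<close>
 define Z where "Z w = max (- ?c) (min ?c (a w - P.expectation a))" for w
 have Za: "adapted m Z"
 proof -
  have "adapted m a" unfolding a_def using m by (intro adapted_coord av_measurable[OF f]) auto
  then show ?thesis unfolding Z_def by (rule adapted_compose[where h="%x. max (- ?c) (min ?c (x - P.expectation a))"]) measurable
 qed
 have Zb: "abs (Z w) <= ?c" for w using c0 unfolding Z_def by auto
 have "Vr P f m N = (LINT w|P. (Z w + MM N m (Suc N) w)^2)" unfolding Vr_def
 proof (intro Bochner_Integration.integral_cong refl)
  fix w assume "w : space P"
  then have wt: "w : space paths" by (simp add: chain_lawD[OF P])
  have "Z w = a w - P.expectation a" using osc[OF wt] unfolding Z_def by auto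
  then have "Sm f m N w - (LINT w|P. Sm f m N w) = Z w + MM N m (Suc N) w" using dev[OF wt] by linarith
  then show "(Sm f m N w - (LINT w|P. Sm f m N w))^2 = (Z w + MM N m (Suc N) w)^2" by (simp only:)
 qed
 also have "... = (LINT w|P. (Z w)^2) + TT N m (Suc N)" using N by (intro second_moment[OF m Za Zb]) simp
 finally have V: "Vr P f m N = (LINT w|P. (Z w)^2) + TT N m (Suc N)" .
 have "integrable P (%w. (Z w)^2)" by (rule law_integrable[OF P, where C="?c^2"]) (use adapted_measurable[OF Za] abs_le_square_iff_D[OF Zb] in auto)
 then have "(LINT w|P. (Z w)^2) <= ?c^2" using abs_le_square_iff_D[OF Zb] by (intro P.integral_le_const AE_I2) auto
 moreover have "0 <= (LINT w|P. (Z w)^2)" by simp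
 ultimately show "TT N m (Suc N) <= Vr P f m N" "Vr P f m N <= TT N m (Suc N) + ?c^2" using V by linarith+
qed

end

end

lemma norm_le_via: "norm (a - b) <= e ==> norm (b - c) <= e' ==> norm (a - c) <= e + e'"
 for a b c :: "'a::real_normed_vector" using norm_triangle_ineq[of "a - b" "b - c"] by simp

lemma cis_mult_diff_le:
 assumes "cmod g <= 1"
 shows "cmod (g * cis a - g * cis b) <= abs (a - b)" using mult_mono[OF assms cis_diff_le[of a b]] unfolding right_diff_distrib[symmetric] norm_mult by simp

context elliptic_chain
begin

lemma law_integral_diff_le:
 fixes F H :: "(nat => 'a) => complex"
 assumes Q: "chain_law Q" and m: "F : borel_measurable paths" "H : borel_measurable paths"
  and b: "!!w. w : space paths ==> cmod (F w) <= C" "!!w. w : space paths ==> cmod (F w - H w) <= e"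
 shows "cmod ((LINT w|Q. F w) - (LINT w|Q. H w)) <= e"
proof -
 interpret Q: prob_space Q using chain_lawD[OF Q] by simp
 have H: "cmod (H w) <= C + e" if "w : space paths" for w using norm_triangle_ineq4[of "F w" "F w - H w"] b[OF that] by simp
 have i: "integrable Q F" "integrable Q H" by (rule law_integrable[OF Q m(1) b(1)], assumption, rule law_integrable[OF Q m(2) H])
 have "cmod (LINT w|Q. F w - H w) <= (LINT w|Q. cmod (F w - H w))" by (rule integral_norm_bound)
 also have "... <= e" using i b(2) chain_lawD(3)[OF Q] by (intro Q.integral_le_const AE_I2) auto
 finally show ?thesis using i by simp
qed

text \<open>The oscillating factor and the end weight \<open>u\<close> interact only through the
  last few steps. Deleting L summands lets \<open>u\<close> mix away; the summands are then
  restored, the sum is replaced by its martingale part, and \<open>char_gauss\<close> applies. The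
  free number \<open>r\<close> is the Gaussian value aimed at.\<close>

lemma clt_bound:
 fixes G :: "(nat => 'a) => complex"
 assumes f: "addf f" and K: "!!n x y. abs (f n x y) <= K" and P: "chain_law P" and Q: "chain_law Q" and m: "m >= 3"
  and G: "adapted m G" "!!w. cmod (G w) <= 1" and L: "L >= 2" and N: "N >= m + L"
  and u: "u : borel_measurable (B (Suc N))" "!!y. y : space (B (Suc N)) ==> 0 <= u y & u y <= (1::real)"
 shows "cmod ((LINT w|Q. G w * cis (t * (Sm f m N w - (LINT w|P. Sm f m N w))) * of_real (u (w (Suc N))))
   - of_real r * (LINT w|Q. G w) * of_real (LINT w|P. u (w (Suc N))))
   <= abs t * (2 * real L * K + 4 * K / eps) + (2/eps) * rate (L - 2) + t^2 * TT f K P N m (Suc N) * E1 K t L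
    + t^2 * (real L * (K1 K)^2 * c2) + abs (exp (- (t^2 / 2 * TT f K P N m (Suc N))) - r)"
proof -
 interpret P: prob_space P using chain_lawD[OF P] by simp
 interpret Q: prob_space Q using chain_lawD[OF Q] by simp
 have m1: "m >= 1" using m by simp
 let ?E = "(LINT w|P. Sm f m N w)" and ?M = "MM f K N m (Suc N)"
 define U where "U = (LINT w|P. u (w (Suc N)))"
 define F where "F w = G w * cis (t * (Sm f m N w - ?E))" for w
 define F' where "F' w = G w * cis (t * (Sm f m (N - L) w - ?E))" for w
 have N1: "Suc N >= 1" by simp
 have Ga: "adapted k G" if "m <= k" for k using G(1) that by (rule adapted_mono)
 have cis_ad: "adapted k (%w. cis (t * (h w - c)))" if "adapted k h" for k h c using that by (rule adapted_compose[where h="%x. cis (t * (x - c))"]) measurable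
 have Fa: "adapted (Suc N) F" "adapted (Suc (N - L)) F'" unfolding F_def F'_def using m1 N by (auto intro!: adapted_mult cis_ad adapted_Sm[OF f] Ga)
 have F1: "cmod (F w) <= 1" "cmod (F' w) <= 1" for w unfolding F_def F'_def using G(2) by (auto simp: norm_mult)
 note Fm [measurable] = adapted_measurable[OF Fa(1)] adapted_measurable[OF Fa(2)] adapted_measurable[OF G(1)]
 have um [measurable]: "(%w. u (w (Suc N))) : borel_measurable paths" using measurable_compose[OF coord[OF N1] u(1)] .
 have ub: "0 <= u (w (Suc N)) & u (w (Suc N)) <= 1" if "w : space paths" for w using u(2) coord_space[OF N1 that] by blast
 have "integrable P (%w. u (w (Suc N)))" by (rule law_integrable[OF P um, where C=1]) (use ub in auto)
 then have U: "0 <= U" "U <= 1" unfolding U_def using P.integral_between[of "%w. u (w (Suc N))" 0 1] ub chain_lawD(3)[OF P] by auto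
 have FF: "cmod (F w - F' w) <= abs t * (real L * K)" for w
 proof -
  have "{m..N} = {m..N - L} \<union> {Suc (N - L)..N}" using N by auto
  then have "Sm f m N w = Sm f m (N - L) w + Sm f (Suc (N - L)) N w" by (simp add: sum.union_disjoint)
  moreover have "abs (Sm f (Suc (N - L)) N w) <= real L * K" using Sm_bounded[OF K, where m="Suc (N - L)" and N=N and w=w] N by simp
  ultimately have s: "abs (Sm f m N w - Sm f m (N - L) w) <= real L * K" by simp
  have "cmod (F w - F' w) <= abs (t * (Sm f m N w - ?E) - t * (Sm f m (N - L) w - ?E))" unfolding F_def F'_def by (rule cis_mult_diff_le[OF G(2)])
  also have "... = abs t * abs (Sm f m N w - Sm f m (N - L) w)" unfolding right_diff_distrib[symmetric] abs_mult by simp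
  also have "... <= abs t * (real L * K)" using s by (intro mult_left_mono) auto
  finally show ?thesis .
 qed
 have s1: "cmod ((LINT w|Q. F w * of_real (u (w (Suc N)))) - (LINT w|Q. F' w * of_real (u (w (Suc N))))) <= abs t * (real L * K)"
 proof (rule law_integral_diff_le[OF Q, where C=1])
  fix w assume wt: "w : space paths"
  show "cmod (F w * of_real (u (w (Suc N)))) <= 1" using mult_mono[OF F1(1)[of w], of "u (w (Suc N))" 1] ub[OF wt] by (simp add: norm_mult)
  have "cmod (F w - F' w) * u (w (Suc N)) <= abs t * (real L * K) * 1" using FF[of w] ub[OF wt] order_trans[OF norm_ge_zero FF[of w]] by (intro mult_mono) auto
  then show "cmod (F w * of_real (u (w (Suc N))) - F' w * of_real (u (w (Suc N)))) <= abs t * (real L * K)" unfolding left_diff_distrib[symmetric] norm_mult using ub[OF wt] by simp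
 qed measurable
 have s2: "cmod ((LINT w|Q. F' w * of_real (u (w (Suc N)))) - (LINT w|Q. F' w) * of_real U) <= (2/eps) * rate (L - 2)"
 proof -
  have j: "Suc N = Suc (N - L) + (L - 2) + 2" using N L by auto
  have i: "integrable Q (%w. F' w * of_real (u (w (Suc N))))" "integrable Q F'"
  proof -
   show "integrable Q F'" by (rule law_integrable[OF Q Fm(2) F1(2)])
   show "integrable Q (%w. F' w * of_real (u (w (Suc N))))"
   proof (rule law_integrable[OF Q, where C=1])
    show "cmod (F' w * of_real (u (w (Suc N)))) <= 1" if "w : space paths" for w using mult_mono[OF F1(2)[of w], of "u (w (Suc N))" 1] ub[OF that] by (simp add: norm_mult)
   qed measurable
  qed
  have "cmod (LINT w|Q. F' w * of_real (u (w (Suc N)) - U)) <= (LINT w|Q. cmod (F' w)) * ((2/eps) * rate (L - 2) * (LINT y|(mu (Suc N)). abs (u y)))"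
   using mix_coord[OF P Q _ Fa(2) F1(2), of u "L - 2" 1] u unfolding j[symmetric] U_def by auto
  also have "... <= 1 * ((2/eps) * rate (L - 2) * 1)"
  proof (intro mult_mono)
   show "(LINT w|Q. cmod (F' w)) <= 1" using F1 i by (intro Q.integral_le_const AE_I2) auto
   show "(LINT y|(mu (Suc N)). abs (u y)) <= 1" using integrable_mu[OF u(1), of 1] u(2) by (intro mu.integral_le_const AE_I2) auto
  qed (use eps_pos rate_nonneg in auto)
  finally show ?thesis using i by (simp add: right_diff_distrib)
 qed
 have s3: "cmod ((LINT w|Q. F' w) * of_real U - (LINT w|Q. F w) * of_real U) <= abs t * (real L * K)"
 proof -
  have "cmod ((LINT w|Q. F' w) - (LINT w|Q. F w)) <= abs t * (real L * K)" by (rule law_integral_diff_le[OF Q, where C=1]) (use F1 FF in \<open>auto simp: norm_minus_commute\<close>)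
  then show ?thesis unfolding left_diff_distrib[symmetric] norm_mult using mult_mono[of "cmod ((LINT w|Q. F' w) - (LINT w|Q. F w))" "abs t * (real L * K)" U 1] U order_trans[OF norm_ge_zero] by auto
 qed
 have Ma: "adapted (Suc N) ?M" using m1 by (rule adapted_MM[OF f K P])
 have s4: "cmod ((LINT w|Q. F w) - (LINT w|Q. G w * cis (t * ?M w))) <= abs t * (4 * K / eps)"
 proof (rule law_integral_diff_le[OF Q, where C=1])
  show "(%w. G w * cis (t * ?M w)) : borel_measurable paths" using adapted_measurable[OF Ma] by measurable
  fix w assume wt: "w : space paths"
  have "cmod (F w - G w * cis (t * ?M w)) <= abs (t * (Sm f m N w - ?E) - t * ?M w)" unfolding F_def by (rule cis_mult_diff_le[OF G(2)])
  also have "... = abs t * abs (Sm f m N w - ?E - ?M w)" unfolding right_diff_distrib[symmetric] abs_mult by simp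
  also have "... <= abs t * (4 * K / eps)" using MM_decomp(1)[OF f K P m1 _ wt, of N] N by (intro mult_left_mono) auto
  finally show "cmod (F w - G w * cis (t * ?M w)) <= abs t * (4 * K / eps)" .
 qed (use F1 in auto)
 define e where "e = exp (- (t^2 / 2 * TT f K P N m (Suc N)))"
 have s5: "cmod ((LINT w|Q. G w * cis (t * ?M w)) - of_real e * (LINT w|Q. G w)) <= t^2 * TT f K P N m (Suc N) * E1 K t L + t^2 * (real L * (K1 K)^2 * c2)" unfolding e_def using N by (intro char_gauss[OF f K P Q m G L]) simp
 have G1: "cmod (LINT w|Q. G w) <= 1" using G(2) by (intro order_trans[OF integral_norm_bound Q.integral_le_const] AE_I2 integrable_norm law_integrable[OF Q Fm(3), where C=1]) auto
 have s6: "cmod (of_real e * (LINT w|Q. G w) - of_real r * (LINT w|Q. G w)) <= abs (e - r)"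
  using mult_left_mono[OF G1, of "abs (e - r)"] unfolding left_diff_distrib[symmetric] norm_mult of_real_diff[symmetric] norm_of_real by simp
 have UU: "cmod (x * of_real U - y * of_real U) <= c" if "cmod (x - y) <= c" for x y c
 proof -
  have "cmod (x - y) * U <= c * 1" using that U order_trans[OF norm_ge_zero that] by (intro mult_mono) auto
  then show ?thesis unfolding left_diff_distrib[symmetric] norm_mult using U by simp
 qed
 note chain = norm_le_via[OF norm_le_via[OF norm_le_via[OF s1 s2] s3] UU[OF norm_le_via[OF norm_le_via[OF s4 s5] s6]]]
 show ?thesis using chain unfolding F_def U_def e_def by (simp add: algebra_simps)
qed

lemma rate_tendsto: "(%k. rate k) ----> 0"
proof -
 have "(%k. (1 - eps) ^ k) ----> 0" using eps_pos eps_less by (intro LIMSEQ_power_zero) simp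
 moreover have "filterlim (%k::nat. k div 2) at_top at_top" unfolding filterlim_at_top
 proof
  fix Z :: nat
  show "\<forall>\<^sub>F k in sequentially. Z <= k div 2" using eventually_ge_at_top[of "2 * Z"] by eventually_elim auto
 qed
 ultimately show ?thesis unfolding rate_def by (rule filterlim_compose)
qed

text \<open>Past factor, normalised sum and end weight become independent in the limit. The lag L is
  fixed first, so that mixing errors are small; then N grows with t = s / \<open>sg N\<close>, which
  removes all errors proportional to L.\<close>

theorem clt:
 fixes G :: "(nat => 'a) => complex"
 assumes f: "addf f" and K: "!!n x y. abs (f n x y) <= K" and P: "chain_law P" and Q: "chain_law Q" and m: "m >= 3"
  and G: "adapted m G" "!!w. cmod (G w) <= 1"
  and u: "!!N. u N : borel_measurable (B (Suc N))" "!!N y. y : space (B (Suc N)) ==> 0 <= u N y & u N y <= (1::real)"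
  and sg: "filterlim sg at_top at_top" "(%N. Vr P f m N / (sg N)^2) ----> 1"
 shows "(%N. (LINT w|Q. G w * cis (s / sg N * (Sm f m N w - (LINT w|P. Sm f m N w))) * of_real (u N (w (Suc N))))
   - of_real (exp (- (s^2) / 2)) * (LINT w|Q. G w) * of_real (LINT w|P. u N (w (Suc N)))) ----> 0"
  (is "?X ----> 0")
proof (rule tendstoI)
 fix e :: real assume e: "e > 0"
 have m1: "m >= 1" using m by simp
 define T where "T N = TT f K P N m (Suc N)" for N
 \<comment> \<open>This expression is the limit of the bound in \<open>clt_bound\<close> as N tends
   to infinity with L fixed.\<close>
 have "(%L. (s^2 / eps^2 + 2 / eps) * rate (L - 2)) ----> (s^2 / eps^2 + 2 / eps) * 0" by (intro tendsto_intros filterlim_compose[OF rate_tendsto] filterlim_minus_const_nat_at_top)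
 then have "\<forall>\<^sub>F L in sequentially. (s^2 / eps^2 + 2 / eps) * rate (L - 2) < e" using e by (auto dest: order_tendstoD)
 then have "\<forall>\<^sub>F L in sequentially. L >= 2 & (s^2 / eps^2 + 2 / eps) * rate (L - 2) < e" using eventually_ge_at_top[of 2] by eventually_elim auto
 then obtain L where L: "L >= 2" "(s^2 / eps^2 + 2 / eps) * rate (L - 2) < e" using eventually_happens by force
 have inv: "(%N. 1 / sg N) ----> 0" using tendsto_divide_0[OF tendsto_const sg(1)[THEN filterlim_at_top_imp_at_infinity]] .
 then have t0: "(%N. s / sg N) ----> 0" using tendsto_mult_left[OF inv, of s] by simp
 have tT: "(%N. (s / sg N)^2 * T N) ----> s^2"
 proof -
  have 1: "(%N. (s / sg N)^2 * Vr P f m N) ----> s^2" using tendsto_mult_left[OF sg(2), of "s^2"] by (simp add: power_divide)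
  have 2: "(%N. (s / sg N)^2 * (Vr P f m N - T N)) ----> 0"
  proof (rule Lim_null_comparison)
   show "\<forall>\<^sub>F N in sequentially. norm ((s / sg N)^2 * (Vr P f m N - T N)) <= (s / sg N)^2 * (4 * K / eps)^2" using eventually_ge_at_top[of m]
   proof eventually_elim
    case (elim N)
    then have "abs (Vr P f m N - T N) <= (4 * K / eps)^2" using MM_decomp(2,3)[OF f K P m1, of N] unfolding T_def by auto
    then show ?case unfolding real_norm_def abs_mult by (simp add: mult_left_mono)
   qed
   show "(%N. (s / sg N)^2 * (4 * K / eps)^2) ----> 0" using tendsto_mult_right[OF tendsto_power[OF t0, of 2], of "(4 * K / eps)^2"] by simp
  qed
  show ?thesis using tendsto_diff[OF 1 2] by (simp add: right_diff_distrib)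
 qed
 define err where "err N = abs (s / sg N) * (2 * real L * K + 4 * K / eps) + (2/eps) * rate (L - 2) + (s / sg N)^2 * T N * E1 K (s / sg N) L
    + (s / sg N)^2 * (real L * (K1 K)^2 * c2) + abs (exp (- ((s / sg N)^2 / 2 * T N)) - exp (- (s^2) / 2))" for N
 have E: "(%N. E1 K (s / sg N) L) ----> rate (L - 2) / eps^2 + abs 0 * (real L * K1 K * c2 / 2 + K1 K / (6 * eps^2)) + 0^2 * (K1 K)^2 / 8" unfolding E1_def[OF f K P] by (intro tendsto_intros t0) auto
 have "(%N. exp (- (((s / sg N)^2 * T N) / 2))) ----> exp (- (s^2 / 2))" by (intro tendsto_intros tT) auto
 then have ex: "(%N. exp (- ((s / sg N)^2 / 2 * T N))) ----> exp (- (s^2) / 2)" by simp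
 have "err ----> abs 0 * (2 * real L * K + 4 * K / eps) + (2/eps) * rate (L - 2) + s^2 * (rate (L - 2) / eps^2 + abs 0 * (real L * K1 K * c2 / 2 + K1 K / (6 * eps^2)) + 0^2 * (K1 K)^2 / 8)
   + 0^2 * (real L * (K1 K)^2 * c2) + abs (exp (- (s^2) / 2) - exp (- (s^2) / 2))" unfolding err_def by (intro tendsto_intros t0 E tT ex)
 moreover have "(2/eps) * rate (L - 2) + s^2 * (rate (L - 2) / eps^2) < e" using L(2) by (simp add: distrib_right)
 ultimately have "\<forall>\<^sub>F N in sequentially. err N < e" by (intro order_tendstoD(2)) auto
 then show "\<forall>\<^sub>F N in sequentially. dist (?X N) 0 < e" using eventually_ge_at_top[of "m + L"]
 proof eventually_elim
  case (elim N)
  have "cmod (?X N) <= err N" unfolding err_def T_def by (rule clt_bound[OF f K P Q m G L(1) elim(2) u])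
  then show ?case using elim(1) by simp
 qed
qed

end

section \<open>Convergence of the centred series and the lattice structure of the sums\<close>

lemma summable_diff_convergent:
 fixes x :: "nat => 'b::real_normed_vector"
 assumes "summable (%i. x (Suc i) - x i)"
 shows "convergent x"
proof -
 have "(%n. (\<Sum>i<n. x (Suc i) - x i) + x 0) ----> (\<Sum>i. x (Suc i) - x i) + x 0" by (intro tendsto_intros summable_LIMSEQ assms)
 then have "x ----> (\<Sum>i. x (Suc i) - x i) + x 0" by (simp add: sum_lessThan_telescope)
 then show ?thesis unfolding convergent_def by blast
qed

lemma (in prob_space) integral_abs_le_sqrt:
 assumes "integrable M X" "integrable M (%x. (X x)^2)" "(LINT x|M. (X x)^2) <= c"
 shows "(LINT x|M. abs (X x)) <= sqrt c"
proof (rule real_le_rsqrt)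
 have "0 <= variance (%x. abs (X x))" by (intro integral_nonneg_AE) auto
 also have "... = (LINT x|M. (X x)^2) - (LINT x|M. abs (X x))^2" using assms by (subst variance_eq) auto
 finally show "(LINT x|M. abs (X x))^2 <= c" using assms(3) by simp
qed

lemma (in prob_space) fast_cauchy_AE_convergent:
 fixes X :: "nat => 'a => real"
 assumes i: "!!n. integrable M (X n)" and b: "!!n. (LINT x|M. abs (X (Suc n) x - X n x)) <= (1/2)^n"
 shows "AE x in M. convergent (%n. X n x)"
proof -
 have id: "integrable M (%x. abs (X (Suc n) x - X n x))" for n using i by auto
 have [measurable]: "X n : borel_measurable M" for n using i by auto
 have "(\<integral>\<^sup>+x. (\<Sum>n. ennreal (abs (X (Suc n) x - X n x))) \<partial>M) = (\<Sum>n. \<integral>\<^sup>+x. ennreal (abs (X (Suc n) x - X n x)) \<partial>M)" by (rule nn_integral_suminf) measurable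
 also have "... <= (\<Sum>n. ennreal ((1/2)^n))" using id b by (intro suminf_le) (auto simp: nn_integral_eq_integral ennreal_leI)
 also have "... = ennreal (\<Sum>n. (1/2)^n)" by (intro suminf_ennreal2 summable_geometric) auto
 also have "... < \<infinity>" by simp
 finally have "AE x in M. (\<Sum>n. ennreal (abs (X (Suc n) x - X n x))) ~= \<infinity>" by (intro nn_integral_PInf_AE) auto
 then show ?thesis
 proof eventually_elim
  case (elim x)
  have "summable (%n. abs (X (Suc n) x - X n x))" by (rule summable_suminf_not_top) (use elim in \<open>simp_all add: infinity_ennreal_def\<close>)
  then show ?case by (rule summable_diff_convergent[OF summable_rabs_cancel])
 qed
qed

context elliptic_chain
begin

text \<open>The tails \<open>t N\<close> are formed from moments under \<open>P\<close>, and
  \<open>var_bound\<close> transfers them to every law. One fast subsequence therefore works for all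
  laws simultaneously, and its pointwise limit is a single function that does not know the starting
  point.\<close>

lemma centred_limit:
 assumes P: "chain_law P" and M: "3 <= M" and h: "!!n. M <= n ==> pmeas n (h n)" and hb: "!!n x y. abs (h n x y) <= C"
  and s: "summable (%n. if n : {M..} then Ex P n (%x y. (h n x y)^2) else 0)"
 obtains L where "L : borel_measurable paths"
  "!!Q xi. chain_law Q ==> (%N. (LINT w|Q. cmod (cis (xi * (\<Sum>n=M..N. st h n w - Ex P n (h n))) - cis (xi * L w)))) ----> 0"
proof -
 define s where "s n = (if n : {M..} then Ex P n (%x y. (h n x y)^2) else 0)" for n
 have s0: "0 <= s n" for n by (simp add: s_def Ex_def)
 have ss: "summable s" using assms(5) unfolding s_def .
 define t where "t N = (\<Sum>n. s (n + N))" for N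
 have t0: "0 <= t N" for N unfolding t_def using ss s0 by (intro suminf_nonneg) (auto simp: summable_iff_shift)
 have tl: "t ----> 0" unfolding t_def by (rule suminf_exist_split2[OF ss])
 have tm: "(\<Sum>n=N..k. s n) <= t N" for N k
 proof -
  have "(\<Sum>n=N..k. s n) = (\<Sum>n<Suc k - N. s (n + N))" by (rule sum.reindex_bij_witness[of _ "%n. n + N" "%n. n - N"]) auto
  also have "... <= t N" unfolding t_def using ss s0 by (intro sum_le_suminf) (auto simp: summable_iff_shift)
  finally show ?thesis .
 qed
 define H where "H N w = (\<Sum>n=M..N. st h n w - Ex P n (h n))" for N w
 have Hm [measurable]: "H N : borel_measurable paths" for N unfolding H_def using M h by (intro borel_measurable_sum borel_measurable_diff borel_measurable_const pmeas_path) auto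
 have Exb: "abs (Ex P n (h n)) <= C" if "n >= M" for n
 proof -
  interpret P: prob_space P using chain_lawD[OF P] by simp
  have "(%w. st h n w) : borel_measurable paths" using M h that by (intro pmeas_path) auto
  then have "integrable P (%w. st h n w)" using hb by (intro law_integrable[OF P, where C=C]) auto
  then show ?thesis unfolding Ex_def using hb by (intro order_trans[OF integral_abs_bound P.integral_le_const]) auto
 qed
 have Hb: "abs (H N w) <= real (Suc N) * (2 * C)" for N w
 proof -
  have C0: "0 <= C" using hb[of 0] order_trans abs_ge_zero by blast
  have "abs (H N w) <= (\<Sum>n=M..N. 2 * C)" unfolding H_def
  proof (intro order_trans[OF sum_abs sum_mono])
   fix n assume "n : {M..N}"
   then show "abs (h n (w n) (w (Suc n)) - Ex P n (h n)) <= 2 * C" using hb[of n "w n" "w (Suc n)"] Exb[of n] by auto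
  qed
  also have "... <= real (Suc N) * (2 * C)" using C0 by (simp add: mult_right_mono)
  finally show ?thesis .
 qed
 have Hi: "integrable Q (H N)" "integrable Q (%w. H N w - H k w)" "integrable Q (%w. (H N w - H k w)^2)" if Q: "chain_law Q" for Q N k
 proof -
  have 1: "integrable Q (H N)" for N using Hb by (intro law_integrable[OF Q Hm, where C="real (Suc N) * (2 * C)"]) auto
  show "integrable Q (H N)" "integrable Q (%w. H N w - H k w)" using 1 by auto
  show "integrable Q (%w. (H N w - H k w)^2)"
  proof (rule law_integrable[OF Q, where C="(real (Suc N) * (2 * C) + real (Suc k) * (2 * C))^2"])
   show "norm ((H N w - H k w)^2) <= (real (Suc N) * (2 * C) + real (Suc k) * (2 * C))^2" for w using Hb[of N w] Hb[of k w] by (simp add: abs_le_square_iff_D)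
  qed measurable
 qed
 have L2: "(LINT w|Q. abs (H k w - H N w)) <= sqrt (cvar * t N)" if Q: "chain_law Q" and N: "N <= k" for Q N k
 proof -
  interpret Q: prob_space Q using chain_lawD[OF Q] by simp
  let ?m = "max M (Suc N)"
  have "H k w - H N w = (\<Sum>n=?m..k. st h n w - Ex P n (h n))" for w
  proof -
   have "{M..k} = {M..N} \<union> {?m..k}" "{M..N} \<inter> {?m..k} = {}" using N by auto
   then show ?thesis unfolding H_def by (simp add: sum.union_disjoint)
  qed
  then have "(LINT w|Q. (H k w - H N w)^2) <= cvar * (\<Sum>n=?m..k. Ex P n (%x y. (h n x y)^2))" using var_bound[OF P Q, of ?m k h "%_. C"] M h hb by simp
  also have "(\<Sum>n=?m..k. Ex P n (%x y. (h n x y)^2)) = (\<Sum>n=?m..k. s n)" by (intro sum.cong) (auto simp: s_def)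
  also have "... <= (\<Sum>n=N..k. s n)" using s0 by (intro sum_mono2) auto
  also have "... <= t N" by (rule tm)
  finally have "(LINT w|Q. (H k w - H N w)^2) <= cvar * t N" using cvar_nonneg by (simp add: mult_left_mono)
  then show ?thesis using Hi[OF Q] by (intro Q.integral_abs_le_sqrt) auto
 qed
 have "\<exists>N\<ge>i. \<forall>k\<ge>N. cvar * t k <= (1/4)^i" for i :: nat
 proof -
  have "(%N. cvar * t N) ----> cvar * 0" by (intro tendsto_intros tl)
  then have "\<forall>\<^sub>F N in sequentially. cvar * t N < (1/4)^i" by (intro order_tendstoD(2)) auto
  then obtain N where "!!k. k >= N ==> cvar * t k < (1/4)^i" unfolding eventually_sequentially by blast
  then show ?thesis by (intro exI[of _ "max i N"]) (auto intro: less_imp_le)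
 qed
 then obtain r where r: "!!i. r i >= i" "!!i k. k >= r i ==> cvar * t k <= (1/4)^i" by metis
 \<comment> \<open>Partial sums make the indices monotone and still at least
   \<open>r i\<close>.\<close>
 define rh where "rh i = (\<Sum>j\<le>i. r j)" for i :: nat
 have rh: "rh i >= r i" "rh i <= rh (Suc i)" "rh i >= i" for i
 proof -
  show "rh i >= r i" unfolding rh_def by (rule member_le_sum) auto
  then show "rh i >= i" using r(1)[of i] by linarith
  show "rh i <= rh (Suc i)" by (simp add: rh_def)
 qed
 \<comment> \<open>\<open>lim\<close> is measurable also where the subsequence diverges; under each
   chain law that set is null.\<close>
 define L where "L w = lim (%i. H (rh i) w)" for w
 have Lm [measurable]: "L : borel_measurable paths" unfolding L_def by (rule borel_measurable_lim_metric) measurable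
 have lim: "(%N. (LINT w|Q. cmod (cis (xi * H N w) - cis (xi * L w)))) ----> 0" if Q: "chain_law Q" for Q xi
 proof -
  interpret Q: prob_space Q using chain_lawD[OF Q] by simp
  note [measurable_cong] = chain_lawD(2)[OF Q]
  have "AE w in Q. convergent (%i. H (rh i) w)"
  proof (rule Q.fast_cauchy_AE_convergent)
   show "(LINT w|Q. abs (H (rh (Suc n)) w - H (rh n) w)) <= (1/2)^n" for n
   proof -
    have "(LINT w|Q. abs (H (rh (Suc n)) w - H (rh n) w)) <= sqrt (cvar * t (rh n))" by (intro L2 Q rh)
    also have "... <= sqrt ((1/4)^n)" using r(2)[OF rh(1)] by simp
    also have "... = (1/2)^n" by (rule real_sqrt_unique) (auto simp: power_mult_distrib[symmetric] power2_eq_square)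
    finally show ?thesis .
   qed
  qed (intro Hi Q)
  then have conv: "AE w in Q. (%i. H (rh i) w) ----> L w" by eventually_elim (simp add: L_def convergent_LIMSEQ_iff)
  have le: "(LINT w|Q. cmod (cis (xi * H N w) - cis (xi * L w))) <= abs xi * sqrt (cvar * t N)" for N
  proof (rule tendsto_upperbound)
   show "(%i. (LINT w|Q. cmod (cis (xi * H N w) - cis (xi * H (rh i) w)))) ----> (LINT w|Q. cmod (cis (xi * H N w) - cis (xi * L w)))"
   proof (rule integral_dominated_convergence[where w="%_. 2"])
    show "AE w in Q. (%i. cmod (cis (xi * H N w) - cis (xi * H (rh i) w))) ----> cmod (cis (xi * H N w) - cis (xi * L w))" using conv
    proof eventually_elim
     case (elim w)
     have "isCont cis x" for x using continuous_on_cis[OF continuous_on_id, of UNIV] by (simp add: continuous_on_eq_continuous_at)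
     then show ?case by (intro tendsto_intros isCont_tendsto_compose[of _ cis] elim)
    qed
    show "AE w in Q. norm (cmod (cis (xi * H N w) - cis (xi * H (rh i) w))) <= 2" for i
    proof (rule AE_I2)
     show "norm (cmod (cis (xi * H N w) - cis (xi * H (rh i) w))) <= 2" for w using norm_triangle_ineq4[of "cis (xi * H N w)" "cis (xi * H (rh i) w)"] by simp
    qed
   qed measurable
   show "\<forall>\<^sub>F i in sequentially. (LINT w|Q. cmod (cis (xi * H N w) - cis (xi * H (rh i) w))) <= abs xi * sqrt (cvar * t N)" using eventually_ge_at_top[of N]
   proof eventually_elim
    case (elim i)
    have "(LINT w|Q. cmod (cis (xi * H N w) - cis (xi * H (rh i) w))) <= (LINT w|Q. abs xi * abs (H (rh i) w - H N w))"
    proof (rule integral_mono')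
     show "cmod (cis (xi * H N w) - cis (xi * H (rh i) w)) <= abs xi * abs (H (rh i) w - H N w)" for w using cis_diff_le[of "xi * H N w" "xi * H (rh i) w"] by (simp add: right_diff_distrib[symmetric] abs_mult abs_minus_commute)
    qed (use Hi[OF Q] in auto)
    also have "... = abs xi * (LINT w|Q. abs (H (rh i) w - H N w))" by simp
    also have "... <= abs xi * sqrt (cvar * t N)" using L2[OF Q, of N "rh i"] rh(3)[of i] elim by (intro mult_left_mono) auto
    finally show ?case .
   qed
  qed auto
  have "(%N. abs xi * sqrt (cvar * t N)) ----> abs xi * sqrt (cvar * 0)" by (intro tendsto_intros tl)
  then have l: "(%N. abs xi * sqrt (cvar * t N)) ----> 0" by simp
  show ?thesis
  proof (rule Lim_null_comparison[OF always_eventually l], rule allI)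
   have "0 <= (LINT w|Q. cmod (cis (xi * H N w) - cis (xi * L w)))" for N by (rule Bochner_Integration.integral_nonneg) simp
   then show "norm (LINT w|Q. cmod (cis (xi * H N w) - cis (xi * L w))) <= abs xi * sqrt (cvar * t N)" for N using le by simp
  qed
 qed
 show thesis using Lm lim unfolding H_def by (rule that)
qed

text \<open>Summing the identity of \<open>reduction\<close>, the gradient telescopes. At the
  resonant frequencies there remain the end term \<open>a (Suc N)\<close>, constants and the
  convergent centred series of \<open>h\<close>; the initial term \<open>a 7\<close> is moved into
  the limit.\<close>

theorem lattice_structure:
 assumes P: "chain_law P" and f: "addf f" and b: "!!N. DD f (2 * pi / dl) N <= d" and dl: "dl > 0"
 obtains a c L where "!!n. n >= 3 ==> a n : borel_measurable (B n)" "L : borel_measurable paths"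
  "!!Q k. chain_law Q ==> (%N. (LINT w|Q. cmod (cis (fq dl k * (Sm f 7 N w - a (Suc N) (w (Suc N)) - c N))
     - cis (fq dl k * L w)))) ----> 0"
proof -
 let ?x = "2 * pi / dl"
 have x: "?x ~= 0" using dl by simp
 obtain a h C where am: "!!n. n >= 3 ==> a n : borel_measurable (B n)"
  and hm: "!!n. n >= 3 ==> pmeas n (h n)" and hb: "!!n x y. abs (h n x y) <= pi / abs ?x"
  and hs: "summable (%n. if n : {7..} then Ex P n (%x y. (h n x y)^2) else 0)"
  and red: "!!n x y. n >= 3 ==> cis (?x * (f n x y - h n x y - a (Suc n) y + a n x - C n)) = 1" by (rule reduction[OF P f b x]) (rule that; (blast | simp))
 obtain H where Hm [measurable]: "H : borel_measurable paths"
  and H: "!!Q xi. chain_law Q ==> (%N. (LINT w|Q. cmod (cis (xi * (\<Sum>n=7..N. st h n w - Ex P n (h n))) - cis (xi * H w)))) ----> 0"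
 proof (rule centred_limit[OF P _ _ hb hs])
  fix L assume "L : borel_measurable paths"
  "!!Q xi. chain_law Q ==> (%N. (LINT w|Q. cmod (cis (xi * (\<Sum>n=7..N. st h n w - Ex P n (h n))) - cis (xi * L w)))) ----> 0"
  then show thesis by (rule that)
 qed (use hm in auto)
 define c where "c N = (\<Sum>n=7..N. C n + Ex P n (h n))" for N
 have cis1: "cis (?x * of_int k * y) = 1" if "cis (?x * y) = 1" for y and k :: int
 proof -
  have "?x * of_int k * y = of_int k * (?x * y)" by simp
  then have "cis (?x * of_int k * y) = cis (?x * y) powi k" by (simp only: cis_power_int)
  then show ?thesis using that by simp
 qed
 have eq: "cis (?x * of_int k * (Sm f 7 N w - a (Suc N) (w (Suc N)) - c N)) =
   cis (?x * of_int k * (\<Sum>n=7..N. st h n w - Ex P n (h n))) * cis (- (?x * of_int k * a 7 (w 7)))"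
  if N: "N >= 6" for N w and k :: int
 proof -
  define X where "X = ?x * of_int k"
  define g where "g n = st f n w - st h n w - a (Suc n) (w (Suc n)) + a n (w n) - C n" for n
  have "(\<Sum>n=7..N. a (Suc n) (w (Suc n)) - a n (w n)) = a (Suc N) (w (Suc N)) - a 7 (w 7)" using sum_Suc_diff[of 7 N "%n. a n (w n)"] N by simp
  moreover have "(\<Sum>n=7..N. g n) = Sm f 7 N w - (\<Sum>n=7..N. st h n w) - (\<Sum>n=7..N. a (Suc n) (w (Suc n)) - a n (w n)) - (\<Sum>n=7..N. C n)" unfolding g_def by (simp add: sum.distrib sum_subtractf)
  ultimately have "Sm f 7 N w - a (Suc N) (w (Suc N)) - c N = (\<Sum>n=7..N. g n) + ((\<Sum>n=7..N. st h n w - Ex P n (h n)) - a 7 (w 7))" by (simp add: c_def sum.distrib sum_subtractf)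
  moreover have "cis (X * (\<Sum>n=7..N. g n)) = 1"
  proof (induction N)
   case (Suc N)
   have "cis (X * g (Suc N)) = 1" if "7 <= Suc N" unfolding X_def g_def by (rule cis1[OF red]) (use that in simp)
   then show ?case using Suc by (auto simp: distrib_left cis_mult[symmetric])
  qed simp
  moreover have "cis (X * (u + (v - wt))) = cis (X * v) * cis (- (X * wt))" if "cis (X * u) = 1" for u v wt using that unfolding distrib_left right_diff_distrib diff_conv_add_uminus cis_mult[symmetric] by simp
  ultimately show ?thesis unfolding X_def[symmetric] by simp
 qed
 have a7 [measurable]: "(%w. a 7 (w 7)) : borel_measurable paths" by (rule measurable_compose[OF coord am]) auto
 show thesis
 proof (rule that[of a "%w. H w - a 7 (w 7)" c])
  fix Q and k :: int assume Q: "chain_law Q"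
  show "(%N. (LINT w|Q. cmod (cis (?x * of_int k * (Sm f 7 N w - a (Suc N) (w (Suc N)) - c N))
     - cis (?x * of_int k * (H w - a 7 (w 7)))))) ----> 0"
  proof (rule Lim_transform_eventually[OF H[OF Q, of "?x * of_int k"]])
   show "\<forall>\<^sub>F N in sequentially. (LINT w|Q. cmod (cis (?x * of_int k * (\<Sum>n=7..N. st h n w - Ex P n (h n))) - cis (?x * of_int k * H w)))
     = (LINT w|Q. cmod (cis (?x * of_int k * (Sm f 7 N w - a (Suc N) (w (Suc N)) - c N)) - cis (?x * of_int k * (H w - a 7 (w 7)))))" using eventually_ge_at_top[of 6]
   proof eventually_elim
    case (elim N)
    have c: "cmod (u * cis t - v * cis t) = cmod (u - v)" for u v t unfolding left_diff_distrib[symmetric] norm_mult by simp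
    have "cis (?x * of_int k * (H w - a 7 (w 7))) = cis (?x * of_int k * H w) * cis (- (?x * of_int k * a 7 (w 7)))" for w by (simp add: cis_mult right_diff_distrib)
    then show ?case unfolding eq[OF elim] by (simp only: c)
   qed
  qed
 qed (use am in auto)
qed

end

lemma isCont_cis: "isCont cis x" using continuous_on_cis[OF continuous_on_id, of UNIV] by (simp add: continuous_on_eq_continuous_at)

lemma tendsto_cis: "(g \<longlongrightarrow> l) F ==> ((%x. cis (g x)) \<longlongrightarrow> cis l) F" by (rule isCont_tendsto_compose[OF isCont_cis])

section \<open>Local limit theorem\<close>

text \<open>\<open>R\<close> stands for the summands at times 1 and 2, of which only the dependence
  on the first three coordinates is known. \<open>u\<close> is the indicator of the conditioning
  event and \<open>b\<close> the correction, both functions of the last state. \<open>tight\<close>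
  and \<open>loose\<close> together say that the multiples of 2 pi / dl are the only resonant
  frequencies.\<close>

locale local_limit = elliptic_chain B mu p eps
 for B :: "nat => 'a measure" and mu p eps +
 fixes f :: "nat => 'a => 'a => real" and K :: real and P Q :: "(nat => 'a) measure"
  and R :: "(nat => 'a) => real" and dl z0 c0 :: real and d :: "int => real" and F :: "(nat => 'a) => real"
  and sg z :: "nat => real" and b u :: "nat => 'a => real"
 assumes f: "addf f" and K: "!!n x y. abs (f n x y) <= K" "K > 0" and P: "chain_law P" and Q: "chain_law Q"
  and R: "adapted 3 R" and dl: "dl > 0"
  and tight: "!!k N. DD f (fq dl k) N <= d k"
  and loose: "!!xi. (!!k::int. xi ~= (fq dl k)) ==> filterlim (DD f xi) at_top sequentially"
  and bm: "!!N. b N : borel_measurable (B (Suc N))" and b: "!!N y. abs (b N y) <= dl"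
  and um: "!!N. u N : borel_measurable (B (Suc N))" and u: "!!N y. 0 <= u N y & u N y <= 1"
  and c0: "c0 > 0" "!!N. N >= 1 ==> c0 <= (LINT w|P. u N (w (Suc N)))"
  and sg: "filterlim sg at_top sequentially" and Vr: "!!m. m >= 3 ==> (%N. Vr P f m N / (sg N)^2) ----> 1"
  and mean: "!!m. m >= 3 ==> (%N. (z N - (LINT w|P. Sm f m N w)) / sg N) ----> z0"
  and Fm: "F : borel_measurable paths"
  and lattice: "!!k::int. (%N. (LINT w|Q. cmod (cis (fq dl k * (R w + Sm f 3 N w - z N - b N (w (Suc N)))) - cis (fq dl k * F w)))) ----> 0"
begin

sublocale Q: prob_space Q using chain_lawD[OF Q] by simp
sublocale P: prob_space P using chain_lawD[OF P] by simp

definition Y :: "nat => (nat => 'a) => real" where "Y N w = R w + Sm f 3 N w - z N - b N (w (Suc N))"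

definition Psi :: "nat => real => complex" where "Psi N xi = (LINT w|Q. cis (xi * Y N w) * of_real (u N (w (Suc N))))"

definition pr :: "nat => real" where "pr N = (LINT w|P. u N (w (Suc N)))"

definition EF :: "int => complex" where "EF k = (LINT w|Q. cis (fq dl k * F w))"

lemma u_path [measurable]: "(%w. u N (w (Suc N))) : borel_measurable paths" using measurable_compose[OF coord um] by simp

lemma adapted_Y: "adapted (max 3 (Suc N)) (Y N)" unfolding Y_def[abs_def] using R bm f by (intro adapted_diff adapted_add adapted_const adapted_mono[OF R] adapted_Sm adapted_coord) auto

lemma Y_measurable [measurable]: "Y N : borel_measurable paths" by (rule adapted_measurable[OF adapted_Y])

lemma Psi_norm: "cmod (Psi N xi) <= 1"
proof -
 have "cmod (Psi N xi) <= (LINT w|Q. 1)" unfolding Psi_def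
 proof (rule order_trans[OF integral_norm_bound integral_mono'])
  show "cmod (cis (xi * Y N w) * of_real (u N (w (Suc N)))) <= 1" for w using u[of N "w (Suc N)"] by (simp add: norm_mult)
 qed auto
 then show ?thesis by (simp add: Q.prob_space)
qed

lemma pr_le: "0 <= pr N" "pr N <= 1"
proof -
 have "integrable P (%w. u N (w (Suc N)))" by (rule law_integrable[OF P u_path, where C=1]) (use u in auto)
 then show "0 <= pr N" "pr N <= 1" unfolding pr_def using P.integral_between[of "%w. u N (w (Suc N))" 0 1] u by auto
qed

lemma Psi_decay:
 assumes "N >= 3"
 shows "cmod (Psi N xi) <= exp (- cdec * DD f xi N)"
proof -
 have eq: "cis (xi * Y N w) * of_real (u N (w (Suc N))) =
   cis (xi * R w) * cis (xi * Sm f 3 N w) * (cis (- xi * (z N + b N (w (Suc N)))) * of_real (u N (w (Suc N))))" for w unfolding mult.assoc[symmetric] cis_mult by (simp add: Y_def algebra_simps)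
 note bm[measurable] um[measurable]
 show ?thesis unfolding Psi_def eq
 proof (rule char_bound[OF Q f assms])
  show "adapted 3 (%w. cis (xi * R w))" using R by (rule adapted_compose[where h="%x. cis (xi * x)"]) measurable
  show "(%y. cis (- xi * (z N + b N y)) * of_real (u N y)) : borel_measurable (B (Suc N))" by measurable
  show "cmod (cis (- xi * (z N + b N y)) * of_real (u N y)) <= 1" for y using u[of N y] by (simp add: norm_mult)
 qed simp
qed

lemma lattice_Y: "(%N. (LINT w|Q. cmod (cis (fq dl k * Y N w) - cis (fq dl k * F w)))) ----> 0" using lattice[of k] unfolding Y_def .

lemma product_diff:
 fixes X X' W W' :: "(nat => 'a) => complex"
 assumes [measurable]: "X : borel_measurable paths" "X' : borel_measurable paths" "W : borel_measurable paths" "W' : borel_measurable paths"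
  and n: "!!w. cmod (X w) <= 1" "!!w. cmod (X' w) <= 1" "!!w. cmod (W w) <= 1" "!!w. cmod (W' w) <= 1"
 shows "cmod ((LINT w|Q. X w * W w * of_real (u N (w (Suc N)))) - (LINT w|Q. X' w * W' w * of_real (u N (w (Suc N)))))
   <= (LINT w|Q. cmod (X w - X' w)) + (LINT w|Q. cmod (W w - W' w))"
proof -
 have prod1: "cmod (x * wt * of_real (u N y)) <= 1" if "cmod x <= 1" "cmod wt <= 1" for x wt y using that u[of N y] mult_mono[OF mult_mono[OF that], of "u N y" 1] by (simp add: norm_mult)
 have d2: "cmod (x - y) <= 2" if "cmod x <= 1" "cmod y <= 1" for x y using norm_triangle_ineq4[of x y] that by linarith
 have i: "integrable Q (%w. X w * W w * of_real (u N (w (Suc N))))" "integrable Q (%w. X' w * W' w * of_real (u N (w (Suc N))))" by (rule law_integrable[OF Q _ prod1]; use n in \<open>simp; measurable?\<close>)+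
 have i2: "integrable Q (%w. cmod (X w - X' w))" "integrable Q (%w. cmod (W w - W' w))" by (rule integrable_norm, rule law_integrable[OF Q _ d2]; use n in \<open>simp; measurable?\<close>)+
 have "cmod (LINT w|Q. X w * W w * of_real (u N (w (Suc N))) - X' w * W' w * of_real (u N (w (Suc N))))
   <= (LINT w|Q. cmod (X w - X' w) + cmod (W w - W' w))"
 proof (rule order_trans[OF integral_norm_bound integral_mono'])
  show "cmod (X w * W w * of_real (u N (w (Suc N))) - X' w * W' w * of_real (u N (w (Suc N)))) <= cmod (X w - X' w) + cmod (W w - W' w)" for w
  proof -
   have "cmod (X w * W w - X' w * W' w) <= cmod (X w - X' w) + cmod (W w - W' w)"
   proof -
    have "X w * W w - X' w * W' w = (X w - X' w) * W w + X' w * (W w - W' w)" by (simp add: algebra_simps)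
    moreover have "cmod ((X w - X' w) * W w) <= cmod (X w - X' w) * 1" unfolding norm_mult using n by (intro mult_left_mono) auto
    moreover have "cmod (X' w * (W w - W' w)) <= 1 * cmod (W w - W' w)" unfolding norm_mult using n by (intro mult_right_mono) auto
    ultimately show ?thesis using norm_triangle_ineq[of "(X w - X' w) * W w" "X' w * (W w - W' w)"] by simp
   qed
   moreover have "cmod (X w * W w - X' w * W' w) * u N (w (Suc N)) <= cmod (X w * W w - X' w * W' w) * 1" using u by (intro mult_left_mono) auto
   ultimately show ?thesis unfolding left_diff_distrib[symmetric] norm_mult using u[of N "w (Suc N)"] by simp
  qed
 qed (use i2 in auto)
 then show ?thesis using i i2 by simp
qed

text \<open>At a resonant frequency the unimodular factor of \<open>Y N\<close> converges in mean,
  so it can be frozen at a fixed index n with small error. Frozen, it depends on finitely many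
  coordinates and can be the past factor of \<open>clt\<close>. What is left over in the exponent
  has a deterministic limit because \<open>sg N\<close> tends to infinity.\<close>

lemma Psi_limit:
 "(%N. Psi N (fq dl k + s / sg N) - of_real (exp (- (s^2) / 2)) * cis (- s * z0) * EF k * of_real (pr N)) ----> 0"
  (is "?D ----> 0")
proof (rule tendstoI)
 fix e :: real assume e: "e > 0"
 let ?x = "(fq dl k)"
 note [measurable_cong] = chain_lawD(2)[OF Q]
 note Fm [measurable] bm [measurable]
 define e1 where "e1 N = (LINT w|Q. cmod (cis (?x * Y N w) - cis (?x * F w)))" for N
 have e1: "e1 ----> 0" unfolding e1_def by (rule lattice_Y)
 then have "\<forall>\<^sub>F N in sequentially. e1 N < e / 5" using e by (intro order_tendstoD(2)) auto
 then have "\<forall>\<^sub>F N in sequentially. N >= 2 & e1 N < e / 5" using eventually_ge_at_top[of 2] by eventually_elim auto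
 then obtain n where n: "n >= 2" "e1 n < e / 5" using eventually_happens by force
 define m where "m = Suc n"
 have m: "m >= 3" using n by (simp add: m_def)
 define G where "G w = cis (?x * Y n w)" for w
 have aY: "adapted m (Y n)" using adapted_Y[of n] n by (simp add: m_def max_def split: if_splits)
 have aG: "adapted m G" unfolding G_def using aY by (rule adapted_compose[where h="%x. cis (?x * x)"]) measurable
 have G1: "cmod (G w) <= 1" for w by (simp add: G_def)
 have Gm [measurable]: "G : borel_measurable paths" by (rule adapted_measurable[OF aG])
 define E where "E N = (LINT w|P. Sm f m N w)" for N
 \<comment> \<open>Everything in the rescaled exponent besides the centred sum from m on: initial
   terms and end correction, which vanish after scaling, and the displacement of \<open>z N\<close>
   from the mean, which tends to \<open>z0\<close>.\<close>
 define rem where "rem N w = s * ((R w + Sm f 3 n w - b N (w (Suc N))) / sg N - (z N - E N) / sg N)" for N w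
 have S3 [measurable]: "Sm f 3 N : borel_measurable paths" "Sm f m N : borel_measurable paths" for N using Sm_measurable[OF f] m by auto
 have Rm [measurable]: "R : borel_measurable paths" by (rule adapted_measurable[OF R])
 have bp [measurable]: "(%w. b N (w (Suc N))) : borel_measurable paths" for N by (rule measurable_compose[OF coord bm]) simp
 have remm [measurable]: "rem N : borel_measurable paths" for N unfolding rem_def by measurable
 have rlim: "(%N. rem N w) ----> - s * z0" for w
 proof -
  have inv: "(%N. 1 / sg N) ----> 0" using tendsto_divide_0[OF tendsto_const sg[THEN filterlim_at_top_imp_at_infinity]] .
  have "(%N. (R w + Sm f 3 n w - b N (w (Suc N))) / sg N) ----> 0"
  proof (rule Lim_null_comparison)
   show "\<forall>\<^sub>F N in sequentially. norm ((R w + Sm f 3 n w - b N (w (Suc N))) / sg N) <= (abs (R w + Sm f 3 n w) + dl) * abs (1 / sg N)"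
   proof (rule always_eventually, rule allI)
    fix N show "norm ((R w + Sm f 3 n w - b N (w (Suc N))) / sg N) <= (abs (R w + Sm f 3 n w) + dl) * abs (1 / sg N)" unfolding real_norm_def divide_inverse[of _ "sg N"] abs_mult using b[of N "w (Suc N)"] by (intro mult_mono) auto
   qed
   show "(%N. (abs (R w + Sm f 3 n w) + dl) * abs (1 / sg N)) ----> 0" using tendsto_mult_left[OF tendsto_rabs_zero[OF inv], of "abs (R w + Sm f 3 n w) + dl"] by simp
  qed
  then have "(%N. rem N w) ----> s * (0 - z0)" unfolding rem_def E_def by (intro tendsto_intros mean m)
  then show ?thesis by simp
 qed
 define e2 where "e2 N = (LINT w|Q. cmod (cis (rem N w) - cis (- s * z0)))" for N
 have e2: "e2 ----> 0"
 proof -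
  have "e2 ----> (LINT w|Q. 0)" unfolding e2_def
  proof (rule integral_dominated_convergence[where w="%_. 2"])
   show "AE w in Q. (%N. cmod (cis (rem N w) - cis (- s * z0))) ----> 0" using tendsto_norm_zero[OF LIM_zero[OF tendsto_cis[OF rlim]]] by simp
   show "AE w in Q. norm (cmod (cis (rem N w) - cis (- s * z0))) <= 2" for N
   proof (rule AE_I2)
    show "norm (cmod (cis (rem N w) - cis (- s * z0))) <= 2" for w using norm_triangle_ineq4[of "cis (rem N w)" "cis (- s * z0)"] by simp
   qed
  qed measurable
  then show ?thesis by simp
 qed
 define e3 where "e3 N = (LINT w|Q. G w * cis (s / sg N * (Sm f m N w - E N)) * of_real (u N (w (Suc N))))
   - of_real (exp (- (s^2) / 2)) * (LINT w|Q. G w) * of_real (pr N)" for N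
 have e3: "e3 ----> 0" unfolding e3_def E_def pr_def by (rule clt[OF f K(1) P Q m aG G1 um _ sg Vr[OF m]]) (use u in auto)
 have main: "cmod (?D N) <= (e1 N + e1 n) + e2 N + cmod (e3 N) + e1 n" if N: "N >= m" for N
 proof -
  define W where "W w = cis (s / sg N * Y N w)" for w
  define W' where "W' w = cis (s / sg N * (Sm f m N w - E N)) * cis (- s * z0)" for w
  have [measurable]: "W : borel_measurable paths" "W' : borel_measurable paths" unfolding W_def W'_def by measurable
  have "Psi N (?x + s / sg N) = (LINT w|Q. cis (?x * Y N w) * W w * of_real (u N (w (Suc N))))" unfolding Psi_def W_def by (simp add: cis_mult distrib_right)
  then have "cmod (Psi N (?x + s / sg N) - (LINT w|Q. G w * W' w * of_real (u N (w (Suc N)))))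
    <= (LINT w|Q. cmod (cis (?x * Y N w) - G w)) + (LINT w|Q. cmod (W w - W' w))" using G1 by (auto intro!: product_diff simp: W_def W'_def norm_mult)
  also have "(LINT w|Q. cmod (cis (?x * Y N w) - G w)) <= (LINT w|Q. cmod (cis (?x * Y N w) - cis (?x * F w)) + cmod (cis (?x * Y n w) - cis (?x * F w)))"
  proof (rule integral_mono')
   have d2: "cmod (cis x - cis y) <= 2" for x y using norm_triangle_ineq4[of "cis x" "cis y"] by simp
   show "integrable Q (%w. cmod (cis (?x * Y N w) - cis (?x * F w)) + cmod (cis (?x * Y n w) - cis (?x * F w)))" by (intro Bochner_Integration.integrable_add integrable_norm law_integrable[OF Q _ d2]) measurable
   show "cmod (cis (?x * Y N w) - G w) <= cmod (cis (?x * Y N w) - cis (?x * F w)) + cmod (cis (?x * Y n w) - cis (?x * F w))" for w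
    unfolding G_def using norm_triangle_ineq4[of "cis (?x * Y N w) - cis (?x * F w)" "cis (?x * Y n w) - cis (?x * F w)"] by simp
  qed auto
  also have "... = e1 N + e1 n"
  proof -
   have d2: "cmod (cis x - cis y) <= 2" for x y using norm_triangle_ineq4[of "cis x" "cis y"] by simp
   have "integrable Q (%w. cmod (cis (?x * Y j w) - cis (?x * F w)))" for j by (intro integrable_norm law_integrable[OF Q _ d2]) measurable
   then show ?thesis unfolding e1_def by simp
  qed
  also have "(LINT w|Q. cmod (W w - W' w)) = e2 N"
  proof -
   have "cmod (W w - W' w) = cmod (cis (rem N w) - cis (- s * z0))" for w
   proof -
    have "{3..N} = {3..n} \<union> {m..N}" using N n by (auto simp: m_def)
    then have "Sm f 3 N w = Sm f 3 n w + Sm f m N w" by (simp add: sum.union_disjoint m_def)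
    then have "s / sg N * Y N w = s / sg N * (Sm f m N w - E N) + rem N w" by (simp add: Y_def rem_def diff_divide_distrib add_divide_distrib algebra_simps)
    then have "W w - W' w = cis (s / sg N * (Sm f m N w - E N)) * (cis (rem N w) - cis (- s * z0))" unfolding W_def W'_def by (simp add: cis_mult[symmetric] right_diff_distrib)
    then show ?thesis by (simp add: norm_mult)
   qed
   then show ?thesis by (simp add: e2_def)
  qed
  finally have s1: "cmod (Psi N (?x + s / sg N) - (LINT w|Q. G w * W' w * of_real (u N (w (Suc N))))) <= e1 N + e1 n + e2 N" by simp
  have "(LINT w|Q. G w * W' w * of_real (u N (w (Suc N)))) = cis (- s * z0) * (LINT w|Q. G w * cis (s / sg N * (Sm f m N w - E N)) * of_real (u N (w (Suc N))))"
   unfolding W'_def integral_mult_right_zero[symmetric] by (intro Bochner_Integration.integral_cong refl) (simp add: mult_ac)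
  then have "(LINT w|Q. G w * W' w * of_real (u N (w (Suc N)))) - of_real (exp (- (s^2) / 2)) * cis (- s * z0) * (LINT w|Q. G w) * of_real (pr N) = cis (- s * z0) * e3 N" by (simp add: e3_def right_diff_distrib mult_ac)
  then have s2: "cmod ((LINT w|Q. G w * W' w * of_real (u N (w (Suc N)))) - of_real (exp (- (s^2) / 2)) * cis (- s * z0) * (LINT w|Q. G w) * of_real (pr N)) <= cmod (e3 N)" by (simp add: norm_mult)
  have s3: "cmod (of_real (exp (- (s^2) / 2)) * cis (- s * z0) * (LINT w|Q. G w) * of_real (pr N) - of_real (exp (- (s^2) / 2)) * cis (- s * z0) * EF k * of_real (pr N)) <= e1 n"
  proof -
   have iG: "integrable Q G" "integrable Q (%w. cis (?x * F w))" by (rule law_integrable[OF Q Gm G1], rule law_integrable[OF Q, where C=1]) auto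
   have "cmod ((LINT w|Q. G w) - EF k) <= e1 n" unfolding EF_def e1_def G_def[symmetric] using iG integral_norm_bound[of Q "%w. G w - cis (?x * F w)"] by simp
   moreover have "cmod (of_real (exp (- (s^2) / 2)) * cis (- s * z0) * of_real (pr N)) <= 1" using pr_le[of N] mult_mono[of "exp (- (s^2) / 2)" 1 "pr N" 1] by (simp add: norm_mult)
   moreover have "of_real (exp (- (s^2) / 2)) * cis (- s * z0) * (LINT w|Q. G w) * of_real (pr N) - of_real (exp (- (s^2) / 2)) * cis (- s * z0) * EF k * of_real (pr N)
     = of_real (exp (- (s^2) / 2)) * cis (- s * z0) * of_real (pr N) * ((LINT w|Q. G w) - EF k)" by (simp add: algebra_simps)
   ultimately show ?thesis using mult_mono[of "cmod (of_real (exp (- (s^2) / 2)) * cis (- s * z0) * of_real (pr N))" 1] by (simp add: norm_mult)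
  qed
  show ?thesis using norm_le_via[OF norm_le_via[OF s1 s2] s3] by simp
 qed
 have "\<forall>\<^sub>F N in sequentially. e1 N < e / 5" "\<forall>\<^sub>F N in sequentially. e2 N < e / 5" "\<forall>\<^sub>F N in sequentially. cmod (e3 N) < e / 5"
  using e by (intro order_tendstoD(2)[OF e1] order_tendstoD(2)[OF e2] order_tendstoD(2)[OF tendsto_norm_zero[OF e3]]; simp)+
 then show "\<forall>\<^sub>F N in sequentially. dist (?D N) 0 < e" using eventually_ge_at_top[of m]
 proof eventually_elim
  case (elim N)
  then show ?case using main[OF elim(4)] n(2) by simp
 qed
qed

end

section \<open>Fourier integrals away from and around the resonant frequencies\<close>

lemma integral_gauss:
 fixes v m :: real
 assumes v: "v > 0"
 shows "integrable lborel (%x. exp (- v * (x - m)^2))" "(LINT x|lborel. exp (- v * (x - m)^2)) = sqrt (pi / v)"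
proof -
 define t where "t = sqrt (1 / (2 * v))"
 have t: "t > 0" "t^2 = 1 / (2 * v)" using v by (auto simp: t_def)
 have eq: "exp (- v * (x - m)^2) = sqrt (pi / v) * normal_density m t x" for x unfolding normal_density_def t(2) using v by (simp add: field_simps)
 show "integrable lborel (%x. exp (- v * (x - m)^2))" "(LINT x|lborel. exp (- v * (x - m)^2)) = sqrt (pi / v)" unfolding eq using t by auto
qed

lemma integral_gauss_cis:
 "integrable lborel (%s. of_real (exp (- (s^2) / 2)) * cis (- s * z))"
 "(LINT s|lborel. of_real (exp (- (s^2) / 2)) * cis (- s * z)) = of_real (sqrt (2 * pi) * exp (- (z^2) / 2))"
proof -
 have m: "(%s. of_real (exp (- (s^2) / 2)) * cis (- s * z)) : borel_measurable lborel" by measurable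
 show "integrable lborel (%s. of_real (exp (- (s^2) / 2)) * cis (- s * z))"
 proof (rule Bochner_Integration.integrable_bound[OF integral_gauss(1)[of "1/2" 0] m])
  show "AE s in lborel. norm (of_real (exp (- (s^2) / 2)) * cis (- s * z)) <= norm (exp (- (1/2) * (s - 0)^2))" by (rule AE_I2) (simp only: norm_mult norm_cis norm_of_real real_norm_def, simp)
 qed simp
 have "char std_normal_distribution (- z) = (LINT s|lborel. std_normal_density s *\<^sub>R cis (- s * z))" unfolding char_def by (subst integral_density) (auto simp: cis_conv_exp mult_ac)
 also have "... = of_real (1 / sqrt (2 * pi)) * (LINT s|lborel. of_real (exp (- (s^2) / 2)) * cis (- s * z))" unfolding integral_mult_right_zero[symmetric]
  by (intro Bochner_Integration.integral_cong refl) (simp add: std_normal_density_def scaleR_conv_of_real)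
 finally show "(LINT s|lborel. of_real (exp (- (s^2) / 2)) * cis (- s * z)) = of_real (sqrt (2 * pi) * exp (- (z^2) / 2))" unfolding char_std_normal_distribution by (simp add: field_simps)
qed

context local_limit
begin

lemma Psi_measurable [measurable]: "Psi N : borel_measurable borel"
proof -
 note [measurable_cong] = chain_lawD(2)[OF Q]
 have "(%(xi, w). cis (xi * Y N w) * of_real (u N (w (Suc N)))) : borel_measurable (borel \<Otimes>\<^sub>M Q)" by measurable
 then show ?thesis unfolding Psi_def[abs_def] by (rule Q.borel_measurable_lebesgue_integral)
qed

lemma DD_quadratic:
 obtains c C where "c > 0" "C >= 0" "\<forall>\<^sub>F N in sequentially. sg N > 0 & (\<forall>s. abs s <= 1 / (2 * K) --> c * (s * sg N)^2 - C <= DD f s N)"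
proof -
 obtain c C where c: "c > 0" and C: "!!N s. abs s <= 1 / (2 * K) ==> c * s^2 * Vr P f 7 N - C <= DD f s N" using DD_lower[OF P f K] by blast
 have "\<forall>\<^sub>F N in sequentially. Vr P f 7 N / (sg N)^2 > 1 / 2" by (rule order_tendstoD(1)[OF Vr]) auto
 moreover have "\<forall>\<^sub>F N in sequentially. sg N > 0" using sg by (rule filterlim_at_top_dense[THEN iffD1, rule_format])
 ultimately have "\<forall>\<^sub>F N in sequentially. sg N > 0 & (\<forall>s. abs s <= 1 / (2 * K) --> c / 2 * (s * sg N)^2 - abs C <= DD f s N)"
 proof eventually_elim
  case (elim N)
  then have V: "(sg N)^2 / 2 <= Vr P f 7 N" by (simp add: field_simps)
  show ?case
  proof (intro conjI allI impI)
   fix s :: real assume s: "abs s <= 1 / (2 * K)"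
   have "c * s^2 * ((sg N)^2 / 2) <= c * s^2 * Vr P f 7 N" using c V by (intro mult_left_mono) auto
   then show "c / 2 * (s * sg N)^2 - abs C <= DD f s N" using C[OF s, of N] by (simp add: power_mult_distrib mult_ac)
  qed (use elim in simp)
 qed
 then show thesis using c by (intro that[of "c / 2" "abs C"]) auto
qed

text \<open>A Dini argument: if the minima stayed below Z, a limit point l of the minimizers would
  satisfy \<open>DD f l N <= Z\<close> for every N, by continuity in the frequency and monotonicity
  in N. This contradicts \<open>loose\<close>.\<close>

lemma DD_min_diverges:
 assumes J: "!!k::int. (fq dl k) \<notin> {al..be}" and x: "!!N. xi N : {al..be}"
  and m: "!!N t. t : {al..be} ==> DD f (xi N) N <= DD f t N"
 shows "filterlim (%N. DD f (xi N) N) at_top sequentially" unfolding filterlim_at_top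
proof (rule allI, rule ccontr)
 fix Z
 have mono: "DD f (xi N) N <= DD f (xi M) M" if "N <= M" for N M using m[of "xi M" N] x[of M] DD_mono[OF f that, of "xi M"] by simp
 assume "~ (\<forall>\<^sub>F N in sequentially. Z <= DD f (xi N) N)"
 then have lt: "DD f (xi N) N <= Z" for N unfolding eventually_sequentially using mono by (meson linear order_trans)
 obtain l r where l: "l : {al..be}" "strict_mono r" "(xi \<circ> r) ----> l"
 proof (rule seq_compactE[OF compact_imp_seq_compact[OF compact_Icc[of al be]]])
  show "\<forall>N. xi N : {al..be}" using x by blast
  fix l r assume "l : {al..be}" "strict_mono r" "(xi \<circ> r) ----> l"
  then show thesis by (rule that)
 qed
 have "DD f l N <= Z" for N
 proof (rule tendsto_upperbound)
  show "(%j. DD f ((xi \<circ> r) j) N) ----> DD f l N"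
   by (rule isCont_tendsto_compose[where g="%t. DD f t N", OF _ l(3)]) (use continuous_DD[OF f, of N] in \<open>simp add: continuous_on_eq_continuous_at\<close>)
  show "\<forall>\<^sub>F j in sequentially. DD f ((xi \<circ> r) j) N <= Z" using eventually_ge_at_top[of N]
  proof eventually_elim
   case (elim j)
   then have "N <= r j" using strict_mono_imp_increasing[OF l(2), of j] by linarith
   then show ?case using DD_mono[OF f, of N "r j" "xi (r j)"] lt[of "r j"] by simp
  qed
 qed auto
 moreover have "filterlim (DD f l) at_top sequentially" using l(1) J by (intro loose) auto
 then have "\<forall>\<^sub>F N in sequentially. DD f l N > Z" by (rule filterlim_at_top_dense[THEN iffD1, rule_format])
 ultimately show False using eventually_happens[of _ sequentially] by (fastforce simp: not_less[symmetric])
qed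

text \<open>The interval is short enough for the quadratic bound to hold for the difference of any
  two of its points. Around the minimizer this gives a Gaussian of width of order 1 /
  \<open>sg N\<close>, which cancels the factor \<open>sg N\<close>; a remaining factor,
  exponentially small in the minimum of \<open>DD\<close>, tends to 0.\<close>

lemma fourier_zero:
 fixes wt :: "real => real"
 assumes wt [measurable]: "wt : borel_measurable borel" and w1: "!!x. abs (wt x) <= 1" and w0: "!!x. x \<notin> {al..be} ==> wt x = 0"
  and J: "al <= be" "be - al <= 1 / (2 * K)" and k: "!!k::int. (fq dl k) \<notin> {al..be}"
 shows "(%N. of_real (sg N) * (LINT x|lborel. of_real (wt x) * Psi N x)) ----> 0"
proof -
 obtain c C where c: "c > 0" "C >= 0" and ev: "\<forall>\<^sub>F N in sequentially. sg N > 0 & (\<forall>s. abs s <= 1 / (2 * K) --> c * (s * sg N)^2 - C <= DD f s N)" using DD_quadratic by blast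
 have "\<exists>x\<in>{al..be}. \<forall>t\<in>{al..be}. DD f x N <= DD f t N" for N using J(1) by (intro continuous_attains_inf continuous_on_subset[OF continuous_DD[OF f]]) auto
 then obtain xi where xi: "!!N. xi N : {al..be}" "!!N t. t : {al..be} ==> DD f (xi N) N <= DD f t N" by metis
 define kp where "kp = cdec * c / 8"
 have kp: "kp > 0" using c cdec_pos by (simp add: kp_def)
 define A where "A = exp (cdec * C / 8) * sqrt (pi / kp)"
 have m: "filterlim (%N. DD f (xi N) N) at_top sequentially" by (rule DD_min_diverges[OF k xi])
 have lim: "(%N. A * exp (- (cdec / 2 * DD f (xi N) N))) ----> A * 0" using cdec_pos by (intro tendsto_intros filterlim_compose[OF exp_at_bot] filterlim_uminus_at_bot_at_top[THEN filterlim_compose]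
   filterlim_tendsto_pos_mult_at_top[OF tendsto_const _ m]) auto
 show ?thesis
 proof (rule Lim_null_comparison)
  show "(%N. A * exp (- (cdec / 2 * DD f (xi N) N))) ----> 0" using lim by simp
  show "\<forall>\<^sub>F N in sequentially. cmod (of_real (sg N) * (LINT x|lborel. of_real (wt x) * Psi N x)) <= A * exp (- (cdec / 2 * DD f (xi N) N))" using ev eventually_ge_at_top[of 3]
  proof eventually_elim
   case (elim N)
   let ?E = "exp (- (cdec / 2 * DD f (xi N) N)) * exp (cdec * C / 8)"
   have sg0: "sg N > 0" and q: "!!s. abs s <= 1 / (2 * K) ==> c * (s * sg N)^2 - C <= DD f s N" using elim by auto
   have v: "kp * (sg N)^2 > 0" using kp sg0 by simp
   have pt: "cmod (of_real (wt x) * Psi N x) <= ?E * exp (- (kp * (sg N)^2) * (x - xi N)^2)" for x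
   proof (cases "x : {al..be}")
    case True
    have "abs (x - xi N) <= 1 / (2 * K)" using True xi(1)[of N] J by auto
    from q[OF this] have "c * ((x - xi N)^2 * (sg N)^2) - C <= DD f (x + - xi N) N" by (simp add: power_mult_distrib)
    also have "... <= 2 * DD f x N + 2 * DD f (xi N) N" using DD_add[OF f, of x "- xi N" N] DD_uminus[OF f] by simp
    \<comment> \<open>Adding four times the minimum before using 2 DD x + 6 min \<le> 8 DD x keeps
      part of the minimum in the exponent along with the Gaussian term.\<close>
    finally have "c * ((x - xi N)^2 * (sg N)^2) - C + 4 * DD f (xi N) N <= 8 * DD f x N" using xi(2)[OF True, of N] by simp
    from mult_left_mono[OF this, of "cdec / 8"] cdec_pos
    have "- cdec * DD f x N <= - (cdec / 2 * DD f (xi N) N) + cdec * C / 8 + - (kp * (sg N)^2) * (x - xi N)^2" by (simp add: kp_def right_diff_distrib distrib_left mult_ac)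
    then have "exp (- cdec * DD f x N) <= ?E * exp (- (kp * (sg N)^2) * (x - xi N)^2)" unfolding exp_add[symmetric] exp_le_cancel_iff .
    moreover have "cmod (of_real (wt x) * Psi N x) <= 1 * exp (- cdec * DD f x N)" unfolding norm_mult using w1 Psi_decay[OF elim(2)] by (intro mult_mono) auto
    ultimately show ?thesis by simp
   qed (simp add: w0)
   have "cmod (LINT x|lborel. of_real (wt x) * Psi N x) <= (LINT x|lborel. ?E * exp (- (kp * (sg N)^2) * (x - xi N)^2))" using integral_gauss(1)[OF v] by (intro order_trans[OF integral_norm_bound integral_mono'] pt) auto
   also have "... = ?E * sqrt (pi / (kp * (sg N)^2))" unfolding integral_mult_right_zero integral_gauss(2)[OF v] ..
   also have "sqrt (pi / (kp * (sg N)^2)) = sqrt (pi / kp) / sg N" using sg0 by (simp add: real_sqrt_divide real_sqrt_mult)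
   finally have "sg N * cmod (LINT x|lborel. of_real (wt x) * Psi N x) <= sg N * (?E * (sqrt (pi / kp) / sg N))" using sg0 by (intro mult_left_mono) auto
   then show ?case using sg0 by (simp add: norm_mult A_def mult_ac)
  qed
 qed
qed

text \<open>After the substitution x = \<open>fq dl k\<close> + s / \<open>sg N\<close> the
  integrand converges pointwise by \<open>Psi_limit\<close>. The majorant is Gaussian:
  almost-subadditivity compares \<open>DD\<close> at x with \<open>DD\<close> at the distance from
  the resonance, where the bound is quadratic, and \<open>tight\<close> pays for the
  resonance.\<close>

lemma fourier_peak:
 fixes wt :: "real => real" and k :: int
 assumes wt: "continuous_on UNIV wt" and w1: "!!x. abs (wt x) <= 1" and w0: "!!x. x \<notin> {al..be} ==> wt x = 0"
  and J: "be - al <= 1 / (2 * K)" and k: "(fq dl k) : {al..be}"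
 shows "(%N. of_real (sg N) * (LINT x|lborel. of_real (wt x) * Psi N x)
   - of_real (wt (fq dl k) * sqrt (2 * pi) * exp (- (z0^2) / 2) * pr N) * EF k) ----> 0"
proof -
 let ?x = "(fq dl k)"
 have [measurable]: "wt : borel_measurable borel" by (rule borel_measurable_continuous_onI[OF wt])
 obtain c C where c: "c > 0" "C >= 0" and ev: "\<forall>\<^sub>F N in sequentially. sg N > 0 & (\<forall>s. abs s <= 1 / (2 * K) --> c * (s * sg N)^2 - C <= DD f s N)" using DD_quadratic by blast
 from ev have "\<forall>\<^sub>F N in sequentially. N >= 3 & sg N > 0 & (\<forall>s. abs s <= 1 / (2 * K) --> c * (s * sg N)^2 - C <= DD f s N)" using eventually_ge_at_top[of 3] by eventually_elim auto
 then obtain N0 where N0: "!!N. N >= N0 ==> N >= 3" "!!N. N >= N0 ==> sg N > 0"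
   "!!N s. N >= N0 ==> abs s <= 1 / (2 * K) ==> c * (s * sg N)^2 - C <= DD f s N" unfolding eventually_sequentially by blast
 define kp where "kp = cdec * c / 2"
 have kp: "kp > 0" using c cdec_pos by (simp add: kp_def)
 define A where "A = exp (cdec * (C / 2 + d k))"
 define h where "h N s = of_real (exp (- (s^2) / 2)) * cis (- s * z0) * EF k * of_real (pr N)" for N s
 define g where "g N s = of_real (wt (?x + s / sg N)) * Psi N (?x + s / sg N) - of_real (wt ?x) * h N s" for N s
 have [measurable]: "g N : borel_measurable borel" "h N : borel_measurable borel" for N unfolding g_def h_def by measurable
 have EF1: "cmod (EF k) <= 1"
 proof -
  have "cmod (EF k) <= (LINT w|Q. 1)" unfolding EF_def by (rule order_trans[OF integral_norm_bound integral_mono']) auto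
  then show ?thesis by (simp add: Q.prob_space)
 qed
 have hb: "cmod (h N s) <= exp (- (1/2) * (s - 0)^2)" for N s using mult_mono[OF EF1, of "pr N" 1] pr_le[of N] by (simp add: h_def norm_mult mult_left_le mult.assoc)
 have pb: "cmod (of_real (wt (?x + s / sg N)) * Psi N (?x + s / sg N)) <= A * exp (- kp * (s - 0)^2)" if N: "N >= N0" for N s
 proof (cases "?x + s / sg N : {al..be}")
  case True
  then have "abs (s / sg N) <= 1 / (2 * K)" using k J by auto
  from N0(3)[OF N this] have "c * s^2 - C <= DD f ((?x + s / sg N) + - ?x) N" using N0(2)[OF N] by simp
  also have "... <= 2 * DD f (?x + s / sg N) N + 2 * DD f ?x N" using DD_add[OF f, of "?x + s / sg N" "- ?x" N] unfolding DD_uminus[OF f] .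
  finally have "c * s^2 - C - 2 * d k <= 2 * DD f (?x + s / sg N) N" using tight[of k N] by linarith
  from mult_left_mono[OF this, of "cdec / 2"] cdec_pos
  have "- cdec * DD f (?x + s / sg N) N <= cdec * (C / 2 + d k) + - kp * (s - 0)^2" by (simp add: kp_def right_diff_distrib distrib_left mult_ac)
  then have "exp (- cdec * DD f (?x + s / sg N) N) <= A * exp (- kp * (s - 0)^2)" unfolding A_def exp_add[symmetric] exp_le_cancel_iff .
  moreover have "cmod (of_real (wt (?x + s / sg N)) * Psi N (?x + s / sg N)) <= 1 * exp (- cdec * DD f (?x + s / sg N) N)" unfolding norm_mult using w1 Psi_decay[OF N0(1)[OF N]] by (intro mult_mono) auto
  ultimately show ?thesis by simp
 qed (simp add: w0 A_def)
 have gb: "cmod (g N s) <= A * exp (- kp * (s - 0)^2) + exp (- (1/2) * (s - 0)^2)" if N: "N >= N0" for N s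
 proof -
  have "cmod (of_real (wt ?x) * h N s) <= 1 * exp (- (1/2) * (s - 0)^2)" unfolding norm_mult using w1 hb by (intro mult_mono) auto
  then show ?thesis unfolding g_def using pb[OF N, of s] by (intro order_trans[OF norm_triangle_ineq4]) simp
 qed
 have bi: "integrable lborel (%s. A * exp (- kp * (s - 0)^2) + exp (- (1/2) * (s - 0)^2))" by (intro Bochner_Integration.integrable_add integrable_mult_right integral_gauss kp) auto
 have gl: "(%N. g N s) ----> 0" for s
 proof -
  have inv: "(%N. s / sg N) ----> 0" using tendsto_divide_0[OF tendsto_const sg[THEN filterlim_at_top_imp_at_infinity]] .
  then have "(%N. ?x + s / sg N) ----> ?x + 0" by (intro tendsto_intros)
  then have wl: "(%N. wt (?x + s / sg N)) ----> wt ?x" by (intro isCont_tendsto_compose[where g=wt]) (use wt in \<open>simp_all add: continuous_on_eq_continuous_at\<close>)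
  have 1: "(%N. (of_real (wt (?x + s / sg N)) - of_real (wt ?x)) * Psi N (?x + s / sg N)) ----> 0"
  proof (rule Lim_null_comparison[OF always_eventually])
   show "\<forall>N. cmod ((of_real (wt (?x + s / sg N)) - of_real (wt ?x)) * Psi N (?x + s / sg N)) <= abs (wt (?x + s / sg N) - wt ?x)"
   proof
    fix N show "cmod ((of_real (wt (?x + s / sg N)) - of_real (wt ?x)) * Psi N (?x + s / sg N)) <= abs (wt (?x + s / sg N) - wt ?x)"
     using mult_left_mono[OF Psi_norm, of "abs (wt (?x + s / sg N) - wt ?x)"] unfolding norm_mult of_real_diff[symmetric] norm_of_real by simp
   qed
   show "(%N. abs (wt (?x + s / sg N) - wt ?x)) ----> 0" by (rule tendsto_rabs_zero[OF LIM_zero[OF wl]])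
  qed
  have "(%N. of_real (wt ?x) * (Psi N (?x + s / sg N) - h N s)) ----> of_real (wt ?x) * 0" unfolding h_def by (intro tendsto_intros Psi_limit)
  from tendsto_add[OF 1 this] show ?thesis by (simp add: g_def algebra_simps)
 qed
 \<comment> \<open>The majorant is only valid from N0 on, hence the shift before dominated
   convergence.\<close>
 have "(%N. (LINT s|lborel. g (N + N0) s)) ----> (LINT s|(lborel :: real measure). 0)"
  by (rule integral_dominated_convergence[OF _ _ bi]) (use gl gb in \<open>auto intro!: LIMSEQ_ignore_initial_segment\<close>)
 then have "(%N. (LINT s|lborel. g (N + N0) s)) ----> 0" by simp
 then have "(%N. (LINT s|lborel. g N s)) ----> 0" by (rule LIMSEQ_offset[where f="%N. (LINT s|lborel. g N s)"])
 then show ?thesis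
 proof (rule Lim_transform_eventually)
  show "\<forall>\<^sub>F N in sequentially. (LINT s|lborel. g N s) = of_real (sg N) * (LINT x|lborel. of_real (wt x) * Psi N x)
   - of_real (wt ?x * sqrt (2 * pi) * exp (- (z0^2) / 2) * pr N) * EF k" using eventually_ge_at_top[of N0]
  proof eventually_elim
   case (elim N)
   have 1: "(LINT x|lborel. of_real (wt x) * Psi N x) = of_real (1 / sg N) * (LINT s|lborel. of_real (wt (?x + s / sg N)) * Psi N (?x + s / sg N))"
    using N0(2)[OF elim] by (subst lborel_integral_real_affine[where c="1 / sg N" and t="?x"]) (auto simp: scaleR_conv_of_real)
   have i: "integrable lborel (%s. of_real (wt (?x + s / sg N)) * Psi N (?x + s / sg N))"
    by (rule Bochner_Integration.integrable_bound[OF bi]) (use order_trans[OF pb[OF elim], of _ "A * exp (- kp * (_ - 0)^2) + exp (- (1/2) * (_ - 0)^2)"] in \<open>auto simp: A_def\<close>)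
   have hi: "integrable lborel (h N)" "(LINT s|lborel. h N s) = of_real (sqrt (2 * pi) * exp (- (z0^2) / 2)) * EF k * of_real (pr N)" unfolding h_def using integral_gauss_cis[of z0] by auto
   have "(LINT s|lborel. g N s) = (LINT s|lborel. of_real (wt (?x + s / sg N)) * Psi N (?x + s / sg N)) - of_real (wt ?x) * (LINT s|lborel. h N s)" unfolding g_def using i hi(1) by simp
   then show ?case unfolding 1 hi(2) using N0(2)[OF elim] by (simp add: mult_ac)
  qed
 qed
qed

end

section \<open>The Fejer kernel and Poisson summation\<close>

definition tent :: "real => real" where "tent t = max 0 (1 - abs t)"

text \<open>The Fejer kernel, with Fourier transform \<open>tent\<close>. As a weight it is
  nonnegative, and expectations against it involve characteristic functions on a bounded interval
  only.\<close>

definition kern :: "real => real" where "kern x = (sinc (x / 2))^2"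

lemma tent_bounds: "0 <= tent t" "tent t <= 1" "abs t >= 1 ==> tent t = 0" "tent (- t) = tent t" by (auto simp: tent_def)

lemma tent_measurable [measurable]: "tent : borel_measurable borel" unfolding tent_def by measurable

lemma tent_lipschitz: "abs (tent x - tent y) <= abs (x - y)" unfolding tent_def by linarith

lemma continuous_tent: "continuous_on UNIV tent" unfolding tent_def[abs_def] by (intro continuous_intros)

lemma kern_nz: "x ~= 0 ==> kern x = 2 * (1 - cos x) / x^2" using cos_double_sin[of "x / 2"] by (simp add: kern_def power_divide field_simps)

lemma kern_0 [simp]: "kern 0 = 1" by (simp add: kern_def)

lemma kern_nonneg: "0 <= kern x" by (simp add: kern_def)

lemma kern_le: "x ~= 0 ==> kern x <= 4 / x^2" "kern x <= 1"
proof -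
 show "kern x <= 4 / x^2" if "x ~= 0" using divide_right_mono[of "2 * (1 - cos x)" 4 "x^2"] cos_ge_minus_one[of x] that by (simp add: kern_nz)
 have "abs (sinc (x / 2)) <= 1" using abs_sin_x_le_abs_x[of "x / 2"] by (simp add: abs_divide abs_mult divide_le_eq)
 then show "kern x <= 1" using power_mono[of "abs (sinc (x / 2))" 1 2] unfolding kern_def power2_abs by simp
qed

lemma continuous_kern: "continuous_on UNIV kern" unfolding kern_def[abs_def] by (intro continuous_on_power continuous_on_sinc) (auto intro!: continuous_intros)

lemma kern_pos: "abs x < 2 * pi ==> 0 < kern x"
proof (cases "x = 0")
 case False
 assume "abs x < 2 * pi"
 then have "sin (x / 2) ~= 0" using False sin_gt_zero[of "x / 2"] sin_gt_zero[of "- (x / 2)"] by (cases "x > 0") auto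
 then show ?thesis using False by (simp add: kern_def)
qed simp

lemma kern_fourier: "(LINT t|lborel. of_real (tent t) * cis (x * t)) = of_real (kern x)"
proof -
 define l r where "l t = of_real (1 + t) * cis (x * t)" and "r t = of_real (1 - t) * cis (x * t)" for t
 have cl: "continuous_on {- 1..0} l" "continuous_on {0..1} r" unfolding l_def r_def by (intro continuous_intros)+
 \<comment> \<open>Explicit antiderivatives on the two halves of the tent; at x = 0 the exponential
   formula degenerates and is replaced by a polynomial.\<close>
 define A where "A t = (if x = 0 then of_real t + of_real t * of_real t / 2 else of_real (1 + t) * cis (x * t) / (\<i> * x) + cis (x * t) / x^2)" for t :: real
 define D where "D t = (if x = 0 then of_real t - of_real t * of_real t / 2 else of_real (1 - t) * cis (x * t) / (\<i> * x) - cis (x * t) / x^2)" for t :: real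
 have A: "(A has_vector_derivative l t) (at t within X)" for t X
 proof (cases "x = 0")
  case True
  then show ?thesis unfolding A_def l_def by (auto intro!: derivative_eq_intros)
 next
  case False
  then show ?thesis unfolding A_def l_def cis_conv_exp by (auto intro!: derivative_eq_intros has_vector_derivative_real_field simp: field_simps power2_eq_square)
 qed
 have D: "(D has_vector_derivative r t) (at t within X)" for t X
 proof (cases "x = 0")
  case True
  then show ?thesis unfolding D_def r_def by (auto intro!: derivative_eq_intros)
 next
  case False
  then show ?thesis unfolding D_def r_def cis_conv_exp by (auto intro!: derivative_eq_intros has_vector_derivative_real_field simp: field_simps power2_eq_square)
 qed
 have 1: "has_bochner_integral lborel (%t. indicator {- 1..0} t *\<^sub>R l t) (A 0 - A (- 1))" using A cl by (intro has_bochner_integral_FTC_Icc) auto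
 have 2: "has_bochner_integral lborel (%t. indicator {0..1} t *\<^sub>R r t) (D 1 - D 0)" using D cl by (intro has_bochner_integral_FTC_Icc) auto
 have "(LINT t|lborel. of_real (tent t) * cis (x * t)) = (LINT t|lborel. indicator {- 1..0} t *\<^sub>R l t + indicator {0..1} t *\<^sub>R r t)"
 proof (rule integral_cong_AE)
  show "AE t in lborel. of_real (tent t) * cis (x * t) = indicator {- 1..0} t *\<^sub>R l t + indicator {0..1} t *\<^sub>R r t"
   using AE_lborel_singleton[of "0::real"] by eventually_elim (auto simp: l_def r_def tent_def indicator_def)
  show "(%t. indicator {- 1..0} t *\<^sub>R l t + indicator {0..1} t *\<^sub>R r t) : borel_measurable lborel" using 1 2 by (intro borel_measurable_add) (auto simp: has_bochner_integral_iff)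
 qed measurable
 also have "... = (A 0 - A (- 1)) + (D 1 - D 0)" using has_bochner_integral_add[OF 1 2] by (simp add: has_bochner_integral_iff)
 also have "... = of_real (kern x)"
 proof (cases "x = 0")
  case False
  have "cis x + cis (- x) = of_real (2 * cos x)" by (simp add: complex_eq_iff)
  moreover have "(A 0 - A (- 1)) + (D 1 - D 0) = (2 - (cis x + cis (- x))) / (of_real x)^2" using False by (simp add: A_def D_def diff_divide_distrib add_divide_distrib)
  ultimately show ?thesis using False by (simp add: kern_nz right_diff_distrib)
 qed (simp add: A_def D_def)
 finally show ?thesis .
qed

lemma integrable_times_cis:
 assumes "integrable lborel b" "G : borel_measurable borel" "!!t. cmod (G t) <= b t"
 shows "integrable lborel (%t. G t * cis (y * t))"
proof (rule Bochner_Integration.integrable_bound[OF assms(1)])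
 show "(%t. G t * cis (y * t)) : borel_measurable lborel" using assms(2) by measurable
 show "AE t in lborel. norm (G t * cis (y * t)) <= norm (b t)" using order_trans[OF assms(3) abs_ge_self] by (auto simp: norm_mult)
qed

text \<open>Averaging the coefficients over a block from M to 2M - 1 does not change the limit and
  inserts a normalised geometric sum under the integral. The latter tends to 0 for t other than 0,
  because the support stays inside |t| < 2 pi, and dominated convergence applies.\<close>

lemma fourier_limit_zero:
 fixes G :: "real => complex" and s A
 assumes G [measurable]: "G : borel_measurable borel" and b: "!!t. cmod (G t) <= C * indicator {- (3/2 * pi)..3/2 * pi} t"
  and s: "abs s = 1" and lim: "(%n. (LINT t|lborel. G t * cis (s * real n * t))) ----> A"
 shows "A = 0"
proof -
 define x where "x n = (LINT t|lborel. G t * cis (s * real n * t))" for n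
 define e where "e M t = (\<Sum>n<M. cis (s * real n * t)) / of_nat M" for M t
 have em [measurable]: "e M : borel_measurable borel" for M unfolding e_def by measurable
 have bi: "integrable lborel (%t. C * indicator {- (3/2 * pi)..3/2 * pi} t :: real)" by (intro integrable_mult_right) simp
 have e1: "cmod (e M t) <= 1" for M t
 proof -
  have "cmod (\<Sum>n<M. cis (s * real n * t)) <= real M" by (rule order_trans[OF norm_sum]) simp
  then show ?thesis unfolding e_def norm_divide by (cases "M = 0") (auto simp: divide_le_eq)
 qed
 have Gi: "integrable lborel (%t. G t * cis (y * t))" for y by (rule integrable_times_cis[OF bi G b])
 define y where "y M = (LINT t|lborel. G t * (cis (s * real M * t) * e M t))" for M
 have y: "y M = (\<Sum>n<M. x (M + n)) / of_nat M" for M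
 proof -
  have "(\<Sum>n<M. x (M + n)) = (LINT t|lborel. (\<Sum>n<M. G t * cis (s * real (M + n) * t)))" unfolding x_def by (rule Bochner_Integration.integral_sum[symmetric, OF Gi])
  also have "... = (LINT t|lborel. G t * (cis (s * real M * t) * (\<Sum>n<M. cis (s * real n * t))))" by (intro Bochner_Integration.integral_cong refl) (simp add: sum_distrib_left cis_mult algebra_simps)
  finally show ?thesis unfolding y_def e_def by simp
 qed
 have "y ----> A"
 proof (rule tendstoI)
  fix ep :: real assume ep: "ep > 0"
  have "\<forall>\<^sub>F n in sequentially. dist (x n) A < ep / 2" using lim ep unfolding x_def by (intro tendstoD) auto
  then obtain N where N: "!!n. n >= N ==> dist (x n) A < ep / 2" unfolding eventually_sequentially by blast
  show "\<forall>\<^sub>F M in sequentially. dist (y M) A < ep" using eventually_ge_at_top[of "max N 1"]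
  proof eventually_elim
   case (elim M)
   have "y M - A = (\<Sum>n<M. x (M + n) - A) / of_nat M" using elim unfolding y by (simp add: sum_subtractf diff_divide_distrib)
   then have "cmod (y M - A) = cmod (\<Sum>n<M. x (M + n) - A) / real M" by (simp add: norm_divide)
   also have "... <= (\<Sum>n<M. ep / 2) / real M" using N elim by (intro divide_right_mono order_trans[OF norm_sum sum_mono]) (auto simp: dist_norm intro!: less_imp_le)
   also have "... = ep / 2" using elim by simp
   finally have "cmod (y M - A) <= ep / 2" .
   then show ?case using ep by (simp add: dist_norm)
  qed
 qed
 moreover have "y ----> (LINT t|(lborel :: real measure). 0)" unfolding y_def
 proof (rule integral_dominated_convergence[OF _ _ bi])
  show "AE t in lborel. cmod (G t * (cis (s * real M * t) * e M t)) <= C * indicator {- (3/2 * pi)..3/2 * pi} t" for M using mult_mono[OF b e1[of M]] order_trans[OF norm_ge_zero b] by (intro AE_I2) (simp add: norm_mult)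
  show "AE t in lborel. (%M. G t * (cis (s * real M * t) * e M t)) ----> 0" using AE_lborel_singleton[of "0::real"]
  proof eventually_elim
   case (elim t)
   show ?case
   proof (cases "abs t <= 3/2 * pi")
    case True
    define wt where "wt = cis (s * t)"
    have "cos (s * t) ~= 1"
    proof
     assume "cos (s * t) = 1"
     then obtain k :: int where k: "s * t = of_int k * 2 * pi" unfolding cos_one_2pi_int by auto
     have "abs t = abs (of_int k) * (2 * pi)" using arg_cong[OF k, of abs] s by (simp add: abs_mult)
     moreover from this elim have "abs (of_int k :: real) >= 1" by (cases "k = 0") (auto simp flip: of_int_abs)
     ultimately have "abs t >= 2 * pi" by (simp add: mult_right_mono)
     then show False using True pi_gt_zero by linarith
    qed
    then have wt: "wt ~= 1" unfolding wt_def by (auto simp: complex_eq_iff)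
    have g: "(\<Sum>n<M. cis (s * real n * t)) = (1 - wt ^ M) / (1 - wt)" for M
    proof -
     have "(\<Sum>n<M. cis (s * real n * t)) = (\<Sum>n<M. wt ^ n)" unfolding wt_def Complex.DeMoivre by (intro sum.cong) (auto simp: mult_ac)
     then show ?thesis using wt by (simp add: sum_gp_strict)
    qed
    have gb: "cmod (G t * (cis (s * real M * t) * e M t)) <= C * (2 / cmod (1 - wt)) * (1 / real M)" for M
    proof -
     have "cmod (1 - wt ^ M) <= 2" using norm_triangle_ineq4[of 1 "wt ^ M"] by (simp add: norm_power wt_def)
     then have "cmod (e M t) <= 2 / cmod (1 - wt) / real M" unfolding e_def g norm_divide by (auto intro!: divide_right_mono)
     moreover have "t : {- (3/2 * pi)..3/2 * pi}" using True unfolding abs_le_iff by simp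
     then have "cmod (G t) <= C" using b[of t] by simp
     ultimately have "cmod (G t) * cmod (e M t) <= C * (2 / cmod (1 - wt) / real M)" using order_trans[OF norm_ge_zero[of "G t"]] by (intro mult_mono) auto
     then show ?thesis by (simp add: norm_mult)
    qed
    show ?thesis
    proof (rule Lim_null_comparison[OF always_eventually])
     show "\<forall>M. cmod (G t * (cis (s * real M * t) * e M t)) <= C * (2 / cmod (1 - wt)) * (1 / real M)" using gb by blast
     show "(%M. C * (2 / cmod (1 - wt)) * (1 / real M)) ----> 0" using tendsto_mult_left[OF lim_1_over_n[where 'a=real], of "C * (2 / cmod (1 - wt))"] by simp
    qed
   next
    case False
    then have "t \<notin> {- (3/2 * pi)..3/2 * pi}" unfolding atLeastAtMost_iff by linarith
    then have "G t = 0" using b[of t] by simp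
    then show ?thesis by simp
   qed
  qed
 qed measurable
 ultimately show ?thesis using LIMSEQ_unique by fastforce
qed


text \<open>|1 - cis t|^2 = \<open>kern t * t^2\<close>, and \<open>kern\<close> has a positive
  minimum on this compact subinterval of (-2 pi, 2 pi).\<close>

lemma one_minus_cis_lower:
 obtains kp where "kp > 0" "!!t. abs t <= 3/2 * pi ==> kp * abs t <= cmod (1 - cis t)"
proof -
 obtain m where m: "m : {- (3/2 * pi)..3/2 * pi}" "!!t. t : {- (3/2 * pi)..3/2 * pi} ==> kern m <= kern t"
  using continuous_attains_inf[OF compact_Icc _ continuous_on_subset[OF continuous_kern], of "- (3/2 * pi)" "3/2 * pi"] by fastforce
 have "abs m < 2 * pi" using m(1) pi_gt_zero unfolding abs_less_iff atLeastAtMost_iff by linarith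
 then have k: "kern m > 0" by (rule kern_pos)
 show thesis
 proof (rule that[of "sqrt (kern m)"])
  fix t :: real assume "abs t <= 3/2 * pi"
  then have le: "kern m <= kern t" by (intro m(2), unfold atLeastAtMost_iff) linarith
  have "(cmod (1 - cis t))^2 = 2 * (1 - cos t)" unfolding cmod_power2 using sin_cos_squared_add[of t] by (simp add: power2_diff)
  also have "... = kern t * t^2" by (cases "t = 0") (simp_all add: kern_nz)
  finally have "(sqrt (kern m) * abs t)^2 <= (cmod (1 - cis t))^2" using k le by (simp add: power_mult_distrib mult_right_mono)
  then show "sqrt (kern m) * abs t <= cmod (1 - cis t)" by (rule power2_le_imp_le) simp
 qed (use k in simp)
qed

text \<open>Division by 1 - cis t turns the coefficients into differences D m - D (m + 1), so both
  half sums telescope to D 0 up to limits of D at the two ends, which vanish by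
  \<open>fourier_limit_zero\<close>. The linear bound at 0 is what keeps the quotient
  bounded.\<close>

lemma fourier_sum_zero:
 fixes g :: "real => complex"
 assumes g [measurable]: "g : borel_measurable borel" and b: "!!t. cmod (g t) <= L * abs t * indicator {- (3/2 * pi)..3/2 * pi} t"
  and L: "0 <= L" and s: "(%m::int. cmod (LINT t|lborel. g t * cis (of_int m * t))) summable_on UNIV"
 shows "((%m::int. (LINT t|lborel. g t * cis (of_int m * t))) has_sum 0) UNIV"
proof -
 obtain kp where kp: "kp > 0" "!!t. abs t <= 3/2 * pi ==> kp * abs t <= cmod (1 - cis t)" by (rule one_minus_cis_lower) blast
 define G where "G t = g t / (1 - cis t)" for t
 define c where "c m = (LINT t|lborel. g t * cis (of_int m * t))" for m :: int
 define D where "D m = (LINT t|lborel. G t * cis (of_int m * t))" for m :: int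
 have Gm [measurable]: "G : borel_measurable borel" unfolding G_def by measurable
 have lo: "kp * abs t <= cmod (1 - cis t)" if "t : {- (3/2 * pi)..3/2 * pi}" for t using that unfolding atLeastAtMost_iff by (intro kp(2)) linarith
 have z: "g t = 0" if "cis t = 1" for t
 proof (cases "t : {- (3/2 * pi)..3/2 * pi}")
  case True
  from lo[OF this] that kp(1) have "t = 0" by (simp add: mult_le_0_iff)
  then show ?thesis using b[of 0] by simp
 qed (use b[of t] in simp)
 have Gb: "cmod (G t) <= L / kp * indicator {- (3/2 * pi)..3/2 * pi} t" for t
 proof (cases "t : {- (3/2 * pi)..3/2 * pi} & t ~= 0")
  case True
  then have p: "0 < kp * abs t" using kp(1) by simp
  have "cmod (G t) <= (L * abs t) / (kp * abs t)" unfolding G_def norm_divide using b[of t] lo[of t] True p L by (intro frac_le) auto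
  then show ?thesis using True by simp
 next
  case False
  then have "G t = 0" unfolding G_def using z[of 0] b[of t] by auto
  then show ?thesis using L kp(1) by simp
 qed
 have bi: "integrable lborel (%t. L / kp * indicator {- (3/2 * pi)..3/2 * pi} t :: real)" by (intro integrable_mult_right) simp
 have Gi: "integrable lborel (%t. G t * cis (y * t))" for y by (rule integrable_times_cis[OF bi Gm Gb])
 have cD: "c m = D m - D (m + 1)" for m
 proof -
  have "g t * cis (of_int m * t) = G t * cis (of_int m * t) - G t * cis (of_int (m + 1) * t)" for t
  proof -
   have "g t = G t * (1 - cis t)" using z[of t] by (simp add: G_def)
   then show ?thesis by (simp add: distrib_right right_diff_distrib left_diff_distrib cis_mult[symmetric])
  qed
  then show ?thesis unfolding c_def D_def by (simp only: Bochner_Integration.integral_diff[OF Gi Gi])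
 qed
 have su: "c summable_on X" for X using summable_on_subset_banach[OF abs_summable_summable[OF s] subset_UNIV] unfolding c_def .
 have "((%n. c (int n)) has_sum infsum c {0..}) UNIV" using has_sum_reindex_bij_witness[of UNIV nat int "{0..}" c "%n. c (int n)"] has_sum_infsum[OF su[of "{0..}"]] by auto
 then have "(%N. \<Sum>n<N. c (int n)) ----> infsum c {0..}" using has_sum_imp_sums unfolding sums_def by blast
 moreover have "(\<Sum>n<N. c (int n)) = D 0 - D (int N)" for N by (induction N) (simp_all add: cD add.commute)
 ultimately have "(%N. D 0 - (D 0 - D (int N))) ----> D 0 - infsum c {0..}" by (intro tendsto_diff tendsto_const) simp
 then have "(%n. (LINT t|lborel. G t * cis (1 * real n * t))) ----> D 0 - infsum c {0..}" by (simp add: D_def)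
 then have 1: "D 0 - infsum c {0..} = 0" by (rule fourier_limit_zero[OF Gm Gb, rotated]) simp
 \<comment> \<open>The negative integers are enumerated as - n - 1, so that 0 belongs to the other
   half sum only.\<close>
 have "((%n. c (- int n - 1)) has_sum infsum c {..<0}) UNIV" using has_sum_reindex_bij_witness[of UNIV "%m. nat (- m - 1)" "%n. - int n - 1" "{..<0}" c "%n. c (- int n - 1)"] has_sum_infsum[OF su[of "{..<0}"]] by auto
 then have "(%N. \<Sum>n<N. c (- int n - 1)) ----> infsum c {..<0}" using has_sum_imp_sums unfolding sums_def by blast
 moreover have "(\<Sum>n<N. c (- int n - 1)) = D (- int N) - D 0" for N
 proof (induction N)
  case (Suc N)
  have e: "D (- int (Suc N)) = D (- int N - 1)" by (rule arg_cong[where f=D]) simp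
  show ?case unfolding e using Suc cD[of "- int N - 1"] by simp
 qed simp
 ultimately have "(%N. D 0 + (D (- int N) - D 0)) ----> D 0 + infsum c {..<0}" by (intro tendsto_add tendsto_const) simp
 then have "(%n. (LINT t|lborel. G t * cis ((- 1) * real n * t))) ----> D 0 + infsum c {..<0}" by (simp add: D_def)
 then have 2: "D 0 + infsum c {..<0} = 0" by (rule fourier_limit_zero[OF Gm Gb, rotated]) simp
 have "(c has_sum (infsum c {0..} + infsum c {..<0})) ({0..} \<union> {..<0})" by (intro has_sum_Un_disjoint has_sum_infsum su) auto
 moreover have "{0..} \<union> {..<0} = (UNIV :: int set)" by auto
 moreover have "infsum c {0..} + infsum c {..<0} = 0" using 1 2 by simp
 ultimately show ?thesis unfolding c_def by simp
qed

lemma integral_cis_period: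
 "(LINT t|lborel. indicator {- pi..pi} t *\<^sub>R cis (of_int m * t)) = (if m = 0 then of_real (2 * pi) else 0)"
proof (cases "m = 0")
 case False
 have d: "((%t. cis (of_int m * t) / (\<i> * of_int m)) has_vector_derivative cis (of_int m * t)) (at t within X)" for t X
  unfolding cis_conv_exp using False by (auto intro!: derivative_eq_intros has_vector_derivative_real_field simp: field_simps)
 have "(LINT t|lborel. indicator {- pi..pi} t *\<^sub>R cis (of_int m * t)) = cis (of_int m * pi) / (\<i> * of_int m) - cis (of_int m * (- pi)) / (\<i> * of_int m)"
  by (rule integral_FTC_Icc[OF _ d]) (auto intro!: continuous_intros)
 moreover have "cis (of_int m * (- pi)) = cis (of_int m * pi)" using sin_zero_iff_int2[of "of_int m * pi"] by (auto simp: complex_eq_iff)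
 ultimately show ?thesis using False by simp
qed (simp add: scaleR_conv_of_real)

text \<open>Poisson summation for a support in which 0 is the only multiple of 2 pi. Subtracting
  \<open>h 0\<close> times the indicator of one period reduces to a function vanishing at 0, as that
  indicator has the single nonzero coefficient 2 pi at m = 0.\<close>

lemma fourier_sum:
 fixes h :: "real => complex"
 assumes h [measurable]: "h : borel_measurable borel" and h0: "!!t. t \<notin> {- (3/2 * pi)..3/2 * pi} ==> h t = 0"
  and L: "!!t. cmod (h t - h 0) <= L * abs t"
  and s: "(%m::int. cmod (LINT t|lborel. h t * cis (of_int m * t))) summable_on UNIV"
 shows "((%m::int. (LINT t|lborel. h t * cis (of_int m * t))) has_sum (of_real (2 * pi) * h 0)) UNIV"
proof -
 define c where "c m = (LINT t|lborel. h t * cis (of_int m * t))" for m :: int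
 define e where "e m = (if m = 0 then of_real (2 * pi) * h 0 else 0)" for m :: int
 define g where "g t = h t - h 0 * indicator {- pi..pi} t" for t
 have [measurable]: "g : borel_measurable borel" unfolding g_def by measurable
 have L0: "0 <= L" using L[of 1] order_trans[OF norm_ge_zero] by fastforce
 have sub: "{- pi..pi} \<subseteq> {- (3/2 * pi)..3/2 * pi}" using pi_gt_zero by auto
 have gb: "cmod (g t) <= (L + cmod (h 0) / pi) * abs t * indicator {- (3/2 * pi)..3/2 * pi} t" for t
 proof -
  consider "t \<notin> {- (3/2 * pi)..3/2 * pi}" | "t : {- pi..pi}" | "t \<notin> {- pi..pi}" "t : {- (3/2 * pi)..3/2 * pi}" by blast
  then show ?thesis
  proof cases
   case 1
   then have "g t = 0" using h0[OF 1] sub by (auto simp: g_def)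
   then show ?thesis using 1 by simp
  next
   case 2
   have "L * abs t <= (L + cmod (h 0) / pi) * abs t" by (intro mult_right_mono) auto
   then show ?thesis using 2 sub L[of t] by (auto simp: g_def)
  next
   case 3
   have "cmod (h t) <= L * abs t + cmod (h 0)" using norm_triangle_ineq[of "h t - h 0" "h 0"] L[of t] by simp
   moreover have "cmod (h 0) * 1 <= cmod (h 0) * (abs t / pi)" using 3 by (intro mult_left_mono) (auto simp: field_simps)
   ultimately show ?thesis using 3 by (simp add: g_def distrib_right)
  qed
 qed
 have hb: "cmod (h t) <= (L * (3/2 * pi) + cmod (h 0)) * indicator {- (3/2 * pi)..3/2 * pi} t" for t
 proof (cases "t : {- (3/2 * pi)..3/2 * pi}")
  case True
  then have "L * abs t <= L * (3/2 * pi)" using L0 by (intro mult_left_mono) (auto simp: abs_le_iff)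
  then show ?thesis using norm_triangle_ineq[of "h t - h 0" "h 0"] L[of t] True by simp
 qed (simp add: h0)
 have hi: "integrable lborel (%t. h t * cis (y * t))" for y by (rule integrable_times_cis[OF _ h hb]) (intro integrable_mult_right, simp)
 have ii: "integrable lborel (%t. indicator {- pi..pi} t *\<^sub>R cis (y * t))" for y by (rule Bochner_Integration.integrable_bound[where f="indicator {- pi..pi} :: real => real"]) auto
 have coef: "(LINT t|lborel. g t * cis (of_int m * t)) = c m - e m" for m
 proof -
  have "g t * cis (of_int m * t) = h t * cis (of_int m * t) - h 0 * (indicator {- pi..pi} t *\<^sub>R cis (of_int m * t))" for t by (simp add: g_def indicator_def left_diff_distrib)
  then have "(LINT t|lborel. g t * cis (of_int m * t)) = c m - h 0 * (LINT t|lborel. indicator {- pi..pi} t *\<^sub>R cis (of_int m * t))"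
   unfolding c_def by (simp only: Bochner_Integration.integral_diff[OF hi integrable_mult_right[OF ii]] integral_mult_right_zero)
  then show ?thesis unfolding integral_cis_period by (simp add: e_def)
 qed
 have es: "(e has_sum (of_real (2 * pi) * h 0)) UNIV" "(%m. cmod (e m)) summable_on UNIV" using has_sum_finite_neutralI[of "{0}" UNIV e "of_real (2 * pi) * h 0"] summable_on_finite[of "{0}" "%m. cmod (e m)"]
   summable_on_cong_neutral[of UNIV "{0}" "%m. cmod (e m)" "%m. cmod (e m)"] by (auto simp: e_def)
 have "((%m::int. (LINT t|lborel. g t * cis (of_int m * t))) has_sum 0) UNIV"
 proof (rule fourier_sum_zero[OF _ gb])
  show "(%m::int. cmod (LINT t|lborel. g t * cis (of_int m * t))) summable_on UNIV" unfolding coef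
  proof (rule summable_on_comparison_test)
   show "(%m. cmod (c m) + cmod (e m)) summable_on UNIV" using summable_on_add[OF s es(2)] unfolding c_def .
  qed (auto intro: norm_triangle_ineq4)
 qed (use L0 in auto)
 then have "((%m. c m - e m) has_sum 0) UNIV" unfolding coef .
 from has_sum_add[OF this es(1)] show ?thesis unfolding c_def by simp
qed

lemma kern_lattice_summable:
 assumes a: "a > 0" and dl: "dl > 0"
 shows "(%m::int. kern (a * (of_int m * dl + y))) summable_on UNIV"
proof -
 have half: "summable (%n. kern (a * (e * real n * dl + y)))" if e: "abs e = 1" for e y
 proof (rule summable_comparison_test_ev)
  have "filterlim (%n. real n * dl) at_top sequentially" by (rule filterlim_at_top_mult_tendsto_pos[OF tendsto_const dl filterlim_real_sequentially])
  then have "\<forall>\<^sub>F n in sequentially. real n * dl >= 2 * abs y + 1" by (auto simp: filterlim_at_top)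
  then show "\<forall>\<^sub>F n in sequentially. norm (kern (a * (e * real n * dl + y))) <= 16 / (a^2 * dl^2) * (1 / real n ^ 2)" using eventually_gt_at_top[of 0]
  proof eventually_elim
   case (elim n)
   let ?x = "e * real n * dl + y"
   have "abs (e * real n * dl) = real n * dl" using e dl by (simp add: abs_mult)
   then have x: "real n * dl / 2 <= abs ?x" using elim(1) by linarith
   have p: "0 < real n * dl / 2" using elim dl by simp
   have nz: "?x ~= 0" using x p by linarith
   have "kern (a * ?x) <= 4 / (a * ?x)^2" using nz a by (intro kern_le) auto
   also have "(a * ?x)^2 = a^2 * abs ?x^2" by (simp add: power_mult_distrib)
   also have "4 / (a^2 * abs ?x^2) <= 4 / (a^2 * (real n * dl / 2)^2)" using a x p elim dl by (intro divide_left_mono mult_left_mono power_mono mult_pos_pos) auto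
   also have "... = 16 / (a^2 * dl^2) * (1 / real n ^ 2)" by (simp add: power_mult_distrib power_divide field_simps)
   finally show ?case using kern_nonneg by simp
  qed
  show "summable (%n. 16 / (a^2 * dl^2) * (1 / real n ^ 2))" using inverse_power_summable[of 2, where 'a=real] by (intro summable_mult) (simp add: inverse_eq_divide power_one_over)
 qed
 have s: "(%n. kern (a * (e * real n * dl + y))) summable_on UNIV" if "abs e = 1" for e y using half[OF that] kern_nonneg by (subst summable_on_UNIV_nonneg_real_iff) auto
 have "(%m::int. kern (a * (of_int m * dl + y))) summable_on {0..}"
 proof (subst summable_on_reindex_bij_witness[of _ int nat UNIV "%n. kern (a * (1 * real n * dl + y))"])
 qed (use s[of 1] in auto)
 moreover have "(%m::int. kern (a * (of_int m * dl + y))) summable_on {..<0}"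
 proof (subst summable_on_reindex_bij_witness[of _ "%n. - int n - 1" "%m. nat (- m - 1)" UNIV "%n. kern (a * ((-1) * real n * dl + (y - dl)))"])
 qed (use s[of "-1" "y - dl"] in \<open>auto simp: algebra_simps\<close>)
 ultimately have "(%m::int. kern (a * (of_int m * dl + y))) summable_on ({0..} \<union> {..<0})" by (intro summable_on_Un_disjoint) auto
 moreover have "{0..} \<union> {..<0} = (UNIV :: int set)" by auto
 ultimately show ?thesis by simp
qed

text \<open>The dual sum runs over frequencies within a of u. As a \<le> pi / (2 dl) and frequency k
  is within pi / dl of u, no other one can occur; rescaled by dl, the support lies within pi/2 + pi,
  the range of \<open>fourier_sum\<close>.\<close>

lemma kern_poisson:
 assumes a: "0 < a" "a <= pi / (2 * dl)" and dl: "dl > 0" and k: "abs ((fq dl k) - u) <= pi / dl"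
 shows "((%m::int. of_real (kern (a * (of_int m * dl + y))) * cis (u * (of_int m * dl + y)))
  has_sum (of_real (2 * pi / (a * dl) * tent ((fq dl k - u) / a)) * cis (fq dl k * y))) UNIV"
proof -
 let ?x = "(fq dl k)"
 \<comment> \<open>The Fourier transform of the summand, recentred at frequency k and rescaled so
   that lattice steps become integers.\<close>
 define h where "h t = of_real (1 / (a * dl) * tent ((t / dl + (?x - u)) / a)) * cis ((?x + t / dl) * y)" for t
 have coef: "(LINT t|lborel. h t * cis (of_int m * t)) = of_real (kern (a * (of_int m * dl + y))) * cis (u * (of_int m * dl + y))" for m
 proof -
  let ?r = "of_int m * dl + y"
  have "of_real (kern (a * ?r)) * cis (u * ?r) = (LINT t|lborel. of_real (tent t) * cis (a * ?r * t) * cis (u * ?r))" unfolding kern_fourier[symmetric] by simp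
  also have "... = abs (1 / (a * dl)) *\<^sub>R (LINT t|lborel. of_real (tent ((?x - u) / a + 1 / (a * dl) * t)) * cis (a * ?r * ((?x - u) / a + 1 / (a * dl) * t)) * cis (u * ?r))"
   by (rule lborel_integral_real_affine) (use a dl in auto)
  also have "... = (LINT t|lborel. h t * cis (of_int m * t))" unfolding integral_scaleR_right[symmetric]
  proof (intro Bochner_Integration.integral_cong refl)
   fix t
   have e: "(?x - u) / a + 1 / (a * dl) * t = (t / dl + (?x - u)) / a" using a dl by (simp add: field_simps)
   have "a * ?r * ((t / dl + (?x - u)) / a) + u * ?r = (?x + t / dl) * y + of_int m * t + 2 * pi * of_int (k * m)" using a dl by (simp add: field_simps)
   then have "cis (a * ?r * ((t / dl + (?x - u)) / a)) * cis (u * ?r) = cis ((?x + t / dl) * y) * cis (of_int m * t) * cis (2 * pi * of_int (k * m))" by (simp only: cis_mult)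
   also have "cis (2 * pi * of_int (k * m)) = 1" by (rule cis_multiple_2pi) simp
   finally have "cis (a * ?r * ((t / dl + (?x - u)) / a)) * cis (u * ?r) = cis ((?x + t / dl) * y) * cis (of_int m * t)" by simp
   then show "abs (1 / (a * dl)) *\<^sub>R (of_real (tent ((?x - u) / a + 1 / (a * dl) * t)) * cis (a * ?r * ((?x - u) / a + 1 / (a * dl) * t)) * cis (u * ?r)) = h t * cis (of_int m * t)"
    unfolding e h_def mult.assoc using a dl by (simp add: scaleR_conv_of_real mult_ac)
  qed
  finally show ?thesis by simp
 qed
 have "((%m::int. (LINT t|lborel. h t * cis (of_int m * t))) has_sum (of_real (2 * pi) * h 0)) UNIV"
 proof (rule fourier_sum)
  show "h : borel_measurable borel" unfolding h_def by measurable
  show "h t = 0" if t: "t \<notin> {- (3/2 * pi)..3/2 * pi}" for t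
  proof -
   have "abs t > 3/2 * pi" using t unfolding atLeastAtMost_iff by linarith
   then have "abs (t / dl) > 3/2 * pi / dl" using divide_strict_right_mono[of "3/2 * pi" "abs t" dl] dl by (simp only: abs_divide abs_of_pos)
   moreover have "3/2 * pi / dl = pi / (2 * dl) + pi / dl" using dl by (simp add: field_simps)
   ultimately have "abs (t / dl + (?x - u)) >= a" using k a by linarith
   then have "abs ((t / dl + (?x - u)) / a) >= 1" unfolding abs_divide using a by simp
   then show ?thesis by (simp add: h_def tent_bounds(3))
  qed
  show "(%m::int. cmod (LINT t|lborel. h t * cis (of_int m * t))) summable_on UNIV" unfolding coef norm_mult using kern_lattice_summable[OF a(1) dl, of y] kern_nonneg by simp
  show "cmod (h t - h 0) <= (1 / (a * dl) * (1 / (a * dl) + abs y / dl)) * abs t" for t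
  proof -
   define T where "T t = tent ((t / dl + (?x - u)) / a)" for t
   define E where "E t = cis ((?x + t / dl) * y)" for t
   have "of_real (T t) * E t - of_real (T 0) * E 0 = of_real (T t - T 0) * E t + of_real (T 0) * (E t - E 0)" by (simp add: algebra_simps)
   then have "cmod (of_real (T t) * E t - of_real (T 0) * E 0) <= abs (T t - T 0) * cmod (E t) + abs (T 0) * cmod (E t - E 0)"
    using norm_triangle_ineq[of "of_real (T t - T 0) * E t" "of_real (T 0) * (E t - E 0)"] by (simp only: norm_mult norm_of_real)
   also have "... <= abs (T t - T 0) * 1 + 1 * cmod (E t - E 0)" using tent_bounds by (intro add_mono mult_mono) (auto simp: E_def T_def)
   also have "abs (T t - T 0) <= abs ((t / dl + (?x - u)) / a - (0 / dl + (?x - u)) / a)" unfolding T_def by (rule tent_lipschitz)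
   also have "... = abs t / (a * dl)" using a dl by (simp add: diff_divide_distrib[symmetric] abs_mult abs_divide mult.commute)
   also have "cmod (E t - E 0) <= abs ((?x + t / dl) * y - (?x + 0 / dl) * y)" unfolding E_def by (rule cis_diff_le)
   also have "... = abs y / dl * abs t" using dl by (simp add: distrib_right abs_mult)
   finally have le: "cmod (of_real (T t) * E t - of_real (T 0) * E 0) <= (1 / (a * dl) + abs y / dl) * abs t" by (simp add: distrib_right)
   have eq: "h t - h 0 = of_real (1 / (a * dl)) * (of_real (T t) * E t - of_real (T 0) * E 0)" by (simp add: h_def T_def E_def right_diff_distrib)
   have "cmod (of_real (1 / (a * dl))) = 1 / (a * dl)" unfolding norm_of_real using a dl by simp
   then show ?thesis unfolding eq norm_mult mult.assoc by (simp only:) (intro mult_left_mono le, use a dl in simp)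
  qed
 qed
 then show ?thesis unfolding coef by (simp add: h_def mult_ac)
qed

section \<open>Levy continuity for weighted measures\<close>

lemma weighted_distr:
 fixes g Y :: "'b => real"
 assumes g: "integrable M g" "!!x. 0 <= g x" and T: "(LINT x|M. g x) > 0" and Y [measurable]: "Y : borel_measurable M"
 defines "W \<equiv> distr (density M (%x. ennreal (g x / (LINT x|M. g x)))) borel Y"
 shows "real_distribution W"
  and "!!h :: real => 'c::{banach, second_countable_topology}. h : borel_measurable borel ==>
   (LINT y|W. h y) = (LINT x|M. g x *\<^sub>R h (Y x)) /\<^sub>R (LINT x|M. g x)"
proof -
 let ?T = "(LINT x|M. g x)"
 have [measurable]: "g : borel_measurable M" using g by auto
 have "(\<integral>\<^sup>+x. ennreal (g x / ?T) \<partial>M) = ennreal (LINT x|M. g x / ?T)" using g T by (intro nn_integral_eq_integral) auto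
 then have "(\<integral>\<^sup>+x. ennreal (g x / ?T) \<partial>M) = 1" using T by simp
 then have "prob_space (density M (%x. ennreal (g x / ?T)))" by (intro prob_spaceI) (simp add: emeasure_density cong: nn_integral_cong)
 then interpret D: prob_space "density M (%x. ennreal (g x / ?T))" .
 have "prob_space W" unfolding W_def by (rule D.prob_space_distr) simp
 then show "real_distribution W" unfolding real_distribution_def real_distribution_axioms_def by (simp add: W_def)
 fix h :: "real => 'c" assume [measurable]: "h : borel_measurable borel"
 have "(LINT y|W. h y) = (LINT x|M. (g x / ?T) *\<^sub>R h (Y x))" unfolding W_def using g T by (simp add: integral_distr integral_density)
 also have "... = (LINT x|M. inverse ?T *\<^sub>R (g x *\<^sub>R h (Y x)))" by (simp add: divide_inverse mult.commute)
 also have "... = inverse ?T *\<^sub>R (LINT x|M. g x *\<^sub>R h (Y x))" by (rule integral_scaleR_right)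
 finally show "(LINT y|W. h y) = (LINT x|M. g x *\<^sub>R h (Y x)) /\<^sub>R ?T" .
qed

text \<open>The weighted image measures need not have mass 1, and the limit lives on another space.
  The characteristic function at 0 gives convergence of the masses; after division by them Levy's
  theorem applies, from an index on where they are positive.\<close>

lemma weighted_levy:
 fixes g Y :: "nat => 'b => real" and g' Y' :: "'c => real" and h :: "real => real"
 assumes g: "!!N. integrable M (g N)" "!!N x. 0 <= g N x" and Y: "!!N. Y N : borel_measurable M"
  and g': "integrable M' g'" "!!x. 0 <= g' x" "(LINT x|M'. g' x) > 0" and Y': "Y' : borel_measurable M'"
  and lim: "!!u. (%N. (LINT x|M. of_real (g N x) * cis (u * Y N x))) ----> (LINT x|M'. of_real (g' x) * cis (u * Y' x))"
  and h: "continuous_on UNIV h" "!!x. abs (h x) <= b"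
 shows "(%N. (LINT x|M. g N x * h (Y N x))) ----> (LINT x|M'. g' x * h (Y' x))"
proof -
 define T where "T N = (LINT x|M. g N x)" for N
 define T' where "T' = (LINT x|M'. g' x)"
 have hm: "h : borel_measurable borel" using h(1) by (rule borel_measurable_continuous_onI)
 have "(%N. of_real (T N) :: complex) ----> of_real T'" using lim[of 0] by (simp add: T_def T'_def)
 then have T: "T ----> T'" by (simp add: tendsto_of_real_iff)
 then have "\<forall>\<^sub>F N in sequentially. T N > 0" using g'(3) by (intro order_tendstoD(1)) (auto simp: T'_def)
 then obtain N0 where N0: "!!N. N >= N0 ==> T N > 0" unfolding eventually_sequentially by blast
 define W where "W N = distr (density M (%x. ennreal (g (N + N0) x / T (N + N0)))) borel (Y (N + N0))" for N
 define W' where "W' = distr (density M' (%x. ennreal (g' x / T'))) borel Y'"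
 have rd: "real_distribution (W N)" for N unfolding W_def T_def using N0[of "N + N0"] by (intro weighted_distr(1) g Y) (simp add: T_def)
 have rd': "real_distribution W'" unfolding W'_def T'_def by (intro weighted_distr(1) g' Y')
 have iW: "(LINT y|(W N). k y) = (LINT x|M. g (N + N0) x *\<^sub>R k (Y (N + N0) x)) /\<^sub>R T (N + N0)"
  if "k : borel_measurable borel" for N and k :: "real => 'd::{banach, second_countable_topology}" unfolding W_def T_def using N0[of "N + N0"] that by (intro weighted_distr(2) g Y) (simp_all add: T_def)
 have iW': "(LINT y|W'. k y) = (LINT x|M'. g' x *\<^sub>R k (Y' x)) /\<^sub>R T'"
  if "k : borel_measurable borel" for k :: "real => 'd::{banach, second_countable_topology}" unfolding W'_def T'_def using that by (intro weighted_distr(2) g' Y')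
 have T0: "T' > 0" using g'(3) by (simp add: T'_def)
 have "weak_conv_m W W'"
 proof (rule levy_continuity[OF rd rd'])
  fix u
  have c: "(%x. iexp (u * x)) : borel_measurable borel" by measurable
  have "(%N. (LINT x|M. of_real (g (N + N0) x) * cis (u * Y (N + N0) x)) /\<^sub>R T (N + N0)) ----> (LINT x|M'. of_real (g' x) * cis (u * Y' x)) /\<^sub>R T'"
   using T0 by (intro tendsto_intros LIMSEQ_ignore_initial_segment lim T) auto
  then show "(%N. char (W N) u) ----> char W' u" unfolding char_def iW[OF c] iW'[OF c] by (simp add: scaleR_conv_of_real cis_conv_exp)
 qed
 then have "(%N. (LINT y|(W N). h y)) ----> (LINT y|W'. h y)" using h rd rd' by (intro weak_conv_imp_integral_bdd_continuous_conv[where B=b]) (auto simp: continuous_on_eq_continuous_at)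
 then have "(%N. T (N + N0) * (LINT y|(W N). h y)) ----> T' * (LINT y|W'. h y)" by (intro tendsto_mult LIMSEQ_ignore_initial_segment T)
 moreover have "T (N + N0) * (LINT y|(W N). h y) = (LINT x|M. g (N + N0) x * h (Y (N + N0) x))" for N using N0[of "N + N0"] by (simp add: iW[OF hm])
 moreover have "T' * (LINT y|W'. h y) = (LINT x|M'. g' x * h (Y' x))" using T0 by (simp add: iW'[OF hm])
 ultimately have "(%N. (LINT x|M. g (N + N0) x * h (Y (N + N0) x))) ----> (LINT x|M'. g' x * h (Y' x))" by simp
 then show ?thesis by (rule LIMSEQ_offset[where f="%N. (LINT x|M. g N x * h (Y N x))"])
qed

lemma has_sum_count_space:
 fixes f :: "'i => 'b::{banach, second_countable_topology}"
 assumes "(%i. norm (f i)) summable_on UNIV" "(f has_sum S) UNIV"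
 shows "integrable (count_space UNIV) f" "(LINT i|(count_space UNIV). f i) = S"
proof -
 have a: "Infinite_Set_Sum.abs_summable_on f UNIV" using assms(1) by (simp add: abs_summable_equivalent[symmetric])
 then show "integrable (count_space UNIV) f" by (simp add: Infinite_Set_Sum.abs_summable_on_def)
 show "(LINT i|(count_space UNIV). f i) = S" using infsetsum_infsum[OF a] infsumI[OF assms(2)] by (simp add: infsetsum_def)
qed

text \<open>Off the closed support the quotient is 0 because phi is, also where \<open>k\<close>
  vanishes. Two open sets on which the quotient is continuous cover the line.\<close>

lemma continuous_on_divide_supported:
 fixes phi k :: "real => real"
 assumes phi: "continuous_on UNIV phi" and k: "continuous_on UNIV k" and s: "closure {t. phi t ~= 0} \<subseteq> U" and U: "open U"
  and nz: "!!t. t : U ==> k t ~= 0"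
 shows "continuous_on UNIV (%t. phi t / k t)"
proof -
 let ?C = "closure {t. phi t ~= 0}"
 have "continuous_on (U \<union> - ?C) (%t. phi t / k t)"
 proof (rule continuous_on_open_Un[OF U])
  show "continuous_on U (%t. phi t / k t)" using nz by (intro continuous_on_divide continuous_on_subset[OF phi] continuous_on_subset[OF k]) auto
  have "phi t / k t = 0" if "t : - ?C" for t using that closure_subset[of "{t. phi t ~= 0}"] by auto
  then show "continuous_on (- ?C) (%t. phi t / k t)" by (intro continuous_on_eq[OF continuous_on_const[of "- ?C" 0]]) simp
 qed auto
 moreover have "U \<union> - ?C = UNIV" using s by auto
 ultimately show ?thesis by simp
qed

section \<open>From characteristic functions to compactly supported test functions\<close>

context local_limit
begin

text \<open>Insert the Fourier representation of the kernel and apply Fubini; only the values of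
  \<open>Psi\<close> within a of t enter.\<close>

lemma kern_expectation:
 assumes a: "a > 0"
 shows "(LINT w|Q. of_real (kern (a * Y N w) * u N (w (Suc N))) * cis (t * Y N w)) = of_real (1 / a) * (LINT x|lborel. of_real (tent ((x - t) / a)) * Psi N x)"
proof -
 note [measurable_cong] = chain_lawD(2)[OF Q]
 interpret QL: pair_sigma_finite Q "lborel :: real measure" ..
 define G where "G w s = of_real (tent s) * (cis ((a * s + t) * Y N w) * of_real (u N (w (Suc N))))" for w s
 have Gm: "(%(w, s). G w s) : borel_measurable (Q \<Otimes>\<^sub>M lborel)" unfolding G_def by measurable
 have Gb: "cmod (G w s) <= indicator {- 1..1} s" for w s
 proof (cases "s : {- 1..1}")
  case True
  then show ?thesis using tent_bounds[of s] u[of N "w (Suc N)"] mult_mono[of "tent s" 1 "u N (w (Suc N))" 1] by (simp add: G_def norm_mult)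
 next
  case False
  then have "abs s >= 1" by auto
  then show ?thesis by (simp add: G_def tent_bounds(3))
 qed
 have bi: "integrable (Q \<Otimes>\<^sub>M lborel) (%(w, s::real). indicator {- 1..1} s :: real)" by (rule QL.Fubini_integrable) (auto simp: split_beta')
 have Gi: "integrable (Q \<Otimes>\<^sub>M lborel) (%(w, s). G w s)" by (rule Bochner_Integration.integrable_bound[OF bi Gm]) (use Gb in auto)
 have "(LINT w|Q. of_real (kern (a * Y N w) * u N (w (Suc N))) * cis (t * Y N w)) = (LINT w|Q. (LINT s|lborel. G w s))"
 proof (intro Bochner_Integration.integral_cong refl)
  fix w
  have "G w s = of_real (tent s) * cis (a * Y N w * s) * (cis (t * Y N w) * of_real (u N (w (Suc N))))" for s by (simp add: G_def distrib_right cis_mult[symmetric] mult_ac)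
  then have "(LINT s|lborel. G w s) = of_real (kern (a * Y N w)) * (cis (t * Y N w) * of_real (u N (w (Suc N))))" by (simp only: integral_mult_left_zero kern_fourier)
  then show "of_real (kern (a * Y N w) * u N (w (Suc N))) * cis (t * Y N w) = (LINT s|lborel. G w s)" by simp
 qed
 also have "... = (LINT s|lborel. (LINT w|Q. G w s))" by (rule QL.Fubini_integral[symmetric, OF Gi])
 also have "... = (LINT s|lborel. of_real (tent s) * Psi N (a * s + t))" unfolding G_def Psi_def by simp
 also have "... = abs (1 / a) *\<^sub>R (LINT x|lborel. of_real (tent (- t / a + 1 / a * x)) * Psi N (a * (- t / a + 1 / a * x) + t))" by (rule lborel_integral_real_affine) (use a in auto)
 also have "... = of_real (1 / a) * (LINT x|lborel. of_real (tent ((x - t) / a)) * Psi N x)"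
 proof -
  have "- t / a + 1 / a * x = (x - t) / a" "a * (- t / a + 1 / a * x) + t = x" for x using a by (simp_all add: field_simps)
  then show ?thesis using a by (simp only: scaleR_conv_of_real) simp
 qed
 finally show ?thesis .
qed

lemma nearest_frequency: obtains k :: int where "abs ((fq dl k) - t) <= pi / dl"
proof -
 let ?k = "round (t * dl / (2 * pi))"
 have "abs (of_int ?k - t * dl / (2 * pi)) <= 1 / 2" by (rule of_int_round_abs_le)
 then have "2 * pi / dl * abs (of_int ?k - t * dl / (2 * pi)) <= 2 * pi / dl * (1 / 2)" using dl by (intro mult_left_mono) auto
 also have "2 * pi / dl * abs (of_int ?k - t * dl / (2 * pi)) = abs (2 * pi / dl * (of_int ?k - t * dl / (2 * pi)))" using dl by (simp only: abs_mult) simp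
 also have "2 * pi / dl * (of_int ?k - t * dl / (2 * pi)) = (fq dl ?k) - t" using dl by (simp add: right_diff_distrib)
 finally show thesis by (intro that[of ?k]) simp
qed

text \<open>The interval [t - a, t + a] can contain no resonant frequency other than k, since a + pi
  / dl < 2 pi / dl; so either \<open>fourier_peak\<close> or \<open>fourier_zero\<close> applies.
  The weight \<open>pr N\<close> need not converge, but it is bounded below by \<open>c0\<close> and
  can be divided out.\<close>

lemma char_limit:
 assumes a: "a > 0" "a <= pi / (2 * dl)" "2 * a <= 1 / (2 * K)" and k: "abs ((fq dl k) - t) <= pi / dl"
 shows "(%N. of_real (sg N / pr N) * (LINT w|Q. of_real (kern (a * Y N w) * u N (w (Suc N))) * cis (t * Y N w)))
  ----> of_real (sqrt (2 * pi) * exp (- (z0^2) / 2) / a * tent ((fq dl k - t) / a)) * EF k"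
proof -
 let ?x = "(fq dl k)"
 define wt where "wt x = tent ((x - t) / a)" for x
 have wc: "continuous_on UNIV wt" unfolding wt_def by (intro continuous_on_compose2[OF continuous_tent]) (use a in \<open>auto intro!: continuous_intros\<close>)
 have w1: "abs (wt x) <= 1" for x using tent_bounds[of "(x - t) / a"] by (simp add: wt_def)
 have w0: "wt x = 0" if "x \<notin> {t - a..t + a}" for x
 proof -
  have "abs (x - t) >= a" using that by auto
  then show ?thesis unfolding wt_def using a by (intro tent_bounds(3)) (simp add: abs_divide)
 qed
 define c where "c = of_real (wt ?x * sqrt (2 * pi) * exp (- (z0^2) / 2)) * EF k"
 have "(%N. of_real (sg N) * (LINT x|lborel. of_real (wt x) * Psi N x) - of_real (pr N) * c) ----> 0"
 proof (cases "?x : {t - a..t + a}")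
  case True
  show ?thesis using fourier_peak[OF wc w1 w0 _ True] a by (simp add: c_def mult_ac)
 next
  case False
  have "(fq dl j) \<notin> {t - a..t + a}" for j :: int
  proof
   assume j: "(fq dl j) : {t - a..t + a}"
   then have "abs ((fq dl j) - ?x) <= a + pi / dl" using k by auto
   also have "... < 2 * pi / dl"
   proof -
    have "pi / (2 * dl) = pi / dl / 2" "2 * pi / dl = 2 * (pi / dl)" "pi / dl > 0" using dl by auto
    then show ?thesis using a(2) by linarith
   qed
   also have "(fq dl j) - ?x = 2 * pi / dl * of_int (j - k)" by (simp add: right_diff_distrib)
   finally have "2 * pi / dl * abs (of_int (j - k)) < 2 * pi / dl" unfolding abs_mult using dl by simp
   then have "2 * pi / dl * abs (of_int (j - k)) < 2 * pi / dl * 1" by simp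
   then have "abs (of_int (j - k) :: real) < 1" by (rule mult_less_cancel_left_pos[THEN iffD1, rotated]) (use dl in simp)
   then have "j = k" by linarith
   then show False using j False by simp
  qed
  from fourier_zero[OF borel_measurable_continuous_onI[OF wc] w1 w0 _ _ this] a w0[OF False] show ?thesis by (simp add: c_def)
 qed
 then have l: "(%N. inverse c0 * cmod (of_real (sg N) * (LINT x|lborel. of_real (wt x) * Psi N x) - of_real (pr N) * c)) ----> 0" using tendsto_mult_left[OF tendsto_norm_zero, of _ _ "inverse c0"] by fastforce
 have "(%N. of_real (sg N / pr N) * (LINT x|lborel. of_real (wt x) * Psi N x) - c) ----> 0"
 proof (rule Lim_null_comparison[OF _ l])
  show "\<forall>\<^sub>F N in sequentially. cmod (of_real (sg N / pr N) * (LINT x|lborel. of_real (wt x) * Psi N x) - c) <=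
    inverse c0 * cmod (of_real (sg N) * (LINT x|lborel. of_real (wt x) * Psi N x) - of_real (pr N) * c)" using eventually_ge_at_top[of 1]
  proof eventually_elim
   case (elim N)
   have p: "c0 <= pr N" unfolding pr_def by (rule c0(2)[OF elim])
   then have "of_real (sg N / pr N) * (LINT x|lborel. of_real (wt x) * Psi N x) - c = of_real (inverse (pr N)) * (of_real (sg N) * (LINT x|lborel. of_real (wt x) * Psi N x) - of_real (pr N) * c)"
    using c0(1) by (simp add: field_simps)
   moreover have "inverse (pr N) <= inverse c0" "0 <= inverse (pr N)" using p c0(1) by (auto intro: le_imp_inverse_le)
   ultimately show ?case by (simp only: norm_mult norm_of_real) (intro mult_right_mono, auto)
  qed
 qed
 then have "(%N. of_real (sg N / pr N) * (LINT x|lborel. of_real (wt x) * Psi N x)) ----> c" by (rule LIM_zero_cancel)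
 from tendsto_mult_left[OF this, of "of_real (1 / a)"]
 show ?thesis unfolding kern_expectation[OF a(1)] by (simp add: c_def wt_def mult_ac)
qed

text \<open>The law of \<open>Y N\<close>, weighted by the Fejer kernel and scaled by
  \<open>sg N\<close>, is shown to converge to the law of m dl + F, with m running over the integers
  with counting measure, weighted by the same kernel. \<open>char_limit\<close> gives the
  characteristic functions and Poisson summation identifies their limit. A test function is the
  kernel times a bounded continuous function.\<close>

theorem local_limit_theorem:
 assumes phi: "continuous_on UNIV phi" and supp: "compact (closure {t. phi t ~= 0})"
 shows "(%N. sg N * (LINT w|Q. phi (Y N w) * u N (w (Suc N))) / pr N) ---->
  dl * exp (- (z0^2) / 2) / sqrt (2 * pi) * (\<Sum>\<^sub>\<infinity>m\<in>(UNIV :: int set). (LINT w|Q. phi (of_int m * dl + F w)))"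
proof -
 note [measurable_cong] = chain_lawD(2)[OF Q]
 note Fm [measurable]
 have [measurable]: "phi : borel_measurable borel" using phi by (rule borel_measurable_continuous_onI)
 have [measurable]: "kern : borel_measurable borel" using continuous_kern by (rule borel_measurable_continuous_onI)
 obtain A where A: "A > 0" "!!t. t : closure {t. phi t ~= 0} ==> abs t < A" using compact_imp_bounded[OF supp] unfolding bounded_pos_less real_norm_def by blast
 \<comment> \<open>\<open>pi / A\<close> keeps the kernel positive on the support of phi,
   \<open>pi / (2 * dl)\<close> separates the resonant frequencies, and \<open>1 / (4 * K)\<close>
   makes an interval of length 2a short enough for the quadratic bound.\<close>
 define a where "a = min (pi / A) (min (pi / (2 * dl)) (1 / (4 * K)))"
 have a0: "a > 0" using A(1) dl K(2) by (simp add: a_def)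
 have "a <= 1 / (4 * K)" by (simp add: a_def)
 then have "2 * a <= 2 * (1 / (4 * K))" by simp
 then have a2: "2 * a <= 1 / (2 * K)" by simp
 have a1: "a <= pi / (2 * dl)" "a <= pi / A" by (auto simp: a_def)
 then have aA: "a * A <= pi" using A(1) by (simp add: field_simps)
 define U where "U = {t. abs (a * t) < 2 * pi}"
 have U: "open U" unfolding U_def by (intro open_Collect_less continuous_intros)
 have sU: "closure {t. phi t ~= 0} \<subseteq> U"
 proof
  fix t assume "t : closure {t. phi t ~= 0}"
  then have "a * abs t <= a * A" using A(2) a0 by (intro mult_left_mono) (auto intro: less_imp_le)
  then have "a * abs t < 2 * pi" using aA pi_gt_zero by linarith
  then show "t : U" using a0 by (simp add: U_def abs_mult)
 qed
 define h where "h t = phi t / kern (a * t)" for t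
 have hc: "continuous_on UNIV h" unfolding h_def
 proof (rule continuous_on_divide_supported[OF phi _ sU U])
  show "continuous_on UNIV (%t. kern (a * t))" by (rule continuous_on_compose2[OF continuous_kern]) (auto intro!: continuous_intros)
  show "kern (a * t) ~= 0" if "t : U" for t using kern_pos[of "a * t"] that by (simp add: U_def)
 qed
 have kh: "kern (a * t) * h t = phi t" for t
 proof (cases "phi t = 0")
  case False
  then have "t : U" using sU closure_subset[of "{t. phi t ~= 0}"] by blast
  then show ?thesis using kern_pos[of "a * t"] by (simp add: U_def h_def)
 qed (simp add: h_def)
 obtain b where b: "!!t. abs (h t) <= b"
 proof -
  have cp: "compact (h ` closure {t. phi t ~= 0})" by (intro compact_continuous_image continuous_on_subset[OF hc] supp) auto
  from bounded_pos[THEN iffD1, OF compact_imp_bounded[OF cp]]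
  obtain b where b0: "b > 0" "\<forall>x\<in>h ` closure {t. phi t ~= 0}. norm x <= b" by (elim exE conjE)
  then have b: "b > 0" "!!t. t : closure {t. phi t ~= 0} ==> abs (h t) <= b" by auto
  have "abs (h t) <= b" for t
  proof (cases "phi t = 0")
   case False
   then show ?thesis using b(2)[of t] closure_subset[of "{t. phi t ~= 0}"] by blast
  qed (use b(1) in \<open>simp add: h_def\<close>)
  then show thesis by (rule that)
 qed
 \<comment> \<open>The absolute value makes the weight nonnegative for every N; \<open>sg N\<close>
   is positive eventually.\<close>
 define g where "g N w = kern (a * Y N w) * u N (w (Suc N)) * (abs (sg N) / pr N)" for N w
 have g0: "0 <= g N w" for N w unfolding g_def using kern_nonneg u pr_le(1) by (intro mult_nonneg_nonneg divide_nonneg_nonneg) auto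
 have ku1: "abs (kern (a * Y N w) * u N (w (Suc N))) <= 1" for N w using mult_mono[OF kern_le(2)[of "a * Y N w"], of "u N (w (Suc N))" 1] kern_nonneg u by simp
 have gi: "integrable Q (g N)" for N
 proof -
  have "integrable Q (%w. kern (a * Y N w) * u N (w (Suc N)))" by (rule law_integrable[OF Q, where C=1]) (use ku1 in \<open>simp_all\<close>)
  then show ?thesis unfolding g_def by (rule integrable_mult_left)
 qed
 interpret C: sigma_finite_measure "count_space (UNIV :: int set)" by (rule sigma_finite_measure_count_space)
 interpret QC: pair_sigma_finite Q "count_space (UNIV :: int set)" ..
 define c where "c = dl * exp (- (z0^2) / 2) / sqrt (2 * pi)"
 have c: "c > 0" using dl by (simp add: c_def)
 \<comment> \<open>Counting measure on the integers turns the sum over the lattice into part of one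
   integral, so that the limit is again a weighted image measure.\<close>
 define Y' where "Y' x = of_int (snd x) * dl + F (fst x)" for x :: "(nat => 'a) \<times> int"
 define g' where "g' x = c * kern (a * Y' x)" for x
 let ?M = "Q \<Otimes>\<^sub>M count_space (UNIV :: int set)"
 have "(%m::int. of_int m :: real) : borel_measurable (count_space UNIV)" by simp
 then have [measurable]: "(%x. of_int (snd x) :: real) : borel_measurable ?M" by (rule measurable_compose[OF measurable_snd])
 have Y'm [measurable]: "Y' : borel_measurable ?M" unfolding Y'_def by measurable
 have g'm [measurable]: "g' : borel_measurable ?M" unfolding g'_def by measurable
 have inner: "integrable (count_space UNIV) (%m. of_real (g' (w, m)) * cis (t * Y' (w, m)))"
   "(LINT m|(count_space UNIV). of_real (g' (w, m)) * cis (t * Y' (w, m))) =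
   of_real (sqrt (2 * pi) * exp (- (z0^2) / 2) / a * tent ((fq dl k - t) / a)) * cis (fq dl k * F w)"
  if k: "abs ((fq dl k) - t) <= pi / dl" for t w and k :: int
 proof -
  let ?f = "%m::int. of_real (kern (a * (of_int m * dl + F w))) * cis (t * (of_int m * dl + F w))"
  have s: "(%m. cmod (?f m)) summable_on UNIV" using kern_lattice_summable[OF a0 dl, of "F w"] kern_nonneg by (simp add: norm_mult)
  note h = has_sum_count_space[OF s kern_poisson[OF a0 a1(1) dl k]]
  have eq: "of_real (g' (w, m)) * cis (t * Y' (w, m)) = of_real c * ?f m" for m by (simp add: g'_def Y'_def)
  show "integrable (count_space UNIV) (%m. of_real (g' (w, m)) * cis (t * Y' (w, m)))" unfolding eq using h(1) by simp
  have "sqrt (2 * pi) * sqrt (2 * pi) = 2 * pi" by simp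
  then have cc: "c * (2 * pi / (a * dl)) = sqrt (2 * pi) * exp (- (z0^2) / 2) / a" unfolding c_def using dl a0 by (simp add: field_simps)
  show "(LINT m|(count_space UNIV). of_real (g' (w, m)) * cis (t * Y' (w, m))) =
   of_real (sqrt (2 * pi) * exp (- (z0^2) / 2) / a * tent ((fq dl k - t) / a)) * cis (fq dl k * F w)" unfolding eq integral_mult_right_zero h(2) cc[symmetric] by simp
 qed
 have g'int: "(LINT m|(count_space UNIV). g' (w, m)) = sqrt (2 * pi) * exp (- (z0^2) / 2) / a" "integrable (count_space UNIV) (%m. g' (w, m))" for w
 proof -
  \<comment> \<open>At t = 0 the nearest resonance is 0 itself and the tent equals 1; this case
    yields the total mass of the limit.\<close>
  have 0: "abs (2 * pi / dl * of_int 0 - 0) <= pi / dl" using dl by simp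
  have "(LINT m|(count_space UNIV). of_real (g' (w, m))) = (of_real (sqrt (2 * pi) * exp (- (z0^2) / 2) / a) :: complex)" using inner(2)[OF 0, of w] by (simp add: tent_def)
  then show "(LINT m|(count_space UNIV). g' (w, m)) = sqrt (2 * pi) * exp (- (z0^2) / 2) / a" unfolding integral_complex_of_real of_real_eq_iff .
  have "integrable (count_space UNIV) (%m. of_real (g' (w, m)) :: complex)" using inner(1)[OF 0, of w] by simp
  then show "integrable (count_space UNIV) (%m. g' (w, m))" by (simp add: complex_of_real_integrable_eq)
 qed
 have g'0: "0 <= g' x" for x unfolding g'_def using c kern_nonneg by (intro mult_nonneg_nonneg) auto
 have g'i: "integrable ?M g'" by (rule QC.Fubini_integrable) (use g'0 g'int in auto)
 have g'T: "(LINT x|?M. g' x) = sqrt (2 * pi) * exp (- (z0^2) / 2) / a" unfolding QC.integral_fst'[OF g'i, symmetric] g'int by (simp add: Q.prob_space)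
 have "(%N. (LINT w|Q. g N w * h (Y N w))) ----> (LINT x|?M. g' x * h (Y' x))"
 proof (rule weighted_levy[OF gi g0 _ g'i g'0 _ Y'm _ hc b])
  show "Y N : borel_measurable Q" for N by measurable
  show "0 < (LINT x|?M. g' x)" unfolding g'T using a0 by simp
  fix t
  obtain k :: int where k: "abs ((fq dl k) - t) <= pi / dl" by (rule nearest_frequency)
  have "integrable ?M (%x. of_real (g' x) * cis (t * Y' x))" by (rule Bochner_Integration.integrable_bound[OF g'i]) (simp_all add: norm_mult)
  then have "(LINT x|?M. of_real (g' x) * cis (t * Y' x)) = (LINT w|Q. (LINT m|(count_space UNIV). of_real (g' (w, m)) * cis (t * Y' (w, m))))" by (rule QC.integral_fst'[symmetric])
  also have "... = of_real (sqrt (2 * pi) * exp (- (z0^2) / 2) / a * tent ((fq dl k - t) / a)) * EF k" unfolding inner(2)[OF k] EF_def by (rule integral_mult_right_zero)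
  finally have r: "(LINT x|?M. of_real (g' x) * cis (t * Y' x)) = of_real (sqrt (2 * pi) * exp (- (z0^2) / 2) / a * tent ((fq dl k - t) / a)) * EF k" .
  show "(%N. (LINT w|Q. of_real (g N w) * cis (t * Y N w))) ----> (LINT x|?M. of_real (g' x) * cis (t * Y' x))" unfolding r
  proof (rule Lim_transform_eventually[OF char_limit[OF a0 a1(1) a2 k]])
   have "\<forall>\<^sub>F N in sequentially. sg N > 0" using sg by (rule filterlim_at_top_dense[THEN iffD1, rule_format])
   then show "\<forall>\<^sub>F N in sequentially. of_real (sg N / pr N) * (LINT w|Q. of_real (kern (a * Y N w) * u N (w (Suc N))) * cis (t * Y N w)) = (LINT w|Q. of_real (g N w) * cis (t * Y N w))"
   proof eventually_elim
    case (elim N)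
    show ?case unfolding integral_mult_right_zero[symmetric] g_def using elim by (intro Bochner_Integration.integral_cong refl) (simp add: mult_ac)
   qed
  qed
 qed
 moreover have "(LINT x|?M. g' x * h (Y' x)) = c * (\<Sum>\<^sub>\<infinity>m\<in>(UNIV :: int set). (LINT w|Q. phi (of_int m * dl + F w)))"
 proof -
  have eq: "g' x * h (Y' x) = c * phi (Y' x)" for x using kh[of "Y' x"] by (simp add: g'_def mult.assoc)
  have hm: "h : borel_measurable borel" using hc by (rule borel_measurable_continuous_onI)
  have "integrable ?M (%x. g' x * h (Y' x))"
  proof (rule Bochner_Integration.integrable_bound[OF integrable_mult_left[OF g'i, of b]])
   show "(%x. g' x * h (Y' x)) : borel_measurable ?M" using measurable_compose[OF Y'm hm] by measurable
   show "AE x in ?M. norm (g' x * h (Y' x)) <= norm (g' x * b)" using mult_left_mono[OF order_trans[OF b abs_ge_self] g'0] g'0 by (simp add: abs_mult)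
  qed
  then have i: "integrable ?M (%(w, m). phi (of_int m * dl + F w))" unfolding eq using c by (simp add: Y'_def split_beta')
  have ab: "integrable (count_space UNIV) (%m. (LINT w|Q. phi (of_int m * dl + F w)))" by (rule QC.integrable_snd[OF i])
  have "(LINT x|?M. phi (Y' x)) = (LINT m|(count_space UNIV). (LINT w|Q. phi (of_int m * dl + F w)))" using QC.integral_snd[OF i] by (simp add: Y'_def split_beta')
  also have "... = (\<Sum>\<^sub>\<infinity>m\<in>(UNIV :: int set). (LINT w|Q. phi (of_int m * dl + F w)))" using infsetsum_infsum[of "%m. (LINT w|Q. phi (of_int m * dl + F w))" UNIV] ab
   by (simp add: infsetsum_def Infinite_Set_Sum.abs_summable_on_def)
  finally show ?thesis unfolding eq by simp
 qed
 ultimately have lim: "(%N. (LINT w|Q. g N w * h (Y N w))) ----> c * (\<Sum>\<^sub>\<infinity>m\<in>(UNIV :: int set). (LINT w|Q. phi (of_int m * dl + F w)))" by simp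
 show ?thesis unfolding c_def[symmetric]
 proof (rule Lim_transform_eventually[OF lim])
  have "\<forall>\<^sub>F N in sequentially. sg N > 0" using sg by (rule filterlim_at_top_dense[THEN iffD1, rule_format])
  then show "\<forall>\<^sub>F N in sequentially. (LINT w|Q. g N w * h (Y N w)) = sg N * (LINT w|Q. phi (Y N w) * u N (w (Suc N))) / pr N"
  proof eventually_elim
   case (elim N)
   have "g N w * h (Y N w) = sg N / pr N * (phi (Y N w) * u N (w (Suc N)))" for w using kh[of "Y N w", symmetric] elim by (simp add: g_def mult_ac)
   then show ?case by simp
  qed
 qed
qed

end

section \<open>Essential range\<close>

lemma cis_eq_1_multiples:
 assumes "cis (xi * x) = 1" "xi ~= 0"
 shows "x : multiples (2 * pi / xi)"
proof -
 have "cos (xi * x) = 1" using arg_cong[OF assms(1), of Re] by simp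
 then obtain k :: int where "xi * x = of_int k * 2 * pi" unfolding cos_one_2pi_int by auto
 then have "x = 2 * pi / xi * of_int k" using assms(2) by (simp add: field_simps)
 then show ?thesis by (auto simp: multiples_def)
qed

lemma closed_subgroup_diff: "closed_subgroup G ==> x : G ==> y : G ==> x - y : G"
 and closed_subgroup_0: "closed_subgroup G ==> 0 : G" by (auto simp: closed_subgroup_def)

lemma closed_subgroup_mult:
 assumes G: "closed_subgroup G" and x: "x : G"
 shows "x * of_int n : G"
proof -
 have m: "- y : G" if "y : G" for y using closed_subgroup_diff[OF G closed_subgroup_0[OF G] that] by simp
 have nat: "x * of_nat k : G" for k :: nat
 proof (induction k)
  case (Suc k)
  then show ?case using closed_subgroup_diff[OF G x m[OF Suc]] by (simp add: distrib_left)
 qed (simp add: closed_subgroup_0[OF G])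
 show ?thesis using nat[of "nat n"] m[OF nat[of "nat (- n)"]] by (cases "n >= 0") auto
qed

lemma multiples_closed_subgroup: "closed_subgroup (multiples r)"
proof (cases "r = 0")
 case True
 then have "multiples r = {0}" by (auto simp: multiples_def)
 then show ?thesis by (simp add: closed_subgroup_def)
next
 case False
 have "closed (range (%m::int. r * of_int m))"
 proof (rule discrete_imp_closed[of "abs r"])
  show "\<forall>x\<in>range (\<lambda>m::int. r * of_int m). \<forall>y\<in>range (\<lambda>m::int. r * of_int m). dist y x < abs r --> y = x"
  proof clarify
   fix m n :: int assume "dist (r * of_int m) (r * of_int n) < abs r"
   then have "abs r * abs (of_int (m - n)) < abs r * 1" by (simp add: dist_real_def right_diff_distrib[symmetric] abs_mult)
   then have "abs (of_int (m - n) :: real) < 1" using False by (simp add: mult_less_cancel_left_pos)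
   then have "m = n" by linarith
   then show "r * of_int m = r * of_int n" by simp
  qed
 qed (use False in simp)
 then show ?thesis unfolding closed_subgroup_def multiples_def by (auto simp: image_iff right_diff_distrib[symmetric] simp flip: of_int_diff intro: exI[of _ 0])
qed

text \<open>If the group had arbitrarily small positive elements, it would be dense and, being
  closed, the whole line. Otherwise the infimum of the positive elements is attained and division
  with remainder shows that it generates.\<close>

lemma closed_subgroup_cases:
 assumes G: "closed_subgroup G" "G ~= UNIV" and d: "d : G" "d > 0"
 obtains r where "r > 0" "G = multiples r"
proof -
 have "\<exists>e>0. \<forall>x\<in>G. x > 0 --> x >= e"
 proof (rule ccontr)
  assume "~ ?thesis"
  then have small: "\<exists>g\<in>G. 0 < g & g < e" if "e > 0" for e using that by (meson not_le)
  have "x : closure G" for x unfolding closure_approachable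
  proof (intro allI impI)
   fix e :: real assume "e > 0"
   then obtain g where g: "g : G" "0 < g" "g < e" using small by blast
   have "g * of_int \<lfloor>x / g\<rfloor> : G" by (rule closed_subgroup_mult[OF G(1) g(1)])
   moreover have "g * of_int \<lfloor>x / g\<rfloor> <= x" "x < g * (of_int \<lfloor>x / g\<rfloor> + 1)" using g floor_divide_lower[of g x] floor_divide_upper[of g x] by (auto simp: mult.commute)
   then have "dist (g * of_int \<lfloor>x / g\<rfloor>) x < e" using g by (simp add: dist_real_def distrib_left)
   ultimately show "\<exists>y\<in>G. dist y x < e" by blast
  qed
  then show False using G by (auto simp: closed_subgroup_def closure_closed)
 qed
 then obtain e where e: "e > 0" "!!x. x : G ==> x > 0 ==> e <= x" by blast
 define A where "A = {x : G. x > 0}"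
 define r where "r = Inf A"
 have A: "A ~= {}" "bdd_below A" using d by (auto simp: A_def intro!: bdd_belowI[of _ 0])
 have r: "r >= e" unfolding r_def using A e(2) by (intro cInf_greatest) (auto simp: A_def)
 have lo: "r <= x" if "x : A" for x unfolding r_def using that A(2) by (rule cInf_lower)
 have "r : A"
 proof (rule ccontr)
  assume rA: "r \<notin> A"
  obtain g where g: "g : A" "g < r + e" using cInf_less_iff[OF A, of "r + e"] e(1) unfolding r_def by auto
  have "r < g" using lo[OF g(1)] rA g(1) by (cases "r = g") auto
  then obtain g' where g': "g' : A" "g' < g" using cInf_less_iff[OF A, of g] unfolding r_def by auto
  have "e <= g - g'" using g(1) g' closed_subgroup_diff[OF G(1)] by (intro e(2)) (auto simp: A_def)
  then show False using lo[OF g'(1)] g(2) by simp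
 qed
 then have rG: "r : G" "r > 0" by (auto simp: A_def)
 show thesis
 proof (rule that[OF rG(2)])
  show "G = multiples r"
  proof
   show "multiples r \<subseteq> G" using closed_subgroup_mult[OF G(1) rG(1)] by (auto simp: multiples_def)
   show "G \<subseteq> multiples r"
   proof
    fix x assume x: "x : G"
    define y where "y = x - r * of_int \<lfloor>x / r\<rfloor>"
    have "y : G" unfolding y_def by (intro closed_subgroup_diff[OF G(1) x] closed_subgroup_mult[OF G(1) rG(1)])
    moreover have "0 <= y" "y < r" using floor_divide_lower[OF rG(2), of x] floor_divide_upper[OF rG(2), of x] by (auto simp: y_def algebra_simps)
    ultimately have "y = 0" using lo[of y] by (cases "y = 0") (auto simp: A_def)
    then show "x : multiples r" by (auto simp: y_def multiples_def)
   qed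
  qed
 qed
qed

lemma center_tightI:
 assumes P: "prob_space P" and X: "!!N. X N : borel_measurable P" "!!N. integrable P (%w. (X N w)^2)" "!!N. (LINT w|P. (X N w)^2) <= v"
  and b: "!!N w. w : space P ==> abs (partial_sum f N w - m N) <= c + abs (X N w)"
 shows "center_tight P f" unfolding center_tight_def
proof (intro exI[of _ m] allI impI)
 interpret P: prob_space P by fact
 fix ep :: real assume ep: "ep > 0"
 have "0 <= (LINT w|P. (X 0 w)^2)" by (rule Bochner_Integration.integral_nonneg) simp
 then have v: "0 <= v" using X(3)[of 0] by linarith
 \<comment> \<open>Makes v / t^2 smaller than \<open>ep\<close>; the summand 1 keeps t positive when
   v = 0.\<close>
 define t where "t = sqrt (v / ep + 1)"
 have t: "t > 0" "t^2 = v / ep + 1" using v ep by (auto simp: t_def add_nonneg_pos)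
 show "\<exists>M. \<forall>N\<ge>1. measure P {w : space P. abs (partial_sum f N w - m N) > M} < ep"
 proof (intro exI[of _ "c + t"] allI impI)
  fix N :: nat
  have "measure P {w : space P. abs (partial_sum f N w - m N) > c + t} <= measure P {w : space P. t <= abs (X N w)}" using X(1)[of N] b[of _ N] by (intro P.finite_measure_mono) (fastforce, measurable)
  also have "... <= (LINT w|P. (X N w)^2) / t^2" using X t by (intro P.second_moment_method) auto
  also have "... <= v / t^2" using X(3) by (intro divide_right_mono) auto
  also have "... < ep" using v ep unfolding t(2) by (simp add: divide_less_eq field_simps add_nonneg_pos)
  finally show "measure P {w : space P. abs (partial_sum f N w - m N) > c + t} < ep" .
 qed
qed

lemma algebraic_range_subset:
 assumes "closed_subgroup G" "!!n. n >= 1 ==> AE w in P. st f n w - c n : G"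
 shows "algebraic_range P f \<subseteq> G" unfolding algebraic_range_def using assms by blast

section \<open>Resonant frequencies and the essential range\<close>

context elliptic_chain
begin

text \<open>A constant at each time multiplies the whole bridge integral by one unimodular
  number.\<close>

lemma dd_phase:
 assumes "!!j x y. cis (xi * f j x y) = cis (xi * h j x y) * cis (e j)"
 shows "dd f xi n = dd h xi n"
proof -
 have "cis (xi * Ph f n z x' a) = cis (xi * Ph h n z x' a) * cis (e n + e (Suc n) + e (Suc (Suc n)))" for z x' a by (cases a) (simp add: Ph_def distrib_left cis_mult[symmetric] assms mult_ac)
 then have "cmod (LINT a|(M2 n). Wt n z x' a *\<^sub>R cis (xi * Ph f n z x' a)) = cmod ((LINT a|(M2 n). Wt n z x' a *\<^sub>R cis (xi * Ph h n z x' a)) * cis (e n + e (Suc n) + e (Suc (Suc n))))" for z x'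
  by (simp only: mult_scaleR_left[symmetric] integral_mult_left_zero)
 then show ?thesis by (simp add: dd_def gap_def phase_gap_def norm_mult)
qed

lemma DD_scale: "addf f ==> DD f (2 ^ j * s) N <= 4 ^ j * DD f s N"
proof (induction j)
 case (Suc j)
 have eq: "2 ^ Suc j * s = 2 ^ j * s + 2 ^ j * s" by simp
 have "DD f (2 ^ Suc j * s) N <= 4 * DD f (2 ^ j * s) N" unfolding eq by (rule order_trans[OF DD_add[OF Suc(2)]]) simp
 then show ?case using Suc by simp
qed simp

lemma partial_sum_split: "N >= 2 ==> partial_sum f N w = partial_sum f 2 w + Sm f 3 N w"
proof -
 assume "N >= 2"
 then have "{1..N} = {1..2} \<union> {3..N}" by auto
 then show ?thesis by (simp add: partial_sum_def sum.union_disjoint)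
qed

lemma partial_sum_measurable: "addf f ==> partial_sum f N : borel_measurable paths" unfolding partial_sum_def[abs_def] by (rule Sm_measurable) auto

text \<open>Subtracting the lattice value of g from f gives \<open>h\<close>, which has the phases
  of f at 2 pi / r up to constants and equals f - g almost surely. Tightness of the latter bounds
  \<open>DD h\<close> near frequency 0, and doubling the frequency, at a factor 4 each time, carries
  the bound to 2 pi / r.\<close>

lemma lattice_frequency:
 assumes P: "chain_law P" and f: "addf f" and g: "addf g" and ct: "center_tight P (%n x y. f n x y - g n x y)"
  and r: "r > 0" and c: "!!n. n >= 1 ==> AE w in P. st g n w - c n : multiples r"
 shows "\<exists>d. \<forall>N. DD f (2 * pi / r) N <= d"
proof -
 interpret P: prob_space P using chain_lawD[OF P] by simp
 note [measurable_cong] = chain_lawD(2)[OF P]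
 \<comment> \<open>Rounding to the lattice makes the identity of phases hold for all arguments, as
   \<open>dd_phase\<close> demands, whereas g lies in its coset only almost surely.\<close>
 define h where "h n x y = f n x y - (c n + r * of_int (round ((g n x y - c n) / r)))" for n x y
 have h: "addf h" unfolding addf_def
 proof (intro allI impI)
  fix n :: nat assume n: "n >= 1"
  have [measurable]: "(%z. f n (fst z) (snd z)) : borel_measurable (B n \<Otimes>\<^sub>M B (Suc n))" "(%z. g n (fst z) (snd z)) : borel_measurable (B n \<Otimes>\<^sub>M B (Suc n))"
   using addfD[OF f n] addfD[OF g n] by (auto simp: pmeas_def split_beta')
  show "pmeas n (h n)" unfolding pmeas_def h_def split_beta' round_def by measurable
 qed
 have phase: "cis (2 * pi / r * f n x y) = cis (2 * pi / r * h n x y) * cis (2 * pi / r * c n)" for n x y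
 proof -
  have "2 * pi / r * f n x y = 2 * pi / r * h n x y + 2 * pi / r * c n + 2 * pi * of_int (round ((g n x y - c n) / r))" using r by (simp add: h_def field_simps)
  then show ?thesis by (simp only: cis_mult[symmetric]) simp
 qed
 have eq: "AE w in P. \<forall>n\<ge>1. st h n w = st f n w - st g n w"
 proof (intro AE_all_countable[THEN iffD2] allI)
  fix n
  show "AE w in P. 1 <= n --> st h n w = st f n w - st g n w"
  proof (cases "n >= 1")
   case True
   from c[OF this] show ?thesis
   proof eventually_elim
    case (elim w)
    then obtain k where k: "st g n w - c n = r * of_int k" by (auto simp: multiples_def)
    then have "st g n w = c n + r * of_int k" by simp
    then show ?case using r by (simp add: h_def)
   qed
  qed simp
 qed
 have pse: "AE w in P. partial_sum (%n x y. f n x y - g n x y) N w = partial_sum h N w" for N using eq by eventually_elim (auto simp: partial_sum_def)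
 obtain m where m: "!!ep. ep > 0 ==> \<exists>M. \<forall>N\<ge>1. measure P {w : space P. abs (partial_sum (%n x y. f n x y - g n x y) N w - m N) > M} < ep" using ct unfolding center_tight_def by blast
 obtain M where M: "!!N. N >= 1 ==> measure P {w : space P. abs (partial_sum (%n x y. f n x y - g n x y) N w - m N) > M} < 1 / 8" using m[of "1 / 8"] by auto
 define M' where "M' = 2 * max M 1"
 note [measurable] = partial_sum_measurable[OF h]
 have fg: "addf (%n x y. f n x y - g n x y)" using f g unfolding addf_def pmeas_def split_beta' by (auto intro!: borel_measurable_diff)
 note [measurable] = partial_sum_measurable[OF fg]
 have Mh: "measure P {w : space P. abs (partial_sum h N w - m N) > max M 1} <= 1 / 8" if "N >= 1" for N
 proof -
  have "measure P {w : space P. abs (partial_sum h N w - m N) > max M 1} <= measure P {w : space P. abs (partial_sum (%n x y. f n x y - g n x y) N w - m N) > M}"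
  proof (rule P.finite_measure_mono_AE)
   show "AE w in P. w : {w : space P. abs (partial_sum h N w - m N) > max M 1} --> w : {w : space P. abs (partial_sum (%n x y. f n x y - g n x y) N w - m N) > M}" using pse[of N] by eventually_elim auto
  qed measurable
  then show ?thesis using M[OF that] by simp
 qed
 have tight: "measure P {w : space P. abs (Sm h 3 N w - (m N - m 2)) > M'} <= 1 / 4" if N: "N >= 2" for N
 proof -
  let ?A = "%N. {w : space P. abs (partial_sum h N w - m N) > max M 1}"
  have "measure P {w : space P. abs (Sm h 3 N w - (m N - m 2)) > M'} <= measure P (?A N \<union> ?A 2)"
  proof (rule P.finite_measure_mono)
   show "?A N \<union> ?A 2 : sets P" by measurable
   show "{w : space P. abs (Sm h 3 N w - (m N - m 2)) > M'} \<subseteq> ?A N \<union> ?A 2" using partial_sum_split[OF N, of h] by (auto simp: M'_def)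
  qed
  also have "... <= measure P (?A N) + measure P (?A 2)" by (rule measure_Un_le) measurable
  finally show ?thesis using Mh[of N] Mh[of 2] N by simp
 qed
 have M'0: "M' > 0" by (simp add: M'_def)
 have small: "DD h s N <= ln 4 / cdec" if "abs s <= 1 / (4 * M')" for s N
 proof (rule tight_DD[OF P h M'0 that])
  show "\<exists>N\<ge>N0. \<exists>m. measure P {w : space P. abs (Sm h 3 N w - m) > M'} <= 1 / 4" for N0 using tight[of "max N0 2"] by (intro exI[of _ "max N0 2"]) auto
 qed
 \<comment> \<open>After j halvings 2 pi / r is small enough for \<open>tight_DD\<close>.\<close>
 obtain j where j: "2 * pi / r * (4 * M') < 2 ^ j" using real_arch_pow[of 2] by auto
 define s where "s = 2 * pi / r / 2 ^ j"
 have "abs s <= 1 / (4 * M')" using j r M'0 by (simp add: s_def field_simps)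
 then have "DD h (2 * pi / r) N <= 4 ^ j * (ln 4 / cdec)" for N using DD_scale[OF h, of j s N] mult_left_mono[OF small[of s N], of "4 ^ j"] by (simp add: s_def)
 moreover have "DD f (2 * pi / r) N = DD h (2 * pi / r) N" for N unfolding DD_def by (intro sum.cong refl dd_phase[OF phase])
 ultimately show ?thesis by auto
qed

lemma abs_sum_le_card:
 fixes x :: "nat => real"
 assumes "!!n. n : A ==> abs (x n) <= C" "card A <= k" "0 <= C"
 shows "abs (\<Sum>n\<in>A. x n) <= real k * C"
proof -
 have "abs (\<Sum>n\<in>A. x n) <= real (card A) * C" by (rule order_trans[OF sum_abs]) (use sum_mono[of A "%n. abs (x n)" "%_. C"] assms(1) in simp)
 also have "... <= real k * C" using assms by (intro mult_right_mono) auto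
 finally show ?thesis .
qed

text \<open>A converse to \<open>lattice_frequency\<close>: removing from f the remainder and the
  gradient found by \<open>reduction\<close> leaves values in a coset of (2 pi / xi)\<int>. What is
  removed has tight sums, since gradients telescope to bounded terms and \<open>var_bound\<close>
  controls the centred remainder. At times 1 and 2, which precede the reduction, g is set to
  0.\<close>

lemma reduced_functional:
 assumes P: "chain_law P" and f: "addf f" and K: "!!n x y. abs (f n x y) <= K" and d: "!!N. DD f xi N <= d" and xi: "xi ~= 0"
 obtains g where "addf g" "center_tight P (%n x y. f n x y - g n x y)" "algebraic_range P g \<subseteq> multiples (2 * pi / xi)"
proof -
 interpret P: prob_space P using chain_lawD[OF P] by simp
 obtain a h C where am: "!!n. n >= 3 ==> a n : borel_measurable (B n)" and ab: "!!n x. abs (a n x) <= pi / abs xi"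
  and hm: "!!n. n >= 3 ==> pmeas n (h n)" and hb: "!!n x y. abs (h n x y) <= pi / abs xi"
  and hs: "summable (%n. if n : {7..} then Ex P n (%x y. (h n x y)^2) else 0)"
  and red: "!!n x y. n >= 3 ==> cis (xi * (f n x y - h n x y - a (Suc n) y + a n x - C n)) = 1" by (rule reduction[OF P f d xi]) (rule that; (blast | simp))
 let ?p = "pi / abs xi"
 define g where "g n x y = (if n >= 3 then f n x y - h n x y - a (Suc n) y + a n x else 0)" for n x y
 have g: "addf g" unfolding addf_def
 proof (intro allI impI)
  fix n :: nat assume n: "n >= 1"
  show "pmeas n (g n)"
  proof (cases "n >= 3")
   case True
   have [measurable]: "(%z. f n (fst z) (snd z)) : borel_measurable (B n \<Otimes>\<^sub>M B (Suc n))" "(%z. h n (fst z) (snd z)) : borel_measurable (B n \<Otimes>\<^sub>M B (Suc n))"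
    using addfD[OF f n] hm[OF True] by (auto simp: pmeas_def split_beta')
   have [measurable]: "a n : borel_measurable (B n)" "a (Suc n) : borel_measurable (B (Suc n))" using am True by auto
   show ?thesis using True unfolding pmeas_def g_def split_beta' by simp
  next
   case False
   then show ?thesis by (simp add: pmeas_def g_def)
  qed
 qed
 have range: "algebraic_range P g \<subseteq> multiples (2 * pi / xi)"
 proof (rule algebraic_range_subset[OF multiples_closed_subgroup, where c="%n. if n >= 3 then C n else 0"])
  fix n :: nat
  have "g n x y - (if n >= 3 then C n else 0) : multiples (2 * pi / xi)" for x y using cis_eq_1_multiples[OF red xi, of n x y] closed_subgroup_0[OF multiples_closed_subgroup] by (auto simp: g_def)
  then show "AE w in P. st g n w - (if n >= 3 then C n else 0) : multiples (2 * pi / xi)" by simp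
 qed
 define X where "X N w = (\<Sum>n=7..N. st h n w - Ex P n (h n))" for N w
 have Xm: "X N : borel_measurable paths" for N unfolding X_def using hm by (intro borel_measurable_sum borel_measurable_diff borel_measurable_const pmeas_path) auto
 have p0: "0 <= ?p" by simp
 have K0: "0 <= K" using K[of 0] order_trans abs_ge_zero by blast
 have ct: "center_tight P (%n x y. f n x y - g n x y)"
 proof (rule center_tightI[OF P.prob_space_axioms])
  show "X N : borel_measurable P" for N using Xm chain_lawD(2)[OF P] by (simp add: measurable_def chain_lawD(3)[OF P])
  show "integrable P (%w. (X N w)^2)" for N
  proof (rule law_integrable[OF P, where C="(\<Sum>n=7..N. ?p + abs (Ex P n (h n)))^2"])
   show "(%w. (X N w)^2) : borel_measurable paths" using Xm by measurable
   have "abs (X N w) <= (\<Sum>n=7..N. ?p + abs (Ex P n (h n)))" for w unfolding X_def by (intro order_trans[OF sum_abs sum_mono] order_trans[OF abs_triangle_ineq4] add_mono hb) auto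
   then show "norm ((X N w)^2) <= (\<Sum>n=7..N. ?p + abs (Ex P n (h n)))^2" for w by (simp add: abs_le_square_iff_D)
  qed
  let ?s = "%n. if n : {7..} then Ex P n (%x y. (h n x y)^2) else 0"
  show "(LINT w|P. (X N w)^2) <= cvar * suminf ?s" for N
  proof -
   have "(LINT w|P. (X N w)^2) <= cvar * (\<Sum>n=7..N. Ex P n (%x y. (h n x y)^2))" unfolding X_def using hm hb by (intro var_bound[OF P P, where C="%_. ?p"]) auto
   also have "(\<Sum>n=7..N. Ex P n (%x y. (h n x y)^2)) = sum ?s {7..N}" by (intro sum.cong) auto
   also have "... <= suminf ?s" by (rule sum_le_suminf[OF hs]) (auto simp: Ex_def)
   finally show ?thesis using cvar_nonneg by (simp add: mult_left_mono)
  qed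
  fix N :: nat and w :: "nat => 'a"
  let ?h = "%n. st h n w"
  let ?D = "%n. st f n w - st g n w"
  have s1: "{1..N} = ({1..N} \<inter> {..2}) \<union> {3..N}" "{3..N} = ({3..N} \<inter> {..6}) \<union> {7..N}" by auto
  have "(\<Sum>n\<in>{1..N}. ?D n) = (\<Sum>n\<in>{1..N} \<inter> {..2}. ?D n) + (\<Sum>n\<in>{3..N}. ?D n)" by (subst s1(1), subst sum.union_disjoint) auto
  also have "(\<Sum>n\<in>{3..N}. ?D n) = (\<Sum>n\<in>{3..N}. ?h n) + (\<Sum>n\<in>{3..N}. a (Suc n) (w (Suc n)) - a n (w n))" unfolding sum.distrib[symmetric] by (intro sum.cong) (auto simp: g_def)
  also have "(\<Sum>n\<in>{3..N}. ?h n) = (\<Sum>n\<in>{3..N} \<inter> {..6}. ?h n) + (\<Sum>n\<in>{7..N}. ?h n)" by (subst s1(2), subst sum.union_disjoint) auto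
  finally have eq: "partial_sum (%n x y. f n x y - g n x y) N w - (\<Sum>n=7..N. Ex P n (h n)) =
    (\<Sum>n\<in>{1..N} \<inter> {..2}. ?D n) + (\<Sum>n\<in>{3..N} \<inter> {..6}. ?h n) + (\<Sum>n\<in>{3..N}. a (Suc n) (w (Suc n)) - a n (w n)) + X N w" by (simp add: partial_sum_def X_def sum_subtractf)
  have c: "card ({1..N} \<inter> {..2}) <= 2" "card ({3..N} \<inter> {..6}) <= 4" using card_mono[of "{1..2::nat}" "{1..N} \<inter> {..2}"] card_mono[of "{3..6::nat}" "{3..N} \<inter> {..6}"] by auto
  have b1: "abs (\<Sum>n\<in>{1..N} \<inter> {..2}. ?D n) <= real 2 * K" by (rule abs_sum_le_card[OF _ c(1) K0]) (use K in \<open>auto simp: g_def\<close>)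
  have b2: "abs (\<Sum>n\<in>{3..N} \<inter> {..6}. ?h n) <= real 4 * ?p" by (rule abs_sum_le_card[OF _ c(2) p0]) (rule hb)
  have b3: "abs (\<Sum>n\<in>{3..N}. a (Suc n) (w (Suc n)) - a n (w n)) <= 2 * ?p"
  proof (cases "N >= 2")
   case True
   then have "(\<Sum>n\<in>{3..N}. a (Suc n) (w (Suc n)) - a n (w n)) = a (Suc N) (w (Suc N)) - a 3 (w 3)" using sum_Suc_diff[of 3 N "%n. a n (w n)"] by simp
   then show ?thesis using ab[of "Suc N" "w (Suc N)"] ab[of 3 "w 3"] by linarith
  qed (use p0 in simp)
  show "abs (partial_sum (%n x y. f n x y - g n x y) N w - (\<Sum>n=7..N. Ex P n (h n))) <= (2 * K + 6 * ?p) + abs (X N w)" unfolding eq using b1 b2 b3 by (simp only: of_nat_numeral)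
 qed
 show thesis by (rule that[OF g ct range])
qed

text \<open>By \<open>reduced_functional\<close> bounded frequencies are multiples of 2 pi / dl, and
  by almost-subadditivity they form a group, generated by k0 (2 pi / dl). Every admissible lattice
  r\<int> yields the bounded frequency 2 pi / r and hence contains dl / k0. So dl / k0 lies in the
  essential range dl\<int>, and k0 = 1. A variance bounded along a subsequence would make all small
  frequencies bounded, which is impossible.\<close>

theorem essential_frequencies:
 assumes P: "chain_law P" and f: "addf f" and K: "!!n x y. abs (f n x y) <= K" "K > 0" and dl: "dl > 0"
  and ess: "\<Inter>{algebraic_range P g | g. addf g & center_tight P (%n x y. f n x y - g n x y)} = multiples dl"
 shows "(\<exists>d. \<forall>N. DD f xi N <= d) \<longleftrightarrow> xi : multiples (2 * pi / dl)"
  and "filterlim (Vr P f 7) at_top sequentially"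
proof -
 define \<H> where "\<H> = {xi. \<exists>d. \<forall>N. DD f xi N <= d}"
 have dlin: "x : algebraic_range P g" if "x : multiples dl" "addf g" "center_tight P (%n x y. f n x y - g n x y)" for x g using that ess by blast
 have dldl: "dl : multiples dl" unfolding multiples_def by (intro image_eqI[of _ _ 1]) auto
 have A1: "\<exists>m::int. xi = (fq dl m)" if xi: "xi : \<H>" for xi
 proof (cases "xi = 0")
  case False
  obtain d where "\<forall>N. DD f xi N <= d" using xi unfolding \<H>_def by blast
  then obtain g where g: "addf g" "center_tight P (%n x y. f n x y - g n x y)" "algebraic_range P g \<subseteq> multiples (2 * pi / xi)" using reduced_functional[OF P f K(1) _ False] by blast
  then have "dl : multiples (2 * pi / xi)" using dlin[OF dldl] by blast
  then obtain m :: int where "dl = 2 * pi / xi * of_int m" by (auto simp: multiples_def)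
  then have "xi = (fq dl m)" using False dl by (simp add: field_simps)
  then show ?thesis ..
 qed (auto intro: exI[of _ 0])
 have diff: "xi - et : \<H>" if xi: "xi : \<H>" "et : \<H>" for xi et
 proof -
  from xi obtain d e where "\<forall>N. DD f xi N <= d" "\<forall>N. DD f et N <= e" unfolding \<H>_def by blast
  then have "DD f (xi - et) N <= 2 * d + 2 * e" for N using DD_add[OF f, of xi "- et" N] DD_uminus[OF f, of et N] by (smt (verit))
  then show ?thesis by (auto simp: \<H>_def)
 qed
 have A3: "\<exists>r>0. G = multiples r & 2 * pi / r : \<H>"
  if g: "addf g" "center_tight P (%n x y. f n x y - g n x y)" and G: "closed_subgroup G" "G ~= UNIV"
   and c: "!!n. n >= 1 ==> AE w in P. st g n w - c n : G" for g G c
 proof -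
  have "dl : G" using dlin[OF dldl g] algebraic_range_subset[OF G(1) c] by blast
  then obtain r where r: "r > 0" "G = multiples r" using closed_subgroup_cases[OF G _ dl] by blast
  have "\<exists>d. \<forall>N. DD f (2 * pi / r) N <= d" using c unfolding r(2) by (intro lattice_frequency[OF P f g r(1)])
  then show ?thesis using r by (auto simp: \<H>_def)
 qed
 have nUNIV: "multiples dl ~= UNIV"
 proof
  assume "multiples dl = UNIV"
  then have "dl / 2 : multiples dl" by simp
  then obtain m :: int where "dl / 2 = dl * of_int m" by (auto simp: multiples_def)
  then have "2 * of_int m = (1::real)" using dl by (simp add: field_simps)
  then have "of_int (2 * m) = (of_int 1 :: real)" by simp
  then have "2 * m = 1" unfolding of_int_eq_iff .
  then show False by presburger
 qed
 \<comment> \<open>The essential range is not the whole line, so some admissible g lives on a proper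
   closed subgroup. This provides a nonzero bounded frequency.\<close>
 obtain g0 G0 c0 where g0: "addf g0" "center_tight P (%n x y. f n x y - g0 n x y)" "closed_subgroup G0" "G0 ~= UNIV"
  "!!n. n >= 1 ==> AE w in P. st g0 n w - c0 n : G0"
 proof -
  obtain x where "x \<notin> \<Inter>{algebraic_range P g | g. addf g & center_tight P (%n x y. f n x y - g n x y)}" using nUNIV ess by auto
  then obtain g where g: "addf g" "center_tight P (%n x y. f n x y - g n x y)" "x \<notin> algebraic_range P g" by blast
  then obtain G c where "closed_subgroup G" "\<forall>n\<ge>1. AE w in P. st g n w - c n : G" "x \<notin> G" unfolding algebraic_range_def by blast
  then show thesis using g by (intro that[of g G c]) auto
 qed
 obtain r0 where r0: "r0 > 0" "2 * pi / r0 : \<H>" using A3[OF g0] by blast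
 define Z where "Z = {m::int. (fq dl m) : \<H>}"
 have H0: "0 : \<H>" using diff[OF r0(2) r0(2)] by simp
 have Zd: "m - n : Z" if "m : Z" "n : Z" for m n using diff[of "(fq dl m)" "(fq dl n)"] that by (simp only: Z_def mem_Collect_eq of_int_diff right_diff_distrib)
 have Z0: "0 : Z" using H0 by (simp add: Z_def)
 have Zu: "- m : Z" if "m : Z" for m using Zd[OF Z0 that] by simp
 have Zm: "k * m : Z" if m: "m : Z" for m k
 proof -
  have n: "int j * m : Z" for j
  proof (induction j)
   case (Suc j)
   show ?case using Zd[OF Suc Zu[OF m]] by (simp add: distrib_right add.commute)
  qed (simp add: Z0)
  show ?thesis using n[of "nat k"] Zu[OF n[of "nat (- k)"]] by (cases "k >= 0") auto
 qed
 obtain m1 :: int where m1: "2 * pi / r0 = (fq dl m1)" using A1[OF r0(2)] by blast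
 have "0 < (fq dl m1)" unfolding m1[symmetric] using r0 by simp
 then have m1': "m1 > 0" "m1 : Z" using dl r0(2) m1 by (auto simp: zero_less_mult_iff zero_less_divide_iff Z_def)
 define k0 where "k0 = (LEAST k::nat. k > 0 & int k : Z)"
 have "nat m1 > 0 & int (nat m1) : Z" using m1' by simp
 then have k0: "k0 > 0" "int k0 : Z" and least: "!!k. k > 0 ==> int k : Z ==> k0 <= k" unfolding k0_def by (metis (mono_tags, lifting) LeastI, metis (mono_tags, lifting) LeastI, auto intro: Least_le)
 have dv: "int k0 dvd m" if "m : Z" for m
 proof -
  have "m mod int k0 : Z" using Zd[OF that Zm[OF k0(2), of "m div int k0"]] by (simp add: minus_div_mult_eq_mod)
  moreover have "0 <= m mod int k0" "m mod int k0 < int k0" using k0 by auto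
  ultimately have "m mod int k0 = 0" using least[of "nat (m mod int k0)"] by (cases "m mod int k0 = 0") auto
  then show ?thesis by auto
 qed
 \<comment> \<open>Minimality of k0 enters through \<open>dv\<close>: each lattice spacing r
   satisfies dl = r m with m a multiple of k0.\<close>
 have "dl / k0 : \<Inter>{algebraic_range P g | g. addf g & center_tight P (%n x y. f n x y - g n x y)}"
 proof clarify
  fix g assume g: "addf g" "center_tight P (%n x y. f n x y - g n x y)"
  show "dl / k0 : algebraic_range P g" unfolding algebraic_range_def
  proof clarify
   fix G c assume G: "closed_subgroup G" and c: "\<forall>n\<ge>1. AE w in P. st g n w - c n : G"
   show "dl / k0 : G"
   proof (cases "G = UNIV")
    case False
    obtain r where r: "r > 0" "G = multiples r" "2 * pi / r : \<H>" using A3[OF g G False, of c] c by blast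
    obtain m :: int where m: "2 * pi / r = (fq dl m)" using A1[OF r(3)] by blast
    then have "m : Z" using r(3) by (simp add: Z_def)
    then obtain j where j: "m = int k0 * j" using dv by (auto elim: dvdE)
    have "dl = r * of_int m" using m r(1) dl by (simp add: field_simps)
    then have "dl / k0 = r * of_int j" using j k0 by simp
    then show ?thesis unfolding r(2) by (auto simp: multiples_def)
   qed simp
  qed
 qed
 then obtain j :: int where "dl / k0 = dl * of_int j" unfolding ess by (auto simp: multiples_def)
 then have "of_int (int k0 * j) = (of_int 1 :: real)" using dl k0 by (simp add: field_simps)
 then have "int k0 * j = 1" unfolding of_int_eq_iff .
 then have "k0 = 1" using k0 by (simp add: zmult_eq_1_iff)
 then have one: "1 : Z" using k0 by simp
 show "(\<exists>d. \<forall>N. DD f xi N <= d) \<longleftrightarrow> xi : multiples (2 * pi / dl)"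
 proof
  assume "\<exists>d. \<forall>N. DD f xi N <= d"
  then show "xi : multiples (2 * pi / dl)" using A1[of xi] by (auto simp: \<H>_def multiples_def)
 next
  assume "xi : multiples (2 * pi / dl)"
  then obtain m :: int where "xi = (fq dl m)" by (auto simp: multiples_def)
  then have "xi : \<H>" using Zm[OF one, of m] by (simp add: Z_def)
  then show "\<exists>d. \<forall>N. DD f xi N <= d" by (simp add: \<H>_def)
 qed
 show "filterlim (Vr P f 7) at_top sequentially"
 proof (rule ccontr)
  assume "~ ?thesis"
  then obtain b where "!!N0. \<exists>N\<ge>N0. Vr P f 7 N <= b" unfolding filterlim_at_top eventually_sequentially by (meson linear)
  then obtain t where t: "t > 0" "!!s N. abs s <= t ==> DD f s N <= ln 4 / cdec" by (rule variance_tight[OF P f K]) blast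
  \<comment> \<open>At most half the spacing of the resonant frequencies, hence strictly between two
    of them.\<close>
  define s where "s = min t (pi / dl)"
  have s: "0 < s" "s <= pi / dl" using t(1) dl by (auto simp: s_def)
  have "s : \<H>" using t(2)[of s] s by (auto simp: \<H>_def s_def)
  then obtain m :: int where m: "s = (fq dl m)" using A1 by blast
  then have "0 < m" "2 * m <= 1" using s dl by (auto simp: zero_less_mult_iff zero_less_divide_iff divide_le_cancel)
  then show False by simp
 qed
qed

end

section \<open>Representatives modulo the lattice and the limit theorem for one chain\<close>

definition fracd :: "real => real => real" where "fracd d x = x - d * of_int \<lfloor>x / d\<rfloor>"

lemma fracd_bounds: "d > 0 ==> 0 <= fracd d x" "d > 0 ==> fracd d x < d" using floor_divide_lower[of d x] floor_divide_upper[of d x] by (auto simp: fracd_def algebra_simps)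

lemma fracd_measurable [measurable]: "fracd d : borel_measurable borel" unfolding fracd_def[abs_def] by measurable

lemma cis_fracd: "d > 0 ==> cis (2 * pi / d * of_int k * fracd d x) = cis (2 * pi / d * of_int k * x)"
proof -
 assume d: "d > 0"
 have "2 * pi / d * of_int k * fracd d x = 2 * pi / d * of_int k * x - 2 * pi * of_int (k * \<lfloor>x / d\<rfloor>)" using d by (simp add: fracd_def field_simps)
 then show ?thesis by (simp only: cis_divide[symmetric]) simp
qed

context elliptic_chain
begin

lemma Vr_diff:
 assumes P: "chain_law P" and f: "addf f" and K: "!!n x y. abs (f n x y) <= K" and N: "1 <= m" "m <= Suc N"
 shows "abs (Vr P f m N - Vr P f 1 N) <= 4 * (real m * K)^2 + 4 * (real m * K) * sqrt (Vr P f 1 N)"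
proof -
 interpret P: prob_space P using chain_lawD[OF P] by simp
 define c where "c = real m * K"
 have K0: "0 <= K" using K[of 0] order_trans abs_ge_zero by blast
 have c0: "0 <= c" using K0 by (simp add: c_def)
 define A where "A w = Sm f 1 (m - 1) w" for w
 define X where "X w = Sm f 1 N w - (LINT w|P. Sm f 1 N w)" for w
 define x where "x w = A w - (LINT w|P. A w)" for w
 have iA: "integrable P A" unfolding A_def by (rule Sm_integrable[OF P f K]) simp
 note i1 = Sm_integrable[OF P f K, of 1 N]
 have Ab: "abs (A w) <= c" for w unfolding A_def c_def using K0 N by (intro order_trans[OF Sm_bounded[OF K]] mult_right_mono) auto
 have EA: "abs ((LINT w|P. A w)) <= c" using Ab iA by (intro order_trans[OF integral_abs_bound P.integral_le_const]) auto
 have xb: "abs (x w) <= 2 * c" for w unfolding x_def using Ab[of w] EA by linarith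
 have s: "Sm f m N w = Sm f 1 N w - A w" for w
 proof -
  have "{1..N} = {1..m - 1} \<union> {m..N}" using N by auto
  then show ?thesis unfolding A_def by (simp add: sum.union_disjoint)
 qed
 have Vm: "Vr P f m N = (LINT w|P. (X w - x w)^2)" unfolding Vr_def s X_def x_def using iA i1 by (simp add: algebra_simps)
 have V1: "Vr P f 1 N = (LINT w|P. (X w)^2)" unfolding Vr_def X_def ..
 have iX: "integrable P X" "integrable P (%w. (X w)^2)" unfolding X_def[abs_def] using i1 by (auto simp: power2_diff)
 have ix: "integrable P x" unfolding x_def[abs_def] using iA by simp
 have ixx: "integrable P (%w. (x w)^2)" by (rule P.integrable_const_bound[where B="(2 * c)^2"]) (use abs_le_square_iff_D[OF xb] ix in auto)
 have iXx: "integrable P (%w. x w * X w)" by (rule Bochner_Integration.integrable_bound[where f="%w. 2 * c * abs (X w)"])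
    (use iX ix c0 xb in \<open>auto simp: abs_mult intro!: mult_right_mono\<close>)
 have "Vr P f m N - Vr P f 1 N = (LINT w|P. (x w)^2 - 2 * (x w * X w))"
 proof -
  have "(X w - x w)^2 = (X w)^2 + ((x w)^2 - 2 * (x w * X w))" for w by (simp add: power2_diff)
  then show ?thesis unfolding Vm V1 using iX ixx iXx by simp
 qed
 also have "abs (...) <= (LINT w|P. (2 * c)^2 + 2 * (2 * c) * abs (X w))"
 proof (rule order_trans[OF integral_abs_bound integral_mono])
  fix w
  have "(x w)^2 <= (2 * c)^2" using xb[of w] by (rule abs_le_square_iff_D)
  moreover have "abs (x w * X w) <= 2 * c * abs (X w)" unfolding abs_mult using xb by (intro mult_right_mono) auto
  ultimately show "abs ((x w)^2 - 2 * (x w * X w)) <= (2 * c)^2 + 2 * (2 * c) * abs (X w)" using zero_le_power2[of "x w"] by linarith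
 qed (use iX ixx iXx in auto)
 also have "... = 4 * c^2 + 4 * c * (LINT w|P. abs (X w))" using iX by (simp add: P.prob_space power_mult_distrib)
 also have "... <= 4 * c^2 + 4 * c * sqrt (Vr P f 1 N)" using c0 P.integral_abs_le_sqrt[OF iX, of "Vr P f 1 N"] unfolding V1 by (intro add_left_mono mult_left_mono) auto
 finally show ?thesis unfolding c_def .
qed

lemma Vr_nonneg: "0 <= Vr P f m N" by (simp add: Vr_def)

text \<open>By \<open>Vr_diff\<close>, dropping a fixed number of summands changes the variance by
  at most a constant times 1 + sigma, so sums from any starting time share the normalisation of the
  full sum.\<close>

lemma Vr_limits:
 assumes P: "chain_law P" and f: "addf f" and K: "!!n x y. abs (f n x y) <= K" and V: "filterlim (Vr P f 7) at_top sequentially"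
 shows "filterlim (%N. sqrt (Vr P f 1 N)) at_top sequentially"
  and "m >= 1 ==> (%N. Vr P f m N / (sqrt (Vr P f 1 N))^2) ----> 1"
proof -
 have K0: "0 <= K" using K[of 0] order_trans abs_ge_zero by blast
 let ?s = "%N. sqrt (Vr P f 1 N)"
 have s2: "(?s N)^2 = Vr P f 1 N" for N using Vr_nonneg by simp
 have "filterlim (%N. - (2 * (7 * K)) + sqrt (Vr P f 7 N)) at_top sequentially" by (intro filterlim_tendsto_add_at_top[OF tendsto_const] filterlim_compose[OF sqrt_at_top V])
 then show S: "filterlim ?s at_top sequentially"
 proof (rule filterlim_at_top_mono)
  show "\<forall>\<^sub>F N in sequentially. - (2 * (7 * K)) + sqrt (Vr P f 7 N) <= ?s N" using eventually_ge_at_top[of 7]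
  proof eventually_elim
   case (elim N)
   have "Vr P f 7 N <= (?s N)^2 + (4 * (7 * K)^2 + 4 * (7 * K) * ?s N)" using Vr_diff[OF P f K, of 7 N] elim unfolding s2 by simp
   also have "... = (?s N + 2 * (7 * K))^2" unfolding power2_sum by (simp add: power2_eq_square)
   finally have "sqrt (Vr P f 7 N) <= ?s N + 2 * (7 * K)" using K0 Vr_nonneg by (intro real_le_lsqrt) auto
   then show ?case by simp
  qed
 qed
 assume m: "m >= 1"
 have inv: "(%N. 1 / ?s N) ----> 0" using tendsto_divide_0[OF tendsto_const S[THEN filterlim_at_top_imp_at_infinity]] .
 have "(%N. 4 * (real m * K)^2 * (1 / ?s N)^2 + 4 * (real m * K) * (1 / ?s N)) ----> 4 * (real m * K)^2 * 0^2 + 4 * (real m * K) * 0" by (intro tendsto_intros inv)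
 then have l: "(%N. 4 * (real m * K)^2 * (1 / ?s N)^2 + 4 * (real m * K) * (1 / ?s N)) ----> 0" by simp
 have "(%N. Vr P f m N / (?s N)^2 - 1) ----> 0"
 proof (rule Lim_null_comparison[OF _ l])
  have "\<forall>\<^sub>F N in sequentially. ?s N > 0" using S by (rule filterlim_at_top_dense[THEN iffD1, rule_format])
  then show "\<forall>\<^sub>F N in sequentially. norm (Vr P f m N / (?s N)^2 - 1) <= 4 * (real m * K)^2 * (1 / ?s N)^2 + 4 * (real m * K) * (1 / ?s N)" using eventually_ge_at_top[of m]
  proof eventually_elim
   case (elim N)
   have "Vr P f m N / (?s N)^2 - 1 = (Vr P f m N - Vr P f 1 N) / (?s N)^2" using elim(1) by (simp add: diff_divide_distrib s2)
   then have "norm (Vr P f m N / (?s N)^2 - 1) <= (4 * (real m * K)^2 + 4 * (real m * K) * ?s N) / (?s N)^2" using Vr_diff[OF P f K m, of N] elim(2) by (simp add: abs_divide divide_right_mono)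
   also have "... = 4 * (real m * K)^2 * (1 / ?s N)^2 + 4 * (real m * K) * (1 / ?s N)"
   proof -
    have "(A + B * s) / s^2 = A * (1 / s)^2 + B * (1 / s)" if "s > 0" for A B s :: real using that by (simp add: field_simps power2_eq_square)
    then show ?thesis using elim(1) .
   qed
   finally show ?case .
  qed
 qed
 then show "(%N. Vr P f m N / (?s N)^2) ----> 1" by (rule LIM_zero_cancel)
qed

text \<open>Conditioning under \<open>Q\<close> divides by probabilities under \<open>Q\<close>,
  while the Fourier estimates normalise with \<open>P\<close>. Mixing makes the two differ by o(1),
  and the lower bound \<open>c0\<close> turns this into a ratio tending to 1.\<close>

lemma law_ratio:
 assumes P: "chain_law P" and Q: "chain_law Q" and um: "!!N. u N : borel_measurable (B (Suc N))" and u: "!!N y. 0 <= u N y & u N y <= (1::real)"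
  and c0: "c0 > 0" "!!N. N >= 1 ==> c0 <= (LINT w|P. u N (w (Suc N)))"
 shows "(%N. (LINT w|Q. u N (w (Suc N))) / (LINT w|P. u N (w (Suc N)))) ----> 1"
proof -
 interpret Q: prob_space Q using chain_lawD[OF Q] by simp
 let ?p = "%N. (LINT w|P. u N (w (Suc N)))" and ?q = "%N. (LINT w|Q. u N (w (Suc N)))"
 have d: "abs (?q N - ?p N) <= (2/eps) * rate (N - 2)" if N: "N >= 2" for N
 proof -
  have e: "1 + (N - 2) + 2 = Suc N" using N by simp
  have iQ: "integrable Q (%w. u N (w (Suc N)))" using u measurable_compose[OF coord um[of N]] by (intro law_integrable[OF Q, where C=1]) auto
  have "cmod (LINT w|Q. 1 * of_real (u N (w (Suc N)) - ?p N)) <= (LINT w|Q. cmod 1) * ((2/eps) * rate (N - 2) * (LINT y|(mu (Suc N)). abs (u N y)))"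
   using mix_coord[OF P Q _ adapted_const[of 1 "1::complex"], of 1 "u N" "N - 2" 1] u um unfolding e by simp
  also have "(LINT w|Q. 1 * of_real (u N (w (Suc N)) - ?p N)) = of_real (?q N - ?p N)" unfolding mult_1_left integral_complex_of_real using iQ by (simp add: Q.prob_space)
  also have "(LINT w|Q. cmod 1) * ((2/eps) * rate (N - 2) * (LINT y|(mu (Suc N)). abs (u N y))) <= 1 * ((2/eps) * rate (N - 2) * 1)"
  proof (intro mult_mono)
   show "(LINT y|(mu (Suc N)). abs (u N y)) <= 1" using integrable_mu[OF um[of N], of 1] u by (intro mu.integral_le_const AE_I2) auto
  qed (use eps_pos rate_nonneg in \<open>auto simp: Q.prob_space\<close>)
  finally show ?thesis unfolding norm_of_real by simp
 qed
 have "(%N. (2/eps) * rate (N - 2) * inverse c0) ----> (2/eps) * 0 * inverse c0" by (intro tendsto_intros filterlim_compose[OF rate_tendsto] filterlim_minus_const_nat_at_top)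
 then have l: "(%N. (2/eps) * rate (N - 2) * inverse c0) ----> 0" by simp
 have "(%N. ?q N / ?p N - 1) ----> 0"
 proof (rule Lim_null_comparison[OF _ l])
  show "\<forall>\<^sub>F N in sequentially. norm (?q N / ?p N - 1) <= (2/eps) * rate (N - 2) * inverse c0" using eventually_ge_at_top[of 2]
  proof eventually_elim
   case (elim N)
   have p: "c0 <= ?p N" using c0(2)[of N] elim by simp
   then have "?q N / ?p N - 1 = (?q N - ?p N) * inverse (?p N)" using c0(1) by (simp add: field_simps)
   moreover have "abs (inverse (?p N)) <= inverse c0" using p c0(1) by (simp add: le_imp_inverse_le)
   ultimately show ?case using d[OF elim] eps_pos rate_nonneg[of "N - 2"] by (simp only: real_norm_def abs_mult) (intro mult_mono, auto)
  qed
 qed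
 then show ?thesis by (rule LIM_zero_cancel)
qed

text \<open>All quantifiers over the law, the centring sequence, the test function and the weight
  come after \<open>b\<close> and \<open>F\<close>, which expresses that both are chosen once and
  for all.\<close>

definition local_limit_property ::
  "(nat => 'a) measure => (nat => 'a => 'a => real) => real => ((nat => 'a) => real) => (nat => 'a => real) => ((nat => 'a) => real) => bool" where
 "local_limit_property P f dl R b F \<longleftrightarrow> (\<forall>Q z z0 phi u c0. chain_law Q --> (\<forall>N\<ge>1. z N : multiples dl) -->
   (%N. (z N - (LINT w|P. Sm f 1 N w)) / sqrt (Vr P f 1 N)) ----> z0 -->
   continuous_on UNIV phi --> compact (closure {t. phi t ~= 0}) -->
   (\<forall>N. u N : borel_measurable (B (Suc N))) --> (\<forall>N y. 0 <= u N y & u N y <= 1) -->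
   c0 > 0 --> (\<forall>N\<ge>1. c0 <= (LINT w|P. u N (w (Suc N)))) -->
   (%N. sqrt (Vr P f 1 N) * ((LINT w|Q. phi (R w + Sm f 3 N w - z N - b N (w (Suc N))) * u N (w (Suc N))) / (LINT w|Q. u N (w (Suc N)))))
   ----> dl * exp (- (z0^2) / 2) / sqrt (2 * pi) * (\<Sum>\<^sub>\<infinity>m\<in>(UNIV :: int set). (LINT w|Q. phi (of_int m * dl + F w))))"

text \<open>At resonant frequencies phases see only residues modulo dl. So the end term
  \<open>a (Suc N) + c N\<close> and the limit of the remaining terms may be replaced by their
  representatives in [0, dl), which gives the bounds on \<open>b\<close> and \<open>F\<close>, and
  \<open>z N\<close> in dl\<int> contributes the factor 1.\<close>

theorem chain_local_limit:
 assumes P: "chain_law P" and f: "addf f" and K: "!!n x y. abs (f n x y) <= K" "K > 0" and dl: "dl > 0"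
  and ess: "\<Inter>{algebraic_range P g | g. addf g & center_tight P (%n x y. f n x y - g n x y)} = multiples dl"
  and R: "adapted 3 R"
 obtains b F where "!!N. b N : borel_measurable (B (Suc N))" "!!N y. 0 <= b N y & b N y < dl"
  "F : borel_measurable paths" "!!w. 0 <= F w & F w < dl"
  "local_limit_property P f dl R b F"
proof -
 note freq = essential_frequencies[OF P f K dl ess]
 have mul: "(fq dl k) : multiples (2 * pi / dl)" for k :: int by (auto simp: multiples_def)
 have "\<exists>d. \<forall>N. DD f (fq dl k) N <= d" for k :: int using mul freq(1) by blast
 then obtain d where d: "!!k N. DD f (fq dl k) N <= d k" by metis
 have loose: "filterlim (DD f xi) at_top sequentially" if "!!k::int. xi ~= (fq dl k)" for xi
 proof -
  have "xi \<notin> multiples (2 * pi / dl)" using that by (auto simp: multiples_def)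
  then have nb: "\<exists>N. Z < DD f xi N" for Z using freq(1)[of xi] by (meson not_le)
  show ?thesis unfolding filterlim_at_top eventually_sequentially using nb DD_mono[OF f] by (meson less_imp_le order_trans)
 qed
 have d1: "DD f (2 * pi / dl) N <= d 1" for N using d[of 1 N] by simp
 obtain a c L where am: "!!n. n >= 3 ==> a n : borel_measurable (B n)" and Lm [measurable]: "L : borel_measurable paths"
  and L: "!!Q k. chain_law Q ==> (%N. (LINT w|Q. cmod (cis (fq dl k * (Sm f 7 N w - a (Suc N) (w (Suc N)) - c N))
     - cis (fq dl k * L w)))) ----> 0"
 proof (rule lattice_structure[OF P f d1 dl])
  fix a c L assume "!!n. n >= 3 ==> a n : borel_measurable (B n)" "L : borel_measurable paths"
  "!!Q k. chain_law Q ==> (%N. (LINT w|Q. cmod (cis (fq dl k * (Sm f 7 N w - a (Suc N) (w (Suc N)) - c N))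
     - cis (fq dl k * L w)))) ----> 0"
  then show thesis by (rule that)
 qed
 \<comment> \<open>\<open>a\<close> is measurable from time 3 on; the value for N < 2 does not
   affect the limit.\<close>
 define b where "b N y = (if N >= 2 then fracd dl (a (Suc N) y + c N) else 0)" for N y
 define F where "F w = fracd dl (R w + Sm f 3 6 w + L w)" for w
 have bm: "b N : borel_measurable (B (Suc N))" for N
 proof (cases "N >= 2")
  case True
  then have [measurable]: "a (Suc N) : borel_measurable (B (Suc N))" by (intro am) simp
  show ?thesis using True unfolding b_def by simp
 qed (simp add: b_def[abs_def])
 have b: "0 <= b N y & b N y < dl" for N y using fracd_bounds[OF dl] dl by (simp add: b_def)
 have [measurable]: "Sm f 3 6 : borel_measurable paths" "R : borel_measurable paths" using Sm_measurable[OF f, of 3 6] adapted_measurable[OF R] by auto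
 have Fm: "F : borel_measurable paths" unfolding F_def by measurable
 have F: "0 <= F w & F w < dl" for w unfolding F_def using fracd_bounds[OF dl] by simp
 show thesis
 proof (rule that[OF bm b Fm F], unfold local_limit_property_def, intro allI impI)
  fix Q and z :: "nat => real" and z0 c0 :: real and phi :: "real => real" and u :: "nat => 'a => real"
  assume Q: "chain_law Q" and z': "\<forall>N\<ge>1. z N : multiples dl"
   and zl: "(%N. (z N - (LINT w|P. Sm f 1 N w)) / sqrt (Vr P f 1 N)) ----> z0"
   and phi: "continuous_on UNIV phi" "compact (closure {t. phi t ~= 0})"
   and um': "\<forall>N. u N : borel_measurable (B (Suc N))" and u': "\<forall>N y. 0 <= u N y & u N y <= 1"
   and c0': "c0 > 0" "\<forall>N\<ge>1. c0 <= (LINT w|P. u N (w (Suc N)))"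
  note z = z'[rule_format] and um = um'[rule_format] and u = u'[rule_format] and c0 = c0'(1) c0'(2)[rule_format]
  interpret P: prob_space P using chain_lawD[OF P] by simp
  let ?sg = "%N. sqrt (Vr P f 1 N)"
  have sg: "filterlim ?sg at_top sequentially" by (rule Vr_limits(1)[OF P f K(1) freq(2)])
  have inv: "(%N. 1 / ?sg N) ----> 0" using tendsto_divide_0[OF tendsto_const sg[THEN filterlim_at_top_imp_at_infinity]] .
  have mean: "(%N. (z N - (LINT w|P. Sm f m N w)) / ?sg N) ----> z0" if m: "m >= 3" for m
  proof -
   define A where "A = (LINT w|P. Sm f 1 (m - 1) w)"
   have "(%N. (z N - (LINT w|P. Sm f 1 N w)) / ?sg N + A * (1 / ?sg N)) ----> z0 + A * 0" by (intro tendsto_intros zl inv)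
   then have "(%N. (z N - (LINT w|P. Sm f 1 N w)) / ?sg N + A * (1 / ?sg N)) ----> z0" by simp
   then show ?thesis
   proof (rule Lim_transform_eventually)
    show "\<forall>\<^sub>F N in sequentially. (z N - (LINT w|P. Sm f 1 N w)) / ?sg N + A * (1 / ?sg N) = (z N - (LINT w|P. Sm f m N w)) / ?sg N" using eventually_ge_at_top[of m]
    proof eventually_elim
     case (elim N)
     have "{1..N} = {1..m - 1} \<union> {m..N}" using elim m by auto
     then have "Sm f 1 N w = Sm f 1 (m - 1) w + Sm f m N w" for w using m by (simp add: sum.union_disjoint)
     then have "(LINT w|P. Sm f 1 N w) = A + (LINT w|P. Sm f m N w)" unfolding A_def using Sm_integrable(1)[OF P f K(1)] m by (simp add: Bochner_Integration.integral_add)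
     then show ?case by (simp add: diff_divide_distrib add_divide_distrib)
    qed
   qed
  qed
  have lattice: "(%N. (LINT w|Q. cmod (cis (fq dl k * (R w + Sm f 3 N w - z N - b N (w (Suc N)))) - cis (fq dl k * F w)))) ----> 0" for k :: int
  proof (rule Lim_transform_eventually[OF L[OF Q, of k]])
   show "\<forall>\<^sub>F N in sequentially. (LINT w|Q. cmod (cis (fq dl k * (Sm f 7 N w - a (Suc N) (w (Suc N)) - c N)) - cis (fq dl k * L w)))
    = (LINT w|Q. cmod (cis (fq dl k * (R w + Sm f 3 N w - z N - b N (w (Suc N)))) - cis (fq dl k * F w)))" using eventually_ge_at_top[of 7]
   proof eventually_elim
    case (elim N)
    let ?x = "(fq dl k)"
    obtain j :: int where j: "z N = dl * of_int j" using z[of N] elim by (auto simp: multiples_def)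
    have zc: "cis (?x * z N) = 1"
    proof -
     have "?x * z N = 2 * pi * of_int (k * j)" unfolding j using dl by simp
     then show ?thesis by simp
    qed
    have eq: "cis (?x * (R w + Sm f 3 N w - z N - b N (w (Suc N)))) - cis (?x * F w) =
     cis (?x * (R w + Sm f 3 6 w)) * (cis (?x * (Sm f 7 N w - a (Suc N) (w (Suc N)) - c N)) - cis (?x * L w))" for w
    proof -
     have "{3..N} = {3..6} \<union> {7..N}" using elim by auto
     then have s: "Sm f 3 N w = Sm f 3 6 w + Sm f 7 N w" by (simp add: sum.union_disjoint)
     have bc: "cis (?x * b N (w (Suc N))) = cis (?x * (a (Suc N) (w (Suc N)) + c N))"
     proof -
      have "b N (w (Suc N)) = fracd dl (a (Suc N) (w (Suc N)) + c N)" using elim by (simp add: b_def)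
      then show ?thesis by (simp only: cis_fracd[OF dl])
     qed
     have "cis (?x * (R w + Sm f 3 N w - z N - b N (w (Suc N)))) =
       cis (?x * (R w + Sm f 3 6 w)) * cis (?x * Sm f 7 N w) / cis (?x * z N) / cis (?x * b N (w (Suc N)))" unfolding s by (simp only: right_diff_distrib distrib_left cis_mult cis_divide add.assoc)
     also have "... = cis (?x * (R w + Sm f 3 6 w)) * (cis (?x * Sm f 7 N w) / cis (?x * (a (Suc N) (w (Suc N)) + c N)))" unfolding bc zc by simp
     also have "cis (?x * Sm f 7 N w) / cis (?x * (a (Suc N) (w (Suc N)) + c N)) = cis (?x * (Sm f 7 N w - a (Suc N) (w (Suc N)) - c N))" unfolding cis_divide right_diff_distrib[symmetric] by (simp only: diff_diff_eq)
     finally have 1: "cis (?x * (R w + Sm f 3 N w - z N - b N (w (Suc N)))) = cis (?x * (R w + Sm f 3 6 w)) * cis (?x * (Sm f 7 N w - a (Suc N) (w (Suc N)) - c N))" .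
     have 2: "cis (?x * F w) = cis (?x * (R w + Sm f 3 6 w)) * cis (?x * L w)" unfolding F_def cis_fracd[OF dl] by (simp only: distrib_left cis_mult add.assoc)
     show ?thesis unfolding 1 2 by (simp only: right_diff_distrib)
    qed
    show ?case unfolding eq norm_mult by simp
   qed
  qed
  interpret LL: local_limit B mu p eps f K P Q R dl z0 c0 d F ?sg z b u
  proof unfold_locales
   show "!!N y. abs (b N y) <= dl" using b by (simp add: less_imp_le)
   show "!!m. 3 <= m ==> (%N. Vr P f m N / (?sg N)^2) ----> 1" using Vr_limits(2)[OF P f K(1) freq(2)] by simp
  qed (fact f K P Q R dl d loose bm um u c0 sg mean Fm lattice)+
  let ?q = "%N. (LINT w|Q. u N (w (Suc N)))" and ?p = "%N. (LINT w|P. u N (w (Suc N)))"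
  let ?I = "%N. (LINT w|Q. phi (R w + Sm f 3 N w - z N - b N (w (Suc N))) * u N (w (Suc N)))"
  let ?R = "dl * exp (- (z0^2) / 2) / sqrt (2 * pi) * (\<Sum>\<^sub>\<infinity>m\<in>(UNIV :: int set). (LINT w|Q. phi (of_int m * dl + F w)))"
  have r: "(%N. ?q N / ?p N) ----> 1" by (rule law_ratio[OF P Q um u c0])
  have "(%N. ?sg N * ?I N / ?p N) ----> ?R" using LL.local_limit_theorem[OF phi] unfolding LL.Y_def LL.pr_def .
  from tendsto_divide[OF this r] have "(%N. (?sg N * ?I N / ?p N) / (?q N / ?p N)) ----> ?R" by simp
  then show "(%N. ?sg N * (?I N / ?q N)) ----> ?R"
  proof (rule Lim_transform_eventually)
   show "\<forall>\<^sub>F N in sequentially. (?sg N * ?I N / ?p N) / (?q N / ?p N) = ?sg N * (?I N / ?q N)" using eventually_ge_at_top[of 1]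
   proof eventually_elim
    case (elim N)
    have "?p N ~= 0" using c0(1) c0(2)[OF elim] by linarith
    then show ?case by simp
   qed
  qed
 qed
qed

end

section \<open>Transfer to the path law\<close>

lemma as_unif_boundedD:
 assumes "as_unif_bounded P f"
 obtains K where "K > 0" "!!n. n >= 1 ==> AE w in P. abs (f n (w n) (w (Suc n))) <= K"
proof -
 let ?s = "%n. esssup P (%w. ereal (abs (f n (w n) (w (Suc n)))))"
 obtain K where K: "(SUP n\<in>{1..}. ?s n) <= ereal K" using assms(1) unfolding as_unif_bounded_def by (cases "SUP n\<in>{1..}. ?s n") auto
 show thesis
 proof (rule that[of "max K 1"])
  fix n :: nat assume n: "n >= 1"
  have "?s n <= (SUP n\<in>{1..}. ?s n)" using n by (intro SUP_upper) auto
  from order_trans[OF this K] have s: "?s n <= ereal K" .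
  have "AE w in P. ereal (abs (f n (w n) (w (Suc n)))) <= ?s n" by (rule esssup_AE)
  then show "AE w in P. abs (f n (w n) (w (Suc n))) <= max K 1"
  proof eventually_elim
   case (elim w)
   then have "ereal (abs (f n (w n) (w (Suc n)))) <= ereal K" using s by (rule order_trans)
   then show ?case by simp
  qed
 qed simp
qed

lemma center_tight_cong:
 assumes "!!N. AE w in P. partial_sum f N w = partial_sum g N w"
  and [measurable]: "!!N. partial_sum f N : borel_measurable P" "!!N. partial_sum g N : borel_measurable P"
 shows "center_tight P f \<longleftrightarrow> center_tight P g"
proof -
 have "measure P {w : space P. abs (partial_sum f N w - m) > M} = measure P {w : space P. abs (partial_sum g N w - m) > M}" for N m M
 proof (rule measure_eq_AE)
  show "AE w in P. w : {w : space P. abs (partial_sum f N w - m) > M} \<longleftrightarrow> w : {w : space P. abs (partial_sum g N w - m) > M}" using assms(1)[of N] by eventually_elim auto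
 qed measurable
 then show ?thesis unfolding center_tight_def by simp
qed

text \<open>The indicator of disagreement has mean 0 under \<open>P\<close>, hence under
  \<open>Q\<close>, because from time 3 on pairs under \<open>Q\<close> are dominated by pairs under
  \<open>P\<close>. At times 1 and 2 there is no such domination.\<close>

lemma (in elliptic_chain) law_AE_transfer:
 assumes P: "chain_law P" and Q: "chain_law Q" and n: "n >= 3" and f: "pmeas n f" and g: "pmeas n (g :: 'a => 'a => real)"
  and ae: "AE w in P. f (w n) (w (Suc n)) = g (w n) (w (Suc n))"
 shows "AE w in Q. f (w n) (w (Suc n)) = g (w n) (w (Suc n))"
proof -
 define u where "u x y = (if f x y = g x y then 0 else 1 :: real)" for x y
 have [measurable]: "(%z. f (fst z) (snd z)) : borel_measurable (B n \<Otimes>\<^sub>M B (Suc n))" "(%z. g (fst z) (snd z)) : borel_measurable (B n \<Otimes>\<^sub>M B (Suc n))" using f g by (auto simp: pmeas_def split_beta')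
 have u: "pmeas n u" unfolding pmeas_def u_def split_beta' by measurable
 have um: "(%w. u (w n) (w (Suc n))) : borel_measurable paths" using n by (intro pmeas_path u) auto
 have "(LINT w|P. u (w n) (w (Suc n))) = (LINT w|P. 0)"
 proof (rule integral_cong_AE)
  show "(%w. u (w n) (w (Suc n))) : borel_measurable P" using um chain_lawD[OF P] by (simp add: measurable_def)
  show "AE w in P. u (w n) (w (Suc n)) = 0" using ae by eventually_elim (simp add: u_def)
 qed simp
 moreover have "(LINT w|Q. u (w n) (w (Suc n))) <= (1/eps^2) * (LINT w|P. u (w n) (w (Suc n)))" by (rule law_pair_le(1)[OF P Q n u, of 1]) (auto simp: u_def)
 moreover have "0 <= (LINT w|Q. u (w n) (w (Suc n)))" by (intro Bochner_Integration.integral_nonneg) (simp add: u_def)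
 ultimately have "(LINT w|Q. u (w n) (w (Suc n))) = 0" by simp
 moreover have "integrable Q (%w. u (w n) (w (Suc n)))" by (rule law_integrable[OF Q um, where C=1]) (simp add: u_def)
 ultimately have "AE w in Q. u (w n) (w (Suc n)) = 0" by (subst (asm) integral_nonneg_eq_0_iff_AE) (auto simp: u_def)
 then show ?thesis by eventually_elim (simp add: u_def split: if_splits)
qed

section \<open>The given chain as an elliptic chain\<close>

locale elliptic_setting =
 fixes S :: "nat => 'a metric" and \<nu> :: "'a measure" and \<pi> :: "nat => 'a => 'a measure"
  and eps :: real and m :: "nat => 'a measure" and q :: "nat => 'a => 'a => real"
 assumes chain: "markov_chain S \<nu> \<pi>" and eps: "0 < eps" "eps < 1"
  and m: "!!n. n >= 1 ==> m n : space (prob_algebra (borel_of (S n)))"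
  and qm: "!!n. n >= 1 ==> (%(x, y). q n x y) : borel_measurable (borel_of (S n) \<Otimes>\<^sub>M borel_of (S (Suc n)))"
  and dens: "!!n x. n >= 1 ==> x : mspace (S n) ==> \<pi> n x = density (m (Suc n)) (%y. ennreal (q n x y))"
  and qb: "!!n x y. n >= 1 ==> x : mspace (S n) ==> y : mspace (S (Suc n)) ==> 0 <= q n x y & q n x y <= 1 / eps"
  and two: "!!n x z. n >= 1 ==> x : mspace (S n) ==> z : mspace (S (Suc (Suc n))) ==>
   (LINT y|(m (Suc n)). q n x y * q (Suc n) y z) > eps"
begin

definition B' where "B' n = borel_of (S (max 1 n))"
definition m' where "m' n = m (max 1 n)"
text \<open>Clipping extends the bounds beyond the carriers without changing values on them. The
  constant 1 at the dummy time 0 is a density of total mass 1.\<close>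

definition q' where "q' n x y = (if n = 0 then 1 else max 0 (min (1 / eps) (q n x y)))"

lemma B'_eq: "n >= 1 ==> B' n = borel_of (S n)" by (simp add: B'_def max_def)

lemma m'_eq: "m' (Suc n) = m (Suc n)" by (simp add: m'_def max_def)

lemma sets_m: "n >= 1 ==> sets (m n) = sets (borel_of (S n))" using m by (simp add: space_prob_algebra)

lemma space_m: "n >= 1 ==> space (m n) = mspace (S n)" using sets_eq_imp_space_eq[OF sets_m] by (simp add: space_borel_of)

lemma q'_eq: "n >= 1 ==> x : mspace (S n) ==> y : mspace (S (Suc n)) ==> q' n x y = q n x y" using qb[of n x y] by (simp add: q'_def)

sublocale elliptic_chain B' m' q' eps
proof (rule elliptic_chain.intro)
 have pm: "prob_space (m' n)" "sets (m' n) = sets (B' n)" for n using m[of "max 1 n"] by (auto simp: m'_def B'_def space_prob_algebra)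
 then show "prob_space (m' n)" "sets (m' n) = sets (B' n)" for n by auto
 show "(%(x, y). q' n x y) : borel_measurable (B' n \<Otimes>\<^sub>M B' (Suc n))" for n
 proof (cases "n = 0")
  case False
  then have [measurable]: "(%z. q n (fst z) (snd z)) : borel_measurable (B' n \<Otimes>\<^sub>M B' (Suc n))" using qm[of n] by (simp add: B'_eq split_beta')
  show ?thesis using False unfolding q'_def split_beta' by simp
 qed (simp add: q'_def)
 show "0 <= q' n x y" "q' n x y <= 1 / eps" for n x y using eps by (auto simp: q'_def)
 show "(LINT y|(m' (Suc n)). q' n x y) = 1" if x: "x : space (B' n)" for n x
 proof (cases "n = 0")
  case True
  show ?thesis using True prob_space.prob_space[OF pm(1)] by (simp add: q'_def)
 next
  case False
  then have n: "n >= 1" by simp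
  have x: "x : mspace (S n)" using x n by (simp add: B'_eq space_borel_of)
  have "\<pi> n : borel_of (S n) \<rightarrow>\<^sub>M prob_algebra (borel_of (S (Suc n)))" using chain n by (auto simp: markov_chain_def)
  from measurable_space[OF this, of x] have "prob_space (\<pi> n x)" using x by (simp add: space_borel_of space_prob_algebra)
  then interpret D: prob_space "density (m (Suc n)) (%y. ennreal (q n x y))" using dens[OF n x] by simp
  have qx: "q n x : borel_measurable (m (Suc n))" using measurable_compose[OF measurable_Pair1' qm[OF n], of x] x sets_m[of "Suc n"] by (simp add: space_borel_of measurable_def space_m)
  have "(\<integral>\<^sup>+y. ennreal (q n x y) \<partial>m (Suc n)) = emeasure (density (m (Suc n)) (%y. ennreal (q n x y))) (space (m (Suc n)))" using qx by (subst emeasure_density) (auto intro!: nn_integral_cong)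
  also have "... = 1" using D.emeasure_space_1 by simp
  finally have "(LINT y|(m (Suc n)). q n x y) = 1" using qx qb[OF n x] by (subst integral_eq_nn_integral) (auto simp: space_m intro!: AE_I2)
  then show ?thesis unfolding m'_eq using q'_eq[OF n x] by (subst Bochner_Integration.integral_cong[OF refl, of _ _ "q n x"]) (auto simp: space_m)
 qed
 show "(LINT y|(m' (Suc n)). q' n x y * q' (Suc n) y z) > eps"
  if n: "n >= 1" and x: "x : space (B' n)" and z: "z : space (B' (Suc (Suc n)))" for n x z
 proof -
  have x: "x : mspace (S n)" and z: "z : mspace (S (Suc (Suc n)))" using x z n by (auto simp: B'_eq space_borel_of)
  have "(LINT y|(m' (Suc n)). q' n x y * q' (Suc n) y z) = (LINT y|(m (Suc n)). q n x y * q (Suc n) y z)" unfolding m'_eq using q'_eq n x z by (intro Bochner_Integration.integral_cong refl) (auto simp: space_m)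
  then show ?thesis using two[OF n x z] by simp
 qed
qed (use eps in auto)

lemma paths_eq: "paths = path_space S" unfolding paths_def path_space_def by (rule PiM_cong) (auto simp: B'_eq)

lemma addf_iff: "addf f \<longleftrightarrow> additive_functional S f" by (auto simp: addf_def additive_functional_def pmeas_def B'_eq)

lemma path_law_chain_law:
 assumes c: "markov_chain S \<nu>' \<pi>"
 shows "chain_law (path_law S \<nu>' \<pi>)" unfolding chain_law_def
proof (intro conjI allI impI ballI)
 show "prob_space (path_law S \<nu>' \<pi>)" by (rule prob_space_path_law[OF c])
 show "sets (path_law S \<nu>' \<pi>) = sets paths" by (simp add: paths_eq)
 fix n :: nat and A E assume n: "n >= 1" and A: "A : sets (PiM {1..n} B')" and E: "E : sets (B' (Suc n))"
 have A': "A : sets (PiM {1..n} (%k. borel_of (S k)))" using A PiM_cong[of "{1..n}" "{1..n}" B' "%k. borel_of (S k)"] by (simp add: B'_eq)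
 have E': "E : sets (borel_of (S (Suc n)))" using E by (simp add: B'_eq)
 have "emeasure (\<pi> n (w n)) E = (\<integral>\<^sup>+y. ennreal (q' n (w n) y) * indicator E y \<partial>m' (Suc n))" if wt: "w : space (path_law S \<nu>' \<pi>)" for w
 proof -
  have x: "w n : mspace (S n)" using wt n coord_space[of n w] by (simp add: paths_eq B'_eq space_borel_of)
  have qx: "q n (w n) : borel_measurable (m (Suc n))" using measurable_compose[OF measurable_Pair1' qm[OF n], of "w n"] x sets_m[of "Suc n"] by (simp add: space_borel_of measurable_def space_m)
  have "emeasure (\<pi> n (w n)) E = (\<integral>\<^sup>+y. ennreal (q n (w n) y) * indicator E y \<partial>m (Suc n))" unfolding dens[OF n x] using E' sets_m[of "Suc n"] qx by (intro emeasure_density) auto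
  also have "... = (\<integral>\<^sup>+y. ennreal (q' n (w n) y) * indicator E y \<partial>m' (Suc n))" unfolding m'_eq using q'_eq[OF n x] by (intro nn_integral_cong) (simp add: space_m)
  finally show ?thesis .
 qed
 then show "emeasure (path_law S \<nu>' \<pi>) {w : space paths. restrict w {1..n} : A & w (Suc n) : E} =
   (\<integral>\<^sup>+w. indicator A (restrict w {1..n}) * (\<integral>\<^sup>+y. ennreal (q' n (w n) y) * indicator E y \<partial>m' (Suc n)) \<partial>path_law S \<nu>' \<pi>)"
  unfolding paths_eq path_law_Markov[OF c n A' E'] by (intro nn_integral_cong) simp
qed

definition conditional_limit_property ::
  "(nat => 'a) measure => (nat => 'a => 'a => real) => real => (nat => 'a => real) => ((nat => 'a) => real) => bool" where
 "conditional_limit_property P f dl b F \<longleftrightarrow> (\<forall>z z0 phi A c x. (\<forall>N\<ge>1. z N : multiples dl) -->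
   (%N. (z N - prob_space.expectation P (partial_sum f N)) / sqrt (prob_space.variance P (partial_sum f N))) ----> z0 -->
   continuous_on UNIV phi --> compactly_supported phi -->
   (\<forall>N\<ge>1. A (Suc N) : sets (borel_of (S (Suc N)))) -->
   c > 0 --> (\<forall>N\<ge>1. c <= measure P {w : space P. w (Suc N) : A (Suc N)}) --> x : mspace (S 1) -->
   (%N. sqrt (prob_space.variance P (partial_sum f N)) *
     expectation_given (path_law_from S \<pi> x) (%w. phi (partial_sum f N w - z N - b N (w (Suc N)))) {w : space (path_space S). w (Suc N) : A (Suc N)})
   ----> dl * exp (- (z0^2) / 2) / sqrt (2 * pi) *
    (\<Sum>\<^sub>\<infinity>m\<in>(UNIV :: int set). prob_space.expectation (path_law_from S \<pi> x) (%w. phi (of_int m * dl + F w))))"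

text \<open>f is bounded only almost surely under \<open>P\<close>, while the estimates need a bound
  for all arguments, so f is clipped to \<open>h\<close>. Almost sure equality preserves
  center-tightness, mean, variance and the essential range. Under the chain started at a point,
  \<open>h\<close> and f agree almost surely from time 3 on.\<close>

theorem setting_local_limit:
 assumes P_def: "P = path_law S \<nu> \<pi>" and f: "additive_functional S f" and bounded: "as_unif_bounded P f"
  and dl: "dl > 0" and ess: "essential_range S P f = multiples dl"
 obtains b F where "!!N. N >= 1 ==> b N : borel_measurable (borel_of (S (Suc N)))" "!!N y. 0 <= b N y & b N y < dl"
  "F : borel_measurable (path_space S)" "!!w. 0 <= F w & F w < dl"
  "conditional_limit_property P f dl b F"
proof -
 have P: "chain_law P" unfolding P_def by (rule path_law_chain_law[OF chain])
 obtain K where K: "K > 0" "!!n. n >= 1 ==> AE w in P. abs (f n (w n) (w (Suc n))) <= K" using as_unif_boundedD[OF bounded] by blast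
 have af: "addf f" using f by (simp add: addf_iff)
 define h where "h n x y = max (- K) (min K (f n x y))" for n x y
 have h: "addf h" unfolding addf_def
 proof (intro allI impI)
  fix n :: nat assume "n >= 1"
  then have [measurable]: "(%z. f n (fst z) (snd z)) : borel_measurable (B' n \<Otimes>\<^sub>M B' (Suc n))" using addfD[OF af] by (simp add: pmeas_def split_beta')
  show "pmeas n (h n)" unfolding pmeas_def h_def split_beta' by measurable
 qed
 have hK: "abs (h n x y) <= K" for n x y using K(1) by (simp add: h_def)
 have hf: "AE w in P. st h n w = st f n w" if "n >= 1" for n using K(2)[OF that] by eventually_elim (simp add: h_def)
 have mP: "X : borel_measurable Q" if "X : borel_measurable paths" "chain_law Q" for X :: "_ => real" and Q using that(1) chain_lawD[OF that(2)] by (simp add: measurable_def)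
 have pm: "partial_sum k N : borel_measurable Q" if "addf k" "chain_law Q" for k N Q by (rule mP[OF partial_sum_measurable[OF that(1)] that(2)])
 have hfall: "AE w in P. \<forall>n\<ge>1. st h n w = st f n w" using hf by (intro AE_all_countable[THEN iffD2] allI) (auto intro: AE_impI)
 have ps: "AE w in P. partial_sum (%n x y. f n x y - g n x y) N w = partial_sum (%n x y. h n x y - g n x y) N w" for g N using hfall by eventually_elim (auto simp: partial_sum_def)
 have sub: "addf (%n x y. k n x y - g n x y)" if "addf k" "addf g" for k g using that unfolding addf_def pmeas_def split_beta' by (auto intro!: borel_measurable_diff)
 have ct: "center_tight P (%n x y. f n x y - g n x y) \<longleftrightarrow> center_tight P (%n x y. h n x y - g n x y)" if g: "addf g" for g by (rule center_tight_cong[OF ps]) (intro pm sub af h g P)+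
 have ess': "\<Inter>{algebraic_range P g | g. addf g & center_tight P (%n x y. h n x y - g n x y)} = multiples dl"
 proof -
  have "{algebraic_range P g | g. addf g & center_tight P (%n x y. h n x y - g n x y)} = {algebraic_range P g | g. additive_functional S g & center_tight P (%n x y. f n x y - g n x y)}" using ct by (auto simp: addf_iff)
  then show ?thesis using ess by (simp add: essential_range_def)
 qed
 \<comment> \<open>The first two summands stay unclipped: under the started chain they may exceed
   the bound that holds under \<open>P\<close>.\<close>
 define R where "R w = f 1 (w 1) (w (Suc 1)) + f 2 (w 2) (w (Suc 2))" for w
 have R: "adapted 3 R" unfolding R_def[abs_def] by (intro adapted_add adapted_coord2 addfD[OF af, unfolded pmeas_def]) auto
 obtain b F where bm: "!!N. b N : borel_measurable (B' (Suc N))" and b: "!!N y. 0 <= b N y & b N y < dl"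
  and Fm: "F : borel_measurable paths" and F: "!!w. 0 <= F w & F w < dl"
  and lim: "local_limit_property P h dl R b F" by (rule chain_local_limit[OF P h hK K(1) dl ess' R]) (rule that; blast)
 have psP: "AE w in P. partial_sum f N w = Sm h 1 N w" for N using hfall by eventually_elim (auto simp: partial_sum_def)
 have Shm: "Sm h k N : borel_measurable Q" if "k >= 1" "chain_law Q" for k N Q by (rule mP[OF Sm_measurable[OF h that(1)] that(2)])
 have E: "(LINT w|P. partial_sum f N w) = (LINT w|P. Sm h 1 N w)" for N by (rule integral_cong_AE[OF pm[OF af P] Shm[OF _ P] psP]) simp
 have V: "(LINT w|P. (partial_sum f N w - (LINT w|P. partial_sum f N w))^2) = Vr P h 1 N" for N unfolding Vr_def E
 proof (rule integral_cong_AE)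
  show "AE w in P. (partial_sum f N w - (LINT w|P. Sm h 1 N w))^2 = (Sm h 1 N w - (LINT w|P. Sm h 1 N w))^2" using psP[of N] by eventually_elim simp
 qed (intro borel_measurable_power borel_measurable_diff borel_measurable_const pm[OF af P] Shm[OF _ P], simp?)+
 show thesis
 proof (rule that[of b F])
  show "b N : borel_measurable (borel_of (S (Suc N)))" if "N >= 1" for N using bm[of N] by (simp add: B'_eq)
  show "0 <= b N y & b N y < dl" for N y by (rule b)
  show "F : borel_measurable (path_space S)" using Fm by (simp add: paths_eq)
  show "0 <= F w & F w < dl" for w by (rule F)
  show "conditional_limit_property P f dl b F" unfolding conditional_limit_property_def
  proof (intro allI impI)
  fix z :: "nat => real" and z0 c :: real and phi :: "real => real" and A x
  assume z: "\<forall>N\<ge>1. z N : multiples dl"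
   and zl: "(%N. (z N - (LINT w|P. partial_sum f N w)) / sqrt (LINT w|P. (partial_sum f N w - (LINT w|P. partial_sum f N w))^2)) ----> z0"
   and phi: "continuous_on UNIV phi" "compactly_supported phi"
   and A: "\<forall>N\<ge>1. A (Suc N) : sets (borel_of (S (Suc N)))"
   and c: "c > 0" "\<forall>N\<ge>1. c <= measure P {w : space P. w (Suc N) : A (Suc N)}" and x: "x : mspace (S 1)"
  let ?Q = "path_law_from S \<pi> x"
  have Q: "chain_law ?Q" unfolding path_law_from_def by (rule path_law_chain_law[OF markov_chain_return[OF chain x]])
  have [measurable]: "phi : borel_measurable borel" using phi(1) by (rule borel_measurable_continuous_onI)
  \<comment> \<open>The value 1 at N = 0, where no event is given, keeps the weight measurable for
    all N.\<close>
  define u where "u N y = (if N >= 1 then indicator (A (Suc N)) y else 1 :: real)" for N y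
  have um: "u N : borel_measurable (B' (Suc N))" for N
  proof (cases "N >= 1")
   case True
   then have "A (Suc N) : sets (borel_of (S (Suc N)))" using A by blast
   then show ?thesis using True unfolding u_def[abs_def] by (simp add: B'_eq)
  qed (simp add: u_def[abs_def])
  have u: "0 <= u N y & u N y <= 1" for N y by (simp add: u_def indicator_def)
  have meas: "(LINT w|Q. u N (w (Suc N))) = measure Q {w : space (path_space S). w (Suc N) : A (Suc N)}" if Q: "chain_law Q" and N: "N >= 1" for Q N
  proof -
   have "(LINT w|Q. u N (w (Suc N))) = (LINT w|Q. indicator {w : space (path_space S). w (Suc N) : A (Suc N)} w)"
    using N chain_lawD(3)[OF Q] by (intro Bochner_Integration.integral_cong refl) (auto simp: u_def indicator_def paths_eq)
   also have "... = measure Q ({w : space (path_space S). w (Suc N) : A (Suc N)} \<inter> space Q)" by (rule Bochner_Integration.integral_indicator)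
   also have "{w : space (path_space S). w (Suc N) : A (Suc N)} \<inter> space Q = {w : space (path_space S). w (Suc N) : A (Suc N)}" using chain_lawD(3)[OF Q] by (auto simp: paths_eq)
   finally show ?thesis .
  qed
  have "space P = space (path_space S)" using chain_lawD(3)[OF P] by (simp add: paths_eq)
  then have c': "c <= (LINT w|P. u N (w (Suc N)))" if "N >= 1" for N using c(2) that meas[OF P that] by simp
  have l: "(%N. sqrt (Vr P h 1 N) * ((LINT w|?Q. phi (R w + Sm h 3 N w - z N - b N (w (Suc N))) * u N (w (Suc N))) / (LINT w|?Q. u N (w (Suc N)))))
   ----> dl * exp (- (z0^2) / 2) / sqrt (2 * pi) * (\<Sum>\<^sub>\<infinity>m\<in>(UNIV :: int set). (LINT w|?Q. phi (of_int m * dl + F w)))"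
   by (rule lim[unfolded local_limit_property_def, rule_format, OF Q z[rule_format] zl[unfolded V, unfolded E] phi(1) phi(2)[unfolded compactly_supported_def] um u c(1) c'])
  show "(%N. sqrt (LINT w|P. (partial_sum f N w - (LINT w|P. partial_sum f N w))^2) *
     expectation_given ?Q (%w. phi (partial_sum f N w - z N - b N (w (Suc N)))) {w : space (path_space S). w (Suc N) : A (Suc N)})
   ----> dl * exp (- (z0^2) / 2) / sqrt (2 * pi) * (\<Sum>\<^sub>\<infinity>m\<in>(UNIV :: int set). (LINT w|?Q. phi (of_int m * dl + F w)))"
  proof (rule Lim_transform_eventually[OF l])
   show "\<forall>\<^sub>F N in sequentially. sqrt (Vr P h 1 N) * ((LINT w|?Q. phi (R w + Sm h 3 N w - z N - b N (w (Suc N))) * u N (w (Suc N))) / (LINT w|?Q. u N (w (Suc N))))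
    = sqrt (LINT w|P. (partial_sum f N w - (LINT w|P. partial_sum f N w))^2) *
     expectation_given ?Q (%w. phi (partial_sum f N w - z N - b N (w (Suc N)))) {w : space (path_space S). w (Suc N) : A (Suc N)}" using eventually_ge_at_top[of 2]
   proof eventually_elim
    case (elim N)
    then have N1: "N >= 1" by simp
    let ?A = "{w : space (path_space S). w (Suc N) : A (Suc N)}"
    have [measurable]: "partial_sum f N : borel_measurable paths" "Sm h 3 N : borel_measurable paths" "R : borel_measurable paths" using partial_sum_measurable[OF af] Sm_measurable[OF h, of 3] adapted_measurable[OF R] by auto
    have [measurable]: "(%w. b N (w (Suc N))) : borel_measurable paths" "(%w. u N (w (Suc N))) : borel_measurable paths" using measurable_compose[OF coord bm[of N]] measurable_compose[OF coord um[of N]] by auto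
    have hQ: "AE w in ?Q. st h n w = st f n w" if "n >= 3" for n using that by (intro law_AE_transfer[OF P Q that addfD[OF h] addfD[OF af] hf]) auto
    have "AE w in ?Q. \<forall>n\<ge>3. st h n w = st f n w" using hQ by (intro AE_all_countable[THEN iffD2] allI) (auto intro: AE_impI)
    then have ae: "AE w in ?Q. partial_sum f N w = R w + Sm h 3 N w"
    proof eventually_elim
     case (elim w)
     have "{1..2::nat} = {1, 2}" by auto
     then have "partial_sum f 2 w = R w" by (simp add: partial_sum_def R_def)
     moreover have "Sm f 3 N w = Sm h 3 N w" using elim by (intro sum.cong) auto
     ultimately show ?case using partial_sum_split[of N f w] \<open>2 <= N\<close> by simp
    qed
    have "(LINT w|?Q. phi (R w + Sm h 3 N w - z N - b N (w (Suc N))) * u N (w (Suc N))) = (LINT w|?Q. phi (partial_sum f N w - z N - b N (w (Suc N))) * u N (w (Suc N)))"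
    proof (rule integral_cong_AE)
     show "AE w in ?Q. phi (R w + Sm h 3 N w - z N - b N (w (Suc N))) * u N (w (Suc N)) = phi (partial_sum f N w - z N - b N (w (Suc N))) * u N (w (Suc N))" using ae by eventually_elim simp
     show "(%w. phi (R w + Sm h 3 N w - z N - b N (w (Suc N))) * u N (w (Suc N))) : borel_measurable ?Q" by (rule mP[OF _ Q]) measurable
     show "(%w. phi (partial_sum f N w - z N - b N (w (Suc N))) * u N (w (Suc N))) : borel_measurable ?Q" by (rule mP[OF _ Q]) measurable
    qed
    also have "... = (LINT w|?Q. indicator ?A w * phi (partial_sum f N w - z N - b N (w (Suc N))))" using N1 chain_lawD(3)[OF Q] by (intro Bochner_Integration.integral_cong refl) (auto simp: u_def indicator_def paths_eq)
    finally show ?case unfolding expectation_given_def V meas[OF Q N1] by simp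
   qed
  qed
  qed
 qed
qed

end

theorem theorem5p1:
  fixes S :: "nat \<Rightarrow> 'a metric"
    and \<nu> :: "'a measure"
    and \<pi> :: "nat \<Rightarrow> 'a \<Rightarrow> 'a measure"
    and f :: "nat \<Rightarrow> 'a \<Rightarrow> 'a \<Rightarrow> real"
    and P :: "(nat \<Rightarrow> 'a) measure"
    and \<delta> :: real
  assumes chain: "markov_chain S \<nu> \<pi>"
    and elliptic: "uniformly_elliptic S \<pi>"
    and P_def: "P = path_law S \<nu> \<pi>"
    and f: "additive_functional S f"
    and bounded: "as_unif_bounded P f"
    and reducible: "reducible S P f"
    and \<delta>: "\<delta> > 0"
    and ess: "essential_range S P f = multiples \<delta>"
  shows "\<exists>(b :: nat \<Rightarrow> 'a \<Rightarrow> 'a \<Rightarrow> real) (F :: (nat \<Rightarrow> 'a) \<Rightarrow> real).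
    (\<forall>N\<ge>1. (\<lambda>(x, y). b N x y) \<in> borel_measurable (borel_of (S 1) \<Otimes>\<^sub>M borel_of (S (Suc N)))) \<and>
    F \<in> borel_measurable (path_space S) \<and>
    (\<forall>(z :: nat \<Rightarrow> real) (z\<^sub>0 :: real) (\<phi> :: real \<Rightarrow> real).
       (\<forall>N\<ge>1. z N \<in> multiples \<delta>) \<and>
       (\<lambda>N. (z N - prob_space.expectation P (partial_sum f N))
              / sqrt (prob_space.variance P (partial_sum f N))) \<longlonglongrightarrow> z\<^sub>0 \<and>
       continuous_on UNIV \<phi> \<and> compactly_supported \<phi> \<longrightarrow>
       (\<forall>x\<in>mspace (S 1).
          (\<lambda>N. sqrt (prob_space.variance P (partial_sum f N)) *
                 prob_space.expectation (path_law_from S \<pi> x)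
                   (\<lambda>\<omega>. \<phi> (partial_sum f N \<omega> - z N - b N (\<omega> 1) (\<omega> (Suc N)))))
          \<longlonglongrightarrow> \<delta> * exp (- z\<^sub>0\<^sup>2 / 2) / sqrt (2 * pi) *
                (\<Sum>\<^sub>\<infinity>m\<in>(UNIV :: int set).
                   prob_space.expectation (path_law_from S \<pi> x)
                     (\<lambda>\<omega>. \<phi> (of_int m * \<delta> + F \<omega>)))) \<and>
       (\<forall>A :: nat \<Rightarrow> 'a set.
          (\<forall>N\<ge>1. A (Suc N) \<in> sets (borel_of (S (Suc N)))) \<and>
          (\<exists>c>0. \<forall>N\<ge>1. measure P {\<omega> \<in> space P. \<omega> (Suc N) \<in> A (Suc N)} \<ge> c) \<longrightarrow>
          (\<forall>x\<in>mspace (S 1).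
             (\<lambda>N. sqrt (prob_space.variance P (partial_sum f N)) *
                    expectation_given (path_law_from S \<pi> x)
                      (\<lambda>\<omega>. \<phi> (partial_sum f N \<omega> - z N - b N (\<omega> 1) (\<omega> (Suc N))))
                      {\<omega> \<in> space (path_space S). \<omega> (Suc N) \<in> A (Suc N)})
             \<longlonglongrightarrow> \<delta> * exp (- z\<^sub>0\<^sup>2 / 2) / sqrt (2 * pi) *
                   (\<Sum>\<^sub>\<infinity>m\<in>(UNIV :: int set).
                      prob_space.expectation (path_law_from S \<pi> x)
                        (\<lambda>\<omega>. \<phi> (of_int m * \<delta> + F \<omega>)))))) \<and>
    (\<forall>N\<ge>1. \<forall>x\<in>mspace (S 1). \<forall>y\<in>mspace (S (Suc N)). \<bar>b N x y\<bar> \<le> 9 * \<delta>) \<and>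
    (\<forall>\<omega>\<in>space (path_space S). 0 \<le> F \<omega> \<and> F \<omega> < \<delta>)"
  proof -
 obtain eps :: real and m :: "nat => 'a measure" and q :: "nat => 'a => 'a => real"
  where "0 < eps" "eps < 1" and m: "\<forall>n\<ge>1. m n : space (prob_algebra (borel_of (S n)))"
   and qm: "\<forall>n\<ge>1. (%(x, y). q n x y) : borel_measurable (borel_of (S n) \<Otimes>\<^sub>M borel_of (S (Suc n)))"
   and dens: "\<forall>n\<ge>1. \<forall>x\<in>mspace (S n). \<pi> n x = density (m (Suc n)) (%y. ennreal (q n x y))"
   and qb: "\<forall>n\<ge>1. \<forall>x\<in>mspace (S n). \<forall>y\<in>mspace (S (Suc n)). 0 <= q n x y & q n x y <= 1 / eps"
   and two: "\<forall>n\<ge>1. \<forall>x\<in>mspace (S n). \<forall>z\<in>mspace (S (Suc (Suc n))). (LINT y|(m (Suc n)). q n x y * q (Suc n) y z) > eps"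
  using elliptic unfolding uniformly_elliptic_def by (elim exE conjE) (rule that)
 then have "elliptic_setting S \<nu> \<pi> eps m q" using chain by unfold_locales auto
 then interpret elliptic_setting S \<nu> \<pi> eps m q .
 let ?Q = "path_law_from S \<pi>"
 obtain b F where b: "!!N. N >= 1 ==> b N : borel_measurable (borel_of (S (Suc N)))" "!!N y. 0 <= b N y & b N y < \<delta>"
  and F: "F : borel_measurable (path_space S)" "!!w. 0 <= F w & F w < \<delta>"
  and lim: "conditional_limit_property P f \<delta> b F" by (rule setting_local_limit[OF P_def f bounded \<delta> ess]) (rule that; blast)
 note lim = lim[unfolded conditional_limit_property_def, rule_format]
 have P: "chain_law P" unfolding P_def by (rule path_law_chain_law[OF chain])
 then have P1: "prob_space P" "space P = space (path_space S)" using chain_lawD[OF P] by (auto simp: paths_eq)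
 have sp: "w (Suc N) : space (borel_of (S (Suc N)))" if "w : space (path_space S)" for w N using that coord_space[of "Suc N" w] by (simp add: paths_eq B'_eq)
 \<comment> \<open>Part (1) is part (2) for the whole state spaces: these events have probability 1
   under every law, so conditioning on them changes nothing.\<close>
 have whole: "expectation_given (?Q x) X {w : space (path_space S). w (Suc N) : space (borel_of (S (Suc N)))} = prob_space.expectation (?Q x) X"
  if x: "x : mspace (S 1)" for x X N
 proof -
  have Q: "chain_law (?Q x)" unfolding path_law_from_def by (rule path_law_chain_law[OF markov_chain_return[OF chain x]])
  interpret Q: prob_space "?Q x" using chain_lawD[OF Q] by simp
  have s: "space (?Q x) = space (path_space S)" using chain_lawD(3)[OF Q] by (simp add: paths_eq)
  have e: "{w : space (path_space S). w (Suc N) : space (borel_of (S (Suc N)))} = space (?Q x)" using sp s by auto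
  have "(LINT w|(?Q x). indicator (space (?Q x)) w * X w) = (LINT w|(?Q x). X w)" by (rule Bochner_Integration.integral_cong) auto
  then show ?thesis unfolding expectation_given_def e Q.prob_space by simp
 qed
 have full: "1 <= measure P {w : space P. w (Suc N) : space (borel_of (S (Suc N)))}" for N
 proof -
  have "{w : space P. w (Suc N) : space (borel_of (S (Suc N)))} = space P" using sp P1(2) by auto
  then show ?thesis using prob_space.prob_space[OF P1(1)] by simp
 qed
 \<comment> \<open>The correction is a function of the last state alone and takes values in
   \<open>[0, \<delta>)\<close>, which lies well inside the bound
   \<open>9 * \<delta>\<close>.\<close>
 show ?thesis
 proof (intro exI[of _ "%N x y. b N y"] exI[of _ F] conjI allI impI ballI)
  show "(%(x, y). b N y) : borel_measurable (borel_of (S 1) \<Otimes>\<^sub>M borel_of (S (Suc N)))" if "N >= 1" for N using measurable_compose[OF measurable_snd b(1)[OF that]] by (simp add: split_beta')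
  show "F : borel_measurable (path_space S)" by (rule F(1))
  show "abs (b N y) <= 9 * \<delta>" for N y using b(2)[of N y] \<delta> by simp
  show "0 <= F w" "F w < \<delta>" for w using F(2)[of w] by auto
 next
  fix z :: "nat => real" and z0 \<phi> x
  assume a: "(\<forall>N\<ge>1. z N : multiples \<delta>) &
    (%N. (z N - prob_space.expectation P (partial_sum f N)) / sqrt (prob_space.variance P (partial_sum f N))) ----> z0 &
    continuous_on UNIV \<phi> & compactly_supported \<phi>" and x: "x : mspace (S 1)"
  show "(%N. sqrt (prob_space.variance P (partial_sum f N)) * prob_space.expectation (?Q x) (%w. \<phi> (partial_sum f N w - z N - b N (w (Suc N)))))
   ----> \<delta> * exp (- (z0^2) / 2) / sqrt (2 * pi) * (\<Sum>\<^sub>\<infinity>m\<in>(UNIV :: int set). prob_space.expectation (?Q x) (%w. \<phi> (of_int m * \<delta> + F w)))"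
   using lim[of z z0 \<phi> "%n. space (borel_of (S n))" 1 x] a x full unfolding whole[OF x] by simp
 next
  fix z :: "nat => real" and z0 \<phi> A x
  assume a: "(\<forall>N\<ge>1. z N : multiples \<delta>) &
    (%N. (z N - prob_space.expectation P (partial_sum f N)) / sqrt (prob_space.variance P (partial_sum f N))) ----> z0 &
    continuous_on UNIV \<phi> & compactly_supported \<phi>"
   and A: "(\<forall>N\<ge>1. A (Suc N) : sets (borel_of (S (Suc N)))) & (\<exists>c>0. \<forall>N\<ge>1. measure P {w : space P. w (Suc N) : A (Suc N)} >= c)"
   and x: "x : mspace (S 1)"
  from A obtain c where "c > 0" "!!N. N >= 1 ==> c <= measure P {w : space P. w (Suc N) : A (Suc N)}" by blast
  then show "(%N. sqrt (prob_space.variance P (partial_sum f N)) *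
     expectation_given (?Q x) (%w. \<phi> (partial_sum f N w - z N - b N (w (Suc N)))) {w : space (path_space S). w (Suc N) : A (Suc N)})
   ----> \<delta> * exp (- (z0^2) / 2) / sqrt (2 * pi) * (\<Sum>\<^sub>\<infinity>m\<in>(UNIV :: int set). prob_space.expectation (?Q x) (%w. \<phi> (of_int m * \<delta> + F w)))"
   using a A x by (intro lim) auto
 qed
qed

end
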